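(* Let $p$ be a prime and $k$ a field of characteristic $p$. Let $T\trianglelefteq\Gamma$ be groups with $T\cong(\mathbb{Z}/p^\infty)^r$ for some $r\ge1$ and $\Gamma/T$ finite of order prime to $p$, and write $\Gamma=T\rtimes H$. Let $\mathbf{D}$ be the chain complex of $k\Gamma$-modules, with augmentation $\varepsilon\colon\mathbf{D}\to k$, constructed in the context. Then $\mathbf{D}$ is a chain complex of length $r+1$ of projective $k\Gamma$-modules, and $\mathbf{D}\xrightarrow{\varepsilon}k\to0$ is (upon restriction to $kT$) an $\Omega$-resolution of $k$ with respect to $T$.
   Context: Ω-resolution of $k$ with respect to $T$: a chain complex $\cdots\to P_1\to P_0\xrightarrow{\varepsilon}k\to0$ of $kT$-modules such that each $P_n$ is projective over $kT$, the complex obtained by applying $k\otimes_{kT}-$ to the whole augmented complex is exact, $T$ acts trivially on $H_n(P_* )$ for all $n\ge0$, and $\varepsilon$ induces an isomorphism $H_0(P_* )\cong k$ (trivial module). Construction of $\mathbf{D}$. Regard $kT$ as a left $k\Gamma$-module where $t\in T$ acts by $x\mapsto tx$ and $h\in H$ by $x\mapsto hxh^{-1}$. For $n\ge1$ let $T_n=\{t\in T\mid t^{p^n}=1\}$, $V=T_1\cong(C_p)^r$ (an $\mathbb{F}_pH$-module by conjugation), and let $I(kT_n)$, $I(kT)$ be the augmentation ideals. For $n\ge1$ let $\overline{\varphi}_n\colon V\to I(kT_n)/I(kT_n)^2$ be the homomorphism $\overline\varphi_n(t)=[s-1]$ for any $s\in T_n$ with $s^{p^{n-1}}=t$; it extends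 to a $kH$-linear isomorphism $k\otimes_{\mathbb{F}_p}V\cong I(kT_n)/I(kT_n)^2$. Choose an $\mathbb{F}_pH$-linear lift $\widetilde\varphi_n\colon V\to I(kT_n)$ of $\overline\varphi_n$, set $kT\cdot V=kT\otimes_{\mathbb{F}_p}V$ (with $T$ acting on the left factor and $H$ acting diagonally), and let $\varphi_n\colon kT\cdot V\to kT$ be the $k\Gamma$-linear map $\varphi_n(\xi\otimes v)=\xi\,\widetilde\varphi_n(v)$. Choose $k\Gamma$-linear maps $\psi_n\colon kT\cdot V\to kT\cdot V$ with $\varphi_{n+1}\circ\psi_n=\varphi_n$ (these exist, and satisfy $\psi_n(kT\cdot V)\le I(kT)\cdot V$). For $0\le m\le r$ let $D_m=\Lambda^m_{kT}(kT\cdot V)\cong kT\otimes_{\mathbb{F}_p}\Lambda^m_{\mathbb{F}_p}(V)$, so $D_0=kT$. For $n\ge1$ let $\mathbf{D}^{(n)}=(D_*,\partial^{(n)}_* )$ with $\partial^{(n)}_m(v_1\wedge\cdots\wedge v_m)=\sum_{i=1}^m(-1)^{i-1}\varphi_n(v_i)\,v_1\wedge\cdots\widehat{v_i}\cdots\wedge v_m$, and let $\Psi^{(n)}\colon\mathbf{D}^{(n)}\to\mathbf{D}^{(n+1)}$ be the chain map given by $\Lambda^m(\psi_n)$ in degree $m$ (the identity of $kT$ for $m=0$). Let $\mathbf{D}$ be the mapping cone of the chain map $\Psi\colon\bigoplus_{n\ge1}\mathbf{D}^{(n)}\to\bigoplus_{n\ge1}\mathbf{D}^{(n)}$, $\Psi(x_1,x_2,x_3,\dots)=(x_1,x_2-\Psi^{(1)}(x_1),x_3-\Psi^{(2)}(x_2),\dots)$.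 Here the mapping cone of $\psi\colon C_*\to C'_*$ has $C'_n\oplus C_{n-1}$ in degree $n$ and differential $\begin{pmatrix}\partial'_n&(-1)^{n-1}\psi_{n-1}\\0&\partial_{n-1}\end{pmatrix}$. The augmentation $\varepsilon$ is the map on degree $0$, $\bigoplus_{n\ge1}kT\to k$, given by the sum of the augmentation maps $kT\to k$. A complex has length $\ell$ if it is concentrated in degrees $0,\dots,\ell$. *)

theory Defs
  imports "HOL-Algebra.Module" "HOL-Algebra.Ideal_Product" "HOL-Algebra.Product_Groups"
    "HOL-Number_Theory.Residues"
begin

section \<open>Modules over a not necessarily commutative ring\<close>

text \<open>
  The axioms are those of the locale \<^locale>\<open>module\<close>, but the ring need not be commutative.
  Modules are records of type \<^typ>\<open>('a, 'b) module\<close>; their multiplication and unit are junk.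
\<close>

locale left_module = R?: ring R + M?: abelian_group M
  for R :: "('a, 'r) ring_scheme" (structure) and M :: "('a, 'b, 'm) module_scheme" (structure) +
  assumes smult_closed:
      "\<lbrakk>a \<in> carrier R; x \<in> carrier M\<rbrakk> \<Longrightarrow> a \<odot>\<^bsub>M\<^esub> x \<in> carrier M"
    and smult_l_distr:
      "\<lbrakk>a \<in> carrier R; b \<in> carrier R; x \<in> carrier M\<rbrakk> \<Longrightarrow>
        (a \<oplus> b) \<odot>\<^bsub>M\<^esub> x = a \<odot>\<^bsub>M\<^esub> x \<oplus>\<^bsub>M\<^esub> b \<odot>\<^bsub>M\<^esub> x"
    and smult_r_distr:
      "\<lbrakk>a \<in> carrier R; x \<in> carrier M; y \<in> carrier M\<rbrakk> \<Longrightarrow>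
        a \<odot>\<^bsub>M\<^esub> (x \<oplus>\<^bsub>M\<^esub> y) = a \<odot>\<^bsub>M\<^esub> x \<oplus>\<^bsub>M\<^esub> a \<odot>\<^bsub>M\<^esub> y"
    and smult_assoc1:
      "\<lbrakk>a \<in> carrier R; b \<in> carrier R; x \<in> carrier M\<rbrakk> \<Longrightarrow>
        (a \<otimes> b) \<odot>\<^bsub>M\<^esub> x = a \<odot>\<^bsub>M\<^esub> (b \<odot>\<^bsub>M\<^esub> x)"
    and smult_one: "x \<in> carrier M \<Longrightarrow> \<one> \<odot>\<^bsub>M\<^esub> x = x"

definition mk_module ::
    "'b set \<Rightarrow> ('b \<Rightarrow> 'b \<Rightarrow> 'b) \<Rightarrow> 'b \<Rightarrow> ('a \<Rightarrow> 'b \<Rightarrow> 'b) \<Rightarrow> ('a, 'b) module"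
  where "mk_module C pl z sm =
    \<lparr>carrier = C, monoid.mult = undefined, one = undefined, ring.zero = z, add = pl, smult = sm\<rparr>"

definition lmod_hom ::
    "('a, 'r) ring_scheme \<Rightarrow> ('a, 'b, 'm) module_scheme \<Rightarrow> ('a, 'c, 'n) module_scheme \<Rightarrow> ('b \<Rightarrow> 'c) set"
  where "lmod_hom R M N = {f \<in> carrier M \<rightarrow> carrier N.
    (\<forall>x\<in>carrier M. \<forall>y\<in>carrier M. f (x \<oplus>\<^bsub>M\<^esub> y) = f x \<oplus>\<^bsub>N\<^esub> f y) \<and>
    (\<forall>a\<in>carrier R. \<forall>x\<in>carrier M. f (a \<odot>\<^bsub>M\<^esub> x) = a \<odot>\<^bsub>N\<^esub> f x)}"

definition lmod_iso ::
    "('a, 'r) ring_scheme \<Rightarrow> ('a, 'b, 'm) module_scheme \<Rightarrow> ('a, 'c, 'n) module_scheme \<Rightarrow> ('b \<Rightarrow> 'c) set"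
  where "lmod_iso R M N = {f \<in> lmod_hom R M N. bij_betw f (carrier M) (carrier N)}"

definition zero_module :: "('a, 'b) module"
  where "zero_module = mk_module {undefined} (\<lambda>_ _. undefined) undefined (\<lambda>_ _. undefined)"

text \<open>The free module \<open>R\<^sup>(\<^sup>S\<^sup>)\<close>: functions of finite support, zero off \<open>S\<close>.\<close>

definition free_module :: "('a, 'r) ring_scheme \<Rightarrow> 'x set \<Rightarrow> ('a, 'x \<Rightarrow> 'a) module"
  where "free_module R S = mk_module
    {u. (\<forall>x\<in>S. u x \<in> carrier R) \<and> (\<forall>x. x \<notin> S \<longrightarrow> u x = \<zero>\<^bsub>R\<^esub>) \<and> finite {x. u x \<noteq> \<zero>\<^bsub>R\<^esub>}}
    (\<lambda>u v x. u x \<oplus>\<^bsub>R\<^esub> v x) (\<lambda>_. \<zero>\<^bsub>R\<^esub>) (\<lambda>a u x. a \<otimes>\<^bsub>R\<^esub> u x)"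

definition free_basis :: "('a, 'r) ring_scheme \<Rightarrow> 'x \<Rightarrow> 'x \<Rightarrow> 'a"
  where "free_basis R x = (\<lambda>y. if y = x then \<one>\<^bsub>R\<^esub> else \<zero>\<^bsub>R\<^esub>)"

text \<open>
  Projective = direct summand of a free module. Index sets inside the type of the elements of
  \<open>P\<close> suffice: if \<open>P\<close> is a summand of any free module, then the canonical surjection from the
  free module on the set \<^term>\<open>carrier P\<close> splits.
\<close>

definition projective_module :: "('a, 'r) ring_scheme \<Rightarrow> ('a, 'b) module \<Rightarrow> bool"
  where "projective_module R P \<longleftrightarrow> left_module R P \<and>
    (\<exists>(S :: 'b set) i q. i \<in> lmod_hom R P (free_module R S) \<and> q \<in> lmod_hom R (free_module R S) P \<and>
       (\<forall>x\<in>carrier P. q (i x) = x))"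

definition quotient_module :: "('a, 'b, 'm) module_scheme \<Rightarrow> 'b set \<Rightarrow> ('a, 'b set) module"
  where "quotient_module M N = mk_module (a_rcosets\<^bsub>M\<^esub> N) (set_add M) N
    (\<lambda>a A. \<Union>x\<in>A. N +>\<^bsub>M\<^esub> (a \<odot>\<^bsub>M\<^esub> x))"

definition submodule_span ::
    "('a, 'r) ring_scheme \<Rightarrow> ('a, 'b, 'm) module_scheme \<Rightarrow> 'b set \<Rightarrow> 'b set"
  where "submodule_span R M S = \<Inter>{N. submodule N R M \<and> S \<subseteq> N}"

text \<open>
  The map out of a quotient of a free \<open>R\<close>-module that is induced by
  \<open>\<Sum> u\<^sub>x x \<mapsto> \<Sum> \<sigma>(u\<^sub>x) \<beta>(x)\<close>. It is \<open>\<sigma>\<close>-semilinear, where \<open>\<sigma>\<close> is a ring homomorphism.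
\<close>

definition induced_map ::
    "('a, 'r) ring_scheme \<Rightarrow> ('a \<Rightarrow> 'c) \<Rightarrow> ('c, 'b, 'm) module_scheme \<Rightarrow> ('x \<Rightarrow> 'b) \<Rightarrow> ('x \<Rightarrow> 'a) set \<Rightarrow> 'b"
  where "induced_map R \<sigma> N \<beta> =
    (\<lambda>c. the_elem ((\<lambda>u. \<Oplus>\<^bsub>N\<^esub>x\<in>{x. u x \<noteq> \<zero>\<^bsub>R\<^esub>}. \<sigma> (u x) \<odot>\<^bsub>N\<^esub> \<beta> x) ` c))"


section \<open>Tensor products and exterior powers over a commutative ring\<close>

definition tensor_relations ::
    "('a, 'r) ring_scheme \<Rightarrow> ('a, 'b, 'm) module_scheme \<Rightarrow> ('a, 'c, 'n) module_scheme \<Rightarrow> ('b \<times> 'c \<Rightarrow> 'a) set"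
  where "tensor_relations R M N =
    (let F = free_module R (carrier M \<times> carrier N); e = free_basis R in
      {e (x \<oplus>\<^bsub>M\<^esub> x', y) \<ominus>\<^bsub>F\<^esub> (e (x, y) \<oplus>\<^bsub>F\<^esub> e (x', y)) | x x' y.
         x \<in> carrier M \<and> x' \<in> carrier M \<and> y \<in> carrier N} \<union>
      {e (x, y \<oplus>\<^bsub>N\<^esub> y') \<ominus>\<^bsub>F\<^esub> (e (x, y) \<oplus>\<^bsub>F\<^esub> e (x, y')) | x y y'.
         x \<in> carrier M \<and> y \<in> carrier N \<and> y' \<in> carrier N} \<union>
      {e (a \<odot>\<^bsub>M\<^esub> x, y) \<ominus>\<^bsub>F\<^esub> a \<odot>\<^bsub>F\<^esub> e (x, y) | a x y.
         a \<in> carrier R \<and> x \<in> carrier M \<and> y \<in> carrier N} \<union>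
      {e (x, a \<odot>\<^bsub>N\<^esub> y) \<ominus>\<^bsub>F\<^esub> a \<odot>\<^bsub>F\<^esub> e (x, y) | a x y.
         a \<in> carrier R \<and> x \<in> carrier M \<and> y \<in> carrier N})"

definition tensor_module ::
    "('a, 'r) ring_scheme \<Rightarrow> ('a, 'b, 'm) module_scheme \<Rightarrow> ('a, 'c, 'n) module_scheme \<Rightarrow>
     ('a, ('b \<times> 'c \<Rightarrow> 'a) set) module"
  where "tensor_module R M N = (let F = free_module R (carrier M \<times> carrier N) in
    quotient_module F (submodule_span R F (tensor_relations R M N)))"

definition tensor ::
    "('a, 'r) ring_scheme \<Rightarrow> ('a, 'b, 'm) module_scheme \<Rightarrow> ('a, 'c, 'n) module_scheme \<Rightarrow>
     'b \<Rightarrow> 'c \<Rightarrow> ('b \<times> 'c \<Rightarrow> 'a) set"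
  where "tensor R M N x y = (let F = free_module R (carrier M \<times> carrier N) in
    submodule_span R F (tensor_relations R M N) +>\<^bsub>F\<^esub> free_basis R (x, y))"

text \<open>\<open>f \<otimes> g\<close>, with values in \<^term>\<open>tensor_module R M N\<close>.\<close>

definition tensor_map ::
    "('a, 'r) ring_scheme \<Rightarrow> ('a, 'b, 'm) module_scheme \<Rightarrow> ('a, 'c, 'n) module_scheme \<Rightarrow>
     ('d \<Rightarrow> 'b) \<Rightarrow> ('e \<Rightarrow> 'c) \<Rightarrow> ('d \<times> 'e \<Rightarrow> 'a) set \<Rightarrow> ('b \<times> 'c \<Rightarrow> 'a) set"
  where "tensor_map R M N f g =
    induced_map R id (tensor_module R M N) (\<lambda>(x, y). tensor R M N (f x) (g y))"

definition tuples :: "('a, 'b, 'm) module_scheme \<Rightarrow> nat \<Rightarrow> 'b list set"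
  where "tuples M m = {xs. set xs \<subseteq> carrier M \<and> length xs = m}"

definition exterior_relations ::
    "('a, 'r) ring_scheme \<Rightarrow> ('a, 'b, 'm) module_scheme \<Rightarrow> nat \<Rightarrow> ('b list \<Rightarrow> 'a) set"
  where "exterior_relations R M m =
    (let F = free_module R (tuples M m); e = free_basis R in
      {e (xs[i := x \<oplus>\<^bsub>M\<^esub> y]) \<ominus>\<^bsub>F\<^esub> (e (xs[i := x]) \<oplus>\<^bsub>F\<^esub> e (xs[i := y])) | xs i x y.
         xs \<in> tuples M m \<and> i < m \<and> x \<in> carrier M \<and> y \<in> carrier M} \<union>
      {e (xs[i := a \<odot>\<^bsub>M\<^esub> x]) \<ominus>\<^bsub>F\<^esub> a \<odot>\<^bsub>F\<^esub> e (xs[i := x]) | xs i a x.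
         xs \<in> tuples M m \<and> i < m \<and> a \<in> carrier R \<and> x \<in> carrier M} \<union>
      {e xs | xs i j. xs \<in> tuples M m \<and> i < j \<and> j < m \<and> xs ! i = xs ! j})"

text \<open>
  For \<open>m = 0\<close> there are no relations and the only tuple is \<open>[]\<close>, so that this is \<open>R\<close> itself up
  to the identification of \<open>a\<close> with the one-element coset of \<open>a\<cdot>[]\<close>.
\<close>

definition exterior_power ::
    "('a, 'r) ring_scheme \<Rightarrow> ('a, 'b, 'm) module_scheme \<Rightarrow> nat \<Rightarrow> ('a, ('b list \<Rightarrow> 'a) set) module"
  where "exterior_power R M m = (let F = free_module R (tuples M m) in
    quotient_module F (submodule_span R F (exterior_relations R M m)))"

definition wedge ::
    "('a, 'r) ring_scheme \<Rightarrow> ('a, 'b, 'm) module_scheme \<Rightarrow> 'b list \<Rightarrow> ('b list \<Rightarrow> 'a) set"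
  where "wedge R M xs = (let m = length xs; F = free_module R (tuples M m) in
    submodule_span R F (exterior_relations R M m) +>\<^bsub>F\<^esub> free_basis R xs)"


section \<open>Chain complexes, indexed by the integers\<close>

text \<open>The differential \<open>d n\<close> goes from degree \<open>n\<close> to degree \<open>n - 1\<close>.\<close>

definition chain_complex ::
    "('a, 'r) ring_scheme \<Rightarrow> (int \<Rightarrow> ('a, 'b) module) \<Rightarrow> (int \<Rightarrow> 'b \<Rightarrow> 'b) \<Rightarrow> bool"
  where "chain_complex R C d \<longleftrightarrow>
    (\<forall>n. left_module R (C n)) \<and>
    (\<forall>n. d n \<in> lmod_hom R (C n) (C (n - 1))) \<and>
    (\<forall>n. \<forall>x\<in>carrier (C n). d (n - 1) (d n x) = \<zero>\<^bsub>C (n - 2)\<^esub>)"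

definition has_length :: "(int \<Rightarrow> ('a, 'b) module) \<Rightarrow> nat \<Rightarrow> bool"
  where "has_length C l \<longleftrightarrow> (\<forall>n. n < 0 \<or> n > int l \<longrightarrow> carrier (C n) = {\<zero>\<^bsub>C n\<^esub>})"

definition cycles :: "(int \<Rightarrow> ('a, 'b) module) \<Rightarrow> (int \<Rightarrow> 'b \<Rightarrow> 'b) \<Rightarrow> int \<Rightarrow> 'b set"
  where "cycles C d n = {x \<in> carrier (C n). d n x = \<zero>\<^bsub>C (n - 1)\<^esub>}"

definition boundaries :: "(int \<Rightarrow> ('a, 'b) module) \<Rightarrow> (int \<Rightarrow> 'b \<Rightarrow> 'b) \<Rightarrow> int \<Rightarrow> 'b set"
  where "boundaries C d n = d (n + 1) ` carrier (C (n + 1))"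

definition homology ::
    "(int \<Rightarrow> ('a, 'b) module) \<Rightarrow> (int \<Rightarrow> 'b \<Rightarrow> 'b) \<Rightarrow> int \<Rightarrow> ('a, 'b set) module"
  where "homology C d n = quotient_module ((C n)\<lparr>carrier := cycles C d n\<rparr>) (boundaries C d n)"

text \<open>Exactness of \<open>L \<rightarrow> M \<rightarrow> N\<close> at \<open>M\<close>, for maps \<open>f\<close> and \<open>g\<close>.\<close>

definition exact_at ::
    "('a, 'b) module \<Rightarrow> ('b \<Rightarrow> 'c) \<Rightarrow> ('a, 'c) module \<Rightarrow> ('c \<Rightarrow> 'd) \<Rightarrow> ('a, 'd) module \<Rightarrow> bool"
  where "exact_at L f M g N \<longleftrightarrow> f ` carrier L = {y \<in> carrier M. g y = \<zero>\<^bsub>N\<^esub>}"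

definition direct_sum :: "'i set \<Rightarrow> ('i \<Rightarrow> ('a, 'b) module) \<Rightarrow> ('a, 'i \<Rightarrow> 'b) module"
  where "direct_sum I M = mk_module
    {x \<in> (\<Pi>\<^sub>E i\<in>I. carrier (M i)). finite {i \<in> I. x i \<noteq> \<zero>\<^bsub>M i\<^esub>}}
    (\<lambda>x y. \<lambda>i\<in>I. x i \<oplus>\<^bsub>M i\<^esub> y i) (\<lambda>i\<in>I. \<zero>\<^bsub>M i\<^esub>) (\<lambda>a x. \<lambda>i\<in>I. a \<odot>\<^bsub>M i\<^esub> x i)"

definition module_pair :: "('a, 'b) module \<Rightarrow> ('a, 'c) module \<Rightarrow> ('a, 'b \<times> 'c) module"
  where "module_pair M N = mk_module (carrier M \<times> carrier N)
    (\<lambda>(x, y) (x', y'). (x \<oplus>\<^bsub>M\<^esub> x', y \<oplus>\<^bsub>N\<^esub> y')) (\<zero>\<^bsub>M\<^esub>, \<zero>\<^bsub>N\<^esub>)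
    (\<lambda>a (x, y). (a \<odot>\<^bsub>M\<^esub> x, a \<odot>\<^bsub>N\<^esub> y))"

text \<open>Multiplication by \<open>(-1)\<^sup>e\<close>.\<close>

definition alt_sign :: "('a, 'b) module \<Rightarrow> int \<Rightarrow> 'b \<Rightarrow> 'b"
  where "alt_sign M e x = (if even e then x else \<ominus>\<^bsub>M\<^esub> x)"

text \<open>The mapping cone of a chain map \<open>f\<close> from \<open>(C, d)\<close> to \<open>(C', d')\<close>.\<close>

definition cone_module ::
    "(int \<Rightarrow> ('a, 'c) module) \<Rightarrow> (int \<Rightarrow> ('a, 'b) module) \<Rightarrow> int \<Rightarrow> ('a, 'c \<times> 'b) module"
  where "cone_module C' C n = module_pair (C' n) (C (n - 1))"

definition cone_diff ::
    "(int \<Rightarrow> ('a, 'c) module) \<Rightarrow> (int \<Rightarrow> 'c \<Rightarrow> 'c) \<Rightarrow> (int \<Rightarrow> 'b \<Rightarrow> 'b) \<Rightarrow> (int \<Rightarrow> 'b \<Rightarrow> 'c) \<Rightarrow>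
     int \<Rightarrow> 'c \<times> 'b \<Rightarrow> 'c \<times> 'b"
  where "cone_diff C' d' d f n = (\<lambda>(x', x).
    (d' n x' \<oplus>\<^bsub>C' (n - 1)\<^esub> alt_sign (C' (n - 1)) (n - 1) (f (n - 1) x), d (n - 1) x))"


section \<open>Group algebras\<close>

text \<open>
  The group algebra \<open>kG\<close> has the functions from \<open>G\<close> to \<open>k\<close> of finite support as elements (extended
  by zero to the whole type); so the group algebra of a subgroup is literally a subring, and a
  module over \<open>kG\<close> is, without any change, a module over the group algebra of the subgroup.
\<close>

definition group_algebra :: "('g, 'x) monoid_scheme \<Rightarrow> ('g \<Rightarrow> 'k::field) ring"
  where "group_algebra G =
    \<lparr>carrier = {a. finite {g. a g \<noteq> 0} \<and> {g. a g \<noteq> 0} \<subseteq> carrier G},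
     monoid.mult = (\<lambda>a b g. \<Sum>(x, y)\<in>{(x, y). a x \<noteq> 0 \<and> b y \<noteq> 0 \<and> x \<otimes>\<^bsub>G\<^esub> y = g}. a x * b y),
     one = (\<lambda>g. if g = \<one>\<^bsub>G\<^esub> then 1 else 0),
     ring.zero = (\<lambda>_. 0),
     add = (\<lambda>a b g. a g + b g)\<rparr>"

abbreviation subgroup_algebra :: "('g, 'x) monoid_scheme \<Rightarrow> 'g set \<Rightarrow> ('g \<Rightarrow> 'k::field) ring"
  where "subgroup_algebra G S \<equiv> group_algebra (G\<lparr>carrier := S\<rparr>)"

text \<open>The element \<open>c\<cdot>g\<close>.\<close>

definition single :: "'g \<Rightarrow> 'k \<Rightarrow> 'g \<Rightarrow> 'k::field"
  where "single g c = (\<lambda>x. if x = g then c else 0)"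

definition augmentation :: "('g \<Rightarrow> 'k) \<Rightarrow> 'k::field"
  where "augmentation a = (\<Sum>g | a g \<noteq> 0. a g)"

definition augmentation_ideal :: "('g, 'x) monoid_scheme \<Rightarrow> ('g \<Rightarrow> 'k::field) set"
  where "augmentation_ideal G = {a \<in> carrier (group_algebra G). augmentation a = 0}"

definition trivial_module :: "('g \<Rightarrow> 'k, 'k::field) module"
  where "trivial_module = mk_module UNIV (+) 0 (\<lambda>a x. augmentation a * x)"

text \<open>
  \<open>\<Omega>\<close>-resolutions of \<open>k\<close> with respect to a group \<open>T\<close>, here for abelian \<open>T\<close> only, since the tensor
  products are over the commutative ring \<open>kT\<close>.
\<close>

definition omega_resolution ::
    "('g, 'x) monoid_scheme \<Rightarrow> (int \<Rightarrow> ('g \<Rightarrow> 'k::field, 'b) module) \<Rightarrow> (int \<Rightarrow> 'b \<Rightarrow> 'b) \<Rightarrow> ('b \<Rightarrow> 'k) \<Rightarrow> bool"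
  where "omega_resolution T P d \<epsilon> \<longleftrightarrow>
   (let kT = (group_algebra T :: ('g \<Rightarrow> 'k) ring);
        k = (trivial_module :: ('g \<Rightarrow> 'k, 'k) module);
        kP = (\<lambda>n. tensor_module kT k (P n));
        kd = (\<lambda>n. tensor_map kT k (P (n - 1)) id (d n))
    in chain_complex kT P d \<and> (\<forall>n<0. carrier (P n) = {\<zero>\<^bsub>P n\<^esub>}) \<and>
       \<epsilon> \<in> lmod_hom kT (P 0) k \<and> (\<forall>x\<in>carrier (P 1). \<epsilon> (d 1 x) = 0) \<and>
       (\<forall>n\<ge>0. projective_module kT (P n)) \<and>
       (\<forall>n\<ge>1. exact_at (kP (n + 1)) (kd (n + 1)) (kP n) (kd n) (kP (n - 1))) \<and>
       exact_at (kP 1) (kd 1) (kP 0) (tensor_map kT k k id \<epsilon>) (tensor_module kT k k) \<and>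
       tensor_map kT k k id \<epsilon> ` carrier (kP 0) = carrier (tensor_module kT k k) \<and>
       (\<forall>n\<ge>0. \<forall>t\<in>carrier T. \<forall>z\<in>carrier (homology P d n). single t 1 \<odot>\<^bsub>homology P d n\<^esub> z = z) \<and>
       (\<lambda>z. the_elem (\<epsilon> ` z)) \<in> lmod_iso kT (homology P d 0) k)"


section \<open>The complex \<open>D\<close>\<close>

text \<open>\<open>\<int>/p\<^sup>\<infinity> = \<int>[1/p]/\<int>\<close>\<close>

definition prufer_group :: "nat \<Rightarrow> rat set monoid"
  where "prufer_group p =
    \<lparr>carrier = {x. \<exists>n. x * of_nat p ^ n \<in> \<int>}, monoid.mult = (+), one = 0\<rparr> Mod \<int>"

definition conj_act :: "('g, 'x) monoid_scheme \<Rightarrow> 'g \<Rightarrow> 'g \<Rightarrow> 'g"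
  where "conj_act G h x = h \<otimes>\<^bsub>G\<^esub> x \<otimes>\<^bsub>G\<^esub> inv\<^bsub>G\<^esub> h"

definition alg_conj :: "('g, 'x) monoid_scheme \<Rightarrow> 'g \<Rightarrow> ('g \<Rightarrow> 'k) \<Rightarrow> 'g \<Rightarrow> 'k::field"
  where "alg_conj G h a = (\<lambda>x. if x \<in> carrier G then a (conj_act G (inv\<^bsub>G\<^esub> h) x) else 0)"

text \<open>The components of \<open>g = t h\<close> with \<open>t \<in> T\<close>, \<open>h \<in> H\<close>.\<close>

definition H_part :: "('g, 'x) monoid_scheme \<Rightarrow> 'g set \<Rightarrow> 'g set \<Rightarrow> 'g \<Rightarrow> 'g"
  where "H_part G T H g = (THE h. h \<in> H \<and> g \<otimes>\<^bsub>G\<^esub> inv\<^bsub>G\<^esub> h \<in> T)"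

definition T_part :: "('g, 'x) monoid_scheme \<Rightarrow> 'g set \<Rightarrow> 'g set \<Rightarrow> 'g \<Rightarrow> 'g"
  where "T_part G T H g = g \<otimes>\<^bsub>G\<^esub> inv\<^bsub>G\<^esub> (H_part G T H g)"

text \<open>
  A \<open>kT\<close>-module \<open>M\<close> on which \<open>H\<close> acts semilinearly (with respect to conjugation on \<open>kT\<close>), as a module
  over the group algebra of \<open>G = T \<rtimes> H\<close>: the element \<open>t h\<close> acts by \<open>x \<mapsto> t (h x)\<close>.
\<close>

definition semidirect_module ::
    "('g, 'x) monoid_scheme \<Rightarrow> 'g set \<Rightarrow> 'g set \<Rightarrow> ('g \<Rightarrow> 'k::field, 'b) module \<Rightarrow> ('g \<Rightarrow> 'b \<Rightarrow> 'b) \<Rightarrow>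
     ('g \<Rightarrow> 'k, 'b) module"
  where "semidirect_module G T H M act = mk_module (carrier M) (add M) (ring.zero M)
    (\<lambda>a x. \<Oplus>\<^bsub>M\<^esub>g\<in>{g. a g \<noteq> 0}. single (T_part G T H g) (a g) \<odot>\<^bsub>M\<^esub> act (H_part G T H g) x)"

definition torsion :: "('g, 'x) monoid_scheme \<Rightarrow> 'g set \<Rightarrow> nat \<Rightarrow> nat \<Rightarrow> 'g set"
  where "torsion G T p n = {t \<in> T. t [^]\<^bsub>G\<^esub> (p ^ n) = \<one>\<^bsub>G\<^esub>}"

abbreviation prime_field :: "nat \<Rightarrow> int ring"
  where "prime_field p \<equiv> residue_ring (int p)"

definition V_mod :: "('g, 'x) monoid_scheme \<Rightarrow> 'g set \<Rightarrow> nat \<Rightarrow> (int, 'g) module"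
  where "V_mod G T p = mk_module (torsion G T p 1) (\<otimes>\<^bsub>G\<^esub>) \<one>\<^bsub>G\<^esub> (\<lambda>c v. v [^]\<^bsub>G\<^esub> c)"

definition kT_Fp :: "('g, 'x) monoid_scheme \<Rightarrow> 'g set \<Rightarrow> (int, 'g \<Rightarrow> 'k::field) module"
  where "kT_Fp G T = (let kT = (subgroup_algebra G T :: ('g \<Rightarrow> 'k) ring) in
    mk_module (carrier kT) (add kT) (ring.zero kT) (\<lambda>c a x. of_int c * a x))"

text \<open>
  \<open>kT\<cdot>V\<close>: its \<open>kT\<close>-module structure, the action of \<open>H\<close>, and the resulting module over the group
  algebra of \<open>G\<close>.
\<close>

type_synonym ('g, 'k) kTV = "(('g \<Rightarrow> 'k) \<times> 'g \<Rightarrow> int) set"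

definition kTV_T ::
    "('g, 'x) monoid_scheme \<Rightarrow> 'g set \<Rightarrow> nat \<Rightarrow> ('g \<Rightarrow> 'k::field, ('g, 'k) kTV) module"
  where "kTV_T G T p =
    (let kT = (subgroup_algebra G T :: ('g \<Rightarrow> 'k) ring); A = (kT_Fp G T :: (int, 'g \<Rightarrow> 'k) module);
         V = V_mod G T p; Q = tensor_module (prime_field p) A V
     in mk_module (carrier Q) (add Q) (ring.zero Q)
          (\<lambda>a. tensor_map (prime_field p) A V (\<lambda>b. a \<otimes>\<^bsub>kT\<^esub> b) id))"

definition kTV_act ::
    "('g, 'x) monoid_scheme \<Rightarrow> 'g set \<Rightarrow> nat \<Rightarrow> 'g \<Rightarrow> ('g, 'k::field) kTV \<Rightarrow> ('g, 'k) kTV"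
  where "kTV_act G T p h =
    tensor_map (prime_field p) (kT_Fp G T) (V_mod G T p) (alg_conj G h) (conj_act G h)"

definition kTV ::
    "('g, 'x) monoid_scheme \<Rightarrow> 'g set \<Rightarrow> 'g set \<Rightarrow> nat \<Rightarrow> ('g \<Rightarrow> 'k::field, ('g, 'k) kTV) module"
  where "kTV G T H p = semidirect_module G T H (kTV_T G T p) (kTV_act G T p)"

text \<open>
  \<open>f\<close> is a lift of \<open>\<phi>\<^sub>n\<close>-bar, where \<open>\<phi>\<^sub>n\<close>-bar sends \<open>t\<close> to the class of \<open>s - 1\<close> modulo the square of the
  augmentation ideal of \<open>kT\<^sub>n\<close>, for any \<open>s \<in> T\<^sub>n\<close> with \<open>s\<close> to the power \<open>p\<^sup>n\<^sup>-\<^sup>1\<close> equal to \<open>t\<close>; and \<open>f\<close> is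
  linear over the group ring of \<open>H\<close> over the prime field.
\<close>

definition phi_lift ::
    "('g, 'x) monoid_scheme \<Rightarrow> 'g set \<Rightarrow> 'g set \<Rightarrow> nat \<Rightarrow> nat \<Rightarrow> ('g \<Rightarrow> 'g \<Rightarrow> 'k::field) \<Rightarrow> bool"
  where "phi_lift G T H p n f \<longleftrightarrow>
   (let Tn = torsion G T p n; V = V_mod G T p;
        kTn = (subgroup_algebra G Tn :: ('g \<Rightarrow> 'k) ring);
        I = augmentation_ideal (G\<lparr>carrier := Tn\<rparr>);
        I2 = I \<cdot>\<^bsub>kTn\<^esub> I
    in f \<in> lmod_hom (prime_field p) V (kT_Fp G T) \<and> f ` carrier V \<subseteq> I \<and>
       (\<forall>h\<in>H. \<forall>v\<in>carrier V. f (conj_act G h v) = alg_conj G h (f v)) \<and>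
       (\<forall>v\<in>carrier V. \<forall>s\<in>Tn. s [^]\<^bsub>G\<^esub> (p ^ (n - 1)) = v \<longrightarrow>
          I2 +>\<^bsub>kTn\<^esub> f v = I2 +>\<^bsub>kTn\<^esub> (single s 1 \<ominus>\<^bsub>kTn\<^esub> single \<one>\<^bsub>G\<^esub> 1)))"

text \<open>The map \<open>\<phi>\<^sub>n\<close> determined by \<open>f\<close>, sending \<open>a \<otimes> v\<close> to \<open>a f(v)\<close>.\<close>

definition phi_map ::
    "('g, 'x) monoid_scheme \<Rightarrow> 'g set \<Rightarrow> nat \<Rightarrow> ('g \<Rightarrow> 'g \<Rightarrow> 'k::field) \<Rightarrow> ('g, 'k) kTV \<Rightarrow> 'g \<Rightarrow> 'k"
  where "phi_map G T p f = induced_map (prime_field p) id (kT_Fp G T)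
    (\<lambda>(a, v). a \<otimes>\<^bsub>subgroup_algebra G T\<^esub> f v)"

text \<open>The modules \<open>D\<^sub>m\<close> over the group algebra of \<open>G\<close>, zero unless \<open>0 \<le> m \<le> r\<close>.\<close>

type_synonym ('g, 'k) D = "(('g, 'k) kTV list \<Rightarrow> 'g \<Rightarrow> 'k) set"

definition D_mod ::
    "('g, 'x) monoid_scheme \<Rightarrow> 'g set \<Rightarrow> 'g set \<Rightarrow> nat \<Rightarrow> nat \<Rightarrow> int \<Rightarrow> ('g \<Rightarrow> 'k::field, ('g, 'k) D) module"
  where "D_mod G T H p r m =
   (if 0 \<le> m \<and> m \<le> int r
    then let kT = subgroup_algebra G T; M = kTV_T G T p; E = exterior_power kT M (nat m)
         in semidirect_module G T H E
              (\<lambda>h. induced_map kT (alg_conj G h) E (\<lambda>xs. wedge kT M (map (kTV_act G T p h) xs)))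
    else zero_module)"

text \<open>The tuples are indexed from 0, hence the sign \<open>(-1)\<^sup>i\<close>.\<close>

definition D_diff ::
    "('g, 'x) monoid_scheme \<Rightarrow> 'g set \<Rightarrow> 'g set \<Rightarrow> nat \<Rightarrow> nat \<Rightarrow> (('g, 'k::field) kTV \<Rightarrow> 'g \<Rightarrow> 'k) \<Rightarrow>
     int \<Rightarrow> ('g, 'k) D \<Rightarrow> ('g, 'k) D"
  where "D_diff G T H p r \<phi> m =
   (if 1 \<le> m \<and> m \<le> int r
    then let kT = subgroup_algebra G T; M = kTV_T G T p; E = exterior_power kT M (nat (m - 1))
         in induced_map kT id E
              (\<lambda>xs. \<Oplus>\<^bsub>E\<^esub>i\<in>{..<length xs}.
                alt_sign E (int i) (\<phi> (xs ! i) \<odot>\<^bsub>E\<^esub> wedge kT M (take i xs @ drop (Suc i) xs)))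
    else (\<lambda>_. \<zero>\<^bsub>D_mod G T H p r (m - 1) :: ('g \<Rightarrow> 'k, ('g, 'k) D) module\<^esub>))"

text \<open>The exterior powers of \<open>\<psi>\<close>.\<close>

definition D_map ::
    "('g, 'x) monoid_scheme \<Rightarrow> 'g set \<Rightarrow> 'g set \<Rightarrow> nat \<Rightarrow> nat \<Rightarrow>
     (('g, 'k::field) kTV \<Rightarrow> ('g, 'k) kTV) \<Rightarrow> int \<Rightarrow> ('g, 'k) D \<Rightarrow> ('g, 'k) D"
  where "D_map G T H p r \<psi> m =
   (if 0 \<le> m \<and> m \<le> int r
    then let kT = subgroup_algebra G T; M = kTV_T G T p
         in induced_map kT id (exterior_power kT M (nat m)) (\<lambda>xs. wedge kT M (map \<psi> xs))
    else (\<lambda>_. \<zero>\<^bsub>D_mod G T H p r m :: ('g \<Rightarrow> 'k, ('g, 'k) D) module\<^esub>))"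

text \<open>
  The direct sum over \<open>n \<ge> 1\<close> of the complexes \<open>D\<^sup>(\<^sup>n\<^sup>)\<close>, its endomorphism \<open>\<Psi>\<close>, and the mapping cone;
  \<open>f n\<close> is the chosen lift of \<open>\<phi>\<^sub>n\<close>-bar.
\<close>

definition sum_mod ::
    "('g, 'x) monoid_scheme \<Rightarrow> 'g set \<Rightarrow> 'g set \<Rightarrow> nat \<Rightarrow> nat \<Rightarrow> int \<Rightarrow>
     ('g \<Rightarrow> 'k::field, nat \<Rightarrow> ('g, 'k) D) module"
  where "sum_mod G T H p r m = direct_sum {1..} (\<lambda>n. D_mod G T H p r m)"

definition sum_diff ::
    "('g, 'x) monoid_scheme \<Rightarrow> 'g set \<Rightarrow> 'g set \<Rightarrow> nat \<Rightarrow> nat \<Rightarrow> (nat \<Rightarrow> 'g \<Rightarrow> 'g \<Rightarrow> 'k::field) \<Rightarrow>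
     int \<Rightarrow> (nat \<Rightarrow> ('g, 'k) D) \<Rightarrow> nat \<Rightarrow> ('g, 'k) D"
  where "sum_diff G T H p r f m x = (\<lambda>n\<in>{1..}. D_diff G T H p r (phi_map G T p (f n)) m (x n))"

definition sum_Psi ::
    "('g, 'x) monoid_scheme \<Rightarrow> 'g set \<Rightarrow> 'g set \<Rightarrow> nat \<Rightarrow> nat \<Rightarrow>
     (nat \<Rightarrow> ('g, 'k::field) kTV \<Rightarrow> ('g, 'k) kTV) \<Rightarrow> int \<Rightarrow> (nat \<Rightarrow> ('g, 'k) D) \<Rightarrow> nat \<Rightarrow> ('g, 'k) D"
  where "sum_Psi G T H p r \<psi> m x = (\<lambda>n\<in>{1..}.
    if n = 1 then x 1
    else x n \<ominus>\<^bsub>D_mod G T H p r m :: ('g \<Rightarrow> 'k, ('g, 'k) D) module\<^esub> D_map G T H p r (\<psi> (n - 1)) m (x (n - 1)))"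

type_synonym ('g, 'k) bD = "(nat \<Rightarrow> ('g, 'k) D) \<times> (nat \<Rightarrow> ('g, 'k) D)"

definition bD_mod ::
    "('g, 'x) monoid_scheme \<Rightarrow> 'g set \<Rightarrow> 'g set \<Rightarrow> nat \<Rightarrow> nat \<Rightarrow> int \<Rightarrow>
     ('g \<Rightarrow> 'k::field, ('g, 'k) bD) module"
  where "bD_mod G T H p r = cone_module (sum_mod G T H p r) (sum_mod G T H p r)"

definition bD_diff ::
    "('g, 'x) monoid_scheme \<Rightarrow> 'g set \<Rightarrow> 'g set \<Rightarrow> nat \<Rightarrow> nat \<Rightarrow> (nat \<Rightarrow> 'g \<Rightarrow> 'g \<Rightarrow> 'k::field) \<Rightarrow>
     (nat \<Rightarrow> ('g, 'k) kTV \<Rightarrow> ('g, 'k) kTV) \<Rightarrow> int \<Rightarrow> ('g, 'k) bD \<Rightarrow> ('g, 'k) bD"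
  where "bD_diff G T H p r f \<psi> = cone_diff (sum_mod G T H p r)
    (sum_diff G T H p r f) (sum_diff G T H p r f) (sum_Psi G T H p r \<psi>)"

text \<open>
  The identification of the zeroth exterior power with \<open>kT\<close> takes a coset to the coefficient of \<open>[]\<close>.
\<close>

definition D0_aug :: "('g, 'k::field) D \<Rightarrow> 'k"
  where "D0_aug c = augmentation (the_elem ((\<lambda>u. u []) ` c))"

definition bD_aug ::
    "('g, 'x) monoid_scheme \<Rightarrow> 'g set \<Rightarrow> 'g set \<Rightarrow> nat \<Rightarrow> nat \<Rightarrow> ('g, 'k::field) bD \<Rightarrow> 'k"
  where "bD_aug G T H p r = (\<lambda>(x, y).
    \<Sum>n | n \<ge> 1 \<and> x n \<noteq> \<zero>\<^bsub>D_mod G T H p r 0 :: ('g \<Rightarrow> 'k, ('g, 'k) D) module\<^esub>. D0_aug (x n))"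

end

theory Submission
  imports "HOL-Computational_Algebra.Polynomial" Defs
begin

text \<open>
  If \<open>t\<close> has order dividing \<open>p\<^sup>n\<close>, then \<open>t - 1 = \<phi>\<^sub>n(x)\<close> for some \<open>x\<close>: modulo the square of the
  augmentation ideal of \<open>kT\<^sub>n\<close> the map \<open>\<phi>\<^sub>n\<close> hits all \<open>s - 1\<close>, and these generators are nilpotent, so
  that Nakayama's lemma applies. For a cycle \<open>w\<close> of \<open>D\<^sup>(\<^sup>n\<^sup>)\<close> the Koszul differential of \<open>x \<and> w\<close> is
  \<open>\<phi>\<^sub>n(x) w = (t - 1) w\<close>. In the telescope every cycle is homologous to a cycle of a single summand
  \<open>D\<^sup>(\<^sup>n\<^sup>)\<close> with \<open>n\<close> as large as desired, hence \<open>T\<close> acts trivially on the homology; in degree 0 the same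
  argument shows that the augmentation is an isomorphism.

  Modulo the augmentation ideal \<open>I\<close> of \<open>kT\<close> the differentials of \<open>D\<^sup>(\<^sup>n\<^sup>)\<close> vanish, and so do the maps
  \<open>\<Psi>\<^sup>(\<^sup>n\<^sup>)\<close> in positive degrees, because \<open>\<psi>\<^sub>n\<close> has values in \<open>I\<cdot>V\<close>: the derivation \<open>\<Sum> a\<^sub>t t \<mapsto> \<Sum> a\<^sub>t \<mu>\<^sub>i(t)\<close>,
  where \<open>\<mu>\<^sub>i(t)\<close> is the \<open>i\<close>-th coordinate of \<open>t\<close> in units of \<open>p\<^sup>-\<^sup>n\<^sup>-\<^sup>1\<close>, reads off the augmentation of the
  \<open>i\<close>-th coordinate of \<open>x\<close> from \<open>\<phi>\<^sub>n\<^sub>+\<^sub>1(x)\<close>, but vanishes on all values of \<open>\<phi>\<^sub>n = \<phi>\<^sub>n\<^sub>+\<^sub>1 \<psi>\<^sub>n\<close>. Therefore \<open>\<Psi>\<close> is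
  the identity modulo \<open>I\<close> in positive degrees and injective modulo \<open>I\<close> in degree 0, which gives the exactness of
  the complex tensored with \<open>k\<close>. Projectivity over \<open>kT\<close> is obtained from dual bases, and
  projectivity over the group algebra of \<open>\<Gamma>\<close> by averaging over \<open>H\<close>.
\<close>

text \<open>Three obstacles shape the proof. Modules are quotients of free modules, so every map
  must be checked on generators and relations; tensor products and exterior powers share one
  universal property, and exterior algebra is done with multiplication \<open>lw\<close> by a vector
  and contraction \<open>contr\<close> rather than with alternating sums over tuples. Next, k is the
  cyclic module kT/I, so k \<otimes> P is P/IP, and exactness after tensoring becomes a statement
  about elements of P modulo IP. Finally, T is known only up to an abstract isomorphism: it provides
  rational coordinates that are additive only modulo integers, and rounding makes \<open>mu\<close>
  additive only when one of two arguments is torsion of bounded order. This suffices because the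
  lifts take their values in kT_n.

  The telescope is set up over an arbitrary ring. The same complex is then read over the group
  algebra of \<Gamma> and over the commutative ring kT: the resolution properties are proved over
  kT, while linearity and projectivity are established over the larger ring.\<close>

lemma mk_module_simps [simp]:
  "carrier (mk_module C pl z sm) = C" "add (mk_module C pl z sm) = pl"
  "ring.zero (mk_module C pl z sm) = z" "smult (mk_module C pl z sm) = sm"
  by (simp_all add: mk_module_def)

section \<open>Additive and semilinear maps\<close>

lemma image_eq_singleton: "x \<in> A ==> (\<And>y. y \<in> A ==> f y = f x) ==> f ` A = {f x}"
  unfolding image_def by blast

text \<open>Stated for ring records, which module records extend, so that it covers maps of modules
  as well as the map a \<mapsto> a x from the ring to a module.\<close>

definition additive_map :: "('b, 'm) ring_scheme => ('c, 'n) ring_scheme => ('b => 'c) => bool"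
  where "additive_map M N f \<longleftrightarrow> f \<in> carrier M \<rightarrow> carrier N \<and>
    (\<forall>x\<in>carrier M. \<forall>y\<in>carrier M. f (x \<oplus>\<^bsub>M\<^esub> y) = f x \<oplus>\<^bsub>N\<^esub> f y)"

lemma additive_map_closed: "additive_map M N f ==> x \<in> carrier M ==> f x \<in> carrier N"
  by (auto simp: additive_map_def)

lemma additive_map_add:
  "additive_map M N f ==> x \<in> carrier M ==> y \<in> carrier M ==> f (x \<oplus>\<^bsub>M\<^esub> y) = f x \<oplus>\<^bsub>N\<^esub> f y"
  by (auto simp: additive_map_def)

lemma additive_map_zero:
  assumes "abelian_group M" "abelian_group N" "additive_map M N f"
  shows "f \<zero>\<^bsub>M\<^esub> = \<zero>\<^bsub>N\<^esub>"
proof -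
  interpret M: abelian_group M by fact
  interpret N: abelian_group N by fact
  have "f \<zero>\<^bsub>M\<^esub> \<oplus>\<^bsub>N\<^esub> f \<zero>\<^bsub>M\<^esub> = f \<zero>\<^bsub>M\<^esub>"
    using additive_map_add[OF assms(3), of "\<zero>\<^bsub>M\<^esub>" "\<zero>\<^bsub>M\<^esub>"] by simp
  thus ?thesis using additive_map_closed[OF assms(3), of "\<zero>\<^bsub>M\<^esub>"] by simp
qed

lemma additive_map_minus:
  assumes "abelian_group M" "abelian_group N" "additive_map M N f" "x \<in> carrier M"
  shows "f (\<ominus>\<^bsub>M\<^esub> x) = \<ominus>\<^bsub>N\<^esub> f x"
proof -
  interpret M: abelian_group M by fact
  interpret N: abelian_group N by fact
  have "f (\<ominus>\<^bsub>M\<^esub> x) \<oplus>\<^bsub>N\<^esub> f x = \<zero>\<^bsub>N\<^esub>"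
    using additive_map_add[OF assms(3), of "\<ominus>\<^bsub>M\<^esub> x" x] additive_map_zero[OF assms(1-3)] assms(4)
    by (simp add: M.l_neg)
  thus ?thesis using additive_map_closed[OF assms(3)] assms(4) by (simp add: N.minus_equality)
qed

lemma additive_map_diff:
  assumes "abelian_group M" "abelian_group N" "additive_map M N f" "x \<in> carrier M" "y \<in> carrier M"
  shows "f (x \<ominus>\<^bsub>M\<^esub> y) = f x \<ominus>\<^bsub>N\<^esub> f y"
proof -
  interpret M: abelian_group M by fact
  show ?thesis using assms
    by (simp add: a_minus_def additive_map_add[OF assms(3)] additive_map_minus[OF assms(1-3)])
qed

lemma additive_map_finsum:
  assumes "abelian_group M" "abelian_group N" "additive_map M N f" "finite A" "g \<in> A \<rightarrow> carrier M"
  shows "f (\<Oplus>\<^bsub>M\<^esub>i\<in>A. g i) = (\<Oplus>\<^bsub>N\<^esub>i\<in>A. f (g i))"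
proof -
  interpret M: abelian_group M by fact
  interpret N: abelian_group N by fact
  note cl = additive_map_closed[OF assms(3)]
  show ?thesis using assms(4,5)
  proof (induction A)
    case empty thus ?case by (simp add: additive_map_zero[OF assms(1-3)])
  next
    case (insert a A)
    have "g \<in> A \<rightarrow> carrier M" "g a \<in> carrier M" using insert by auto
    moreover have "(\<lambda>i. f (g i)) \<in> A \<rightarrow> carrier N" "f (g a) \<in> carrier N" using calculation cl by auto
    ultimately show ?case using insert
      by (simp add: M.finsum_insert N.finsum_insert additive_map_add[OF assms(3)] M.finsum_closed)
  qed
qed

text \<open>Elements of H act on kT-modules only semilinearly, with conjugation as
  \<open>\<sigma>\<close>; linear maps are the case \<open>\<sigma> = id\<close>. That
  \<open>\<sigma>\<close> is a ring homomorphism is stated separately where it matters.\<close>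

definition slin :: "('a => 'c) => ('a, 'r) ring_scheme => ('a, 'b, 'm) module_scheme =>
    ('c, 'd, 'n) module_scheme => ('b => 'd) set"
  where "slin \<sigma> R M N = {f. additive_map M N f \<and>
    (\<forall>a\<in>carrier R. \<forall>x\<in>carrier M. f (a \<odot>\<^bsub>M\<^esub> x) = \<sigma> a \<odot>\<^bsub>N\<^esub> f x)}"

lemma lmod_hom_slin: "lmod_hom R M N = slin id R M N"
  by (auto simp: lmod_hom_def slin_def additive_map_def)

lemma slin_additive: "f \<in> slin \<sigma> R M N ==> additive_map M N f"
  by (simp add: slin_def)

lemma slin_smult: "f \<in> slin \<sigma> R M N ==> a \<in> carrier R ==> x \<in> carrier M ==>
   f (a \<odot>\<^bsub>M\<^esub> x) = \<sigma> a \<odot>\<^bsub>N\<^esub> f x"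
  by (simp add: slin_def)

lemma hom_additive: "f \<in> lmod_hom R M N ==> additive_map M N f"
  by (simp add: lmod_hom_slin slin_def)

lemma hom_smult: "f \<in> lmod_hom R M N ==> a \<in> carrier R ==> x \<in> carrier M ==>
   f (a \<odot>\<^bsub>M\<^esub> x) = a \<odot>\<^bsub>N\<^esub> f x"
  by (simp add: lmod_hom_def)

lemma hom_closed: "f \<in> lmod_hom R M N ==> x \<in> carrier M ==> f x \<in> carrier N"
  by (auto simp: lmod_hom_def)

lemma lmod_homI:
  assumes "\<And>x. x \<in> carrier M ==> f x \<in> carrier N"
    "\<And>x y. x \<in> carrier M ==> y \<in> carrier M ==> f (x \<oplus>\<^bsub>M\<^esub> y) = f x \<oplus>\<^bsub>N\<^esub> f y"
    "\<And>a x. a \<in> carrier R ==> x \<in> carrier M ==> f (a \<odot>\<^bsub>M\<^esub> x) = a \<odot>\<^bsub>N\<^esub> f x"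
  shows "f \<in> lmod_hom R M N"
  using assms by (auto simp: lmod_hom_def)

lemma lmod_hom_comp:
  "f \<in> lmod_hom R M N ==> g \<in> lmod_hom R N L ==> (\<lambda>x. g (f x)) \<in> lmod_hom R M L"
  by (auto simp: lmod_hom_def Pi_iff)

section \<open>Left modules, spans and products with ideals\<close>

context left_module begin

lemma left_module: "left_module R M" ..
lemma ab: "abelian_group M" ..
lemma ring_R: "ring R" ..

lemma smult_add_map: "a \<in> carrier R ==> additive_map M M (\<lambda>x. a \<odot>\<^bsub>M\<^esub> x)"
  by (auto simp: additive_map_def smult_r_distr smult_closed)

lemma smult_l_add_map: "x \<in> carrier M ==> additive_map R M (\<lambda>a. a \<odot>\<^bsub>M\<^esub> x)"
  by (auto simp: additive_map_def smult_l_distr smult_closed)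

lemma ab_R: "abelian_group R" ..

lemma smult_r_null: "a \<in> carrier R ==> a \<odot>\<^bsub>M\<^esub> \<zero>\<^bsub>M\<^esub> = \<zero>\<^bsub>M\<^esub>"
  using additive_map_zero[OF ab ab smult_add_map] .
lemma smult_l_null: "x \<in> carrier M ==> \<zero> \<odot>\<^bsub>M\<^esub> x = \<zero>\<^bsub>M\<^esub>"
  using additive_map_zero[OF ab_R ab smult_l_add_map] .
lemma smult_r_minus: "a \<in> carrier R ==> x \<in> carrier M ==> a \<odot>\<^bsub>M\<^esub> (\<ominus>\<^bsub>M\<^esub> x) = \<ominus>\<^bsub>M\<^esub> (a \<odot>\<^bsub>M\<^esub> x)"
  using additive_map_minus[OF ab ab smult_add_map] .
lemma smult_l_minus: "a \<in> carrier R ==> x \<in> carrier M ==> (\<ominus> a) \<odot>\<^bsub>M\<^esub> x = \<ominus>\<^bsub>M\<^esub> (a \<odot>\<^bsub>M\<^esub> x)"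
  using additive_map_minus[OF ab_R ab smult_l_add_map] .
lemma smult_r_diff: "a \<in> carrier R ==> x \<in> carrier M ==> y \<in> carrier M ==>
    a \<odot>\<^bsub>M\<^esub> (x \<ominus>\<^bsub>M\<^esub> y) = a \<odot>\<^bsub>M\<^esub> x \<ominus>\<^bsub>M\<^esub> a \<odot>\<^bsub>M\<^esub> y"
  using additive_map_diff[OF ab ab smult_add_map] .
lemma smult_l_diff: "a \<in> carrier R ==> b \<in> carrier R ==> x \<in> carrier M ==>
    (a \<ominus> b) \<odot>\<^bsub>M\<^esub> x = a \<odot>\<^bsub>M\<^esub> x \<ominus>\<^bsub>M\<^esub> b \<odot>\<^bsub>M\<^esub> x"
  using additive_map_diff[OF ab_R ab smult_l_add_map] .
lemmas smult_finsum = additive_map_finsum[OF ab ab smult_add_map]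
text \<open>Closure under negatives comes from multiplication by
  \<open>\<ominus> \<one>\<close>.\<close>

lemma submoduleI:
  assumes "H \<subseteq> carrier M" "\<zero>\<^bsub>M\<^esub> \<in> H" "\<And>x y. x \<in> H ==> y \<in> H ==> x \<oplus>\<^bsub>M\<^esub> y \<in> H"
    "\<And>a x. a \<in> carrier R ==> x \<in> H ==> a \<odot>\<^bsub>M\<^esub> x \<in> H"
  shows "submodule H R M"
proof -
  have neg: "\<ominus>\<^bsub>M\<^esub> x \<in> H" if "x \<in> H" for x
  proof -
    have "(\<ominus> \<one>) \<odot>\<^bsub>M\<^esub> x = \<ominus>\<^bsub>M\<^esub> x" using that assms(1) by (auto simp: smult_l_minus smult_one)
    thus ?thesis using assms(4)[of "\<ominus> \<one>" x] that by simp
  qed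
  show ?thesis
    apply (intro submodule.intro subgroup.intro)
    using assms neg by (auto simp: submodule_axioms_def a_inv_def)
qed

lemma submodule_props:
  assumes "submodule H R M"
  shows "H \<subseteq> carrier M" "\<zero>\<^bsub>M\<^esub> \<in> H" "\<And>x y. x \<in> H ==> y \<in> H ==> x \<oplus>\<^bsub>M\<^esub> y \<in> H"
    "\<And>x. x \<in> H ==> \<ominus>\<^bsub>M\<^esub> x \<in> H"
    "\<And>x y. x \<in> H ==> y \<in> H ==> x \<ominus>\<^bsub>M\<^esub> y \<in> H"
    "\<And>a x. a \<in> carrier R ==> x \<in> H ==> a \<odot>\<^bsub>M\<^esub> x \<in> H"
proof -
  interpret submodule H R M by fact
  show 1: "H \<subseteq> carrier M" "\<zero>\<^bsub>M\<^esub> \<in> H" "\<And>x y. x \<in> H ==> y \<in> H ==> x \<oplus>\<^bsub>M\<^esub> y \<in> H"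
    using subset one_closed m_closed by auto
  show 2: "\<And>x. x \<in> H ==> \<ominus>\<^bsub>M\<^esub> x \<in> H" using m_inv_closed by (simp add: a_inv_def)
  show "\<And>x y. x \<in> H ==> y \<in> H ==> x \<ominus>\<^bsub>M\<^esub> y \<in> H"  using 1 2 by (simp add: a_minus_def)
  show "\<And>a x. a \<in> carrier R ==> x \<in> H ==> a \<odot>\<^bsub>M\<^esub> x \<in> H" by (rule smult_closed)
qed

lemma span_incl: "S \<subseteq> submodule_span R M S"
  by (auto simp: submodule_span_def)

lemma span_submodule:
  assumes "S \<subseteq> carrier M" shows "submodule (submodule_span R M S) R M"
proof -
  have "submodule (carrier M) R M" by (rule submoduleI) (auto intro: smult_closed)
  with assms have 1: "submodule_span R M S \<subseteq> carrier M" by (auto simp: submodule_span_def)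
  show ?thesis
    by (rule submoduleI[OF 1]) (auto simp: submodule_span_def submodule_props)
qed

text \<open>The span is an intersection of submodules; its minimality is applied to the submodule of
  all elements satisfying \<open>P\<close>. This takes the place of a description of spans by linear
  combinations.\<close>

lemma span_induct [consumes 2, case_names base zero add smult]:
  assumes "x \<in> submodule_span R M S" "S \<subseteq> carrier M" "\<And>x. x \<in> S ==> P x" "P \<zero>\<^bsub>M\<^esub>"
    "\<And>x y. x \<in> carrier M ==> y \<in> carrier M ==> P x ==> P y ==> P (x \<oplus>\<^bsub>M\<^esub> y)"
    "\<And>a x. a \<in> carrier R ==> x \<in> carrier M ==> P x ==> P (a \<odot>\<^bsub>M\<^esub> x)"
  shows "P x"
proof -
  have "submodule {x \<in> carrier M. P x} R M"
    by (rule submoduleI) (use assms in \<open>auto intro: smult_closed\<close>)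
  thus ?thesis using assms(1-3) by (auto simp: submodule_span_def)
qed

end

lemma abelian_groupI':
  assumes "\<And>x y. x \<in> carrier M ==> y \<in> carrier M ==> x \<oplus>\<^bsub>M\<^esub> y \<in> carrier M"
    "\<zero>\<^bsub>M\<^esub> \<in> carrier M"
    "\<And>x y z. x \<in> carrier M ==> y \<in> carrier M ==> z \<in> carrier M ==>
       (x \<oplus>\<^bsub>M\<^esub> y) \<oplus>\<^bsub>M\<^esub> z = x \<oplus>\<^bsub>M\<^esub> (y \<oplus>\<^bsub>M\<^esub> z)"
    "\<And>x y. x \<in> carrier M ==> y \<in> carrier M ==> x \<oplus>\<^bsub>M\<^esub> y = y \<oplus>\<^bsub>M\<^esub> x"
    "\<And>x. x \<in> carrier M ==> \<zero>\<^bsub>M\<^esub> \<oplus>\<^bsub>M\<^esub> x = x"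
    "\<And>x. x \<in> carrier M ==> \<exists>y\<in>carrier M. y \<oplus>\<^bsub>M\<^esub> x = \<zero>\<^bsub>M\<^esub>"
  shows "abelian_group M"
  by (rule abelian_groupI) (use assms in auto)

lemma left_moduleI:
  assumes "ring R" "abelian_group M"
    "\<And>a x. a \<in> carrier R ==> x \<in> carrier M ==> a \<odot>\<^bsub>M\<^esub> x \<in> carrier M"
    "\<And>a b x. a \<in> carrier R ==> b \<in> carrier R ==> x \<in> carrier M ==>
       (a \<oplus>\<^bsub>R\<^esub> b) \<odot>\<^bsub>M\<^esub> x = a \<odot>\<^bsub>M\<^esub> x \<oplus>\<^bsub>M\<^esub> b \<odot>\<^bsub>M\<^esub> x"
    "\<And>a x y. a \<in> carrier R ==> x \<in> carrier M ==> y \<in> carrier M ==>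
       a \<odot>\<^bsub>M\<^esub> (x \<oplus>\<^bsub>M\<^esub> y) = a \<odot>\<^bsub>M\<^esub> x \<oplus>\<^bsub>M\<^esub> a \<odot>\<^bsub>M\<^esub> y"
    "\<And>a b x. a \<in> carrier R ==> b \<in> carrier R ==> x \<in> carrier M ==>
       (a \<otimes>\<^bsub>R\<^esub> b) \<odot>\<^bsub>M\<^esub> x = a \<odot>\<^bsub>M\<^esub> (b \<odot>\<^bsub>M\<^esub> x)"
    "\<And>x. x \<in> carrier M ==> \<one>\<^bsub>R\<^esub> \<odot>\<^bsub>M\<^esub> x = x"
  shows "left_module R M"
  by (intro left_module.intro left_module_axioms.intro) (use assms in auto)

lemma left_module_ab: "left_module R M ==> abelian_group M"
  by (simp add: left_module_def)

lemma lmod_hom_add: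
  assumes N: "left_module R N" and "f \<in> lmod_hom R M N" "g \<in> lmod_hom R M N"
  shows "(\<lambda>x. f x \<oplus>\<^bsub>N\<^esub> g x) \<in> lmod_hom R M N"
proof -
  interpret N: left_module R N by fact
  show ?thesis using assms(2,3)
    by (intro lmod_homI) (auto simp: lmod_hom_def Pi_iff N.smult_r_distr N.M.a_ac)
qed

lemma lmod_hom_smult:
  assumes "cring R" and N: "left_module R N" and "f \<in> lmod_hom R M N" "r \<in> carrier R"
  shows "(\<lambda>x. r \<odot>\<^bsub>N\<^esub> f x) \<in> lmod_hom R M N"
proof -
  interpret N: left_module R N by fact
  interpret R: cring R by fact
  have "r \<odot>\<^bsub>N\<^esub> (a \<odot>\<^bsub>N\<^esub> x) = a \<odot>\<^bsub>N\<^esub> (r \<odot>\<^bsub>N\<^esub> x)" if "a \<in> carrier R" "x \<in> carrier N" for a x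
    using that assms(4) by (simp add: N.smult_assoc1[symmetric] R.m_comm)
  thus ?thesis using assms(3,4)
    by (intro lmod_homI) (auto simp: lmod_hom_def Pi_iff N.smult_r_distr N.smult_closed)
qed

lemma lmod_hom_neg:
  assumes N: "left_module R N" and "f \<in> lmod_hom R M N"
  shows "(\<lambda>x. \<ominus>\<^bsub>N\<^esub> f x) \<in> lmod_hom R M N"
proof -
  interpret N: left_module R N by fact
  show ?thesis using assms(2)
    by (intro lmod_homI) (auto simp: lmod_hom_def Pi_iff N.smult_r_minus N.M.minus_add)
qed

lemma lmod_hom_diff:
  assumes N: "left_module R N" and "f \<in> lmod_hom R M N" "g \<in> lmod_hom R M N"
  shows "(\<lambda>x. f x \<ominus>\<^bsub>N\<^esub> g x) \<in> lmod_hom R M N"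
  using lmod_hom_add[OF N assms(2) lmod_hom_neg[OF N assms(3)]] by (simp add: a_minus_def)

lemma lmod_hom_zero:
  assumes N: "left_module R N" shows "(\<lambda>x. \<zero>\<^bsub>N\<^esub>) \<in> lmod_hom R M N"
proof -
  interpret N: left_module R N by fact
  show ?thesis by (intro lmod_homI) (auto simp: N.smult_r_null)
qed

lemma lmod_hom_id: "(\<lambda>x. x) \<in> lmod_hom R M M"
  by (auto simp: lmod_hom_def)

lemma hom_add: "f \<in> lmod_hom R M N ==> x \<in> carrier M ==> y \<in> carrier M ==>
   f (x \<oplus>\<^bsub>M\<^esub> y) = f x \<oplus>\<^bsub>N\<^esub> f y"
  by (simp add: lmod_hom_def)

lemma hom_zero: "left_module R M ==> left_module R N ==> f \<in> lmod_hom R M N ==> f \<zero>\<^bsub>M\<^esub> = \<zero>\<^bsub>N\<^esub>"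
  using additive_map_zero[OF left_module_ab left_module_ab hom_additive] .

lemma hom_minus: "left_module R M ==> left_module R N ==> f \<in> lmod_hom R M N ==> x \<in> carrier M ==>
   f (\<ominus>\<^bsub>M\<^esub> x) = \<ominus>\<^bsub>N\<^esub> f x"
  using additive_map_minus[OF left_module_ab left_module_ab hom_additive] .

lemma hom_diff: "left_module R M ==> left_module R N ==> f \<in> lmod_hom R M N ==>
   x \<in> carrier M ==> y \<in> carrier M ==> f (x \<ominus>\<^bsub>M\<^esub> y) = f x \<ominus>\<^bsub>N\<^esub> f y"
  using additive_map_diff[OF left_module_ab left_module_ab hom_additive] .

lemma hom_finsum: "left_module R M ==> left_module R N ==> f \<in> lmod_hom R M N ==> finite A ==>
   g \<in> A \<rightarrow> carrier M ==> f (\<Oplus>\<^bsub>M\<^esub>i\<in>A. g i) = (\<Oplus>\<^bsub>N\<^esub>i\<in>A. f (g i))"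
  using additive_map_finsum[OF left_module_ab left_module_ab hom_additive] .

text \<open>The submodule I M. With I the augmentation ideal, M / I M is k \<otimes> M, so this is
  the submodule modulo which exactness after tensoring is tested.\<close>

definition ideal_smult :: "('a, 'r) ring_scheme => 'a set => ('a, 'b, 'm) module_scheme => 'b set"
  where "ideal_smult R I M = submodule_span R M {a \<odot>\<^bsub>M\<^esub> x | a x. a \<in> I \<and> x \<in> carrier M}"

text \<open>Linear forms are homomorphisms into this module, and ideals are its submodules, so that
  the results on spans can be used for ideals.\<close>

definition regular :: "('a, 'r) ring_scheme => ('a, 'a) module"
  where "regular R = mk_module (carrier R) (add R) (ring.zero R) (monoid.mult R)"

lemma regular_simps [simp]:
  "carrier (regular R) = carrier R" "add (regular R) = add R"
  "ring.zero (regular R) = ring.zero R" "smult (regular R) = monoid.mult R"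
  by (simp_all add: regular_def)

lemma regular_left_module: "ring R ==> left_module R (regular R)"
proof -
  assume "ring R"
  then interpret ring R .
  show ?thesis
  proof (rule left_moduleI[OF \<open>ring R\<close>])
    show "abelian_group (regular R)"
    proof (rule abelian_groupI', goal_cases)
      case (6 x)
      thus ?case by (intro bexI[of _ "\<ominus>\<^bsub>R\<^esub> x"]) (auto simp: l_neg)
    qed (auto simp: a_ac)
  qed (auto simp: l_distr r_distr m_assoc)
qed

context left_module begin

lemma ideal_gens_subset: "I \<subseteq> carrier R ==> {a \<odot>\<^bsub>M\<^esub> x | a x. a \<in> I \<and> x \<in> carrier M} \<subseteq> carrier M"
  by (auto intro: smult_closed)

lemma ideal_smult_submodule: "I \<subseteq> carrier R ==> submodule (ideal_smult R I M) R M"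
  unfolding ideal_smult_def by (intro span_submodule ideal_gens_subset)

lemma ideal_smultI: "a \<in> I ==> x \<in> carrier M ==> a \<odot>\<^bsub>M\<^esub> x \<in> ideal_smult R I M"
  unfolding ideal_smult_def using span_incl[of "{a \<odot>\<^bsub>M\<^esub> x | a x. a \<in> I \<and> x \<in> carrier M}"] by blast

text \<open>On generators f (a x) = a f x. Congruences modulo I therefore travel along every linear
  map: projections, inclusions of summands, exterior multiplication.\<close>

lemma ideal_smult_hom:
  assumes "I \<subseteq> carrier R" "left_module R N" "f \<in> lmod_hom R M N" "x \<in> ideal_smult R I M"
  shows "f x \<in> ideal_smult R I N"
proof -
  interpret N: left_module R N by fact
  note sub = N.submodule_props[OF N.ideal_smult_submodule[OF assms(1)]]
  show ?thesis using assms(4)[unfolded ideal_smult_def] ideal_gens_subset[OF assms(1)]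
  proof (induction rule: span_induct)
    case (base x)
    then obtain a y where "x = a \<odot>\<^bsub>M\<^esub> y" "a \<in> I" "y \<in> carrier M" by blast
    moreover have "f (a \<odot>\<^bsub>M\<^esub> y) = a \<odot>\<^bsub>N\<^esub> f y" using hom_smult[OF assms(3)] calculation assms(1) by auto
    ultimately show ?case using N.ideal_smultI[of a I "f y"] hom_closed[OF assms(3)] by simp
  next
    case zero thus ?case using hom_zero[OF left_module assms(2,3)] sub(2) by simp
  next
    case (add x y) thus ?case using sub(3) by (simp add: hom_add[OF assms(3)])
  next
    case (smult a x) thus ?case using sub(6) by (simp add: hom_smult[OF assms(3)])
  qed
qed

end

section \<open>Quotients and free modules\<close>

lemma (in abelian_group) minus_eq_zero_iff:
  assumes "x \<in> carrier G" "y \<in> carrier G"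
  shows "x \<ominus> y = \<zero> \<longleftrightarrow> x = y"
proof
  assume "x \<ominus> y = \<zero>"
  hence "(x \<ominus> y) \<oplus> y = y" using assms by simp
  thus "x = y" using assms by (simp add: a_minus_def a_assoc l_neg)
qed (use assms in \<open>simp add: a_minus_def r_neg\<close>)

lemma (in abelian_group) minus_zero: "x \<in> carrier G ==> x \<ominus> \<zero> = x"
  by (simp add: a_minus_def)

lemma (in abelian_group) coset_eq_iff:
  assumes "subgroup K (add_monoid G)" "x \<in> carrier G" "y \<in> carrier G"
  shows "K +>\<^bsub>G\<^esub> x = K +>\<^bsub>G\<^esub> y \<longleftrightarrow> x \<ominus>\<^bsub>G\<^esub> y \<in> K"
proof -
  interpret abelian_subgroup K G
    by (rule abelian_subgroupI3) (use assms in \<open>auto intro: additive_subgroup.intro abelian_group_axioms\<close>)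
  show ?thesis
  proof
    assume "K +> x = K +> y"
    hence "x \<in> K +> y" using a_rcos_self[OF assms(2)] by simp
    thus "x \<ominus> y \<in> K" using a_rcos_module[OF assms(3,2)] by (simp add: a_minus_def)
  next
    assume "x \<ominus> y \<in> K"
    hence "x \<in> K +> y" using a_rcos_module[OF assms(3,2)] by (simp add: a_minus_def)
    thus "K +> x = K +> y" using a_repr_independence[of x K y] assms by simp
  qed
qed

context left_module begin

context
  fixes K assumes K: "submodule K R M"
begin

lemma K_sub: "subgroup K (add_monoid M)" using K by (simp add: submodule_def)

lemma K_abs: "abelian_subgroup K M"
  by (rule abelian_subgroupI3) (use K_sub in \<open>auto intro: additive_subgroup.intro ab\<close>)

lemma quotient_carrier: "carrier (quotient_module M K) = (\<lambda>x. K +>\<^bsub>M\<^esub> x) ` carrier M"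
  by (auto simp: quotient_module_def A_RCOSETS_def')

lemma quotient_zero': "\<zero>\<^bsub>quotient_module M K\<^esub> = K +>\<^bsub>M\<^esub> \<zero>\<^bsub>M\<^esub>"
  using submodule_props(1)[OF K] by (simp add: quotient_module_def M.a_coset_add_zero)

lemma quotient_add: "x \<in> carrier M ==> y \<in> carrier M ==>
   (K +>\<^bsub>M\<^esub> x) \<oplus>\<^bsub>quotient_module M K\<^esub> (K +>\<^bsub>M\<^esub> y) = K +>\<^bsub>M\<^esub> (x \<oplus>\<^bsub>M\<^esub> y)"
  using abelian_subgroup.a_rcos_sum[OF K_abs] by (simp add: quotient_module_def)

lemma quotient_eq_iff: "x \<in> carrier M ==> y \<in> carrier M ==>
    K +>\<^bsub>M\<^esub> x = K +>\<^bsub>M\<^esub> y \<longleftrightarrow> x \<ominus>\<^bsub>M\<^esub> y \<in> K"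
  using M.coset_eq_iff[OF K_sub] .

lemma coset_mem_iff: "x \<in> carrier M ==> y \<in> K +>\<^bsub>M\<^esub> x \<longleftrightarrow> y \<in> carrier M \<and> y \<ominus>\<^bsub>M\<^esub> x \<in> K"
proof -
  assume x: "x \<in> carrier M"
  interpret A: abelian_subgroup K M by (rule K_abs)
  show ?thesis using A.a_rcos_module[OF x, of y] A.a_elemrcos_carrier[OF x, of y]
    by (auto simp: a_minus_def)
qed

lemma quotient_smult:
  assumes a: "a \<in> carrier R" and x: "x \<in> carrier M"
  shows "a \<odot>\<^bsub>quotient_module M K\<^esub> (K +>\<^bsub>M\<^esub> x) = K +>\<^bsub>M\<^esub> (a \<odot>\<^bsub>M\<^esub> x)"
proof -
  have "K +>\<^bsub>M\<^esub> (a \<odot>\<^bsub>M\<^esub> y) = K +>\<^bsub>M\<^esub> (a \<odot>\<^bsub>M\<^esub> x)" if "y \<in> K +>\<^bsub>M\<^esub> x" for y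
  proof -
    have y: "y \<in> carrier M" "y \<ominus>\<^bsub>M\<^esub> x \<in> K" using coset_mem_iff[OF x] that by auto
    have "a \<odot>\<^bsub>M\<^esub> y \<ominus>\<^bsub>M\<^esub> a \<odot>\<^bsub>M\<^esub> x = a \<odot>\<^bsub>M\<^esub> (y \<ominus>\<^bsub>M\<^esub> x)" using a x y by (simp add: smult_r_diff)
    thus ?thesis using y a x submodule_props(6)[OF K] by (subst quotient_eq_iff) (auto simp: smult_closed)
  qed
  moreover have "x \<in> K +>\<^bsub>M\<^esub> x" using x submodule_props(2)[OF K] by (simp add: coset_mem_iff M.r_neg a_minus_def)
  ultimately have im: "(\<lambda>y. K +>\<^bsub>M\<^esub> (a \<odot>\<^bsub>M\<^esub> y)) ` (K +>\<^bsub>M\<^esub> x) = {K +>\<^bsub>M\<^esub> (a \<odot>\<^bsub>M\<^esub> x)}"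
    by (intro image_eq_singleton)
  show ?thesis unfolding quotient_module_def mk_module_simps im by simp
qed

lemma quotient_left_module: "left_module R (quotient_module M K)"
proof -
  let ?Q = "quotient_module M K"
  show ?thesis
  proof (rule left_moduleI[OF ring_R])
    show "abelian_group ?Q"
      apply (rule abelian_groupI')
           apply (auto simp: quotient_carrier quotient_add quotient_zero' M.a_ac intro!: imageI)
      subgoal for x by (rule bexI[of _ "\<ominus>\<^bsub>M\<^esub> x"]) (simp_all add: quotient_add M.l_neg M.r_neg)
      done
    show "a \<odot>\<^bsub>?Q\<^esub> x \<in> carrier ?Q" if "a \<in> carrier R" "x \<in> carrier ?Q" for a x
      using that by (auto simp: quotient_carrier quotient_smult intro!: imageI smult_closed)
  qed (clarsimp simp: quotient_carrier quotient_add quotient_smult smult_closed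
        smult_r_distr smult_l_distr smult_assoc1 smult_one)+
qed

text \<open>A map that kills \<open>K\<close> is constant on its cosets. All uses of
  \<open>the_elem\<close> are evaluated this way: in \<open>induced_map\<close>, in the coefficient
  of \<open>[]\<close>, and in the map that the augmentation induces on homology.\<close>

lemma the_elem_coset:
  assumes "abelian_group N" "additive_map M N g" "\<And>x. x \<in> K ==> g x = \<zero>\<^bsub>N\<^esub>" "x \<in> carrier M"
  shows "the_elem (g ` (K +>\<^bsub>M\<^esub> x)) = g x"
proof -
  interpret N: abelian_group N by fact
  have "g y = g x" if "y \<in> K +>\<^bsub>M\<^esub> x" for y
  proof -
    have y: "y \<in> carrier M" "y \<ominus>\<^bsub>M\<^esub> x \<in> K" using coset_mem_iff[OF assms(4)] that by auto
    have "g y \<ominus>\<^bsub>N\<^esub> g x = \<zero>\<^bsub>N\<^esub>"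
      using additive_map_diff[OF ab assms(1,2) y(1) assms(4)] assms(3)[OF y(2)] by simp
    thus ?thesis using N.minus_eq_zero_iff additive_map_closed[OF assms(2)] y(1) assms(4) by blast
  qed
  moreover have "x \<in> K +>\<^bsub>M\<^esub> x"
    using assms(4) submodule_props(2)[OF K] by (simp add: coset_mem_iff M.r_neg a_minus_def)
  ultimately have "g ` (K +>\<^bsub>M\<^esub> x) = {g x}" by (intro image_eq_singleton)
  thus ?thesis by simp
qed

end
end

section \<open>Free modules and linear extension\<close>

definition supp :: "('a, 'r) ring_scheme => ('x => 'a) => 'x set"
  where "supp R u = {x. u x \<noteq> \<zero>\<^bsub>R\<^esub>}"

text \<open>The expression inside \<open>induced_map\<close>: the semilinear extension of
  \<open>\<beta>\<close> to the free module, before it descends to a quotient.\<close>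

definition lincomb :: "('a, 'r) ring_scheme => ('a => 'c) => ('c, 'b, 'm) module_scheme => ('x => 'b) => ('x => 'a) => 'b"
  where "lincomb R \<sigma> N \<beta> u = (\<Oplus>\<^bsub>N\<^esub>x\<in>{x. u x \<noteq> \<zero>\<^bsub>R\<^esub>}. \<sigma> (u x) \<odot>\<^bsub>N\<^esub> \<beta> x)"

lemma free_module_simps:
  "u \<in> carrier (free_module R S) \<longleftrightarrow> (\<forall>x\<in>S. u x \<in> carrier R) \<and> (\<forall>x. x \<notin> S \<longrightarrow> u x = \<zero>\<^bsub>R\<^esub>) \<and> finite {x. u x \<noteq> \<zero>\<^bsub>R\<^esub>}"
  "u \<oplus>\<^bsub>free_module R S\<^esub> v = (\<lambda>x. u x \<oplus>\<^bsub>R\<^esub> v x)"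
  "\<zero>\<^bsub>free_module R S\<^esub> = (\<lambda>_. \<zero>\<^bsub>R\<^esub>)"
  "a \<odot>\<^bsub>free_module R S\<^esub> u = (\<lambda>x. a \<otimes>\<^bsub>R\<^esub> u x)"
  by (simp_all add: free_module_def)

lemma free_module_eval: "ring R ==> u \<in> carrier (free_module R S) ==> u x \<in> carrier R"
  by (cases "x \<in> S") (auto simp: free_module_simps ring.ring_simprules)

lemma free_left_module:
  fixes R (structure)
  assumes "ring R" shows "left_module R (free_module R S)"
proof -
  interpret ring R by fact
  let ?F = "free_module R S"
  have add: "u \<oplus>\<^bsub>?F\<^esub> v \<in> carrier ?F" if "u \<in> carrier ?F" "v \<in> carrier ?F" for u v
  proof -
    have "{x. u x \<oplus> v x \<noteq> \<zero>} \<subseteq> {x. u x \<noteq> \<zero>} \<union> {x. v x \<noteq> \<zero>}" by auto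
    moreover have "finite ({x. u x \<noteq> \<zero>} \<union> {x. v x \<noteq> \<zero>})" using that by (simp add: free_module_simps)
    ultimately have "finite {x. u x \<oplus> v x \<noteq> \<zero>}" by (rule finite_subset)
    thus ?thesis using that by (simp add: free_module_simps)
  qed
  have sm: "a \<odot>\<^bsub>?F\<^esub> u \<in> carrier ?F" if "a \<in> carrier R" "u \<in> carrier ?F" for a u
  proof -
    have "{x. a \<otimes> u x \<noteq> \<zero>} \<subseteq> {x. u x \<noteq> \<zero>}" using that by auto
    moreover have "finite {x. u x \<noteq> \<zero>}" using that by (simp add: free_module_simps)
    ultimately have "finite {x. a \<otimes> u x \<noteq> \<zero>}" by (rule finite_subset)
    thus ?thesis using that by (simp add: free_module_simps)
  qed
  note ev = free_module_eval[OF assms, of _ S]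
  have neg: "\<exists>v\<in>carrier ?F. v \<oplus>\<^bsub>?F\<^esub> u = \<zero>\<^bsub>?F\<^esub>" if u: "u \<in> carrier ?F" for u
  proof
    show "((\<ominus> \<one>) \<odot>\<^bsub>?F\<^esub> u) \<in> carrier ?F" using u by (intro sm) auto
    show "((\<ominus> \<one>) \<odot>\<^bsub>?F\<^esub> u) \<oplus>\<^bsub>?F\<^esub> u = \<zero>\<^bsub>?F\<^esub>" using ev[OF u] by (auto simp: free_module_simps l_minus l_neg)
  qed
  show ?thesis
  proof (rule left_moduleI[OF assms])
    show "abelian_group ?F"
      apply (rule abelian_groupI')
           apply (fact add)
          apply (simp add: free_module_simps)
         apply (simp only: free_module_simps(2), rule ext, simp add: a_assoc ev)
        apply (simp only: free_module_simps(2), rule ext, simp add: a_comm ev)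
       apply (simp add: free_module_simps(2,3) ev)
      by (fact neg)
    show "\<And>a x. a \<in> carrier R ==> x \<in> carrier ?F ==> a \<odot>\<^bsub>?F\<^esub> x \<in> carrier ?F" by (rule sm)
  qed (simp_all only: free_module_simps(2-4) fun_eq_iff ev l_distr r_distr m_assoc l_one simp_thms)
qed

lemma free_basis_closed:
  fixes R (structure)
  assumes "ring R" "x \<in> S" shows "free_basis R x \<in> carrier (free_module R S)"
proof -
  interpret ring R by fact
  have "{y. free_basis R x y \<noteq> \<zero>} \<subseteq> {x}" by (auto simp: free_basis_def)
  hence "finite {y. free_basis R x y \<noteq> \<zero>}" by (rule finite_subset) simp
  thus ?thesis using assms unfolding free_module_simps by (auto simp: free_basis_def)
qed

text \<open>Induction on the support, clearing one coordinate at a time.\<close>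

lemma free_induct [consumes 2, case_names zero add basis]:
  fixes R (structure)
  assumes R: "ring R" and u: "u \<in> carrier (free_module R S)"
    and "P (\<lambda>_. \<zero>\<^bsub>R\<^esub>)"
    and add: "\<And>u v. u \<in> carrier (free_module R S) ==> v \<in> carrier (free_module R S) ==> P u ==> P v ==>
        P (u \<oplus>\<^bsub>free_module R S\<^esub> v)"
    and sm: "\<And>a x. a \<in> carrier R ==> x \<in> S ==> P (a \<odot>\<^bsub>free_module R S\<^esub> free_basis R x)"
  shows "P u"
proof -
  interpret ring R by fact
  interpret F: left_module R "free_module R S" by (rule free_left_module[OF R])
  have "P u" if "finite W" "{x. u x \<noteq> \<zero>} = W" "u \<in> carrier (free_module R S)" for W u
    using that
  proof (induction W arbitrary: u rule: finite_induct)
    case empty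
    hence "u = (\<lambda>_. \<zero>)" by auto
    thus ?case using assms(3) by simp
  next
    case (insert x W)
    have xS: "x \<in> S" using insert.prems by (auto simp: free_module_simps)
    have ux: "u x \<in> carrier R" using insert.prems by (auto intro: free_module_eval[OF R])
    let ?v = "u(x := \<zero>)"
    have sv: "{y. ?v y \<noteq> \<zero>} = W" using insert.prems insert.hyps by auto
    have v: "?v \<in> carrier (free_module R S)"
      using insert.prems insert.hyps unfolding free_module_simps sv by auto
    have "u = ?v \<oplus>\<^bsub>free_module R S\<^esub> (u x \<odot>\<^bsub>free_module R S\<^esub> free_basis R x)"
      using ux free_module_eval[OF R insert.prems(2)] by (auto simp: free_module_simps free_basis_def)
    moreover have "P (?v \<oplus>\<^bsub>free_module R S\<^esub> (u x \<odot>\<^bsub>free_module R S\<^esub> free_basis R x))"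
      by (intro add v insert.IH sv sm ux xS F.smult_closed free_basis_closed R)
    ultimately show ?case by metis
  qed
  moreover have "finite {x. u x \<noteq> \<zero>}" using u by (simp add: free_module_simps)
  ultimately show ?thesis using u by blast
qed

text \<open>Two rings and a homomorphism \<open>\<sigma>\<close> between them, so that linear maps
  and the semilinear action of H are extended by the same construction.\<close>

locale lincomb_setup = R: ring R + R': ring R' + N: left_module R' N
  for R :: "('a, 'r) ring_scheme" and R' :: "('c, 's) ring_scheme" and N :: "('c, 'b, 'm) module_scheme" +
  fixes \<sigma> S and \<beta> :: "'x => 'b"
  assumes sigma: "\<sigma> \<in> ring_hom R R'" and beta: "\<And>x. x \<in> S ==> \<beta> x \<in> carrier N"
begin

abbreviation "F \<equiv> free_module R S"
abbreviation "lin \<equiv> lincomb R \<sigma> N \<beta>"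

lemma s_zero: "\<sigma> \<zero>\<^bsub>R\<^esub> = \<zero>\<^bsub>R'\<^esub>"
  using ring_hom_zero[OF sigma R.ring_axioms R'.ring_axioms] .
lemma s_cl: "a \<in> carrier R ==> \<sigma> a \<in> carrier R'"
  using ring_hom_closed[OF sigma] .
lemma s_add: "a \<in> carrier R ==> b \<in> carrier R ==> \<sigma> (a \<oplus>\<^bsub>R\<^esub> b) = \<sigma> a \<oplus>\<^bsub>R'\<^esub> \<sigma> b"
  using ring_hom_add[OF sigma] .
lemma s_mult: "a \<in> carrier R ==> b \<in> carrier R ==> \<sigma> (a \<otimes>\<^bsub>R\<^esub> b) = \<sigma> a \<otimes>\<^bsub>R'\<^esub> \<sigma> b"
  using ring_hom_mult[OF sigma] .
lemma s_one: "\<sigma> \<one>\<^bsub>R\<^esub> = \<one>\<^bsub>R'\<^esub>"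
  using ring_hom_one[OF sigma] .

lemma ev: "u \<in> carrier F ==> u x \<in> carrier R"
  using free_module_eval[OF R.ring_axioms] .

lemma term_cl: "u \<in> carrier F ==> x \<in> S ==> \<sigma> (u x) \<odot>\<^bsub>N\<^esub> \<beta> x \<in> carrier N"
  by (intro N.smult_closed s_cl ev beta)

lemma supp_S: "u \<in> carrier F ==> {x. u x \<noteq> \<zero>\<^bsub>R\<^esub>} \<subseteq> S"
  by (auto simp: free_module_simps)

text \<open>The sum in \<open>lincomb\<close> runs over the support, which changes with the
  argument; additivity needs a common finite index set for both summands.\<close>

lemma lin_superset:
  assumes "u \<in> carrier F" "finite W" "{x. u x \<noteq> \<zero>\<^bsub>R\<^esub>} \<subseteq> W" "W \<subseteq> S"
  shows "lin u = (\<Oplus>\<^bsub>N\<^esub>x\<in>W. \<sigma> (u x) \<odot>\<^bsub>N\<^esub> \<beta> x)"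
  unfolding lincomb_def
  by (rule N.add.finprod_mono_neutral_cong_left[OF assms(2,3), folded finsum_def])
     (use assms beta in \<open>auto simp: s_zero N.smult_l_null intro!: term_cl\<close>)

lemma lin_closed: "u \<in> carrier F ==> lin u \<in> carrier N"
  unfolding lincomb_def using supp_S[of u] term_cl[of u] by (intro N.finsum_closed) auto

lemma lin_add:
  assumes u: "u \<in> carrier F" and v: "v \<in> carrier F"
  shows "lin (u \<oplus>\<^bsub>F\<^esub> v) = lin u \<oplus>\<^bsub>N\<^esub> lin v"
proof -
  interpret FM: left_module R F by (rule free_left_module) unfold_locales
  let ?W = "{x. u x \<noteq> \<zero>\<^bsub>R\<^esub>} \<union> {x. v x \<noteq> \<zero>\<^bsub>R\<^esub>}"
  have fin: "finite ?W" using u v by (auto simp: free_module_simps)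
  have W: "?W \<subseteq> S" using supp_S[OF u] supp_S[OF v] by auto
  have uv: "u \<oplus>\<^bsub>F\<^esub> v \<in> carrier F" using u v by simp
  have s: "{x. (u \<oplus>\<^bsub>F\<^esub> v) x \<noteq> \<zero>\<^bsub>R\<^esub>} \<subseteq> ?W" by (auto simp: free_module_simps)
  have "lin (u \<oplus>\<^bsub>F\<^esub> v) = (\<Oplus>\<^bsub>N\<^esub>x\<in>?W. \<sigma> ((u \<oplus>\<^bsub>F\<^esub> v) x) \<odot>\<^bsub>N\<^esub> \<beta> x)"
    by (rule lin_superset[OF uv fin s W])
  also have "\<dots> = (\<Oplus>\<^bsub>N\<^esub>x\<in>?W. \<sigma> (u x) \<odot>\<^bsub>N\<^esub> \<beta> x \<oplus>\<^bsub>N\<^esub> \<sigma> (v x) \<odot>\<^bsub>N\<^esub> \<beta> x)"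
    using W by (intro N.finsum_cong') (auto simp: free_module_simps(2) s_add ev[OF u] ev[OF v] N.smult_l_distr s_cl beta subset_iff intro!: N.smult_closed)
  also have "\<dots> = (\<Oplus>\<^bsub>N\<^esub>x\<in>?W. \<sigma> (u x) \<odot>\<^bsub>N\<^esub> \<beta> x) \<oplus>\<^bsub>N\<^esub> (\<Oplus>\<^bsub>N\<^esub>x\<in>?W. \<sigma> (v x) \<odot>\<^bsub>N\<^esub> \<beta> x)"
    using W term_cl[OF u] term_cl[OF v] by (intro N.finsum_addf) (auto simp: subset_iff)
  also have "\<dots> = lin u \<oplus>\<^bsub>N\<^esub> lin v"
    using lin_superset[OF u fin _ W] lin_superset[OF v fin _ W] by simp
  finally show ?thesis .
qed

lemma lin_smult:
  assumes a: "a \<in> carrier R" and u: "u \<in> carrier F"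
  shows "lin (a \<odot>\<^bsub>F\<^esub> u) = \<sigma> a \<odot>\<^bsub>N\<^esub> lin u"
proof -
  interpret FM: left_module R F by (rule free_left_module) unfold_locales
  let ?W = "{x. u x \<noteq> \<zero>\<^bsub>R\<^esub>}"
  have fin: "finite ?W" using u by (auto simp: free_module_simps)
  have W: "?W \<subseteq> S" by (rule supp_S[OF u])
  have au: "a \<odot>\<^bsub>F\<^esub> u \<in> carrier F" using a u by (rule FM.smult_closed)
  have s: "{x. (a \<odot>\<^bsub>F\<^esub> u) x \<noteq> \<zero>\<^bsub>R\<^esub>} \<subseteq> ?W" using a by (auto simp: free_module_simps)
  have "lin (a \<odot>\<^bsub>F\<^esub> u) = (\<Oplus>\<^bsub>N\<^esub>x\<in>?W. \<sigma> ((a \<odot>\<^bsub>F\<^esub> u) x) \<odot>\<^bsub>N\<^esub> \<beta> x)"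
    by (rule lin_superset[OF au fin s W])
  also have "\<dots> = (\<Oplus>\<^bsub>N\<^esub>x\<in>?W. \<sigma> a \<odot>\<^bsub>N\<^esub> (\<sigma> (u x) \<odot>\<^bsub>N\<^esub> \<beta> x))"
    using W a by (intro N.finsum_cong') (auto simp: free_module_simps(4) s_mult ev[OF u] N.smult_assoc1 s_cl beta subset_iff intro!: N.smult_closed)
  also have "\<dots> = \<sigma> a \<odot>\<^bsub>N\<^esub> lin u"
    unfolding lincomb_def using W by (intro N.smult_finsum[symmetric] s_cl a fin) (auto intro!: term_cl[OF u])
  finally show ?thesis .
qed

lemma lin_basis:
  assumes "x \<in> S" shows "lin (free_basis R x) = \<beta> x"
proof -
  have "lin (free_basis R x) = (\<Oplus>\<^bsub>N\<^esub>y\<in>{x}. \<sigma> (free_basis R x y) \<odot>\<^bsub>N\<^esub> \<beta> y)"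
    using assms by (intro lin_superset free_basis_closed R.ring_axioms) (auto simp: free_basis_def)
  also have "\<dots> = \<sigma> (free_basis R x x) \<odot>\<^bsub>N\<^esub> \<beta> x"
    using assms beta by (subst N.finsum_insert) (auto simp: free_basis_def s_one N.smult_one)
  finally show ?thesis using assms beta by (auto simp: free_basis_def s_one N.smult_one)
qed

text \<open>Together with \<open>lin_rel_smult\<close> this covers every shape of relation for
  tensor products and exterior powers except the vanishing of tuples with a repeated entry.\<close>

lemma lin_rel_add:
  assumes "a \<in> S" "b \<in> S" "c \<in> S" "\<beta> a = \<beta> b \<oplus>\<^bsub>N\<^esub> \<beta> c"
  shows "lin (free_basis R a \<ominus>\<^bsub>F\<^esub> (free_basis R b \<oplus>\<^bsub>F\<^esub> free_basis R c)) = \<zero>\<^bsub>N\<^esub>"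
proof -
  interpret FM: left_module R F by (rule free_left_module) unfold_locales
  note cl = free_basis_closed[OF R.ring_axioms, of _ S]
  have "additive_map F N lin" by (auto simp: additive_map_def lin_closed lin_add)
  from additive_map_diff[OF FM.ab N.ab this] show ?thesis
    using assms beta by (simp add: cl lin_add lin_basis N.minus_eq_zero_iff)
qed

lemma lin_rel_smult:
  assumes "a \<in> S" "b \<in> S" "r \<in> carrier R" "\<beta> a = \<sigma> r \<odot>\<^bsub>N\<^esub> \<beta> b"
  shows "lin (free_basis R a \<ominus>\<^bsub>F\<^esub> r \<odot>\<^bsub>F\<^esub> free_basis R b) = \<zero>\<^bsub>N\<^esub>"
proof -
  interpret FM: left_module R F by (rule free_left_module) unfold_locales
  note cl = free_basis_closed[OF R.ring_axioms, of _ S]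
  have "additive_map F N lin" by (auto simp: additive_map_def lin_closed lin_add)
  from additive_map_diff[OF FM.ab N.ab this] show ?thesis
    using assms beta by (simp add: cl FM.smult_closed lin_smult lin_basis N.minus_eq_zero_iff N.smult_closed s_cl)
qed

lemma lin_slin: "lin \<in> slin \<sigma> R F N"
  by (auto simp: slin_def additive_map_def lin_closed lin_add lin_smult)

end

section \<open>Modules with generators and relations\<close>

text \<open>Tensor products and exterior powers are both free modules modulo the span of explicit
  relations. Generators, induction and the universal property are obtained here once for
  both.\<close>

locale presented = R: ring R for R :: "('a, 'r) ring_scheme" +
  fixes S :: "'x set" and Rel
  assumes Rel: "Rel \<subseteq> carrier (free_module R S)"
begin

definition "F = free_module R S"
definition "K = submodule_span R F Rel"
definition "Q = quotient_module F K"
definition "gen x = K +>\<^bsub>F\<^esub> free_basis R x"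

sublocale F: left_module R F unfolding F_def by (rule free_left_module) unfold_locales

lemma K: "submodule K R F" unfolding K_def by (rule F.span_submodule) (use Rel in \<open>simp add: F_def\<close>)

sublocale Q: left_module R Q unfolding Q_def by (rule F.quotient_left_module[OF K])

lemma basis_cl: "x \<in> S ==> free_basis R x \<in> carrier F"
  unfolding F_def by (rule free_basis_closed) unfold_locales

lemma gen_closed: "x \<in> S ==> gen x \<in> carrier Q"
  unfolding Q_def gen_def F.quotient_carrier[OF K] by (auto intro: basis_cl)

lemma Q_induct [consumes 1, case_names add smult zero]:
  assumes "z \<in> carrier Q"
    and "\<And>x y. x \<in> carrier Q ==> y \<in> carrier Q ==> P x ==> P y ==> P (x \<oplus>\<^bsub>Q\<^esub> y)"
    and "\<And>a x. a \<in> carrier R ==> x \<in> S ==> P (a \<odot>\<^bsub>Q\<^esub> gen x)"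
    and "P \<zero>\<^bsub>Q\<^esub>"
  shows "P z"
proof -
  obtain u where u: "u \<in> carrier F" "z = K +>\<^bsub>F\<^esub> u"
    using assms(1) by (auto simp: Q_def F.quotient_carrier[OF K])
  have "P (K +>\<^bsub>F\<^esub> u)"
    using R.ring_axioms u(1)[unfolded F_def]
  proof (induction rule: free_induct)
    case zero
    show ?case using assms(4) unfolding Q_def F.quotient_zero'[OF K] by (simp add: F_def free_module_simps)
  next
    case (add u v)
    thus ?case using assms(2)[of "K +>\<^bsub>F\<^esub> u" "K +>\<^bsub>F\<^esub> v"] unfolding Q_def F_def[symmetric]
      by (simp add: F.quotient_add[OF K] F.quotient_carrier[OF K])
  next
    case (basis a x)
    thus ?case using assms(3)[of a x] unfolding Q_def F_def[symmetric] gen_def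
      by (simp add: F.quotient_smult[OF K] basis_cl)
  qed
  thus ?thesis using u by simp
qed

lemma relation_diff: "x \<in> carrier F ==> y \<in> carrier F ==> x \<ominus>\<^bsub>F\<^esub> y \<in> Rel ==> K +>\<^bsub>F\<^esub> x = K +>\<^bsub>F\<^esub> y"
  using F.span_incl[of Rel] by (subst F.quotient_eq_iff[OF K]) (auto simp: K_def)

lemma relation_zero: "x \<in> Rel ==> K +>\<^bsub>F\<^esub> x = \<zero>\<^bsub>Q\<^esub>"
  using F.span_incl[of Rel] subsetD[OF Rel, of x] unfolding Q_def F.quotient_zero'[OF K]
  by (subst F.quotient_eq_iff[OF K]) (auto simp: K_def F_def[symmetric] F.M.minus_zero)

lemma coset_hom: "u \<in> carrier F ==> v \<in> carrier F ==> K +>\<^bsub>F\<^esub> (u \<oplus>\<^bsub>F\<^esub> v) = (K +>\<^bsub>F\<^esub> u) \<oplus>\<^bsub>Q\<^esub> (K +>\<^bsub>F\<^esub> v)"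
  "a \<in> carrier R ==> u \<in> carrier F ==> K +>\<^bsub>F\<^esub> (a \<odot>\<^bsub>F\<^esub> u) = a \<odot>\<^bsub>Q\<^esub> (K +>\<^bsub>F\<^esub> u)"
  unfolding Q_def by (simp_all add: F.quotient_add[OF K] F.quotient_smult[OF K])

lemma gen_add:
  assumes "a \<in> S" "b \<in> S" "c \<in> S" "free_basis R a \<ominus>\<^bsub>F\<^esub> (free_basis R b \<oplus>\<^bsub>F\<^esub> free_basis R c) \<in> Rel"
  shows "gen a = gen b \<oplus>\<^bsub>Q\<^esub> gen c"
  using relation_diff[OF _ _ assms(4)] assms(1-3) by (simp add: gen_def coset_hom basis_cl)

lemma gen_smult:
  assumes "a \<in> S" "b \<in> S" "r \<in> carrier R" "free_basis R a \<ominus>\<^bsub>F\<^esub> r \<odot>\<^bsub>F\<^esub> free_basis R b \<in> Rel"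
  shows "gen a = r \<odot>\<^bsub>Q\<^esub> gen b"
  using relation_diff[OF _ _ assms(4)] assms(1-3) by (simp add: gen_def coset_hom basis_cl F.smult_closed)

lemma gen_zero: "free_basis R a \<in> Rel ==> gen a = \<zero>\<^bsub>Q\<^esub>"
  by (simp add: gen_def relation_zero)

lemma slin_ext:
  assumes N: "left_module R' N" and f: "f \<in> slin \<sigma> R Q N" and g: "g \<in> slin \<sigma> R Q N"
    and "\<And>x. x \<in> S ==> f (gen x) = g (gen x)" and "z \<in> carrier Q"
  shows "f z = g z"
  using assms(5)
proof (induction rule: Q_induct)
  case (add x y) thus ?case by (simp add: additive_map_add[OF slin_additive[OF f]] additive_map_add[OF slin_additive[OF g]])
next
  case (smult a x) thus ?case by (simp add: slin_smult[OF f] slin_smult[OF g] gen_closed assms(4))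
next
  case zero thus ?case
    using additive_map_zero[OF Q.ab left_module_ab[OF N]] slin_additive[OF f] slin_additive[OF g] by metis
qed

text \<open>The universal property. Vanishing on relations spreads to their span by
  \<open>span_induct\<close>, after which the linear extension is constant on cosets.\<close>

theorem induced:
  assumes R': "ring R'" and N: "left_module R' N" and s: "\<sigma> \<in> ring_hom R R'"
    and b: "\<And>x. x \<in> S ==> \<beta> x \<in> carrier N"
    and rel: "\<And>\<rho>. \<rho> \<in> Rel ==> lincomb R \<sigma> N \<beta> \<rho> = \<zero>\<^bsub>N\<^esub>"
  shows "induced_map R \<sigma> N \<beta> \<in> slin \<sigma> R Q N"
    and "\<And>x. x \<in> S ==> induced_map R \<sigma> N \<beta> (gen x) = \<beta> x"
proof -
  interpret L: lincomb_setup R R' N \<sigma> S \<beta>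
    using assms by (intro lincomb_setup.intro lincomb_setup_axioms.intro) (auto intro: R.ring_axioms)
  have zeroK: "L.lin u = \<zero>\<^bsub>N\<^esub>" if "u \<in> K" for u
    using that[unfolded K_def] Rel[folded F_def]
  proof (induction rule: F.span_induct)
    case (base x) thus ?case by (rule rel)
  next
    case zero show ?case
      using additive_map_zero[OF F.ab L.N.ab slin_additive[OF L.lin_slin, folded F_def]] .
  next
    case (add x y) thus ?case using L.lin_add[of x y] by (simp add: F_def)
  next
    case (smult a x) thus ?case using L.lin_smult[of a x] by (simp add: F_def L.s_cl L.N.smult_r_null)
  qed
  have ind: "induced_map R \<sigma> N \<beta> (K +>\<^bsub>F\<^esub> u) = L.lin u" if "u \<in> carrier F" for u
    using F.the_elem_coset[OF K L.N.ab slin_additive[OF L.lin_slin, folded F_def] zeroK that]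
    by (simp add: induced_map_def lincomb_def)
  show "induced_map R \<sigma> N \<beta> \<in> slin \<sigma> R Q N"
    unfolding slin_def additive_map_def
    using L.lin_add L.lin_smult L.lin_closed
    by (auto simp: Q_def F.quotient_carrier[OF K] ind F.quotient_add[OF K] F.quotient_smult[OF K] F.smult_closed)
       (simp_all add: F_def)
  show "\<And>x. x \<in> S ==> induced_map R \<sigma> N \<beta> (gen x) = \<beta> x"
    by (simp add: gen_def ind basis_cl L.lin_basis)
qed

end

section \<open>Tensor products\<close>

locale tensor_product = M: left_module R M + N: left_module R N
  for R :: "('a, 'r) ring_scheme" and M :: "('a, 'b, 'm) module_scheme" and N :: "('a, 'c, 'n) module_scheme"
begin

lemma relations_closed: "tensor_relations R M N \<subseteq> carrier (free_module R (carrier M \<times> carrier N))"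
proof -
  interpret F: left_module R "free_module R (carrier M \<times> carrier N)"
    by (rule free_left_module[OF M.ring_R])
  note cl = free_basis_closed[OF M.ring_R]
  show ?thesis unfolding tensor_relations_def Let_def
    by (auto intro!: F.M.minus_closed F.M.a_closed F.smult_closed cl M.smult_closed N.smult_closed)
qed

sublocale P: presented R "carrier M \<times> carrier N" "tensor_relations R M N"
  by (intro presented.intro presented_axioms.intro M.ring_R relations_closed)

abbreviation "T \<equiv> tensor_module R M N"
abbreviation "tens \<equiv> tensor R M N"

lemma Q_eq: "P.Q = T" by (simp add: P.Q_def P.K_def P.F_def tensor_module_def Let_def)
lemma gen_eq: "P.gen (x, y) = tens x y" by (simp add: P.gen_def P.K_def P.F_def tensor_def Let_def)

lemma left_module_T: "left_module R T" using P.Q.left_module unfolding Q_eq .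

lemma tensor_closed: "x \<in> carrier M ==> y \<in> carrier N ==> tens x y \<in> carrier T"
  using P.gen_closed[of "(x, y)"] by (simp add: Q_eq gen_eq)

lemma tensor_add_l:
  assumes "x \<in> carrier M" "x' \<in> carrier M" "y \<in> carrier N"
  shows "tens (x \<oplus>\<^bsub>M\<^esub> x') y = tens x y \<oplus>\<^bsub>T\<^esub> tens x' y"
proof -
  have "free_basis R (x \<oplus>\<^bsub>M\<^esub> x', y) \<ominus>\<^bsub>P.F\<^esub> (free_basis R (x, y) \<oplus>\<^bsub>P.F\<^esub> free_basis R (x', y)) \<in> tensor_relations R M N"
    unfolding tensor_relations_def Let_def P.F_def using assms by blast
  from P.gen_add[OF _ _ _ this] show ?thesis using assms by (simp add: Q_eq gen_eq)
qed

lemma tensor_add_r: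
  assumes "x \<in> carrier M" "y \<in> carrier N" "y' \<in> carrier N"
  shows "tens x (y \<oplus>\<^bsub>N\<^esub> y') = tens x y \<oplus>\<^bsub>T\<^esub> tens x y'"
proof -
  have "free_basis R (x, y \<oplus>\<^bsub>N\<^esub> y') \<ominus>\<^bsub>P.F\<^esub> (free_basis R (x, y) \<oplus>\<^bsub>P.F\<^esub> free_basis R (x, y')) \<in> tensor_relations R M N"
    unfolding tensor_relations_def Let_def P.F_def using assms by blast
  from P.gen_add[OF _ _ _ this] show ?thesis using assms by (simp add: Q_eq gen_eq)
qed

lemma tensor_smult_l:
  assumes "a \<in> carrier R" "x \<in> carrier M" "y \<in> carrier N"
  shows "tens (a \<odot>\<^bsub>M\<^esub> x) y = a \<odot>\<^bsub>T\<^esub> tens x y"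
proof -
  have "free_basis R (a \<odot>\<^bsub>M\<^esub> x, y) \<ominus>\<^bsub>P.F\<^esub> a \<odot>\<^bsub>P.F\<^esub> free_basis R (x, y) \<in> tensor_relations R M N"
    unfolding tensor_relations_def Let_def P.F_def using assms by blast
  from P.gen_smult[OF _ _ _ this] show ?thesis using assms by (simp add: Q_eq gen_eq M.smult_closed)
qed

lemma tensor_smult_r:
  assumes "a \<in> carrier R" "x \<in> carrier M" "y \<in> carrier N"
  shows "tens x (a \<odot>\<^bsub>N\<^esub> y) = a \<odot>\<^bsub>T\<^esub> tens x y"
proof -
  have "free_basis R (x, a \<odot>\<^bsub>N\<^esub> y) \<ominus>\<^bsub>P.F\<^esub> a \<odot>\<^bsub>P.F\<^esub> free_basis R (x, y) \<in> tensor_relations R M N"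
    unfolding tensor_relations_def Let_def P.F_def using assms by blast
  from P.gen_smult[OF _ _ _ this] show ?thesis using assms by (simp add: Q_eq gen_eq N.smult_closed)
qed

lemma tensor_zero_l: "y \<in> carrier N ==> tens \<zero>\<^bsub>M\<^esub> y = \<zero>\<^bsub>T\<^esub>"
  using additive_map_zero[OF M.ab P.Q.ab[unfolded Q_eq], of "\<lambda>x. tens x y"]
  by (simp add: additive_map_def tensor_add_l tensor_closed)

lemma tensor_zero_r: "x \<in> carrier M ==> tens x \<zero>\<^bsub>N\<^esub> = \<zero>\<^bsub>T\<^esub>"
  using additive_map_zero[OF N.ab P.Q.ab[unfolded Q_eq], of "\<lambda>y. tens x y"]
  by (simp add: additive_map_def tensor_add_r tensor_closed)

text \<open>No case for scalars: a scalar multiple of a pure tensor is again a pure tensor, the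
  scalar being absorbed by the left factor.\<close>

lemma tensor_induct [consumes 1, case_names tensor add]:
  assumes "z \<in> carrier T" "\<And>x y. x \<in> carrier M ==> y \<in> carrier N ==> P (tens x y)"
    "\<And>x y. x \<in> carrier T ==> y \<in> carrier T ==> P x ==> P y ==> P (x \<oplus>\<^bsub>T\<^esub> y)"
  shows "P z"
  using assms(1)[folded Q_eq]
proof (induction rule: P.Q_induct)
  case (add x y) thus ?case using assms(3) by (simp add: Q_eq)
next
  case (smult a xy)
  then obtain x y where "xy = (x, y)" "x \<in> carrier M" "y \<in> carrier N" by auto
  thus ?case using assms(2)[of "a \<odot>\<^bsub>M\<^esub> x" y] smult by (simp add: gen_eq Q_eq tensor_smult_l M.smult_closed)
next
  case zero thus ?case using assms(2)[of "\<zero>\<^bsub>M\<^esub>" "\<zero>\<^bsub>N\<^esub>"] tensor_zero_l by (simp add: Q_eq)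
qed

lemma tensor_lift:
  assumes R': "ring R'" and L: "left_module R' L" and s: "\<sigma> \<in> ring_hom R R'"
    and cl: "\<And>x y. x \<in> carrier M ==> y \<in> carrier N ==> \<beta> (x, y) \<in> carrier L"
    and al: "\<And>x x' y. x \<in> carrier M ==> x' \<in> carrier M ==> y \<in> carrier N ==>
      \<beta> (x \<oplus>\<^bsub>M\<^esub> x', y) = \<beta> (x, y) \<oplus>\<^bsub>L\<^esub> \<beta> (x', y)"
    and ar: "\<And>x y y'. x \<in> carrier M ==> y \<in> carrier N ==> y' \<in> carrier N ==>
      \<beta> (x, y \<oplus>\<^bsub>N\<^esub> y') = \<beta> (x, y) \<oplus>\<^bsub>L\<^esub> \<beta> (x, y')"
    and ml: "\<And>a x y. a \<in> carrier R ==> x \<in> carrier M ==> y \<in> carrier N ==>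
      \<beta> (a \<odot>\<^bsub>M\<^esub> x, y) = \<sigma> a \<odot>\<^bsub>L\<^esub> \<beta> (x, y)"
    and mr: "\<And>a x y. a \<in> carrier R ==> x \<in> carrier M ==> y \<in> carrier N ==>
      \<beta> (x, a \<odot>\<^bsub>N\<^esub> y) = \<sigma> a \<odot>\<^bsub>L\<^esub> \<beta> (x, y)"
  shows "induced_map R \<sigma> L \<beta> \<in> slin \<sigma> R T L"
    and "\<And>x y. x \<in> carrier M ==> y \<in> carrier N ==> induced_map R \<sigma> L \<beta> (tens x y) = \<beta> (x, y)"
proof -
  interpret S: lincomb_setup R R' L \<sigma> "carrier M \<times> carrier N" \<beta>
    using R' L s cl M.ring_R by (intro lincomb_setup.intro lincomb_setup_axioms.intro) auto
  have rel: "S.lin \<rho> = \<zero>\<^bsub>L\<^esub>" if "\<rho> \<in> tensor_relations R M N" for \<rho>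
    using that unfolding tensor_relations_def Let_def
    apply (elim UnE CollectE exE conjE; hypsubst)
       apply (rule S.lin_rel_add; simp add: al ar)
      apply (rule S.lin_rel_add; simp add: al ar)
     apply (rule S.lin_rel_smult; simp add: ml mr M.smult_closed)
    apply (rule S.lin_rel_smult; simp add: ml mr N.smult_closed)
    done
  have b: "\<beta> xy \<in> carrier L" if "xy \<in> carrier M \<times> carrier N" for xy using that cl by auto
  show "induced_map R \<sigma> L \<beta> \<in> slin \<sigma> R T L"
    using P.induced(1)[OF R' L s b rel] by (simp add: Q_eq)
  show "induced_map R \<sigma> L \<beta> (tens x y) = \<beta> (x, y)" if "x \<in> carrier M" "y \<in> carrier N" for x y
    using P.induced(2)[OF R' L s b rel, of "(x, y)"] that by (simp add: gen_eq)
qed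

end

section \<open>Exterior powers\<close>

text \<open>Exactly the conditions under which the linear extension kills
  \<open>exterior_relations\<close>, with \<open>\<sigma>\<close> included so that the action of H
  on exterior powers is covered.\<close>

definition multilinear_alternating ::
  "('a => 'c) => ('a, 'r) ring_scheme => ('a, 'b, 'm) module_scheme => ('c, 'd, 'n) module_scheme =>
    nat => ('b list => 'd) => bool"
  where "multilinear_alternating \<sigma> R M N m \<beta> \<longleftrightarrow>
    (\<forall>xs\<in>tuples M m. \<beta> xs \<in> carrier N) \<and>
    (\<forall>xs\<in>tuples M m. \<forall>i<m. \<forall>x\<in>carrier M. \<forall>y\<in>carrier M.
       \<beta> (xs[i := x \<oplus>\<^bsub>M\<^esub> y]) = \<beta> (xs[i := x]) \<oplus>\<^bsub>N\<^esub> \<beta> (xs[i := y])) \<and>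
    (\<forall>xs\<in>tuples M m. \<forall>i<m. \<forall>a\<in>carrier R. \<forall>x\<in>carrier M.
       \<beta> (xs[i := a \<odot>\<^bsub>M\<^esub> x]) = \<sigma> a \<odot>\<^bsub>N\<^esub> \<beta> (xs[i := x])) \<and>
    (\<forall>xs\<in>tuples M m. \<forall>i j. i < j \<longrightarrow> j < m \<longrightarrow> xs ! i = xs ! j \<longrightarrow> \<beta> xs = \<zero>\<^bsub>N\<^esub>)"

lemma tuples_update: "xs \<in> tuples M m ==> x \<in> carrier M ==> xs[i := x] \<in> tuples M m"
  unfolding tuples_def using set_update_subset_insert by fastforce

lemma tuples_Cons: "x # xs \<in> tuples M m \<longleftrightarrow> x \<in> carrier M \<and> (\<exists>k. m = Suc k \<and> xs \<in> tuples M k)"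
  by (auto simp: tuples_def)

lemma tuples_Suc_iff: "xs \<in> tuples M (Suc m) \<longleftrightarrow> (\<exists>y ys. xs = y # ys \<and> y \<in> carrier M \<and> ys \<in> tuples M m)"
  by (cases xs) (auto simp: tuples_def)

lemma tuples_0: "tuples M 0 = {[]}" by (auto simp: tuples_def)

lemma tuples_length: "xs \<in> tuples M m ==> length xs = m" by (simp add: tuples_def)

locale exterior = left_module R M + cring R for R (structure) and M (structure)
begin

lemma ext_relations_closed: "exterior_relations R M m \<subseteq> carrier (free_module R (tuples M m))"
proof -
  interpret F: left_module R "free_module R (tuples M m)"
    by (rule free_left_module[OF ring_R])
  note cl = free_basis_closed[OF ring_R]
  show ?thesis unfolding exterior_relations_def Let_def
    by (auto intro!: F.M.minus_closed F.M.a_closed F.smult_closed cl tuples_update smult_closed)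
qed

sublocale P: presented R "tuples M m" "exterior_relations R M m" for m
  by (intro presented.intro presented_axioms.intro ring_R ext_relations_closed)

abbreviation "E \<equiv> exterior_power R M"
abbreviation "w \<equiv> wedge R M"

lemma Q_eq: "P.Q m = E m" by (simp add: P.Q_def P.K_def P.F_def exterior_power_def Let_def)
lemma gen_eq: "xs \<in> tuples M m ==> P.gen m xs = w xs"
  by (simp add: P.gen_def P.K_def P.F_def wedge_def Let_def tuples_length)

lemma left_module_E: "left_module R (E m)" using P.Q.left_module unfolding Q_eq .
lemma ab_E: "abelian_group (E m)" using left_module_E by (rule left_module_ab)

lemma wedge_closed: "xs \<in> tuples M m ==> w xs \<in> carrier (E m)"
  by (metis P.gen_closed gen_eq Q_eq)

lemma wedge_alternating: "multilinear_alternating id R M (E m) m w"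
  unfolding multilinear_alternating_def
proof (intro conjI ballI allI impI)
  fix xs i x y assume xs: "xs \<in> tuples M m" "i < m" and x: "x \<in> carrier M" and y: "y \<in> carrier M"
  have "free_basis R (xs[i := x \<oplus>\<^bsub>M\<^esub> y]) \<ominus>\<^bsub>P.F m\<^esub> (free_basis R (xs[i := x]) \<oplus>\<^bsub>P.F m\<^esub> free_basis R (xs[i := y]))
     \<in> exterior_relations R M m"
    unfolding exterior_relations_def Let_def P.F_def using xs x y by blast
  from P.gen_add[OF _ _ _ this] show "w (xs[i := x \<oplus>\<^bsub>M\<^esub> y]) = w (xs[i := x]) \<oplus>\<^bsub>E m\<^esub> w (xs[i := y])"
    using xs x y by (simp add: tuples_update Q_eq gen_eq)
next
  fix xs i a x assume xs: "xs \<in> tuples M m" "i < m" and a: "a \<in> carrier R" and x: "x \<in> carrier M"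
  have "free_basis R (xs[i := a \<odot>\<^bsub>M\<^esub> x]) \<ominus>\<^bsub>P.F m\<^esub> a \<odot>\<^bsub>P.F m\<^esub> free_basis R (xs[i := x])
     \<in> exterior_relations R M m"
    unfolding exterior_relations_def Let_def P.F_def using xs x a by blast
  from P.gen_smult[OF _ _ a this] show "w (xs[i := a \<odot>\<^bsub>M\<^esub> x]) = id a \<odot>\<^bsub>E m\<^esub> w (xs[i := x])"
    using xs x a by (simp add: tuples_update Q_eq gen_eq smult_closed)
next
  fix xs i j assume xs: "xs \<in> tuples M m" "i < j" "j < m" "xs ! i = xs ! j"
  hence "free_basis R xs \<in> exterior_relations R M m"
    unfolding exterior_relations_def Let_def by blast
  from P.gen_zero[OF this] show "w xs = \<zero>\<^bsub>E m\<^esub>" using xs by (simp add: Q_eq gen_eq)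
qed (rule wedge_closed)

lemma multilinear_lift:
  assumes R': "ring R'" and L: "left_module R' N" and s: "\<sigma> \<in> ring_hom R R'"
    and ma: "multilinear_alternating \<sigma> R M N m \<beta>"
  shows "induced_map R \<sigma> N \<beta> \<in> slin \<sigma> R (E m) N"
    and "\<And>xs. xs \<in> tuples M m ==> induced_map R \<sigma> N \<beta> (w xs) = \<beta> xs"
proof -
  have b: "\<beta> xs \<in> carrier N" if "xs \<in> tuples M m" for xs
    using ma that by (simp add: multilinear_alternating_def)
  interpret S: lincomb_setup R R' N \<sigma> "tuples M m" \<beta>
    using R' L s b ring_R by (intro lincomb_setup.intro lincomb_setup_axioms.intro) auto
  have rel: "S.lin \<rho> = \<zero>\<^bsub>N\<^esub>" if "\<rho> \<in> exterior_relations R M m" for \<rho>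
    using that unfolding exterior_relations_def Let_def
    apply (elim UnE CollectE exE conjE; hypsubst)
      apply (rule S.lin_rel_add; use ma in \<open>simp add: multilinear_alternating_def tuples_update\<close>)
     apply (rule S.lin_rel_smult; use ma in \<open>simp add: multilinear_alternating_def tuples_update smult_closed\<close>)
    apply (subst S.lin_basis; use ma in \<open>auto simp: multilinear_alternating_def\<close>)
    done
  show "induced_map R \<sigma> N \<beta> \<in> slin \<sigma> R (E m) N"
    using P.induced(1)[OF R' L s b rel] by (simp add: Q_eq)
  show "induced_map R \<sigma> N \<beta> (w xs) = \<beta> xs" if "xs \<in> tuples M m" for xs
    using P.induced(2)[OF R' L s b rel that] gen_eq[OF that] by simp
qed

lemma slin_ext_E:
  assumes "left_module R' N" "f \<in> slin \<sigma> R (E m) N" "g \<in> slin \<sigma> R (E m) N"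
    "\<And>xs. xs \<in> tuples M m ==> f (w xs) = g (w xs)" "z \<in> carrier (E m)"
  shows "f z = g z"
  by (rule P.slin_ext[OF assms(1) assms(2,3)[folded Q_eq] _ assms(5)[folded Q_eq]]) (simp add: gen_eq assms(4))

lemmas hom_ext_E = slin_ext_E[where \<sigma> = id, folded lmod_hom_slin]

lemma E_induct [consumes 1, case_names add smult zero]:
  assumes "z \<in> carrier (E m)"
    and "\<And>x y. x \<in> carrier (E m) ==> y \<in> carrier (E m) ==> P x ==> P y ==> P (x \<oplus>\<^bsub>E m\<^esub> y)"
    and "\<And>a xs. a \<in> carrier R ==> xs \<in> tuples M m ==> P (a \<odot>\<^bsub>E m\<^esub> w xs)"
    and "P \<zero>\<^bsub>E m\<^esub>"
  shows "P z"
  using assms(1)[folded Q_eq]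
proof (induction rule: P.Q_induct)
  case (smult a xs) thus ?case using assms(3)[of a xs] by (simp add: Q_eq gen_eq)
qed (use assms(2,4) in \<open>simp_all add: Q_eq\<close>)

lemma ring_hom_id: "id \<in> ring_hom R R" by (auto simp: ring_hom_def)

subsection \<open>Exterior multiplication\<close>

text \<open>Exterior multiplication z \<mapsto> a \<and> z on degree m. The degree has to be given
  since elements of all exterior powers have the same type.\<close>

definition lw :: "nat => 'c => ('c list => 'a) set => ('c list => 'a) set"
  where "lw m a = induced_map R id (E (Suc m)) (\<lambda>xs. w (a # xs))"

lemma wedge_Cons_alternating:
  assumes "a \<in> carrier M" shows "multilinear_alternating id R M (E (Suc m)) m (\<lambda>xs. w (a # xs))"
proof -
  note wa = wedge_alternating[of "Suc m", unfolded multilinear_alternating_def]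
  show ?thesis unfolding multilinear_alternating_def
  proof (intro conjI ballI allI impI)
    fix xs assume "xs \<in> tuples M m"
    thus "w (a # xs) \<in> carrier (E (Suc m))" using assms by (intro wedge_closed) (simp add: tuples_Cons)
  next
    fix xs i x y assume *: "xs \<in> tuples M m" "i < m" "x \<in> carrier M" "y \<in> carrier M"
    from * wa[THEN conjunct2, THEN conjunct1, rule_format, of "a # xs" "Suc i" x y]
    show "w (a # xs[i := x \<oplus>\<^bsub>M\<^esub> y]) = w (a # xs[i := x]) \<oplus>\<^bsub>E (Suc m)\<^esub> w (a # xs[i := y])"
      using assms by (simp add: tuples_Cons)
  next
    fix xs i c x assume *: "xs \<in> tuples M m" "i < m" "c \<in> carrier R" "x \<in> carrier M"
    from * wa[THEN conjunct2, THEN conjunct2, THEN conjunct1, rule_format, of "a # xs" "Suc i" c x]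
    show "w (a # xs[i := c \<odot>\<^bsub>M\<^esub> x]) = id c \<odot>\<^bsub>E (Suc m)\<^esub> w (a # xs[i := x])"
      using assms by (simp add: tuples_Cons)
  next
    fix xs i j assume *: "xs \<in> tuples M m" "i < j" "j < m" "xs ! i = xs ! j"
    from * wa[THEN conjunct2, THEN conjunct2, THEN conjunct2, rule_format, of "a # xs" "Suc i" "Suc j"]
    show "w (a # xs) = \<zero>\<^bsub>E (Suc m)\<^esub>" using assms by (simp add: tuples_Cons)
  qed
qed

lemma lw_hom: "a \<in> carrier M ==> lw m a \<in> lmod_hom R (E m) (E (Suc m))"
  unfolding lw_def lmod_hom_slin
  by (rule multilinear_lift(1)[OF ring_R left_module_E ring_hom_id wedge_Cons_alternating])

lemma lw_wedge: "a \<in> carrier M ==> xs \<in> tuples M m ==> lw m a (w xs) = w (a # xs)"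
  unfolding lw_def
  by (rule multilinear_lift(2)[OF ring_R left_module_E ring_hom_id wedge_Cons_alternating])

lemma lw_closed: "a \<in> carrier M ==> z \<in> carrier (E m) ==> lw m a z \<in> carrier (E (Suc m))"
  using hom_closed[OF lw_hom] .

lemma wedge_add:
  assumes "a \<in> carrier M" "b \<in> carrier M" "xs \<in> tuples M m"
  shows "w ((a \<oplus>\<^bsub>M\<^esub> b) # xs) = w (a # xs) \<oplus>\<^bsub>E (Suc m)\<^esub> w (b # xs)"
  using wedge_alternating[of "Suc m", unfolded multilinear_alternating_def, THEN conjunct2, THEN conjunct1,
    rule_format, of "a # xs" 0 a b] assms by (simp add: tuples_Cons)

lemma wedge_smult:
  assumes "c \<in> carrier R" "a \<in> carrier M" "xs \<in> tuples M m"
  shows "w ((c \<odot>\<^bsub>M\<^esub> a) # xs) = c \<odot>\<^bsub>E (Suc m)\<^esub> w (a # xs)"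
  using wedge_alternating[of "Suc m", unfolded multilinear_alternating_def, THEN conjunct2, THEN conjunct2, THEN conjunct1,
    rule_format, of "a # xs" 0 c a] assms by (simp add: tuples_Cons)

lemma wedge_repeat: "xs \<in> tuples M m ==> \<not> distinct xs ==> w xs = \<zero>\<^bsub>E m\<^esub>"
proof -
  assume xs: "xs \<in> tuples M m" "\<not> distinct xs"
  then obtain i j where "i < length xs" "j < length xs" "i \<noteq> j" "xs ! i = xs ! j"
    by (auto simp: distinct_conv_nth)
  hence "\<exists>i j. i < j \<and> j < m \<and> xs ! i = xs ! j" using xs(1) by (metis tuples_length linorder_neqE_nat)
  thus ?thesis
    using wedge_alternating[of m, unfolded multilinear_alternating_def, THEN conjunct2, THEN conjunct2, THEN conjunct2] xs(1)
    by blast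
qed

lemma lw_add:
  assumes "a \<in> carrier M" "b \<in> carrier M" "z \<in> carrier (E m)"
  shows "lw m (a \<oplus>\<^bsub>M\<^esub> b) z = lw m a z \<oplus>\<^bsub>E (Suc m)\<^esub> lw m b z"
  by (rule hom_ext_E[OF left_module_E lw_hom lmod_hom_add[OF left_module_E lw_hom lw_hom] _ assms(3)])
     (use assms in \<open>auto simp: lw_wedge wedge_add\<close>)

lemma lw_smult:
  assumes "c \<in> carrier R" "a \<in> carrier M" "z \<in> carrier (E m)"
  shows "lw m (c \<odot>\<^bsub>M\<^esub> a) z = c \<odot>\<^bsub>E (Suc m)\<^esub> lw m a z"
  by (rule hom_ext_E[OF left_module_E lw_hom lmod_hom_smult[OF is_cring left_module_E lw_hom] _ assms(3)])
     (use assms in \<open>auto simp: lw_wedge wedge_smult smult_closed\<close>)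

lemma lw_hom_l: "z \<in> carrier (E m) ==> (\<lambda>a. lw m a z) \<in> lmod_hom R M (E (Suc m))"
  by (intro lmod_homI) (auto simp: lw_add lw_smult lw_closed)

lemma lw_lw_same:
  assumes "a \<in> carrier M" "z \<in> carrier (E m)" shows "lw (Suc m) a (lw m a z) = \<zero>\<^bsub>E (Suc (Suc m))\<^esub>"
  by (rule hom_ext_E[OF left_module_E lmod_hom_comp[OF lw_hom lw_hom] lmod_hom_zero[OF left_module_E] _ assms(2)])
     (use assms in \<open>auto simp: lw_wedge tuples_Cons intro!: wedge_repeat\<close>)

text \<open>Polarization: expand (a + b) \<and> (a + b) \<and> z = 0.\<close>

lemma lw_anticomm:
  assumes a: "a \<in> carrier M" and b: "b \<in> carrier M" and z: "z \<in> carrier (E m)"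
  shows "lw (Suc m) a (lw m b z) = \<ominus>\<^bsub>E (Suc (Suc m))\<^esub> lw (Suc m) b (lw m a z)"
proof -
  interpret E2: abelian_group "E (Suc (Suc m))" by (rule ab_E)
  have cl: "lw (Suc m) x (lw m y z) \<in> carrier (E (Suc (Suc m)))" if "x \<in> carrier M" "y \<in> carrier M" for x y
    using that z by (intro lw_closed)
  have "\<zero>\<^bsub>E (Suc (Suc m))\<^esub> = lw (Suc m) (a \<oplus>\<^bsub>M\<^esub> b) (lw m (a \<oplus>\<^bsub>M\<^esub> b) z)"
    using a b z by (simp add: lw_lw_same)
  also have "\<dots> = lw (Suc m) a (lw m b z) \<oplus>\<^bsub>E (Suc (Suc m))\<^esub> lw (Suc m) b (lw m a z)"
    using a b z cl by (simp add: lw_add lw_closed hom_add[OF lw_hom] lw_lw_same E2.a_ac)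
  finally show ?thesis using cl[OF a b] cl[OF b a] by (metis E2.minus_equality)
qed

text \<open>A scalar in front of a wedge is absorbed into its first vector, so sums of elements a
  \<and> y exhaust degree m + 1. With this rule identities in exterior powers are proved by
  induction on the degree, without tuples.\<close>

lemma E_Suc_induct [consumes 1, case_names add lw]:
  assumes z: "z \<in> carrier (E (Suc m))"
    and add: "\<And>x y. x \<in> carrier (E (Suc m)) ==> y \<in> carrier (E (Suc m)) ==> P x ==> P y ==> P (x \<oplus>\<^bsub>E (Suc m)\<^esub> y)"
    and l: "\<And>a y. a \<in> carrier M ==> y \<in> carrier (E m) ==> P (lw m a y)"
  shows "P z"
  using z
proof (induction rule: E_induct)
  case (smult c xs)
  then obtain y ys where y: "xs = y # ys" "y \<in> carrier M" "ys \<in> tuples M m" by (auto simp: tuples_Suc_iff)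
  hence "c \<odot>\<^bsub>E (Suc m)\<^esub> w xs = lw m (c \<odot>\<^bsub>M\<^esub> y) (w ys)" using smult by (simp add: lw_wedge wedge_smult smult_closed)
  thus ?case using l[of "c \<odot>\<^bsub>M\<^esub> y" "w ys"] y smult by (simp add: wedge_closed smult_closed)
next
  case zero
  interpret E0: abelian_group "E m" by (rule ab_E)
  have "lw m \<zero>\<^bsub>M\<^esub> \<zero>\<^bsub>E m\<^esub> = \<zero>\<^bsub>E (Suc m)\<^esub>" by (rule hom_zero[OF left_module_E left_module_E lw_hom]) simp
  thus ?case using l[of "\<zero>\<^bsub>M\<^esub>" "\<zero>\<^bsub>E m\<^esub>"] by simp
qed (rule add)

subsection \<open>Degree zero\<close>

lemma E_0: "z \<in> carrier (E 0) ==> \<exists>a\<in>carrier R. z = a \<odot>\<^bsub>E 0\<^esub> w []"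
proof (induction rule: E_induct)
  case (add x y)
  interpret E0: left_module R "E 0" by (rule left_module_E)
  from add obtain a b where "a \<in> carrier R" "b \<in> carrier R" "x = a \<odot>\<^bsub>E 0\<^esub> w []" "y = b \<odot>\<^bsub>E 0\<^esub> w []" by auto
  thus ?case using wedge_closed[of "[]" 0] by (intro bexI[of _ "a \<oplus> b"]) (auto simp: tuples_0 E0.smult_l_distr)
next
  case (smult a xs) thus ?case by (auto simp: tuples_0)
next
  case zero
  interpret E0: left_module R "E 0" by (rule left_module_E)
  show ?case using wedge_closed[of "[]" 0] by (intro bexI[of _ \<zero>]) (auto simp: tuples_0 E0.smult_l_null)
qed

text \<open>In degree 0 there are no relations, so the submodule divided out is zero and evaluation
  at \<open>[]\<close> is well defined on cosets.\<close>

lemma E_0_coeff: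
  assumes "a \<in> carrier R" shows "the_elem ((\<lambda>u. u []) ` (a \<odot>\<^bsub>E 0\<^esub> w [])) = a"
proof -
  have cl: "u [] \<in> carrier R" if "u \<in> carrier (P.F 0)" for u
    by (rule free_module_eval[OF ring_R that[unfolded P.F_def]])
  have add: "additive_map (P.F 0) R (\<lambda>u. u [])"
    using cl unfolding additive_map_def by (auto simp: P.F_def free_module_simps(2))
  have "exterior_relations R M 0 = {}" by (auto simp: exterior_relations_def Let_def)
  hence K: "x [] = \<zero>" if "x \<in> P.K 0" for x
  proof -
    have "x \<in> submodule_span R (P.F 0) {}" using that \<open>exterior_relations R M 0 = {}\<close> P.K_def[of 0] by simp
    thus ?thesis using empty_subsetI[of "carrier (P.F 0)"]
  proof (induction rule: P.F.span_induct)
    case (add x y) thus ?case by (simp add: P.F_def free_module_simps(2))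
  next
    case (smult a x) thus ?case by (simp add: P.F_def free_module_simps(4))
  qed (auto simp: P.F_def free_module_simps)
  qed
  have b: "free_basis R [] \<in> carrier (P.F 0)" by (rule P.basis_cl) (simp add: tuples_0)
  have "a \<odot>\<^bsub>E 0\<^esub> w [] = P.K 0 +>\<^bsub>P.F 0\<^esub> (a \<odot>\<^bsub>P.F 0\<^esub> free_basis R [])"
    using P.coset_hom(2)[OF assms b, unfolded Q_eq, folded P.gen_def] gen_eq[of "[]" 0] by (metis tuples_0 singletonI)
  moreover have "the_elem ((\<lambda>u. u []) ` (P.K 0 +>\<^bsub>P.F 0\<^esub> (a \<odot>\<^bsub>P.F 0\<^esub> free_basis R []))) = (a \<odot>\<^bsub>P.F 0\<^esub> free_basis R []) []"
  proof (rule P.F.the_elem_coset)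
    show "submodule (P.K 0) R (P.F 0)" by (rule P.K)
    show "additive_map (P.F 0) R (\<lambda>u. u [])" by (rule add)
  qed (use K b assms ab_R in \<open>auto intro: P.F.smult_closed\<close>)
  ultimately have "the_elem ((\<lambda>u. u []) ` (a \<odot>\<^bsub>E 0\<^esub> w [])) = (a \<odot>\<^bsub>P.F 0\<^esub> free_basis R []) []" by simp
  thus ?thesis using assms by (simp add: P.F_def free_module_simps(4) free_basis_def)
qed

end

subsection \<open>Contraction with a linear form\<close>

context exterior begin

text \<open>Written in the form of the summands in \<open>D_diff\<close>, so that
  \<open>contr\<close> becomes the differential of D^(n) by mere unfolding.\<close>

definition koszul_term :: "('c => 'a) => nat => 'c list => nat => ('c list => 'a) set"
  where "koszul_term \<phi> m xs i =
    alt_sign (E m) (int i) (\<phi> (xs ! i) \<odot>\<^bsub>E m\<^esub> w (take i xs @ drop (Suc i) xs))"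

definition koszul :: "('c => 'a) => nat => 'c list => ('c list => 'a) set"
  where "koszul \<phi> m xs = (\<Oplus>\<^bsub>E m\<^esub>i\<in>{..<length xs}. koszul_term \<phi> m xs i)"

definition contr :: "('c => 'a) => nat => ('c list => 'a) set => ('c list => 'a) set"
  where "contr \<phi> m = induced_map R id (E m) (koszul \<phi> m)"

context
  fixes \<phi> assumes \<phi>: "\<phi> \<in> lmod_hom R M (regular R)"
begin

lemma phi_closed: "x \<in> carrier M ==> \<phi> x \<in> carrier R"
  using hom_closed[OF \<phi>] by simp

lemma phi_add: "x \<in> carrier M ==> y \<in> carrier M ==> \<phi> (x \<oplus>\<^bsub>M\<^esub> y) = \<phi> x \<oplus> \<phi> y"
  using hom_add[OF \<phi>] by simp

lemma phi_smult: "a \<in> carrier R ==> x \<in> carrier M ==> \<phi> (a \<odot>\<^bsub>M\<^esub> x) = a \<otimes> \<phi> x"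
  using hom_smult[OF \<phi>] by simp

lemma koszul_term_closed:
  assumes "xs \<in> tuples M (Suc m)" "i < Suc m" shows "koszul_term \<phi> m xs i \<in> carrier (E m)"
proof -
  interpret E: left_module R "E m" by (rule left_module_E)
  have "set (take i xs @ drop (Suc i) xs) \<subseteq> set xs" by (auto dest: in_set_takeD in_set_dropD)
  hence "take i xs @ drop (Suc i) xs \<in> tuples M m" using assms by (auto simp: tuples_def)
  moreover have "xs ! i \<in> carrier M" using assms by (auto simp: tuples_def)
  ultimately have "\<phi> (xs ! i) \<odot>\<^bsub>E m\<^esub> w (take i xs @ drop (Suc i) xs) \<in> carrier (E m)"
    by (intro E.smult_closed phi_closed wedge_closed)
  thus ?thesis by (simp add: koszul_term_def alt_sign_def)
qed

lemma koszul_closed: "xs \<in> tuples M (Suc m) ==> koszul \<phi> m xs \<in> carrier (E m)"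
proof -
  interpret E: left_module R "E m" by (rule left_module_E)
  assume xs: "xs \<in> tuples M (Suc m)"
  show ?thesis unfolding koszul_def using koszul_term_closed[OF xs]
    by (intro E.M.finsum_closed) (auto simp: tuples_length[OF xs])
qed

lemma koszul_single: "x \<in> carrier M ==> koszul \<phi> 0 [x] = \<phi> x \<odot>\<^bsub>E 0\<^esub> w []"
proof -
  interpret E: left_module R "E 0" by (rule left_module_E)
  assume x: "x \<in> carrier M"
  have "koszul_term \<phi> 0 [x] 0 = \<phi> x \<odot>\<^bsub>E 0\<^esub> w []" by (simp add: koszul_term_def alt_sign_def)
  moreover have "w [] \<in> carrier (E 0)" by (rule wedge_closed) (simp add: tuples_0)
  ultimately show ?thesis using x by (simp add: koszul_def lessThan_Suc E.M.finsum_insert E.smult_closed phi_closed)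
qed

text \<open>The term that deletes x stands alone; in all others x stays in front and the position of
  the deleted entry moves by one, which changes the sign. The recursion replaces the alternating sum
  from here on.\<close>

lemma koszul_Cons:
  assumes x: "x \<in> carrier M" and xs: "xs \<in> tuples M (Suc m)"
  shows "koszul \<phi> (Suc m) (x # xs) = \<phi> x \<odot>\<^bsub>E (Suc m)\<^esub> w xs \<ominus>\<^bsub>E (Suc m)\<^esub> lw m x (koszul \<phi> m xs)"
proof -
  interpret E: left_module R "E (Suc m)" by (rule left_module_E)
  interpret E': left_module R "E m" by (rule left_module_E)
  have len: "length xs = Suc m" using xs by (simp add: tuples_length)
  have xxs: "x # xs \<in> tuples M (Suc (Suc m))" using x xs by (simp add: tuples_Cons)
  \<comment> \<open>Deleting entry i + 1 of \<open>x # xs\<close> leaves x in front of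
    \<open>xs\<close> with entry i deleted, with the opposite sign.\<close>
  have shift: "koszul_term \<phi> (Suc m) (x # xs) (Suc i) = \<ominus>\<^bsub>E (Suc m)\<^esub> lw m x (koszul_term \<phi> m xs i)" if i: "i < Suc m" for i
  proof -
    let ?ys = "take i xs @ drop (Suc i) xs"
    have "set ?ys \<subseteq> set xs" by (auto dest: in_set_takeD in_set_dropD)
    hence ys: "?ys \<in> tuples M m" using xs i by (auto simp: tuples_def)
    have xi: "xs ! i \<in> carrier M" using i xs by (auto simp: tuples_def)
    have cl: "\<phi> (xs ! i) \<odot>\<^bsub>E m\<^esub> w ?ys \<in> carrier (E m)" using ys xi by (intro E'.smult_closed phi_closed wedge_closed)
    have l: "lw m x (\<phi> (xs ! i) \<odot>\<^bsub>E m\<^esub> w ?ys) = \<phi> (xs ! i) \<odot>\<^bsub>E (Suc m)\<^esub> w (x # ?ys)"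
      using x xi ys by (simp add: hom_smult[OF lw_hom] phi_closed wedge_closed lw_wedge)
    show ?thesis
      using cl l lw_closed[OF x cl] hom_minus[OF left_module_E left_module_E lw_hom[OF x] cl]
      by (simp add: koszul_term_def alt_sign_def)
  qed
  have cl: "koszul_term \<phi> m xs \<in> {..<Suc m} \<rightarrow> carrier (E m)" using koszul_term_closed[OF xs] by auto
  have "koszul \<phi> (Suc m) (x # xs) = (\<Oplus>\<^bsub>E (Suc m)\<^esub>i\<in>{..Suc m}. koszul_term \<phi> (Suc m) (x # xs) i)"
    by (simp add: koszul_def len lessThan_Suc_atMost)
  also have "\<dots> = (\<Oplus>\<^bsub>E (Suc m)\<^esub>i\<in>{..m}. koszul_term \<phi> (Suc m) (x # xs) (Suc i)) \<oplus>\<^bsub>E (Suc m)\<^esub> koszul_term \<phi> (Suc m) (x # xs) 0"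
    using koszul_term_closed[OF xxs] by (intro E.M.finsum_Suc2) auto
  also have "koszul_term \<phi> (Suc m) (x # xs) 0 = \<phi> x \<odot>\<^bsub>E (Suc m)\<^esub> w xs"
    by (simp add: koszul_term_def alt_sign_def)
  also have "(\<Oplus>\<^bsub>E (Suc m)\<^esub>i\<in>{..m}. koszul_term \<phi> (Suc m) (x # xs) (Suc i)) =
     (\<Oplus>\<^bsub>E (Suc m)\<^esub>i\<in>{..<Suc m}. \<ominus>\<^bsub>E (Suc m)\<^esub> lw m x (koszul_term \<phi> m xs i))"
    using koszul_term_closed[OF xs] lw_closed[OF x]
    by (intro E.M.finsum_cong') (auto simp: lessThan_Suc_atMost shift)
  also have "\<dots> = \<ominus>\<^bsub>E (Suc m)\<^esub> lw m x (koszul \<phi> m xs)"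
    unfolding koszul_def len
    by (rule hom_finsum[OF left_module_E left_module_E lmod_hom_neg[OF left_module_E lw_hom[OF x]] _ cl, symmetric]) simp
  finally show ?thesis
    using lw_closed[OF x koszul_closed[OF xs]] wedge_closed[OF xs] phi_closed[OF x]
    by (simp add: a_minus_def E.M.a_comm E.smult_closed)
qed

text \<open>This would follow by contracting x \<and> xs = 0, but contraction is not yet known to be
  well defined on wedges. It is proved for tuples instead, and serves to establish just
  that.\<close>

lemma lw_koszul:
  assumes "xs \<in> tuples M (Suc m)" "x \<in> set xs"
  shows "lw m x (koszul \<phi> m xs) = \<phi> x \<odot>\<^bsub>E (Suc m)\<^esub> w xs"
  using assms
proof (induction m arbitrary: xs)
  case 0
  then obtain y where y: "xs = [y]" "y \<in> carrier M" by (auto simp: tuples_Suc_iff tuples_0)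
  have "w [] \<in> carrier (E 0)" by (rule wedge_closed) (simp add: tuples_0)
  thus ?case using y 0 by (simp add: koszul_single hom_smult[OF lw_hom] phi_closed lw_wedge tuples_0)
next
  case (Suc m)
  interpret E2: left_module R "E (Suc (Suc m))" by (rule left_module_E)
  interpret E1: left_module R "E (Suc m)" by (rule left_module_E)
  from Suc obtain y ys where y: "xs = y # ys" "y \<in> carrier M" "ys \<in> tuples M (Suc m)" by (auto simp: tuples_Suc_iff)
  have x: "x \<in> carrier M" using Suc.prems by (auto simp: tuples_def)
  have k: "koszul \<phi> m ys \<in> carrier (E m)" using y by (simp add: koszul_closed)
  have 1: "lw (Suc m) x (koszul \<phi> (Suc m) xs) =
      \<phi> y \<odot>\<^bsub>E (Suc (Suc m))\<^esub> w (x # ys) \<ominus>\<^bsub>E (Suc (Suc m))\<^esub> lw (Suc m) x (lw m y (koszul \<phi> m ys))"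
    using x y k by (simp add: koszul_Cons hom_diff[OF left_module_E left_module_E lw_hom] hom_smult[OF lw_hom]
        wedge_closed E1.smult_closed phi_closed lw_closed lw_wedge)
  have wx: "w (x # ys) \<in> carrier (E (Suc (Suc m)))" "w (y # ys) \<in> carrier (E (Suc (Suc m)))"
    using x y by (auto intro!: wedge_closed simp: tuples_Cons)
  show ?case
  proof (cases "x \<in> set ys")
    case True
    have "w (x # ys) = \<zero>\<^bsub>E (Suc (Suc m))\<^esub>" using True x y by (intro wedge_repeat) (auto simp: tuples_Cons)
    \<comment> \<open>Anticommutation moves x next to the contracted tail, where the induction
      hypothesis applies.\<close>
    moreover have "lw (Suc m) x (lw m y (koszul \<phi> m ys)) = \<ominus>\<^bsub>E (Suc (Suc m))\<^esub> (\<phi> x \<odot>\<^bsub>E (Suc (Suc m))\<^esub> w (y # ys))"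
      using Suc.IH[OF y(3) True] lw_anticomm[OF x y(2) k] x y
      by (simp add: hom_smult[OF lw_hom] phi_closed wedge_closed lw_wedge)
    ultimately show ?thesis unfolding 1 using wx x y
      by (simp add: E2.smult_r_null phi_closed a_minus_def E2.smult_closed)
  next
    case False
    hence "x = y" using Suc.prems y by simp
    thus ?thesis unfolding 1 using wx x y k by (simp add: lw_lw_same E2.M.minus_zero E2.smult_closed phi_closed)
  qed
qed

text \<open>Well-definedness of contraction. By \<open>koszul_Cons\<close> all conditions reduce to
  the tail, except for a repetition that involves the first entry, where \<open>lw_koszul\<close> is
  needed.\<close>

lemma koszul_alternating: "multilinear_alternating id R M (E m) (Suc m) (koszul \<phi> m)"
proof (induction m)
  case 0
  interpret E: left_module R "E 0" by (rule left_module_E)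
  have w: "w [] \<in> carrier (E 0)" by (rule wedge_closed) (simp add: tuples_0)
  show ?case unfolding multilinear_alternating_def using w
    by (auto simp: tuples_Suc_iff tuples_0 koszul_single phi_closed phi_add phi_smult smult_closed
      E.smult_l_distr E.smult_assoc1 intro!: E.smult_closed)
next
  case (Suc m)
  interpret E: left_module R "E (Suc m)" by (rule left_module_E)
  interpret E': left_module R "E m" by (rule left_module_E)
  note IH = Suc[unfolded multilinear_alternating_def, THEN conjunct2]
  note IHa = IH[THEN conjunct1, rule_format]
    and IHm = IH[THEN conjunct2, THEN conjunct1, rule_format]
    and IHz = IH[THEN conjunct2, THEN conjunct2, rule_format]
  note wa = wedge_alternating[of "Suc m", unfolded multilinear_alternating_def, THEN conjunct2]
  note wm = wa[THEN conjunct2, THEN conjunct1, rule_format]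
  note wa = wa[THEN conjunct1, rule_format]
  have cl: "\<phi> x \<odot>\<^bsub>E (Suc m)\<^esub> w ys \<in> carrier (E (Suc m))" "lw m x (koszul \<phi> m ys) \<in> carrier (E (Suc m))"
    if "x \<in> carrier M" "ys \<in> tuples M (Suc m)" for x ys
    using that by (auto intro!: E.smult_closed phi_closed wedge_closed lw_closed koszul_closed)
  show ?case unfolding multilinear_alternating_def
  proof (intro conjI ballI allI impI)
    fix xs assume "xs \<in> tuples M (Suc (Suc m))"
    thus "koszul \<phi> (Suc m) xs \<in> carrier (E (Suc m))" by (rule koszul_closed)
  next
    fix xs i u v assume *: "xs \<in> tuples M (Suc (Suc m))" "i < Suc (Suc m)" and uv: "u \<in> carrier M" "v \<in> carrier M"
    then obtain y ys where y: "xs = y # ys" "y \<in> carrier M" "ys \<in> tuples M (Suc m)" by (auto simp: tuples_Suc_iff)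
    show "koszul \<phi> (Suc m) (xs[i := u \<oplus>\<^bsub>M\<^esub> v]) = koszul \<phi> (Suc m) (xs[i := u]) \<oplus>\<^bsub>E (Suc m)\<^esub> koszul \<phi> (Suc m) (xs[i := v])"
    proof (cases i)
      case 0
      thus ?thesis using y uv cl[of u ys] cl[of v ys]
        by (simp add: koszul_Cons phi_add E.smult_l_distr phi_closed wedge_closed lw_add koszul_closed a_minus_def E.M.minus_add E.M.a_ac)
    next
      case (Suc j)
      hence j: "j < Suc m" using * by simp
      show ?thesis using Suc y uv cl[OF y(2), of "ys[j := u]"] cl[OF y(2), of "ys[j := v]"] wa[OF y(3) j uv] IHa[OF y(3) j uv]
        by (simp add: koszul_Cons tuples_update E.smult_r_distr phi_closed wedge_closed hom_add[OF lw_hom]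
            koszul_closed a_minus_def E.M.minus_add E.M.a_ac)
    qed
  next
    fix xs i c u assume *: "xs \<in> tuples M (Suc (Suc m))" "i < Suc (Suc m)" and u: "c \<in> carrier R" "u \<in> carrier M"
    then obtain y ys where y: "xs = y # ys" "y \<in> carrier M" "ys \<in> tuples M (Suc m)" by (auto simp: tuples_Suc_iff)
    show "koszul \<phi> (Suc m) (xs[i := c \<odot>\<^bsub>M\<^esub> u]) = id c \<odot>\<^bsub>E (Suc m)\<^esub> koszul \<phi> (Suc m) (xs[i := u])"
    proof (cases i)
      case 0
      thus ?thesis using y u cl[of u ys]
        by (simp add: koszul_Cons phi_smult smult_closed E.smult_r_diff E.smult_assoc1 phi_closed wedge_closed lw_smult koszul_closed)
    next
      case (Suc j)
      hence j: "j < Suc m" using * by simp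
      \<comment> \<open>The scalar has to pass the coefficient contributed by the first entry; this
        uses commutativity of the ring.\<close>
      have "\<phi> y \<odot>\<^bsub>E (Suc m)\<^esub> (c \<odot>\<^bsub>E (Suc m)\<^esub> w (ys[j := u])) = c \<odot>\<^bsub>E (Suc m)\<^esub> (\<phi> y \<odot>\<^bsub>E (Suc m)\<^esub> w (ys[j := u]))"
        using y u by (simp add: E.smult_assoc1[symmetric] phi_closed wedge_closed tuples_update m_comm)
      thus ?thesis using Suc y u cl[OF y(2), of "ys[j := u]"] wm[OF y(3) j u] IHm[OF y(3) j u]
        by (simp add: koszul_Cons tuples_update E.smult_r_diff phi_closed wedge_closed hom_smult[OF lw_hom]
            koszul_closed smult_closed)
    qed
  next
    fix xs i j assume *: "xs \<in> tuples M (Suc (Suc m))" "i < j" "j < Suc (Suc m)" "xs ! i = xs ! j"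
    then obtain y ys where y: "xs = y # ys" "y \<in> carrier M" "ys \<in> tuples M (Suc m)" by (auto simp: tuples_Suc_iff)
    obtain j' where j': "j = Suc j'" "j' < Suc m" using * by (cases j) auto
    show "koszul \<phi> (Suc m) xs = \<zero>\<^bsub>E (Suc m)\<^esub>"
    proof (cases i)
      case 0
      \<comment> \<open>The first entry recurs in the tail, so by \<open>lw_koszul\<close> the two
        terms of \<open>koszul_Cons\<close> are equal and cancel.\<close>
      hence "y \<in> set ys" using * y j' by (auto simp: tuples_length)
      from lw_koszul[OF y(3) this] show ?thesis using y cl[OF y(2,3)] by (simp add: koszul_Cons E.M.minus_eq_zero_iff)
    next
      case (Suc i')
      hence eq: "ys ! i' = ys ! j'" "i' < j'" using * y j' by auto
      have "i' < Suc m" using eq(2) j'(2) by simp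
      hence "\<not> distinct ys" using eq j'(2) y(3) by (metis distinct_conv_nth tuples_length nat_neq_iff)
      hence "w ys = \<zero>\<^bsub>E (Suc m)\<^esub>" using y by (intro wedge_repeat)
      moreover have "lw m y \<zero>\<^bsub>E m\<^esub> = \<zero>\<^bsub>E (Suc m)\<^esub>" by (rule hom_zero[OF left_module_E left_module_E lw_hom[OF y(2)]])
      ultimately show ?thesis using y IHz[OF y(3) eq(2) j'(2) eq(1)]
        by (simp add: koszul_Cons phi_closed E.smult_r_null E.M.minus_zero)
    qed
  qed
qed

lemma contr_hom: "contr \<phi> m \<in> lmod_hom R (E (Suc m)) (E m)"
  unfolding contr_def lmod_hom_slin
  by (rule multilinear_lift(1)[OF ring_R left_module_E ring_hom_id koszul_alternating])

lemma contr_wedge: "xs \<in> tuples M (Suc m) ==> contr \<phi> m (w xs) = koszul \<phi> m xs"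
  unfolding contr_def
  by (rule multilinear_lift(2)[OF ring_R left_module_E ring_hom_id koszul_alternating])

lemma contr_closed: "z \<in> carrier (E (Suc m)) ==> contr \<phi> m z \<in> carrier (E m)"
  using hom_closed[OF contr_hom] .

text \<open>The antiderivation rule, which is \<open>koszul_Cons\<close> read on wedges. It is the
  rule by which contractions are computed from now on.\<close>

lemma contr_lw:
  assumes a: "a \<in> carrier M" and z: "z \<in> carrier (E (Suc m))"
  shows "contr \<phi> (Suc m) (lw (Suc m) a z) = \<phi> a \<odot>\<^bsub>E (Suc m)\<^esub> z \<ominus>\<^bsub>E (Suc m)\<^esub> lw m a (contr \<phi> m z)"
  by (rule hom_ext_E[OF left_module_E lmod_hom_comp[OF lw_hom contr_hom]
      lmod_hom_diff[OF left_module_E lmod_hom_smult[OF is_cring left_module_E lmod_hom_id] lmod_hom_comp[OF contr_hom lw_hom]] _ z])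
     (use a in \<open>auto simp: phi_closed lw_wedge contr_wedge tuples_Cons koszul_Cons\<close>)

text \<open>Degree 0 is separate because contracting z itself would lead to degree -1.\<close>

lemma contr_lw_0:
  assumes a: "a \<in> carrier M" and z: "z \<in> carrier (E 0)"
  shows "contr \<phi> 0 (lw 0 a z) = \<phi> a \<odot>\<^bsub>E 0\<^esub> z"
  by (rule hom_ext_E[OF left_module_E lmod_hom_comp[OF lw_hom contr_hom]
      lmod_hom_smult[OF is_cring left_module_E lmod_hom_id] _ z])
     (use a in \<open>auto simp: phi_closed lw_wedge contr_wedge tuples_Cons tuples_0 koszul_single\<close>)

text \<open>For z = a \<and> y the antiderivation rule, used twice, produces the contraction of y
  with the factor \<phi>(a) and opposite signs, and a wedge with a double contraction in lower
  degree.\<close>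

lemma contr_contr:
  "z \<in> carrier (E (Suc (Suc m))) ==> contr \<phi> m (contr \<phi> (Suc m) z) = \<zero>\<^bsub>E m\<^esub>"
proof (induction m arbitrary: z)
  case 0
  interpret E0: left_module R "E 0" by (rule left_module_E)
  interpret E1: left_module R "E (Suc 0)" by (rule left_module_E)
  from 0 show ?case
  proof (induction rule: E_Suc_induct)
    case (add x y) thus ?case by (simp add: hom_add[OF contr_hom] contr_closed)
  next
    case (lw a y)
    thus ?case
      by (simp add: contr_lw hom_diff[OF left_module_E left_module_E contr_hom] hom_smult[OF contr_hom]
         E1.smult_closed phi_closed lw_closed contr_closed contr_lw_0 E0.M.minus_eq_zero_iff E0.smult_closed)
  qed
next
  case (Suc m)
  note IH = Suc.IH
  interpret E0: left_module R "E (Suc m)" by (rule left_module_E)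
  interpret E1: left_module R "E (Suc (Suc m))" by (rule left_module_E)
  from Suc.prems show ?case
  proof (induction rule: E_Suc_induct)
    case (add x y) thus ?case by (simp add: hom_add[OF contr_hom] contr_closed)
  next
    case (lw a y)
    thus ?case
      by (simp add: contr_lw hom_diff[OF left_module_E left_module_E contr_hom] hom_smult[OF contr_hom]
         E1.smult_closed phi_closed lw_closed contr_closed IH hom_zero[OF left_module_E left_module_E lw_hom]
         E0.M.minus_zero E0.M.minus_eq_zero_iff E0.smult_closed)
  qed
qed

text \<open>In the antiderivation rule the first term has a factor in I, and the second stays in I
  times the module because multiplication by a is linear.\<close>

lemma contr_ideal:
  assumes I: "I \<subseteq> carrier R" and "\<And>a. a \<in> carrier M ==> \<phi> a \<in> I" and "z \<in> carrier (E (Suc m))"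
  shows "contr \<phi> m z \<in> ideal_smult R I (E m)"
  using assms(3)
proof (induction m arbitrary: z)
  case 0
  interpret E: left_module R "E 0" by (rule left_module_E)
  note sub = E.submodule_props[OF E.ideal_smult_submodule[OF I]]
  from 0 show ?case
  proof (induction rule: E_Suc_induct)
    case (add x y) thus ?case by (simp add: hom_add[OF contr_hom] sub)
  next
    case (lw a y) thus ?case using E.ideal_smultI assms(2) by (simp add: contr_lw_0)
  qed
next
  case (Suc m)
  interpret E: left_module R "E (Suc m)" by (rule left_module_E)
  interpret E': left_module R "E m" by (rule left_module_E)
  note sub = E.submodule_props[OF E.ideal_smult_submodule[OF I]]
  note IH = Suc.IH
  from Suc.prems show ?case
  proof (induction rule: E_Suc_induct)
    case (add x y) thus ?case by (simp add: hom_add[OF contr_hom] sub)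
  next
    case (lw a y)
    have "lw m a (contr \<phi> m y) \<in> ideal_smult R I (E (Suc m))"
      using E'.ideal_smult_hom[OF I left_module_E lw_hom IH] lw by blast
    thus ?case using E.ideal_smultI assms(2) lw by (simp add: contr_lw sub)
  qed
qed

end

subsection \<open>Functoriality\<close>

text \<open>The case \<open>\<sigma> = id\<close> gives the exterior powers of \<psi>_n; with
  \<open>\<sigma>\<close> a conjugation it gives the action of an element of H.\<close>

definition ext_map :: "('a => 'a) => ('c => 'c) => nat => ('c list => 'a) set => ('c list => 'a) set"
  where "ext_map \<sigma> \<psi> m = induced_map R \<sigma> (E m) (\<lambda>xs. w (map \<psi> xs))"

context
  fixes \<sigma> \<psi> assumes \<sigma>: "\<sigma> \<in> ring_hom R R" and \<psi>: "\<psi> \<in> slin \<sigma> R M M"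
begin

lemma tuples_map: "xs \<in> tuples M m ==> map \<psi> xs \<in> tuples M m"
  using additive_map_closed[OF slin_additive[OF \<psi>]] by (auto simp: tuples_def)

lemma psi_closed: "x \<in> carrier M ==> \<psi> x \<in> carrier M"
  using additive_map_closed[OF slin_additive[OF \<psi>]] .

lemma wedge_map_alternating: "multilinear_alternating \<sigma> R M (E m) m (\<lambda>xs. w (map \<psi> xs))"
proof -
  note wa = wedge_alternating[of m, unfolded multilinear_alternating_def, THEN conjunct2]
  note wm = wa[THEN conjunct2, THEN conjunct1, rule_format] and wz = wa[THEN conjunct2, THEN conjunct2, rule_format]
  note wa = wa[THEN conjunct1, rule_format]
  have s: "\<sigma> a \<in> carrier R" if "a \<in> carrier R" for a using ring_hom_closed[OF \<sigma> that] .
  show ?thesis unfolding multilinear_alternating_def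
  proof (intro conjI ballI allI impI)
    fix xs i j assume *: "xs \<in> tuples M m" "i < j" "j < m" "xs ! i = xs ! j"
    show "w (map \<psi> xs) = \<zero>\<^bsub>E m\<^esub>" using * by (intro wz[OF tuples_map, of xs i j]) (auto simp: tuples_length)
  qed (simp_all add: wedge_closed tuples_map map_update additive_map_add[OF slin_additive[OF \<psi>]]
      slin_smult[OF \<psi>] wa wm s psi_closed)
qed

lemma ext_map_slin: "ext_map \<sigma> \<psi> m \<in> slin \<sigma> R (E m) (E m)"
  unfolding ext_map_def
  by (rule multilinear_lift(1)[OF ring_R left_module_E \<sigma> wedge_map_alternating])

lemma ext_map_wedge: "xs \<in> tuples M m ==> ext_map \<sigma> \<psi> m (w xs) = w (map \<psi> xs)"
  unfolding ext_map_def
  by (rule multilinear_lift(2)[OF ring_R left_module_E \<sigma> wedge_map_alternating])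

lemma ext_map_closed: "z \<in> carrier (E m) ==> ext_map \<sigma> \<psi> m z \<in> carrier (E m)"
  using additive_map_closed[OF slin_additive[OF ext_map_slin]] .

lemma ext_map_add: "x \<in> carrier (E m) ==> y \<in> carrier (E m) ==>
   ext_map \<sigma> \<psi> m (x \<oplus>\<^bsub>E m\<^esub> y) = ext_map \<sigma> \<psi> m x \<oplus>\<^bsub>E m\<^esub> ext_map \<sigma> \<psi> m y"
  using additive_map_add[OF slin_additive[OF ext_map_slin]] .

lemma ext_map_smult: "a \<in> carrier R ==> x \<in> carrier (E m) ==>
   ext_map \<sigma> \<psi> m (a \<odot>\<^bsub>E m\<^esub> x) = \<sigma> a \<odot>\<^bsub>E m\<^esub> ext_map \<sigma> \<psi> m x"
  using slin_smult[OF ext_map_slin] .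

lemma ext_map_lw:
  assumes a: "a \<in> carrier M" and z: "z \<in> carrier (E m)"
  shows "ext_map \<sigma> \<psi> (Suc m) (lw m a z) = lw m (\<psi> a) (ext_map \<sigma> \<psi> m z)"
proof (rule slin_ext_E[OF left_module_E _ _ _ z, where \<sigma> = \<sigma>])
  note l = lw_hom[OF a, of m] lw_hom[OF psi_closed[OF a], of m]
  show "(\<lambda>z. ext_map \<sigma> \<psi> (Suc m) (lw m a z)) \<in> slin \<sigma> R (E m) (E (Suc m))"
    using l by (auto simp: slin_def additive_map_def hom_add[OF l(1)] hom_smult[OF l(1)] lw_closed[OF a] ext_map_add ext_map_smult ext_map_closed)
  show "(\<lambda>z. lw m (\<psi> a) (ext_map \<sigma> \<psi> m z)) \<in> slin \<sigma> R (E m) (E (Suc m))"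
    using ring_hom_closed[OF \<sigma>] lw_closed[OF psi_closed[OF a]]
    by (auto simp: slin_def additive_map_def hom_add[OF l(2)] hom_smult[OF l(2)] ext_map_add ext_map_smult ext_map_closed)
  show "ext_map \<sigma> \<psi> (Suc m) (lw m a (w xs)) = lw m (\<psi> a) (ext_map \<sigma> \<psi> m (w xs))" if "xs \<in> tuples M m" for xs
    using that a by (simp add: lw_wedge ext_map_wedge tuples_Cons psi_closed tuples_map)
qed

text \<open>Used twice: with \<open>\<sigma> = id\<close> and two different forms it says that the
  exterior powers of \<psi>_n commute with the differentials of D^(n) and D^(n+1); with
  \<open>\<sigma>\<close> a conjugation and one form it says that the differential is
  H-equivariant.\<close>

lemma contr_ext_map:
  assumes \<phi>: "\<phi> \<in> lmod_hom R M (regular R)" and \<phi>': "\<phi>' \<in> lmod_hom R M (regular R)"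
    and eq: "\<And>x. x \<in> carrier M ==> \<phi>' (\<psi> x) = \<sigma> (\<phi> x)" and z: "z \<in> carrier (E (Suc m))"
  shows "contr \<phi>' m (ext_map \<sigma> \<psi> (Suc m) z) = ext_map \<sigma> \<psi> m (contr \<phi> m z)"
  using z
proof (induction m arbitrary: z)
  case 0
  from 0 show ?case
  proof (induction rule: E_Suc_induct)
    case (add x y) thus ?case by (simp add: hom_add[OF contr_hom[OF \<phi>]] hom_add[OF contr_hom[OF \<phi>']] ext_map_add ext_map_closed contr_closed[OF \<phi>])
  next
    case (lw a y) thus ?case by (simp add: ext_map_lw contr_lw_0[OF \<phi>] contr_lw_0[OF \<phi>'] ext_map_closed psi_closed eq ext_map_smult phi_closed[OF \<phi>])
  qed
next
  case (Suc m)
  note IH = Suc.IH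
  interpret E: left_module R "E (Suc m)" by (rule left_module_E)
  from Suc.prems show ?case
  proof (induction rule: E_Suc_induct)
    case (add x y) thus ?case by (simp add: hom_add[OF contr_hom[OF \<phi>]] hom_add[OF contr_hom[OF \<phi>']] ext_map_add ext_map_closed contr_closed[OF \<phi>])
  next
    case (lw a y)
    thus ?case
      by (simp add: ext_map_lw contr_lw[OF \<phi>] contr_lw[OF \<phi>'] ext_map_closed psi_closed eq ext_map_smult phi_closed[OF \<phi>]
          additive_map_diff[OF ab_E ab_E slin_additive[OF ext_map_slin]] E.smult_closed lw_closed contr_closed[OF \<phi>] IH)
  qed
qed

end

text \<open>Four maps rather than two, so that one statement covers both the law for products in H
  (with one factor the identity) and the commutation of exterior powers of \<psi>_n with the action
  of H.\<close>

lemma ext_map_comp: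
  assumes s: "\<sigma>1 \<in> ring_hom R R" "\<sigma>2 \<in> ring_hom R R" "\<sigma>3 \<in> ring_hom R R" "\<sigma>4 \<in> ring_hom R R"
    and p: "\<psi>1 \<in> slin \<sigma>1 R M M" "\<psi>2 \<in> slin \<sigma>2 R M M" "\<psi>3 \<in> slin \<sigma>3 R M M" "\<psi>4 \<in> slin \<sigma>4 R M M"
    and eqs: "\<And>a. a \<in> carrier R ==> \<sigma>1 (\<sigma>2 a) = \<sigma>3 (\<sigma>4 a)"
    and eqp: "\<And>x. x \<in> carrier M ==> \<psi>1 (\<psi>2 x) = \<psi>3 (\<psi>4 x)" and z: "z \<in> carrier (E m)"
  shows "ext_map \<sigma>1 \<psi>1 m (ext_map \<sigma>2 \<psi>2 m z) = ext_map \<sigma>3 \<psi>3 m (ext_map \<sigma>4 \<psi>4 m z)"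
proof (rule slin_ext_E[OF left_module_E _ _ _ z, where \<sigma> = "\<lambda>a. \<sigma>1 (\<sigma>2 a)"])
  note simps = ext_map_add[OF s(1) p(1)] ext_map_add[OF s(2) p(2)] ext_map_add[OF s(3) p(3)] ext_map_add[OF s(4) p(4)]
    ext_map_smult[OF s(1) p(1)] ext_map_smult[OF s(2) p(2)] ext_map_smult[OF s(3) p(3)] ext_map_smult[OF s(4) p(4)]
    ext_map_closed[OF s(1) p(1)] ext_map_closed[OF s(2) p(2)] ext_map_closed[OF s(3) p(3)] ext_map_closed[OF s(4) p(4)]
    ring_hom_closed[OF s(2)] ring_hom_closed[OF s(4)]
  show "(\<lambda>z. ext_map \<sigma>1 \<psi>1 m (ext_map \<sigma>2 \<psi>2 m z)) \<in> slin (\<lambda>a. \<sigma>1 (\<sigma>2 a)) R (E m) (E m)"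
    by (auto simp: slin_def additive_map_def simps)
  show "(\<lambda>z. ext_map \<sigma>3 \<psi>3 m (ext_map \<sigma>4 \<psi>4 m z)) \<in> slin (\<lambda>a. \<sigma>1 (\<sigma>2 a)) R (E m) (E m)"
    by (auto simp: slin_def additive_map_def simps eqs)
  fix xs assume xs: "xs \<in> tuples M m"
  hence "map (\<psi>1 \<circ> \<psi>2) xs = map (\<psi>3 \<circ> \<psi>4) xs" using eqp by (auto simp: tuples_def)
  hence "w (map (\<psi>1 \<circ> \<psi>2) xs) = w (map (\<psi>3 \<circ> \<psi>4) xs)" by (rule arg_cong)
  thus "ext_map \<sigma>1 \<psi>1 m (ext_map \<sigma>2 \<psi>2 m (w xs)) = ext_map \<sigma>3 \<psi>3 m (ext_map \<sigma>4 \<psi>4 m (w xs))"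
    using xs by (simp add: ext_map_wedge[OF s(1) p(1)] ext_map_wedge[OF s(2) p(2)] ext_map_wedge[OF s(3) p(3)]
       ext_map_wedge[OF s(4) p(4)] tuples_map[OF s(2) p(2)] tuples_map[OF s(4) p(4)])
qed

text \<open>The condition on \<open>\<psi>\<close> is guarded by \<open>m > 0\<close>: in degree 0
  there are no vectors to apply it to, so every linear map induces the identity there. This is why
  the telescope map is the identity between the degree 0 parts.\<close>

lemma ext_map_id:
  assumes s: "\<sigma> \<in> ring_hom R R" and p: "\<psi> \<in> slin \<sigma> R M M" and "\<And>a. a \<in> carrier R ==> \<sigma> a = a"
    and "\<And>x. x \<in> carrier M ==> m > 0 ==> \<psi> x = x" and z: "z \<in> carrier (E m)"
  shows "ext_map \<sigma> \<psi> m z = z"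
proof (rule slin_ext_E[OF left_module_E ext_map_slin[OF s p] _ _ z])
  show "(\<lambda>z. z) \<in> slin \<sigma> R (E m) (E m)" using assms(3) by (auto simp: slin_def additive_map_def)
  fix xs assume xs: "xs \<in> tuples M m"
  hence "map \<psi> xs = xs" using assms(4) by (cases m) (auto simp: tuples_def intro!: map_idI)
  thus "ext_map \<sigma> \<psi> m (w xs) = w xs" using ext_map_wedge[OF s p xs] by simp
qed

text \<open>In positive degree a single vector with image in I M is enough, since a wedge is linear
  in its first vector.\<close>

lemma ext_map_ideal:
  assumes I: "I \<subseteq> carrier R" and p: "\<psi> \<in> lmod_hom R M M"
    and "\<And>a. a \<in> carrier M ==> \<psi> a \<in> ideal_smult R I M" and "z \<in> carrier (E (Suc m))"
  shows "ext_map id \<psi> (Suc m) z \<in> ideal_smult R I (E (Suc m))"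
proof -
  interpret E: left_module R "E (Suc m)" by (rule left_module_E)
  note p = p[unfolded lmod_hom_slin]
  note sub = E.submodule_props[OF E.ideal_smult_submodule[OF I]]
  from assms(4) show ?thesis
  proof (induction rule: E_Suc_induct)
    case (add x y) thus ?case by (simp only: ext_map_add[OF ring_hom_id p] sub(3))
  next
    case (lw a y)
    show ?case using ideal_smult_hom[OF I left_module_E lw_hom_l assms(3), OF ext_map_closed[OF ring_hom_id p lw(2)] lw(1)]
      by (simp only: ext_map_lw[OF ring_hom_id p lw])
  qed
qed

end

section \<open>Finite dual bases\<close>

text \<open>The maps that factor through a finite free module, that is, finite sums of maps x
  \<mapsto> c(x) v. The identity is such a map exactly when there is a finite dual basis. The
  inductive form gives closure under sums and compositions without handling index sets.\<close>

inductive finite_factor :: "('a, 'r) ring_scheme => ('a, 'b, 'm) module_scheme => ('a, 'c, 'n) module_scheme => ('b => 'c) => bool"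
  for R M N where
  zero: "(\<And>x. x \<in> carrier M ==> g x = \<zero>\<^bsub>N\<^esub>) ==> finite_factor R M N g"
| step: "finite_factor R M N g ==> c \<in> lmod_hom R M (regular R) ==> v \<in> carrier N ==>
    (\<And>x. x \<in> carrier M ==> g' x = g x \<oplus>\<^bsub>N\<^esub> c x \<odot>\<^bsub>N\<^esub> v) ==> finite_factor R M N g'"

lemma finite_factor_cong:
  assumes "finite_factor R M N g" "\<And>x. x \<in> carrier M ==> g' x = g x"
  shows "finite_factor R M N g'"
  using assms by (induction arbitrary: g') (auto intro: finite_factor.intros)

lemma finite_factor_pre:
  assumes "finite_factor R M N g" "h \<in> lmod_hom R L M"
  shows "finite_factor R L N (\<lambda>x. g (h x))"
  using assms(1)
proof induction
  case (zero g) thus ?case by (intro finite_factor.zero) (auto simp: hom_closed[OF assms(2)])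
next
  case (step g c v g')
  show ?case
    by (rule finite_factor.step[OF step.IH lmod_hom_comp[OF assms(2) step.hyps(2)] step.hyps(3)])
       (simp add: step hom_closed[OF assms(2)])
qed

lemma finite_factor_closed:
  assumes "left_module R N" "finite_factor R M N g" "x \<in> carrier M" shows "g x \<in> carrier N"
proof -
  interpret N: left_module R N by fact
  show ?thesis using assms(2,3)
  proof induction
    case (step g c v g')
    hence "c x \<in> carrier R" using hom_closed[OF step.hyps(2)] by simp
    thus ?case using step by (simp add: N.smult_closed)
  qed simp
qed

text \<open>With \<open>finite_factor_pre\<close> and \<open>finite_factor_add\<close> this makes
  the class a two-sided ideal of maps, so it suffices to write the identity as a sum of composites
  through members of the class.\<close>

lemma finite_factor_post:
  assumes L: "left_module R N" "left_module R L" and g: "finite_factor R M N g" and h: "h \<in> lmod_hom R N L"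
  shows "finite_factor R M L (\<lambda>x. h (g x))"
  using g
proof induction
  case (zero g) thus ?case by (intro finite_factor.zero) (auto simp: hom_zero[OF L h])
next
  case (step g c v g')
  interpret N: left_module R N by fact
  show ?case
  proof (rule finite_factor.step[OF step.IH step.hyps(2) hom_closed[OF h step.hyps(3)]])
    fix x assume x: "x \<in> carrier M"
    have "c x \<in> carrier R" using hom_closed[OF step.hyps(2) x] by simp
    thus "h (g' x) = h (g x) \<oplus>\<^bsub>L\<^esub> c x \<odot>\<^bsub>L\<^esub> h v"
      using x step.hyps finite_factor_closed[OF L(1) step.hyps(1) x]
      by (simp add: step.hyps(4) hom_add[OF h] hom_smult[OF h] N.smult_closed)
  qed
qed

lemma finite_factor_add:
  assumes N: "left_module R N" and g: "finite_factor R M N g" and h: "finite_factor R M N h"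
  shows "finite_factor R M N (\<lambda>x. g x \<oplus>\<^bsub>N\<^esub> h x)"
proof -
  interpret N: left_module R N by fact
  note cl = finite_factor_closed[OF N]
  show ?thesis using h
  proof induction
    case (zero h) thus ?case by (intro finite_factor_cong[OF g]) (auto simp: cl[OF g])
  next
    case (step h c v h')
    show ?case
    proof (rule finite_factor.step[OF step.IH step.hyps(2,3)])
      fix x assume x: "x \<in> carrier M"
      have "c x \<in> carrier R" using hom_closed[OF step.hyps(2) x] by simp
      thus "g x \<oplus>\<^bsub>N\<^esub> h' x = (g x \<oplus>\<^bsub>N\<^esub> h x) \<oplus>\<^bsub>N\<^esub> c x \<odot>\<^bsub>N\<^esub> v"
        using x cl[OF g x] cl[OF step.hyps(1) x] step.hyps(3)
        by (simp add: step.hyps(4) N.M.a_assoc N.smult_closed)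
    qed
  qed
qed

lemma finite_factor_rank_one:
  assumes N: "left_module R N" and "c \<in> lmod_hom R M (regular R)" "v \<in> carrier N"
  shows "finite_factor R M N (\<lambda>x. c x \<odot>\<^bsub>N\<^esub> v)"
proof -
  interpret N: left_module R N by fact
  show ?thesis
    using hom_closed[OF assms(2)] assms(3)
    by (intro finite_factor.step[OF finite_factor.zero assms(2,3), of "\<lambda>x. \<zero>\<^bsub>N\<^esub>"]) (auto simp: N.smult_closed)
qed

text \<open>Back from the inductive form to explicit families of coordinates and vectors.\<close>

lemma finite_factor_sum:
  assumes N: "left_module R N" and "finite_factor R M N g"
  shows "\<exists>n::nat. \<exists>c v. (\<forall>l<n. c l \<in> lmod_hom R M (regular R) \<and> v l \<in> carrier N) \<and>
     (\<forall>x\<in>carrier M. g x = (\<Oplus>\<^bsub>N\<^esub>l\<in>{..<n}. c l x \<odot>\<^bsub>N\<^esub> v l))"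
proof -
  interpret N: left_module R N by fact
  from assms(2) show ?thesis
  proof induction
    case (zero g) thus ?case by (intro exI[of _ "0::nat"]) auto
  next
    case (step g c v g')
    from step.IH obtain n :: nat and c' v' where **: "\<forall>l<n. c' l \<in> lmod_hom R M (regular R) \<and> v' l \<in> carrier N"
      "\<forall>x\<in>carrier M. g x = (\<Oplus>\<^bsub>N\<^esub>l\<in>{..<n}. c' l x \<odot>\<^bsub>N\<^esub> v' l)" by blast
    have *: "\<And>l. l < n ==> c' l \<in> lmod_hom R M (regular R)" "\<And>l. l < n ==> v' l \<in> carrier N"
      "\<And>x. x \<in> carrier M ==> g x = (\<Oplus>\<^bsub>N\<^esub>l\<in>{..<n}. c' l x \<odot>\<^bsub>N\<^esub> v' l)" using ** by simp_all
    let ?c = "\<lambda>l. if l < n then c' l else c" and ?v = "\<lambda>l. if l < n then v' l else v"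
    have cl: "?c l x \<odot>\<^bsub>N\<^esub> ?v l \<in> carrier N" if "x \<in> carrier M" for x l
      using hom_closed[OF *(1) that] hom_closed[OF step.hyps(2) that] *(2) step.hyps(3)
      by (auto intro!: N.smult_closed)
    have "g' x = (\<Oplus>\<^bsub>N\<^esub>l\<in>{..<Suc n}. ?c l x \<odot>\<^bsub>N\<^esub> ?v l)" if x: "x \<in> carrier M" for x
    proof -
      have "(\<Oplus>\<^bsub>N\<^esub>l\<in>{..<Suc n}. ?c l x \<odot>\<^bsub>N\<^esub> ?v l) = c x \<odot>\<^bsub>N\<^esub> v \<oplus>\<^bsub>N\<^esub> (\<Oplus>\<^bsub>N\<^esub>l\<in>{..<n}. ?c l x \<odot>\<^bsub>N\<^esub> ?v l)"
        unfolding lessThan_Suc using cl[OF x] cl[OF x, of n] by (subst N.M.finsum_insert) auto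
      also have "(\<Oplus>\<^bsub>N\<^esub>l\<in>{..<n}. ?c l x \<odot>\<^bsub>N\<^esub> ?v l) = (\<Oplus>\<^bsub>N\<^esub>l\<in>{..<n}. c' l x \<odot>\<^bsub>N\<^esub> v' l)"
        using cl[OF x] hom_closed[OF *(1) x] *(2) by (intro N.M.finsum_cong') (auto intro!: N.smult_closed)
      finally show ?thesis
        using x step.hyps *(3)[OF x] finite_factor_closed[OF N step.hyps(1) x] cl[OF x, of n] by (simp add: N.M.a_comm)
    qed
    moreover have "\<forall>l<Suc n. ?c l \<in> lmod_hom R M (regular R) \<and> ?v l \<in> carrier N"
      using *(1,2) step.hyps by auto
    ultimately show ?case by (intro exI[of _ "Suc n"] exI[of _ ?c] exI[of _ ?v] conjI) simp_all
  qed
qed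

text \<open>A finite free module given by its basis together with the coordinate forms, since the
  forms are what contraction takes as input.\<close>

locale exterior_basis = exterior R M for R (structure) and M (structure) +
  fixes r :: nat and e and e'
  assumes e: "\<And>j. j < r ==> e j \<in> carrier M"
    and e': "\<And>j. j < r ==> e' j \<in> lmod_hom R M (regular R)"
    and e'_e: "\<And>i j. i < r ==> j < r ==> e' i (e j) = (if i = j then \<one> else \<zero>)"
    and basis: "\<And>x. x \<in> carrier M ==> x = (\<Oplus>\<^bsub>M\<^esub>j\<in>{..<r}. e' j x \<odot>\<^bsub>M\<^esub> e j)"
begin

text \<open>
  \<open>Qo j\<close> is the projection onto the span of the basis wedges that do not contain \<open>e j\<close>. The composite
  \<open>Wo r\<close> of all of them vanishes in positive degrees, and \<open>z - Qo j z = e j \<and> contr (e' j) z\<close> leads from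
  \<open>Wo (j + 1)\<close> back to \<open>Wo j\<close>, hence to the identity \<open>Wo 0\<close>.
\<close>

definition Qo :: "nat => nat => ('c list => 'a) set => ('c list => 'a) set"
  where "Qo j m z = contr (e' j) m (lw m (e j) z)"

primrec Wo :: "nat => nat => ('c list => 'a) set => ('c list => 'a) set"
  where "Wo 0 m z = z" | "Wo (Suc j) m z = Wo j m (Qo j m z)"

lemma Qo_hom: "j < r ==> Qo j m \<in> lmod_hom R (E m) (E m)"
  using lmod_hom_comp[OF lw_hom[OF e] contr_hom[OF e']] unfolding Qo_def by simp

lemma Qo_closed: "j < r ==> z \<in> carrier (E m) ==> Qo j m z \<in> carrier (E m)"
  using hom_closed[OF Qo_hom] .

lemma Wo_hom: "j \<le> r ==> Wo j m \<in> lmod_hom R (E m) (E m)"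
proof (induction j)
  case 0 thus ?case by (simp add: lmod_hom_id)
next
  case (Suc j)
  hence "(\<lambda>z. Wo j m (Qo j m z)) \<in> lmod_hom R (E m) (E m)" by (intro lmod_hom_comp[OF Qo_hom]) auto
  thus ?case by simp
qed

text \<open>For distinct indices two signs cancel: one from exchanging e_i and e_j, one from the
  antiderivation rule, whose other term has coefficient e'_i(e_j) = 0.\<close>

lemma Qo_lw:
  assumes "i < r" "j < r" "y \<in> carrier (E m)"
  shows "Qo i (Suc m) (lw m (e j) y) = (if i = j then \<zero>\<^bsub>E (Suc m)\<^esub> else lw m (e j) (Qo i m y))"
proof (cases "i = j")
  case True
  thus ?thesis using assms by (simp add: Qo_def lw_lw_same e hom_zero[OF left_module_E left_module_E contr_hom[OF e']])
next
  case False
  interpret E1: left_module R "E (Suc m)" by (rule left_module_E)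
  have l: "lw m (e i) y \<in> carrier (E (Suc m))" using assms by (simp add: lw_closed e)
  have c: "lw m (e j) (Qo i m y) \<in> carrier (E (Suc m))" using assms by (simp add: lw_closed e Qo_closed)
  have "Qo i (Suc m) (lw m (e j) y) = contr (e' i) (Suc m) (\<ominus>\<^bsub>E (Suc (Suc m))\<^esub> lw (Suc m) (e j) (lw m (e i) y))"
    using assms by (simp add: Qo_def lw_anticomm[OF e e, of i j])
  also have "\<dots> = \<ominus>\<^bsub>E (Suc m)\<^esub> contr (e' i) (Suc m) (lw (Suc m) (e j) (lw m (e i) y))"
    using assms l by (intro hom_minus[OF left_module_E left_module_E contr_hom[OF e']] lw_closed e) auto
  also have "contr (e' i) (Suc m) (lw (Suc m) (e j) (lw m (e i) y)) = \<ominus>\<^bsub>E (Suc m)\<^esub> lw m (e j) (Qo i m y)"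
    using assms False l c by (simp add: contr_lw[OF e'] e e'_e E1.smult_l_null Qo_def a_minus_def)
  finally show ?thesis using c False by simp
qed

text \<open>The projections with index below k kill e_i as soon as i is among them and commute with
  multiplication by e_i otherwise.\<close>

lemma Wo_lw:
  assumes "k \<le> r" "i < r" "y \<in> carrier (E m)"
  shows "Wo k (Suc m) (lw m (e i) y) = (if k \<le> i then lw m (e i) (Wo k m y) else \<zero>\<^bsub>E (Suc m)\<^esub>)"
  using assms
proof (induction k arbitrary: y)
  case 0 thus ?case by simp
next
  case (Suc k)
  have "Wo k (Suc m) \<zero>\<^bsub>E (Suc m)\<^esub> = \<zero>\<^bsub>E (Suc m)\<^esub>"
    using hom_zero[OF left_module_E left_module_E Wo_hom[of k "Suc m"]] Suc.prems by simp
  thus ?case using Suc.prems by (auto simp: Qo_lw Suc.IH Qo_closed)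
qed

lemma lw_expand:
  assumes "a \<in> carrier M" "y \<in> carrier (E m)"
  shows "lw m a y = (\<Oplus>\<^bsub>E (Suc m)\<^esub>j\<in>{..<r}. e' j a \<odot>\<^bsub>E (Suc m)\<^esub> lw m (e j) y)"
proof -
  interpret E1: left_module R "E (Suc m)" by (rule left_module_E)
  have c: "e' j a \<in> carrier R" if "j < r" for j using hom_closed[OF e'[OF that] assms(1)] by simp
  have "lw m a y = lw m (\<Oplus>\<^bsub>M\<^esub>j\<in>{..<r}. e' j a \<odot>\<^bsub>M\<^esub> e j) y" using basis[OF assms(1)] by simp
  also have "\<dots> = (\<Oplus>\<^bsub>E (Suc m)\<^esub>j\<in>{..<r}. lw m (e' j a \<odot>\<^bsub>M\<^esub> e j) y)"
    using c e by (intro hom_finsum[OF left_module left_module_E lw_hom_l[OF assms(2)]]) (auto intro!: smult_closed)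
  also have "\<dots> = (\<Oplus>\<^bsub>E (Suc m)\<^esub>j\<in>{..<r}. e' j a \<odot>\<^bsub>E (Suc m)\<^esub> lw m (e j) y)"
    using c e assms by (intro E1.M.finsum_cong') (auto simp: lw_smult intro!: E1.smult_closed lw_closed)
  finally show ?thesis .
qed

text \<open>A wedge is linear in its first vector, so basis vectors in front are enough.\<close>

lemma hom_zero_on_basis:
  assumes N: "left_module R N" and f: "f \<in> lmod_hom R (E (Suc m)) N"
    and 0: "\<And>j y. j < r ==> y \<in> carrier (E m) ==> f (lw m (e j) y) = \<zero>\<^bsub>N\<^esub>" and z: "z \<in> carrier (E (Suc m))"
  shows "f z = \<zero>\<^bsub>N\<^esub>"
proof -
  interpret N: left_module R N by fact
  interpret E1: left_module R "E (Suc m)" by (rule left_module_E)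
  from z show ?thesis
  proof (induction rule: E_Suc_induct)
    case (add x y) thus ?case by (simp add: hom_add[OF f])
  next
    case (lw a y)
    have c: "e' j a \<in> carrier R" if "j < r" for j using hom_closed[OF e'[OF that] lw(1)] by simp
    have "f (lw m a y) = (\<Oplus>\<^bsub>N\<^esub>j\<in>{..<r}. f (e' j a \<odot>\<^bsub>E (Suc m)\<^esub> lw m (e j) y))"
      unfolding lw_expand[OF lw] using c e lw
      by (intro hom_finsum[OF left_module_E N f]) (auto intro!: E1.smult_closed lw_closed)
    also have "\<dots> = (\<Oplus>\<^bsub>N\<^esub>j\<in>{..<r}. \<zero>\<^bsub>N\<^esub>)"
      using c e lw by (intro N.M.finsum_cong') (auto simp: hom_smult[OF f] lw_closed 0 N.smult_r_null)
    finally show ?case by (simp add: N.M.finsum_zero)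
  qed
qed

lemma finite_factor_E0: "finite_factor R (E 0) (E 0) (\<lambda>z. z)"
proof -
  interpret E0: left_module R "E 0" by (rule left_module_E)
  let ?c = "\<lambda>z. the_elem ((\<lambda>u. u []) ` z)"
  have w: "w [] \<in> carrier (E 0)" by (rule wedge_closed) (simp add: tuples_0)
  have c: "?c \<in> lmod_hom R (E 0) (regular R)"
  proof (rule lmod_homI)
    show "?c x \<in> carrier (regular R)" if "x \<in> carrier (E 0)" for x
      using E_0[OF that] by (auto simp: E_0_coeff)
    show "?c (x \<oplus>\<^bsub>E 0\<^esub> y) = ?c x \<oplus>\<^bsub>regular R\<^esub> ?c y" if "x \<in> carrier (E 0)" "y \<in> carrier (E 0)" for x y
      using E_0[OF that(1)] E_0[OF that(2)] w by (auto simp: E_0_coeff E0.smult_l_distr[symmetric])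
    show "?c (a \<odot>\<^bsub>E 0\<^esub> x) = a \<odot>\<^bsub>regular R\<^esub> ?c x" if "a \<in> carrier R" "x \<in> carrier (E 0)" for x a
      using E_0[OF that(2)] w that(1) by (auto simp: E_0_coeff E0.smult_assoc1[symmetric])
  qed
  have "z = ?c z \<odot>\<^bsub>E 0\<^esub> w []" if "z \<in> carrier (E 0)" for z
    using E_0[OF that] by (auto simp: E_0_coeff)
  thus ?thesis by (intro finite_factor_cong[OF finite_factor_rank_one[OF left_module_E c w]])
qed

text \<open>Induction downwards from \<open>r\<close>, for all degrees at once because the
  correction term passes through the degree below. At the start, all positive degrees are killed and
  degree 0 is free of rank one.\<close>

lemma finite_factor_Wo:
  assumes "j \<le> r" shows "finite_factor R (E m) (E m) (Wo j m)"
  using assms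
proof (induction j arbitrary: m rule: inc_induct)
  case base
  show ?case
  proof (cases m)
    case 0 thus ?thesis using finite_factor_pre[OF finite_factor_E0 Wo_hom[of r 0]] by simp
  next
    case (Suc k)
    have "Wo r (Suc k) z = \<zero>\<^bsub>E (Suc k)\<^esub>" if "z \<in> carrier (E (Suc k))" for z
      by (rule hom_zero_on_basis[OF left_module_E Wo_hom _ that]) (simp_all add: Wo_lw)
    thus ?thesis using Suc by (auto intro: finite_factor.zero)
  qed
next
  case (step j)
  hence j: "j < r" "j \<le> r" by auto
  show ?case
  proof (cases m)
    case 0 thus ?thesis using finite_factor_pre[OF finite_factor_E0 Wo_hom[of j 0]] j by simp
  next
    case (Suc k)
    interpret E1: left_module R "E (Suc k)" by (rule left_module_E)
    interpret E0: left_module R "E k" by (rule left_module_E)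
    have eq: "Wo j (Suc k) z = Wo (Suc j) (Suc k) z \<oplus>\<^bsub>E (Suc k)\<^esub> lw k (e j) (Wo (Suc j) k (contr (e' j) k z))"
      if z: "z \<in> carrier (E (Suc k))" for z
    proof -
      let ?c = "contr (e' j) k z"
      have c: "?c \<in> carrier (E k)" using z by (simp add: contr_closed[OF e'[OF j(1)]])
      have l: "lw k (e j) ?c \<in> carrier (E (Suc k))" using c j by (simp add: lw_closed e)
      have "Qo j (Suc k) z = z \<ominus>\<^bsub>E (Suc k)\<^esub> lw k (e j) ?c"
        using z j by (simp add: Qo_def contr_lw[OF e'] e e'_e E1.smult_one)
      hence "z = Qo j (Suc k) z \<oplus>\<^bsub>E (Suc k)\<^esub> lw k (e j) ?c"
        using z l by (simp add: a_minus_def E1.M.a_assoc E1.M.l_neg)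
      hence "Wo j (Suc k) z = Wo j (Suc k) (Qo j (Suc k) z) \<oplus>\<^bsub>E (Suc k)\<^esub> Wo j (Suc k) (lw k (e j) ?c)"
        using hom_add[OF Wo_hom[OF j(2), of "Suc k"] Qo_closed[OF j(1) z] l] by simp
      also have "Wo j (Suc k) (lw k (e j) ?c) = lw k (e j) (Wo j k ?c)" using j c by (simp add: Wo_lw)
      \<comment> \<open>A contraction with e'_j contains no e_j, because contracting twice gives
        zero. Hence the projection fixes it and \<open>Wo j\<close> may be replaced by
        \<open>Wo (Suc j)\<close>, to which the induction hypothesis applies.\<close>
      also have "?c = Qo j k ?c"
      proof (cases k)
        case 0 thus ?thesis using c j by (simp add: Qo_def contr_lw_0[OF e'] e e'_e E0.smult_one[unfolded 0])
      next
        case (Suc k')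
        interpret E2: left_module R "E k'" by (rule left_module_E)
        have "contr (e' j) k' ?c = \<zero>\<^bsub>E k'\<^esub>" using z Suc by (simp add: contr_contr[OF e'[OF j(1)]])
        moreover have "lw k' (e j) \<zero>\<^bsub>E k'\<^esub> = \<zero>\<^bsub>E k\<^esub>" using Suc hom_zero[OF left_module_E left_module_E lw_hom[OF e[OF j(1)]]] by simp
        ultimately show ?thesis using c j Suc by (simp add: Qo_def contr_lw[OF e'] e e'_e E0.smult_one[unfolded Suc] E0.M.minus_zero[unfolded Suc])
      qed
      finally show ?thesis by simp
    qed
    show ?thesis unfolding Suc
      by (rule finite_factor_cong[OF finite_factor_add[OF left_module_E step.IH[of "Suc k"]
          finite_factor_post[OF left_module_E left_module_E finite_factor_pre[OF step.IH[of k] contr_hom[OF e'[OF j(1)]]] lw_hom[OF e[OF j(1)]]]] eq])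
  qed
qed

lemma finite_factor_E: "finite_factor R (E m) (E m) (\<lambda>z. z)"
  using finite_factor_cong[OF finite_factor_Wo[of 0 m], of "\<lambda>z. z"] by simp

text \<open>The index lists may repeat entries; this is enough for the vanishing above the rank. The
  property is generalized because the induction uses it composed with multiplication by e_j.\<close>

lemma E_span:
  assumes "z \<in> carrier (E m)"
    and P: "P \<zero>\<^bsub>E m\<^esub>" "\<And>x y. x \<in> carrier (E m) ==> y \<in> carrier (E m) ==> P x ==> P y ==> P (x \<oplus>\<^bsub>E m\<^esub> y)"
      "\<And>a x. a \<in> carrier R ==> x \<in> carrier (E m) ==> P x ==> P (a \<odot>\<^bsub>E m\<^esub> x)"
      "\<And>js. set js \<subseteq> {..<r} ==> length js = m ==> P (w (map e js))"
  shows "P z"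
  using assms
proof (induction m arbitrary: z P)
  case 0
  interpret E0: left_module R "E 0" by (rule left_module_E)
  have w: "w [] \<in> carrier (E 0)" by (rule wedge_closed) (simp add: tuples_0)
  from E_0[OF 0(1)] 0(4)[OF _ w] 0(5)[of "[]"] show ?case by auto
next
  case (Suc m)
  interpret E1: left_module R "E (Suc m)" by (rule left_module_E)
  interpret E0: left_module R "E m" by (rule left_module_E)
  note P = Suc.prems(2-5)
  have l: "P (lw m (e j) y)" if "y \<in> carrier (E m)" "j < r" for y j
  proof (rule Suc.IH[OF that(1), of "\<lambda>y. P (lw m (e j) y)"])
    note ej = e[OF that(2)]
    show "P (lw m (e j) \<zero>\<^bsub>E m\<^esub>)" using P(1) by (simp add: hom_zero[OF left_module_E left_module_E lw_hom[OF ej]])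
    show "P (lw m (e j) (x \<oplus>\<^bsub>E m\<^esub> y))" if "x \<in> carrier (E m)" "y \<in> carrier (E m)" "P (lw m (e j) x)" "P (lw m (e j) y)" for x y
      using that P(2) by (simp add: hom_add[OF lw_hom[OF ej]] lw_closed ej)
    show "P (lw m (e j) (a \<odot>\<^bsub>E m\<^esub> x))" if "a \<in> carrier R" "x \<in> carrier (E m)" "P (lw m (e j) x)" for a x
      using that P(3) by (simp add: hom_smult[OF lw_hom[OF ej]] lw_closed ej)
    show "P (lw m (e j) (w (map e js)))" if "set js \<subseteq> {..<r}" "length js = m" for js
    proof -
      have "map e js \<in> tuples M m" using that e by (auto simp: tuples_def)
      thus ?thesis using P(4)[of "j # js"] that \<open>j < r\<close> by (simp add: lw_wedge ej)
    qed
  qed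
  from Suc.prems(1) show ?case
  proof (induction rule: E_Suc_induct)
    case (add x y) thus ?case by (rule P(2))
  next
    case (lw a y)
    have c: "e' j a \<odot>\<^bsub>E (Suc m)\<^esub> lw m (e j) y \<in> carrier (E (Suc m))" "P (e' j a \<odot>\<^bsub>E (Suc m)\<^esub> lw m (e j) y)" if "j < r" for j
      using hom_closed[OF e'[OF that] lw(1)] l[OF lw(2) that] lw_closed[OF e[OF that] lw(2)] P(3)
      by (auto intro: E1.smult_closed)
    have "(\<Oplus>\<^bsub>E (Suc m)\<^esub>j\<in>A. e' j a \<odot>\<^bsub>E (Suc m)\<^esub> lw m (e j) y) \<in> carrier (E (Suc m)) \<and>
        P (\<Oplus>\<^bsub>E (Suc m)\<^esub>j\<in>A. e' j a \<odot>\<^bsub>E (Suc m)\<^esub> lw m (e j) y)" if "finite A" "A \<subseteq> {..<r}" for A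
      using that
    proof (induction A)
      case empty thus ?case using P(1) by simp
    next
      case (insert j A)
      have f: "(\<lambda>j. e' j a \<odot>\<^bsub>E (Suc m)\<^esub> lw m (e j) y) \<in> A \<rightarrow> carrier (E (Suc m))" using insert.prems c by auto
      show ?case using insert c[of j] P(2) by (simp add: E1.M.finsum_insert[OF insert.hyps f])
    qed
    thus ?case unfolding lw_expand[OF lw] by simp
  qed
qed

text \<open>By the pigeonhole principle some basis vector occurs twice. It is needed in degree
  \<open>r\<close>, where the homotopy by multiplication with a vector leaves the complex.\<close>

lemma E_top_zero:
  assumes "r < m" "z \<in> carrier (E m)" shows "z = \<zero>\<^bsub>E m\<^esub>"
proof -
  interpret E1: left_module R "E m" by (rule left_module_E)
  show ?thesis using assms(2)
  proof (rule E_span)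
    fix js assume js: "set js \<subseteq> {..<r}" "length js = m"
    have "card (set js) \<le> r" using card_mono[OF _ js(1)] by simp
    hence "\<not> distinct js" using js(2) assms(1) distinct_card[of js] by auto
    hence "\<not> distinct (map e js)" by (simp add: distinct_map)
    thus "w (map e js) = \<zero>\<^bsub>E m\<^esub>" using js e by (intro wedge_repeat) (auto simp: tuples_def)
  qed (auto simp: E1.smult_r_null)
qed

end

section \<open>Direct sums and projective modules\<close>

lemma module_pair_simps [simp]:
  "carrier (module_pair M N) = carrier M \<times> carrier N"
  "p \<oplus>\<^bsub>module_pair M N\<^esub> q = (fst p \<oplus>\<^bsub>M\<^esub> fst q, snd p \<oplus>\<^bsub>N\<^esub> snd q)"
  "\<zero>\<^bsub>module_pair M N\<^esub> = (\<zero>\<^bsub>M\<^esub>, \<zero>\<^bsub>N\<^esub>)"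
  "a \<odot>\<^bsub>module_pair M N\<^esub> p = (a \<odot>\<^bsub>M\<^esub> fst p, a \<odot>\<^bsub>N\<^esub> snd p)"
  by (auto simp: module_pair_def split: prod.splits)

lemma module_pair_left_module:
  assumes M: "left_module R M" and N: "left_module R N" shows "left_module R (module_pair M N)"
proof -
  interpret M: left_module R M by fact
  interpret N: left_module R N by fact
  show ?thesis
  proof (rule left_moduleI[OF M.ring_R])
    show "abelian_group (module_pair M N)"
    proof (rule abelian_groupI', goal_cases)
      case (6 x)
      thus ?case by (intro bexI[of _ "(\<ominus>\<^bsub>M\<^esub> fst x, \<ominus>\<^bsub>N\<^esub> snd x)"]) (auto simp: M.M.l_neg N.M.l_neg)
    qed (auto simp: M.M.a_ac N.M.a_ac)
  qed (auto simp: M.smult_closed N.smult_closed M.smult_l_distr N.smult_l_distr M.smult_r_distr N.smult_r_distr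
      M.smult_assoc1 N.smult_assoc1 M.smult_one N.smult_one)
qed

lemma direct_sum_simps:
  "x \<in> carrier (direct_sum I M) \<longleftrightarrow> x \<in> (\<Pi>\<^sub>E i\<in>I. carrier (M i)) \<and> finite {i \<in> I. x i \<noteq> \<zero>\<^bsub>M i\<^esub>}"
  "x \<oplus>\<^bsub>direct_sum I M\<^esub> y = (\<lambda>i\<in>I. x i \<oplus>\<^bsub>M i\<^esub> y i)"
  "\<zero>\<^bsub>direct_sum I M\<^esub> = (\<lambda>i\<in>I. \<zero>\<^bsub>M i\<^esub>)"
  "a \<odot>\<^bsub>direct_sum I M\<^esub> x = (\<lambda>i\<in>I. a \<odot>\<^bsub>M i\<^esub> x i)"
  by (auto simp: direct_sum_def)

lemma direct_sum_comp: "x \<in> carrier (direct_sum I M) ==> i \<in> I ==> x i \<in> carrier (M i)"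
  by (auto simp: direct_sum_simps(1))

lemma direct_sum_ext: "x \<in> carrier (direct_sum I M) ==> y \<in> carrier (direct_sum I M) ==>
   (\<And>i. i \<in> I ==> x i = y i) ==> x = y"
  by (auto simp: direct_sum_simps(1) intro: PiE_ext)

lemma direct_sum_memI:
  assumes "\<And>i. i \<in> I ==> f i \<in> carrier (M i)" "finite A" "\<And>i. i \<in> I ==> i \<notin> A ==> f i = \<zero>\<^bsub>M i\<^esub>"
  shows "(\<lambda>i\<in>I. f i) \<in> carrier (direct_sum I M)"
proof -
  have "{i \<in> I. (\<lambda>i\<in>I. f i) i \<noteq> \<zero>\<^bsub>M i\<^esub>} \<subseteq> A" using assms(3) by auto
  hence "finite {i \<in> I. (\<lambda>i\<in>I. f i) i \<noteq> \<zero>\<^bsub>M i\<^esub>}" using assms(2) by (rule finite_subset)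
  thus ?thesis unfolding direct_sum_simps(1) using assms(1) by simp
qed

lemma direct_sum_left_module:
  assumes R: "ring R" and M: "\<And>i. i \<in> I ==> left_module R (M i)" shows "left_module R (direct_sum I M)"
proof -
  let ?D = "direct_sum I M"
  have z: "\<zero>\<^bsub>?D\<^esub> \<in> carrier ?D" unfolding direct_sum_simps(3)
    using M by (intro direct_sum_memI[of _ _ _ "{}"]) (auto simp: left_module_def abelian_group_def intro: abelian_monoid.zero_closed)
  have add: "x \<oplus>\<^bsub>?D\<^esub> y \<in> carrier ?D" if "x \<in> carrier ?D" "y \<in> carrier ?D" for x y
    unfolding direct_sum_simps(2)
  proof (rule direct_sum_memI)
    show "finite ({i \<in> I. x i \<noteq> \<zero>\<^bsub>M i\<^esub>} \<union> {i \<in> I. y i \<noteq> \<zero>\<^bsub>M i\<^esub>})" using that by (simp add: direct_sum_simps(1))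
    fix i assume i: "i \<in> I"
    interpret left_module R "M i" by (rule M[OF i])
    show "x i \<oplus>\<^bsub>M i\<^esub> y i \<in> carrier (M i)" using that i by (auto dest: direct_sum_comp)
    show "i \<notin> {i \<in> I. x i \<noteq> \<zero>\<^bsub>M i\<^esub>} \<union> {i \<in> I. y i \<noteq> \<zero>\<^bsub>M i\<^esub>} ==> x i \<oplus>\<^bsub>M i\<^esub> y i = \<zero>\<^bsub>M i\<^esub>" using i by auto
  qed
  have sm: "a \<odot>\<^bsub>?D\<^esub> x \<in> carrier ?D" if "a \<in> carrier R" "x \<in> carrier ?D" for a x
    unfolding direct_sum_simps(4)
  proof (rule direct_sum_memI)
    show "finite {i \<in> I. x i \<noteq> \<zero>\<^bsub>M i\<^esub>}" using that by (simp add: direct_sum_simps(1))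
    fix i assume i: "i \<in> I"
    interpret left_module R "M i" by (rule M[OF i])
    show "a \<odot>\<^bsub>M i\<^esub> x i \<in> carrier (M i)" using that i by (auto dest: direct_sum_comp intro: smult_closed)
    show "i \<notin> {i \<in> I. x i \<noteq> \<zero>\<^bsub>M i\<^esub>} ==> a \<odot>\<^bsub>M i\<^esub> x i = \<zero>\<^bsub>M i\<^esub>" using i that by (auto simp: smult_r_null)
  qed
  have neg: "\<exists>y\<in>carrier ?D. y \<oplus>\<^bsub>?D\<^esub> x = \<zero>\<^bsub>?D\<^esub>" if "x \<in> carrier ?D" for x
  proof (rule bexI)
    interpret ring R by fact
    show "(\<ominus>\<^bsub>R\<^esub> \<one>\<^bsub>R\<^esub>) \<odot>\<^bsub>?D\<^esub> x \<in> carrier ?D" using that by (intro sm) auto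
    have "(\<ominus>\<^bsub>R\<^esub> \<one>\<^bsub>R\<^esub>) \<odot>\<^bsub>M i\<^esub> x i \<oplus>\<^bsub>M i\<^esub> x i = \<zero>\<^bsub>M i\<^esub>" if i: "i \<in> I" for i
    proof -
      interpret Mi: left_module R "M i" by (rule M[OF i])
      show ?thesis using direct_sum_comp[OF \<open>x \<in> carrier ?D\<close> i] by (simp add: Mi.smult_l_minus Mi.smult_one Mi.M.l_neg)
    qed
    thus "(\<ominus>\<^bsub>R\<^esub> \<one>\<^bsub>R\<^esub>) \<odot>\<^bsub>?D\<^esub> x \<oplus>\<^bsub>?D\<^esub> x = \<zero>\<^bsub>?D\<^esub>" by (auto simp: direct_sum_simps(2-4))
  qed
  have G: "P" if "i \<in> I" "left_module R (M i) ==> P" for i P using that M by blast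
  show ?thesis
  proof (rule left_moduleI[OF R])
    show "abelian_group ?D"
    proof (rule abelian_groupI', goal_cases)
      case (1 x y) thus ?case by (rule add)
    next
      case 2 show ?case by (rule z)
    next
      case (3 x y u)
      have "x i \<oplus>\<^bsub>M i\<^esub> y i \<oplus>\<^bsub>M i\<^esub> u i = x i \<oplus>\<^bsub>M i\<^esub> (y i \<oplus>\<^bsub>M i\<^esub> u i)" if i: "i \<in> I" for i
      proof -
        interpret Mi: left_module R "M i" by (rule M[OF i])
        show ?thesis using 3[THEN direct_sum_comp, OF i] by (simp add: Mi.M.a_assoc)
      qed
      thus ?case by (auto simp: direct_sum_simps(2))
    next
      case (4 x y)
      have "x i \<oplus>\<^bsub>M i\<^esub> y i = y i \<oplus>\<^bsub>M i\<^esub> x i" if i: "i \<in> I" for i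
      proof -
        interpret Mi: left_module R "M i" by (rule M[OF i])
        show ?thesis using 4[THEN direct_sum_comp, OF i] by (simp add: Mi.M.a_comm)
      qed
      thus ?case by (auto simp: direct_sum_simps(2))
    next
      case (5 x)
      have 1: "\<zero>\<^bsub>M i\<^esub> \<oplus>\<^bsub>M i\<^esub> x i = x i" if i: "i \<in> I" for i
      proof -
        interpret Mi: left_module R "M i" by (rule M[OF i])
        show ?thesis using direct_sum_comp[OF 5 i] by simp
      qed
      show ?case by (rule direct_sum_ext[OF add[OF z 5] 5]) (simp add: direct_sum_simps(2,3) 1)
    next
      case (6 x) thus ?case by (rule neg)
    qed
    show "a \<odot>\<^bsub>?D\<^esub> x \<in> carrier ?D" if "a \<in> carrier R" "x \<in> carrier ?D" for a x using that by (rule sm)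
    show "(a \<oplus>\<^bsub>R\<^esub> b) \<odot>\<^bsub>?D\<^esub> x = a \<odot>\<^bsub>?D\<^esub> x \<oplus>\<^bsub>?D\<^esub> b \<odot>\<^bsub>?D\<^esub> x"
      if "a \<in> carrier R" "b \<in> carrier R" "x \<in> carrier ?D" for a b x
      unfolding direct_sum_simps(2,4)
      using left_module.smult_l_distr[OF M] direct_sum_comp[OF that(3)] that by (intro restrict_ext) simp
    show "a \<odot>\<^bsub>?D\<^esub> (x \<oplus>\<^bsub>?D\<^esub> y) = a \<odot>\<^bsub>?D\<^esub> x \<oplus>\<^bsub>?D\<^esub> a \<odot>\<^bsub>?D\<^esub> y"
      if "a \<in> carrier R" "x \<in> carrier ?D" "y \<in> carrier ?D" for a x y
      unfolding direct_sum_simps(2,4)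
      using left_module.smult_r_distr[OF M] direct_sum_comp[OF that(2)] direct_sum_comp[OF that(3)] that by (intro restrict_ext) simp
    show "(a \<otimes>\<^bsub>R\<^esub> b) \<odot>\<^bsub>?D\<^esub> x = a \<odot>\<^bsub>?D\<^esub> (b \<odot>\<^bsub>?D\<^esub> x)"
      if "a \<in> carrier R" "b \<in> carrier R" "x \<in> carrier ?D" for a b x
      unfolding direct_sum_simps(2,4)
      using left_module.smult_assoc1[OF M] direct_sum_comp[OF that(3)] that by (intro restrict_ext) simp
    show "\<one>\<^bsub>R\<^esub> \<odot>\<^bsub>?D\<^esub> x = x" if "x \<in> carrier ?D" for x
      using left_module.smult_one[OF M] direct_sum_comp[OF that]
      by (intro direct_sum_ext[OF sm that]) (auto simp: direct_sum_simps(4) that R ring.ring_simprules)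
  qed
qed

definition summand_incl :: "'i set => ('i => ('a, 'b) module) => 'i => 'b => 'i => 'b"
  where "summand_incl I M j x = (\<lambda>i\<in>I. if i = j then x else \<zero>\<^bsub>M i\<^esub>)"

lemma summand_incl_apply: "i \<in> I ==> summand_incl I M j x i = (if i = j then x else \<zero>\<^bsub>M i\<^esub>)"
  by (simp add: summand_incl_def)

context
  fixes R I and M :: "'i => ('a, 'b) module"
  assumes R: "ring R" and M: "\<And>i. i \<in> I ==> left_module R (M i)"
begin

lemma comp_zero_closed: "i \<in> I ==> \<zero>\<^bsub>M i\<^esub> \<in> carrier (M i)"
  using left_module_ab[OF M] by (simp add: abelian_group_def abelian_monoid.zero_closed)

lemma summand_incl_closed: "j \<in> I ==> x \<in> carrier (M j) ==> summand_incl I M j x \<in> carrier (direct_sum I M)"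
  unfolding summand_incl_def by (rule direct_sum_memI[of _ _ _ "{j}"]) (auto intro: comp_zero_closed)

lemma summand_incl_hom: "j \<in> I ==> summand_incl I M j \<in> lmod_hom R (M j) (direct_sum I M)"
proof (rule lmod_homI)
  assume j: "j \<in> I"
  show "summand_incl I M j x \<in> carrier (direct_sum I M)" if "x \<in> carrier (M j)" for x
    using summand_incl_closed[OF j that] .
  show "summand_incl I M j (x \<oplus>\<^bsub>M j\<^esub> y) = summand_incl I M j x \<oplus>\<^bsub>direct_sum I M\<^esub> summand_incl I M j y"
    if "x \<in> carrier (M j)" "y \<in> carrier (M j)" for x y
    unfolding direct_sum_simps(2) summand_incl_def
    using left_module_ab[OF M] comp_zero_closed
    by (intro restrict_ext) (auto simp: abelian_group_def abelian_monoid.l_zero)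
  show "summand_incl I M j (a \<odot>\<^bsub>M j\<^esub> x) = a \<odot>\<^bsub>direct_sum I M\<^esub> summand_incl I M j x"
    if "a \<in> carrier R" "x \<in> carrier (M j)" for a x
    unfolding direct_sum_simps(4) summand_incl_def
    using that by (intro restrict_ext) (auto simp: left_module.smult_r_null[OF M])
qed

lemma proj_hom: "j \<in> I ==> (\<lambda>x. x j) \<in> lmod_hom R (direct_sum I M) (M j)"
  by (intro lmod_homI) (auto simp: direct_sum_simps(2,4) dest: direct_sum_comp)

lemma direct_sum_decompose:
  assumes x: "x \<in> carrier (direct_sum I M)" and A: "finite A" "A \<subseteq> I" "\<And>i. i \<in> I ==> i \<notin> A ==> x i = \<zero>\<^bsub>M i\<^esub>"
  shows "x = (\<Oplus>\<^bsub>direct_sum I M\<^esub>j\<in>A. summand_incl I M j (x j))"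
proof -
  interpret D: left_module R "direct_sum I M" by (rule direct_sum_left_module[OF R M])
  have cl: "(\<lambda>j. summand_incl I M j (x j)) \<in> A \<rightarrow> carrier (direct_sum I M)"
    using A(2) direct_sum_comp[OF x] by (auto intro!: summand_incl_closed)
  show ?thesis
  proof (rule direct_sum_ext[OF x D.M.finsum_closed[OF cl]])
    fix i assume i: "i \<in> I"
    interpret Mi: left_module R "M i" by (rule M[OF i])
    have "(\<Oplus>\<^bsub>direct_sum I M\<^esub>j\<in>A. summand_incl I M j (x j)) i = (\<Oplus>\<^bsub>M i\<^esub>j\<in>A. summand_incl I M j (x j) i)"
      by (rule hom_finsum[OF D.left_module Mi.left_module proj_hom[OF i] A(1) cl])
    also have "\<dots> = (\<Oplus>\<^bsub>M i\<^esub>j\<in>A. if i = j then x j else \<zero>\<^bsub>M i\<^esub>)"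
      using direct_sum_comp[OF x i] by (intro Mi.M.finsum_cong') (auto simp: summand_incl_apply i)
    also have "\<dots> = x i"
    proof (cases "i \<in> A")
      case True
      have "(\<Oplus>\<^bsub>M i\<^esub>j\<in>A. if i = j then x j else \<zero>\<^bsub>M i\<^esub>) = (\<Oplus>\<^bsub>M i\<^esub>j\<in>A. if i = j then x i else \<zero>\<^bsub>M i\<^esub>)"
        using direct_sum_comp[OF x i] by (intro Mi.M.finsum_cong') auto
      thus ?thesis using True A(1) direct_sum_comp[OF x i] Mi.M.finsum_singleton[of i A "\<lambda>_. x i"] by simp
    next
      case False
      have "(\<Oplus>\<^bsub>M i\<^esub>j\<in>A. if i = j then x j else \<zero>\<^bsub>M i\<^esub>) = (\<Oplus>\<^bsub>M i\<^esub>j\<in>A. \<zero>\<^bsub>M i\<^esub>)"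
        using False by (intro Mi.M.finsum_cong') auto
      thus ?thesis using A(3)[OF i False] by (simp add: Mi.M.finsum_zero)
    qed
    finally show "x i = (\<Oplus>\<^bsub>direct_sum I M\<^esub>j\<in>A. summand_incl I M j (x j)) i" by simp
  qed
qed

text \<open>The last case concerns only the components of the given element, so that information
  about these components can be used in it.\<close>

lemma direct_sum_induct [consumes 1, case_names zero add incl]:
  assumes x: "x \<in> carrier (direct_sum I M)" and "P \<zero>\<^bsub>direct_sum I M\<^esub>"
    "\<And>x y. x \<in> carrier (direct_sum I M) ==> y \<in> carrier (direct_sum I M) ==> P x ==> P y ==> P (x \<oplus>\<^bsub>direct_sum I M\<^esub> y)"
    "\<And>j y. j \<in> I ==> x j \<noteq> \<zero>\<^bsub>M j\<^esub> ==> P (summand_incl I M j (x j))"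
  shows "P x"
proof -
  interpret D: left_module R "direct_sum I M" by (rule direct_sum_left_module[OF R M])
  let ?A = "{i \<in> I. x i \<noteq> \<zero>\<^bsub>M i\<^esub>}"
  have fin: "finite ?A" using x by (simp add: direct_sum_simps(1))
  have "(\<Oplus>\<^bsub>direct_sum I M\<^esub>j\<in>B. summand_incl I M j (x j)) \<in> carrier (direct_sum I M) \<and>
      P (\<Oplus>\<^bsub>direct_sum I M\<^esub>j\<in>B. summand_incl I M j (x j))" if "finite B" "B \<subseteq> ?A" for B
    using that
  proof (induction B)
    case empty thus ?case using assms(2) by simp
  next
    case (insert j B)
    have f: "(\<lambda>j. summand_incl I M j (x j)) \<in> B \<rightarrow> carrier (direct_sum I M)"
      using insert.prems direct_sum_comp[OF x] by (auto intro!: summand_incl_closed)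
    have j: "summand_incl I M j (x j) \<in> carrier (direct_sum I M)"
      using insert.prems direct_sum_comp[OF x] by (auto intro!: summand_incl_closed)
    show ?case using insert j assms(3,4) by (simp add: D.M.finsum_insert[OF insert.hyps f j])
  qed
  from this[OF fin order_refl] show ?thesis using direct_sum_decompose[OF x fin] by auto
qed

end

section \<open>Dual bases and projectivity\<close>

definition dual_basis :: "('a, 'r) ring_scheme => ('a, 'b) module => 's set => ('s => 'b => 'a) => ('s => 'b) => bool"
  where "dual_basis R P S c b \<longleftrightarrow>
    (\<forall>s\<in>S. c s \<in> lmod_hom R P (regular R) \<and> b s \<in> carrier P) \<and>
    (\<forall>x\<in>carrier P. finite {s \<in> S. c s x \<noteq> \<zero>\<^bsub>R\<^esub>} \<and>
       x = (\<Oplus>\<^bsub>P\<^esub>s\<in>{s \<in> S. c s x \<noteq> \<zero>\<^bsub>R\<^esub>}. c s x \<odot>\<^bsub>P\<^esub> b s))"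

lemma dual_basisD:
  assumes "dual_basis R P S c b"
  shows "\<And>s. s \<in> S ==> c s \<in> lmod_hom R P (regular R)" "\<And>s. s \<in> S ==> b s \<in> carrier P"
    "\<And>x. x \<in> carrier P ==> finite {s \<in> S. c s x \<noteq> \<zero>\<^bsub>R\<^esub>}"
    "\<And>x. x \<in> carrier P ==> (\<Oplus>\<^bsub>P\<^esub>s\<in>{s \<in> S. c s x \<noteq> \<zero>\<^bsub>R\<^esub>}. c s x \<odot>\<^bsub>P\<^esub> b s) = x"
    "\<And>s x. s \<in> S ==> x \<in> carrier P ==> c s x \<in> carrier R"
  using assms hom_closed[of _ R P "regular R"] unfolding dual_basis_def by auto

lemma finite_dual_basis:
  assumes P: "left_module R P" and c: "\<And>l. l < (n::nat) ==> c l \<in> lmod_hom R P (regular R) \<and> v l \<in> carrier P"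
    and x: "\<And>x. x \<in> carrier P ==> x = (\<Oplus>\<^bsub>P\<^esub>l\<in>{..<n}. c l x \<odot>\<^bsub>P\<^esub> v l)"
  shows "dual_basis R P {..<n} c v"
proof -
  interpret P: left_module R P by fact
  have "(\<Oplus>\<^bsub>P\<^esub>l\<in>{l \<in> {..<n}. c l x \<noteq> \<zero>\<^bsub>R\<^esub>}. c l x \<odot>\<^bsub>P\<^esub> v l) = (\<Oplus>\<^bsub>P\<^esub>l\<in>{..<n}. c l x \<odot>\<^bsub>P\<^esub> v l)"
    if "x \<in> carrier P" for x
    using c hom_closed[OF c[THEN conjunct1] that]
    by (intro P.M.add.finprod_mono_neutral_cong_left) (auto simp: P.smult_l_null intro!: P.smult_closed)
  thus ?thesis unfolding dual_basis_def using c x by auto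
qed

text \<open>The definition of projectivity wants a free module on elements of \<open>P\<close>,
  whereas a dual basis has its own index type. The coordinate map into the free module on
  \<open>S\<close> is followed by the map sending s to the basis element of b s, which adds up
  coefficients where b is not injective; evaluation splits it.\<close>

theorem dual_basis_projective:
  assumes P: "left_module R P" and db: "dual_basis R P S c b"
  shows "projective_module R P"
proof -
  interpret P: left_module R P by fact
  note c = dual_basisD[OF db]
  let ?F = "free_module R (carrier P)" and ?G = "free_module R S"
  interpret F: left_module R ?F by (rule free_left_module[OF P.ring_R])
  interpret q: lincomb_setup R R P id "carrier P" "\<lambda>x. x"
    by (intro lincomb_setup.intro lincomb_setup_axioms.intro P.ring_R P.left_module) (auto simp: ring_hom_def)
  interpret p: lincomb_setup R R ?F id S "\<lambda>s. free_basis R (b s)"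
    by (intro lincomb_setup.intro lincomb_setup_axioms.intro P.ring_R F.left_module)
       (auto simp: ring_hom_def intro!: free_basis_closed P.ring_R c(2))
  let ?j = "\<lambda>x s. if s \<in> S then c s x else \<zero>\<^bsub>R\<^esub>"
  have jsupp: "{s. ?j x s \<noteq> \<zero>\<^bsub>R\<^esub>} = {s \<in> S. c s x \<noteq> \<zero>\<^bsub>R\<^esub>}" for x by auto
  have j: "?j \<in> lmod_hom R P ?G"
  proof (rule lmod_homI)
    fix x assume "x \<in> carrier P"
    thus "?j x \<in> carrier ?G" unfolding free_module_simps(1) jsupp using c by simp
  next
    fix x y assume "x \<in> carrier P" "y \<in> carrier P"
    thus "?j (x \<oplus>\<^bsub>P\<^esub> y) = ?j x \<oplus>\<^bsub>?G\<^esub> ?j y" using hom_add[OF c(1)] by (auto simp: free_module_simps(2))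
  next
    fix a x assume "a \<in> carrier R" "x \<in> carrier P"
    thus "?j (a \<odot>\<^bsub>P\<^esub> x) = a \<odot>\<^bsub>?G\<^esub> ?j x" using hom_smult[OF c(1)] by (auto simp: free_module_simps(4))
  qed
  note ph = p.lin_slin[folded lmod_hom_slin] and qh = q.lin_slin[folded lmod_hom_slin]
  have "q.lin (p.lin (?j x)) = x" if x: "x \<in> carrier P" for x
  proof -
    let ?A = "{s \<in> S. c s x \<noteq> \<zero>\<^bsub>R\<^esub>}"
    have cl: "(\<lambda>s. c s x \<odot>\<^bsub>?F\<^esub> free_basis R (b s)) \<in> ?A \<rightarrow> carrier ?F"
      using c(2,5) x by (auto intro!: F.smult_closed free_basis_closed P.ring_R)
    have "p.lin (?j x) = (\<Oplus>\<^bsub>?F\<^esub>s\<in>?A. c s x \<odot>\<^bsub>?F\<^esub> free_basis R (b s))"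
      unfolding lincomb_def jsupp using cl by (intro F.M.finsum_cong') auto
    hence "q.lin (p.lin (?j x)) = (\<Oplus>\<^bsub>P\<^esub>s\<in>?A. q.lin (c s x \<odot>\<^bsub>?F\<^esub> free_basis R (b s)))"
      using hom_finsum[OF F.left_module P.left_module qh c(3)[OF x] cl] by simp
    also have "\<dots> = (\<Oplus>\<^bsub>P\<^esub>s\<in>?A. c s x \<odot>\<^bsub>P\<^esub> b s)"
      using c(2,5) x by (intro P.M.finsum_cong') (auto simp: hom_smult[OF qh] free_basis_closed P.ring_R q.lin_basis intro!: P.smult_closed)
    finally show ?thesis using c(4)[OF x] by simp
  qed
  thus ?thesis unfolding projective_module_def
    using P.left_module lmod_hom_comp[OF j ph] qh by (intro conjI exI[of _ "carrier P"]) (auto intro!: exI)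
qed

lemma dual_basis_sum:
  assumes R: "ring R" and M: "\<And>i. i \<in> I ==> left_module R (M i)"
    and db: "\<And>i. i \<in> I ==> dual_basis R (M i) (S i) (c i) (b i)"
  shows "dual_basis R (direct_sum I M) (Sigma I S) (\<lambda>(i, s) x. c i s (x i)) (\<lambda>(i, s). summand_incl I M i (b i s))"
proof -
  let ?D = "direct_sum I M" and ?c = "\<lambda>(i, s) x. c i s (x i)" and ?b = "\<lambda>(i, s). summand_incl I M i (b i s)"
  interpret D: left_module R ?D by (rule direct_sum_left_module[OF R M])
  note d = dual_basisD[OF db]
  have ph: "(\<lambda>x. x j) \<in> lmod_hom R ?D (M j)" if "j \<in> I" for j
    using R M that by (rule proj_hom)
  have ic: "summand_incl I M j y \<in> carrier ?D" if "j \<in> I" "y \<in> carrier (M j)" for j y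
    using R M that by (rule summand_incl_closed)
  have 1: "?c p \<in> lmod_hom R ?D (regular R) \<and> ?b p \<in> carrier ?D" if p: "p \<in> Sigma I S" for p
  proof -
    obtain i s where pq: "p = (i, s)" "i \<in> I" "s \<in> S i" using p by auto
    show ?thesis unfolding pq using lmod_hom_comp[OF ph[OF pq(2)] d(1)[OF pq(2,3)]]
        ic[OF pq(2) d(2)[OF pq(2,3)]] by simp
  qed
  have 2: "finite {p \<in> Sigma I S. ?c p x \<noteq> \<zero>\<^bsub>R\<^esub>} \<and>
      x = (\<Oplus>\<^bsub>?D\<^esub>p\<in>{p \<in> Sigma I S. ?c p x \<noteq> \<zero>\<^bsub>R\<^esub>}. ?c p x \<odot>\<^bsub>?D\<^esub> ?b p)" if x: "x \<in> carrier ?D" for x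
  proof
    let ?W = "{p \<in> Sigma I S. ?c p x \<noteq> \<zero>\<^bsub>R\<^esub>}" and ?A = "{i \<in> I. x i \<noteq> \<zero>\<^bsub>M i\<^esub>}"
    let ?B = "\<lambda>i. {s \<in> S i. c i s (x i) \<noteq> \<zero>\<^bsub>R\<^esub>}"
    have xi: "x i \<in> carrier (M i)" if "i \<in> I" for i using direct_sum_comp[OF x that] .
    have c0: "c i s (\<zero>\<^bsub>M i\<^esub>) = \<zero>\<^bsub>R\<^esub>" if "i \<in> I" "s \<in> S i" for i s
      using hom_zero[OF M[OF that(1)] regular_left_module[OF R] d(1)[OF that]] by simp
    have "?W \<subseteq> Sigma ?A ?B" using c0 by auto
    moreover have "finite (Sigma ?A ?B)" using x xi d(3) by (intro finite_SigmaI) (auto simp: direct_sum_simps(1))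
    ultimately show fin: "finite ?W" by (rule finite_subset)
    have cl: "(\<lambda>p. ?c p x \<odot>\<^bsub>?D\<^esub> ?b p) \<in> ?W \<rightarrow> carrier ?D"
      using xi d(2,5) by (auto intro!: D.smult_closed ic)
    show "x = (\<Oplus>\<^bsub>?D\<^esub>p\<in>?W. ?c p x \<odot>\<^bsub>?D\<^esub> ?b p)"
    proof (rule direct_sum_ext[OF x D.M.finsum_closed[OF cl]])
      fix i assume i: "i \<in> I"
      interpret Mi: left_module R "M i" by (rule M[OF i])
      have ev: "(?c p x \<odot>\<^bsub>?D\<^esub> ?b p) i = (if fst p = i then c i (snd p) (x i) \<odot>\<^bsub>M i\<^esub> b i (snd p) else \<zero>\<^bsub>M i\<^esub>)"
        if "p \<in> ?W" for p
        using that i d(5) xi by (auto simp: direct_sum_simps(4) summand_incl_apply Mi.smult_r_null)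
      have bcl: "c i s (x i) \<odot>\<^bsub>M i\<^esub> b i s \<in> carrier (M i)" if "s \<in> S i" for s
        using d(2,5)[OF i that] xi[OF i] by (auto intro: Mi.smult_closed)
      have "(\<Oplus>\<^bsub>?D\<^esub>p\<in>?W. ?c p x \<odot>\<^bsub>?D\<^esub> ?b p) i = (\<Oplus>\<^bsub>M i\<^esub>p\<in>?W. (?c p x \<odot>\<^bsub>?D\<^esub> ?b p) i)"
        by (rule hom_finsum[OF D.left_module Mi.left_module ph[OF i] fin cl])
      also have "\<dots> = (\<Oplus>\<^bsub>M i\<^esub>p\<in>?W. if fst p = i then c i (snd p) (x i) \<odot>\<^bsub>M i\<^esub> b i (snd p) else \<zero>\<^bsub>M i\<^esub>)"
        using bcl by (intro Mi.M.finsum_cong' ev) auto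
      \<comment> \<open>In component i only the index pairs with first entry i contribute.\<close>
      also have "\<dots> = (\<Oplus>\<^bsub>M i\<^esub>p\<in>Pair i ` ?B i. c i (snd p) (x i) \<odot>\<^bsub>M i\<^esub> b i (snd p))"
        using bcl fin i by (intro Mi.M.add.finprod_mono_neutral_cong_right) auto
      also have "\<dots> = (\<Oplus>\<^bsub>M i\<^esub>s\<in>?B i. c i s (x i) \<odot>\<^bsub>M i\<^esub> b i s)"
        using bcl by (subst Mi.M.finsum_reindex) (auto simp: inj_on_def)
      also have "\<dots> = x i" using d(4)[OF i xi[OF i]] .
      finally show "x i = (\<Oplus>\<^bsub>?D\<^esub>p\<in>?W. ?c p x \<odot>\<^bsub>?D\<^esub> ?b p) i" by simp
    qed
  qed
  show ?thesis unfolding dual_basis_def using 1 2 by blast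
qed

lemma dual_basis_pair:
  assumes M: "left_module R M" and N: "left_module R N"
    and db: "dual_basis R M S c b" and db': "dual_basis R N S' c' b'"
  shows "dual_basis R (module_pair M N) (S <+> S') (case_sum (\<lambda>s x. c s (fst x)) (\<lambda>s x. c' s (snd x)))
     (case_sum (\<lambda>s. (b s, \<zero>\<^bsub>N\<^esub>)) (\<lambda>s. (\<zero>\<^bsub>M\<^esub>, b' s)))"
proof -
  interpret M: left_module R M by fact
  interpret N: left_module R N by fact
  let ?P = "module_pair M N" and ?c = "case_sum (\<lambda>s x. c s (fst x)) (\<lambda>s x. c' s (snd x))"
    and ?b = "case_sum (\<lambda>s. (b s, \<zero>\<^bsub>N\<^esub>)) (\<lambda>s. (\<zero>\<^bsub>M\<^esub>, b' s))"
  interpret P: left_module R ?P by (rule module_pair_left_module[OF M N])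
  note d = dual_basisD[OF db] and d' = dual_basisD[OF db']
  have fst: "fst \<in> lmod_hom R ?P M" and snd: "snd \<in> lmod_hom R ?P N" by (auto simp: lmod_hom_def)
  have inl: "(\<lambda>x. (x, \<zero>\<^bsub>N\<^esub>)) \<in> lmod_hom R M ?P" and inr: "(\<lambda>x. (\<zero>\<^bsub>M\<^esub>, x)) \<in> lmod_hom R N ?P"
    by (auto simp: lmod_hom_def M.smult_r_null N.smult_r_null)
  have 1: "?c p \<in> lmod_hom R ?P (regular R) \<and> ?b p \<in> carrier ?P" if "p \<in> S <+> S'" for p
    using that lmod_hom_comp[OF fst d(1)] lmod_hom_comp[OF snd d'(1)] d(2) d'(2) by (auto split: sum.split)
  have 2: "finite {p \<in> S <+> S'. ?c p x \<noteq> \<zero>\<^bsub>R\<^esub>} \<and>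
      x = (\<Oplus>\<^bsub>?P\<^esub>p\<in>{p \<in> S <+> S'. ?c p x \<noteq> \<zero>\<^bsub>R\<^esub>}. ?c p x \<odot>\<^bsub>?P\<^esub> ?b p)" if x: "x \<in> carrier ?P" for x
  proof -
    obtain y z where yz: "x = (y, z)" "y \<in> carrier M" "z \<in> carrier N" using x by auto
    let ?A = "{s \<in> S. c s y \<noteq> \<zero>\<^bsub>R\<^esub>}" and ?B = "{s \<in> S'. c' s z \<noteq> \<zero>\<^bsub>R\<^esub>}"
    have W: "{p \<in> S <+> S'. ?c p x \<noteq> \<zero>\<^bsub>R\<^esub>} = Inl ` ?A \<union> Inr ` ?B" using yz by auto
    have fin: "finite ?A" "finite ?B" using d(3) d'(3) yz by auto
    have cA: "c s y \<odot>\<^bsub>M\<^esub> b s \<in> carrier M" if "s \<in> S" for s using d(2,5) yz that by (auto intro: M.smult_closed)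
    have cB: "c' s z \<odot>\<^bsub>N\<^esub> b' s \<in> carrier N" if "s \<in> S'" for s using d'(2,5) yz that by (auto intro: N.smult_closed)
    have cl: "(\<lambda>p. ?c p x \<odot>\<^bsub>?P\<^esub> ?b p) \<in> Inl ` ?A \<rightarrow> carrier ?P" "(\<lambda>p. ?c p x \<odot>\<^bsub>?P\<^esub> ?b p) \<in> Inr ` ?B \<rightarrow> carrier ?P"
      using cA cB yz d(5) d'(5) by (auto simp: M.smult_r_null N.smult_r_null)
    have "(\<Oplus>\<^bsub>?P\<^esub>p\<in>Inl ` ?A \<union> Inr ` ?B. ?c p x \<odot>\<^bsub>?P\<^esub> ?b p) =
       (\<Oplus>\<^bsub>?P\<^esub>p\<in>Inl ` ?A. ?c p x \<odot>\<^bsub>?P\<^esub> ?b p) \<oplus>\<^bsub>?P\<^esub> (\<Oplus>\<^bsub>?P\<^esub>p\<in>Inr ` ?B. ?c p x \<odot>\<^bsub>?P\<^esub> ?b p)"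
      using fin by (intro P.M.finsum_Un_disjoint cl) auto
    also have "(\<Oplus>\<^bsub>?P\<^esub>p\<in>Inl ` ?A. ?c p x \<odot>\<^bsub>?P\<^esub> ?b p) = (\<Oplus>\<^bsub>?P\<^esub>s\<in>?A. (c s y \<odot>\<^bsub>M\<^esub> b s, \<zero>\<^bsub>N\<^esub>))"
      using cl(1) cA d(5) yz by (subst P.M.finsum_reindex) (auto simp: N.smult_r_null intro!: P.M.finsum_cong')
    also have "\<dots> = (y, \<zero>\<^bsub>N\<^esub>)"
      using hom_finsum[OF M P.left_module inl fin(1), of "\<lambda>s. c s y \<odot>\<^bsub>M\<^esub> b s"] cA d(4)[OF yz(2)] by auto
    also have "(\<Oplus>\<^bsub>?P\<^esub>p\<in>Inr ` ?B. ?c p x \<odot>\<^bsub>?P\<^esub> ?b p) = (\<Oplus>\<^bsub>?P\<^esub>s\<in>?B. (\<zero>\<^bsub>M\<^esub>, c' s z \<odot>\<^bsub>N\<^esub> b' s))"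
      using cl(2) cB d'(5) yz by (subst P.M.finsum_reindex) (auto simp: M.smult_r_null intro!: P.M.finsum_cong')
    also have "\<dots> = (\<zero>\<^bsub>M\<^esub>, z)"
      using hom_finsum[OF N P.left_module inr fin(2), of "\<lambda>s. c' s z \<odot>\<^bsub>N\<^esub> b' s"] cB d'(4)[OF yz(3)] by auto
    finally show ?thesis unfolding W using fin yz by simp
  qed
  show ?thesis unfolding dual_basis_def using 1 2 by blast
qed

section \<open>Group algebras\<close>

lemma group_algebra_simps:
  "a \<in> carrier (group_algebra G) \<longleftrightarrow> finite {g. a g \<noteq> 0} \<and> (\<forall>g. a g \<noteq> 0 \<longrightarrow> g \<in> carrier G)"
  "a \<otimes>\<^bsub>group_algebra G\<^esub> b = (\<lambda>g. \<Sum>(x, y)\<in>{(x, y). a x \<noteq> 0 \<and> b y \<noteq> 0 \<and> x \<otimes>\<^bsub>G\<^esub> y = g}. a x * b y)"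
  "a \<oplus>\<^bsub>group_algebra G\<^esub> b = (\<lambda>g. a g + b g)"
  "\<zero>\<^bsub>group_algebra G\<^esub> = (\<lambda>_. 0)"
  "\<one>\<^bsub>group_algebra G\<^esub> = single \<one>\<^bsub>G\<^esub> 1"
  by (auto simp add: group_algebra_def single_def)

lemma single_zero: "single g 0 = (\<lambda>_. 0)" by (auto simp: single_def)

lemma single_closed: "g \<in> carrier G ==> single g c \<in> carrier (group_algebra G)"
  by (auto simp: group_algebra_simps single_def)

lemma single_add: "single g c \<oplus>\<^bsub>group_algebra G\<^esub> single g d = single g (c + d)"
  by (auto simp: group_algebra_simps single_def)

lemma group_algebra_induct [consumes 1, case_names zero add single]:
  assumes a: "a \<in> carrier (group_algebra G)" and "P (\<lambda>_. 0)"
    and add: "\<And>a b. a \<in> carrier (group_algebra G) ==> b \<in> carrier (group_algebra G) ==> P a ==> P b ==>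
        P (a \<oplus>\<^bsub>group_algebra G\<^esub> b)"
    and single: "\<And>g c. g \<in> carrier G ==> P (single g c)"
  shows "P a"
proof -
  have "P a" if "finite W" "{x. a x \<noteq> 0} = W" "a \<in> carrier (group_algebra G)" for W a
    using that
  proof (induction W arbitrary: a rule: finite_induct)
    case empty
    hence "a = (\<lambda>_. 0)" by auto
    thus ?case using assms(2) by simp
  next
    case (insert x W)
    have x: "x \<in> carrier G" using insert.prems by (auto simp: group_algebra_simps)
    let ?v = "a(x := 0)"
    have sv: "{y. ?v y \<noteq> 0} = W" using insert.prems insert.hyps by auto
    have v: "?v \<in> carrier (group_algebra G)"
      using insert.prems insert.hyps unfolding group_algebra_simps sv by auto
    have "a = ?v \<oplus>\<^bsub>group_algebra G\<^esub> single x (a x)" by (auto simp: group_algebra_simps single_def)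
    moreover have "P (?v \<oplus>\<^bsub>group_algebra G\<^esub> single x (a x))"
      by (intro add v insert.IH sv single_closed single x)
    ultimately show ?case by metis
  qed
  thus ?thesis using a by (auto simp: group_algebra_simps(1))
qed

text \<open>The convolution sum depends on the supports of both factors. Over a fixed finite
  rectangle, with zero terms added, biadditivity becomes distributivity in the field.\<close>

lemma conv_superset:
  assumes "finite A" "finite B" "\<And>g. a g \<noteq> 0 ==> g \<in> A" "\<And>g. b g \<noteq> 0 ==> g \<in> B"
  shows "(a \<otimes>\<^bsub>group_algebra G\<^esub> b) g = (\<Sum>(x, y)\<in>A \<times> B. if x \<otimes>\<^bsub>G\<^esub> y = g then a x * b y else 0)"
  unfolding group_algebra_simps(2)
  by (rule sum.mono_neutral_cong_left) (use assms in \<open>auto split: if_splits\<close>)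

lemma conv_add_left:
  assumes "a \<in> carrier (group_algebra G)" "a' \<in> carrier (group_algebra G)" "b \<in> carrier (group_algebra G)"
  shows "(a \<oplus>\<^bsub>group_algebra G\<^esub> a') \<otimes>\<^bsub>group_algebra G\<^esub> b =
    (a \<otimes>\<^bsub>group_algebra G\<^esub> b) \<oplus>\<^bsub>group_algebra G\<^esub> (a' \<otimes>\<^bsub>group_algebra G\<^esub> b)"
proof
  fix g
  let ?A = "{g. a g \<noteq> 0} \<union> {g. a' g \<noteq> 0}" and ?B = "{g. b g \<noteq> 0}"
  have f: "finite ?A" "finite ?B" using assms by (auto simp: group_algebra_simps)
  note c = conv_superset[OF f, where G = G and g = g]
  have "((a \<oplus>\<^bsub>group_algebra G\<^esub> a') \<otimes>\<^bsub>group_algebra G\<^esub> b) g =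
     (\<Sum>(x, y)\<in>?A \<times> ?B. if x \<otimes>\<^bsub>G\<^esub> y = g then (a x + a' x) * b y else 0)"
    by (subst c) (auto simp: group_algebra_simps(3) cong: if_cong)
  also have "\<dots> = (\<Sum>(x, y)\<in>?A \<times> ?B. (if x \<otimes>\<^bsub>G\<^esub> y = g then a x * b y else 0) + (if x \<otimes>\<^bsub>G\<^esub> y = g then a' x * b y else 0))"
    by (intro sum.cong) (auto simp: distrib_right)
  also have "\<dots> = (a \<otimes>\<^bsub>group_algebra G\<^esub> b) g + (a' \<otimes>\<^bsub>group_algebra G\<^esub> b) g"
    by (subst (1 2) c) (auto simp: sum.distrib case_prod_unfold)
  finally show "((a \<oplus>\<^bsub>group_algebra G\<^esub> a') \<otimes>\<^bsub>group_algebra G\<^esub> b) g =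
    ((a \<otimes>\<^bsub>group_algebra G\<^esub> b) \<oplus>\<^bsub>group_algebra G\<^esub> (a' \<otimes>\<^bsub>group_algebra G\<^esub> b)) g"
    by (simp add: group_algebra_simps(3))
qed

lemma conv_add_right:
  assumes "a \<in> carrier (group_algebra G)" "a' \<in> carrier (group_algebra G)" "b \<in> carrier (group_algebra G)"
  shows "b \<otimes>\<^bsub>group_algebra G\<^esub> (a \<oplus>\<^bsub>group_algebra G\<^esub> a') =
    (b \<otimes>\<^bsub>group_algebra G\<^esub> a) \<oplus>\<^bsub>group_algebra G\<^esub> (b \<otimes>\<^bsub>group_algebra G\<^esub> a')"
proof
  fix g
  let ?A = "{g. a g \<noteq> 0} \<union> {g. a' g \<noteq> 0}" and ?B = "{g. b g \<noteq> 0}"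
  have f: "finite ?B" "finite ?A" using assms by (auto simp: group_algebra_simps)
  note c = conv_superset[OF f, where G = G and g = g]
  have "(b \<otimes>\<^bsub>group_algebra G\<^esub> (a \<oplus>\<^bsub>group_algebra G\<^esub> a')) g =
     (\<Sum>(x, y)\<in>?B \<times> ?A. if x \<otimes>\<^bsub>G\<^esub> y = g then b x * (a y + a' y) else 0)"
    by (subst c) (auto simp: group_algebra_simps(3) cong: if_cong)
  also have "\<dots> = (\<Sum>(x, y)\<in>?B \<times> ?A. (if x \<otimes>\<^bsub>G\<^esub> y = g then b x * a y else 0) + (if x \<otimes>\<^bsub>G\<^esub> y = g then b x * a' y else 0))"
    by (intro sum.cong) (auto simp: distrib_left)
  also have "\<dots> = (b \<otimes>\<^bsub>group_algebra G\<^esub> a) g + (b \<otimes>\<^bsub>group_algebra G\<^esub> a') g"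
    by (subst (1 2) c) (auto simp: sum.distrib case_prod_unfold)
  finally show "(b \<otimes>\<^bsub>group_algebra G\<^esub> (a \<oplus>\<^bsub>group_algebra G\<^esub> a')) g =
    ((b \<otimes>\<^bsub>group_algebra G\<^esub> a) \<oplus>\<^bsub>group_algebra G\<^esub> (b \<otimes>\<^bsub>group_algebra G\<^esub> a')) g"
    by (simp add: group_algebra_simps(3))
qed

lemma single_mult: "single x c \<otimes>\<^bsub>group_algebra G\<^esub> single y d = single (x \<otimes>\<^bsub>G\<^esub> y) (c * d)"
proof
  fix g
  have "(single x c \<otimes>\<^bsub>group_algebra G\<^esub> single y d) g =
     (\<Sum>(x', y')\<in>{x} \<times> {y}. if x' \<otimes>\<^bsub>G\<^esub> y' = g then single x c x' * single y d y' else 0)"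
    by (rule conv_superset) (auto simp: single_def split: if_splits)
  thus "(single x c \<otimes>\<^bsub>group_algebra G\<^esub> single y d) g = single (x \<otimes>\<^bsub>G\<^esub> y) (c * d) g"
    by (simp add: single_def)
qed

lemma conv_zero: "(\<lambda>_. 0) \<otimes>\<^bsub>group_algebra G\<^esub> b = (\<lambda>_. 0)" "a \<otimes>\<^bsub>group_algebra G\<^esub> (\<lambda>_. 0) = (\<lambda>_. 0)"
  by (simp_all add: group_algebra_simps)

lemma group_algebra_add_closed:
  assumes "a \<in> carrier (group_algebra G)" "b \<in> carrier (group_algebra G)"
  shows "a \<oplus>\<^bsub>group_algebra G\<^esub> b \<in> carrier (group_algebra G)"
proof -
  have "{g. a g + b g \<noteq> 0} \<subseteq> {g. a g \<noteq> 0} \<union> {g. b g \<noteq> 0}" by auto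
  moreover have "finite ({g. a g \<noteq> 0} \<union> {g. b g \<noteq> 0})" using assms by (simp add: group_algebra_simps)
  ultimately have "finite {g. a g + b g \<noteq> 0}" by (rule finite_subset)
  moreover have "g \<in> carrier G" if "a g + b g \<noteq> 0" for g
  proof -
    have "a g \<noteq> 0 \<or> b g \<noteq> 0" using that by auto
    thus ?thesis using assms by (auto simp: group_algebra_simps(1))
  qed
  ultimately show ?thesis by (simp add: group_algebra_simps(1,3))
qed

lemma group_algebra_zero_closed: "(\<lambda>_. 0) \<in> carrier (group_algebra G)"
  by (simp add: group_algebra_simps)

lemma group_algebra_abelian_group: "abelian_group (group_algebra G)"
proof (rule abelian_groupI', goal_cases)
  case (6 a)
  show ?case
  proof (rule bexI)
    show "(\<lambda>g. - a g) \<oplus>\<^bsub>group_algebra G\<^esub> a = \<zero>\<^bsub>group_algebra G\<^esub>" by (simp add: group_algebra_simps)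
    show "(\<lambda>g. - a g) \<in> carrier (group_algebra G)" using 6 by (simp add: group_algebra_simps)
  qed
next
  case (1 a b) thus ?case by (rule group_algebra_add_closed)
qed (auto simp: group_algebra_simps(3,4) group_algebra_zero_closed add.assoc add.commute)

text \<open>All laws are additive in each argument, so that they are verified on multiples of group
  elements.\<close>

lemma (in group) group_algebra_ring: "ring (group_algebra G :: ('a => 'k::field) ring)"
proof -
  let ?k = "group_algebra G :: ('a => 'k) ring"
  have cl: "a \<otimes>\<^bsub>?k\<^esub> b \<in> carrier ?k" if "a \<in> carrier ?k" "b \<in> carrier ?k" for a b
    using that(1)
  proof (induction rule: group_algebra_induct)
    case (single g c)
    from that(2) show ?case
      by (induction rule: group_algebra_induct)
         (auto simp: conv_zero group_algebra_zero_closed single_mult single single_closed conv_add_right intro: group_algebra_add_closed)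
  qed (auto simp: conv_zero group_algebra_zero_closed conv_add_left that intro: group_algebra_add_closed)
  have assoc: "a \<otimes>\<^bsub>?k\<^esub> b \<otimes>\<^bsub>?k\<^esub> c = a \<otimes>\<^bsub>?k\<^esub> (b \<otimes>\<^bsub>?k\<^esub> c)" if "a \<in> carrier ?k" "b \<in> carrier ?k" "c \<in> carrier ?k" for a b c
    using that(1)
  proof (induction rule: group_algebra_induct)
    case (single x p)
    note x = single single_closed[OF single]
    from that(2) show ?case
    proof (induction rule: group_algebra_induct)
      case (single y q)
      note y = single single_closed[OF single]
      from that(3) show ?case
        by (induction rule: group_algebra_induct)
           (auto simp: conv_zero single_mult conv_add_right conv_add_left single_closed m_assoc mult.assoc x y cl)
    qed (auto simp: conv_zero conv_add_right conv_add_left x cl that)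
  qed (auto simp: conv_zero conv_add_left cl that)
  have one: "\<one>\<^bsub>?k\<^esub> \<otimes>\<^bsub>?k\<^esub> a = a \<and> a \<otimes>\<^bsub>?k\<^esub> \<one>\<^bsub>?k\<^esub> = a" if "a \<in> carrier ?k" for a
    using that unfolding group_algebra_simps(5)
    by (induction rule: group_algebra_induct)
       (auto simp: conv_zero single_mult conv_add_right conv_add_left single_closed)
  show ?thesis
  proof (rule ringI[OF group_algebra_abelian_group])
    show "monoid ?k" using one by (intro monoidI cl assoc) (auto simp: group_algebra_simps(5) single_closed)
  qed (auto intro: conv_add_left conv_add_right)
qed

lemma (in comm_group) group_algebra_cring: "cring (group_algebra G :: ('a => 'k::field) ring)"
proof -
  let ?k = "group_algebra G :: ('a => 'k) ring"
  interpret k: ring ?k by (rule group_algebra_ring)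
  have "a \<otimes>\<^bsub>?k\<^esub> b = b \<otimes>\<^bsub>?k\<^esub> a" if "a \<in> carrier ?k" "b \<in> carrier ?k" for a b
    using that(1)
  proof (induction rule: group_algebra_induct)
    case (single g c)
    from that(2) show ?case
      by (induction rule: group_algebra_induct)
         (use single in \<open>auto simp: conv_zero single_mult conv_add_right conv_add_left single_closed m_comm mult.commute\<close>)
  qed (auto simp: conv_zero conv_add_left conv_add_right that)
  thus ?thesis by unfold_locales
qed

section \<open>Augmentation and the algebras of subgroups\<close>

lemma augmentation_superset: "finite A ==> (\<And>g. a g \<noteq> 0 ==> g \<in> A) ==> augmentation a = (\<Sum>g\<in>A. a g)"
  unfolding augmentation_def by (rule sum.mono_neutral_left) auto

lemma augmentation_add:
  assumes "a \<in> carrier (group_algebra G)" "b \<in> carrier (group_algebra G)"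
  shows "augmentation (a \<oplus>\<^bsub>group_algebra G\<^esub> b) = augmentation a + augmentation b"
proof -
  let ?A = "{g. a g \<noteq> 0} \<union> {g. b g \<noteq> 0}"
  have f: "finite ?A" using assms by (simp add: group_algebra_simps)
  show ?thesis
    by (subst (1 2 3) augmentation_superset[OF f]) (auto simp: group_algebra_simps(3) sum.distrib)
qed

lemma augmentation_single: "augmentation (single g c) = c"
  by (subst augmentation_superset[of "{g}"]) (auto simp: single_def split: if_splits)

lemma augmentation_zero: "augmentation (\<lambda>_. 0) = 0" by (simp add: augmentation_def)

lemma (in group) augmentation_mult:
  fixes a b :: "'a => 'k::field"
  assumes "a \<in> carrier (group_algebra G)" "b \<in> carrier (group_algebra G)"
  shows "augmentation (a \<otimes>\<^bsub>group_algebra G\<^esub> b) = augmentation a * augmentation b"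
proof -
  interpret k: ring "group_algebra G :: ('a => 'k) ring" by (rule group_algebra_ring)
  from assms(1) show ?thesis
  proof (induction rule: group_algebra_induct)
    case (single g c)
    note s = single_closed[OF single]
    from assms(2) show ?case
      by (induction rule: group_algebra_induct)
         (auto simp: conv_zero augmentation_zero single_mult augmentation_single conv_add_right augmentation_add distrib_left s)
  qed (auto simp: conv_zero augmentation_zero conv_add_left augmentation_add distrib_right assms(2))
qed

text \<open>Only the carrier depends on the subgroup. As simp rules these turn all operations into
  those of the large algebra; this is why ring facts about kT reappear later in a form with the
  operations of \<open>kG\<close>.\<close>

lemma subgroup_algebra_simps [simp]:
  "monoid.mult (subgroup_algebra G S) = monoid.mult (group_algebra G)"
  "add (subgroup_algebra G S) = add (group_algebra G)"
  "ring.zero (subgroup_algebra G S) = ring.zero (group_algebra G)"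
  "one (subgroup_algebra G S) = one (group_algebra G)"
  by (auto simp: group_algebra_def)

lemma subgroup_algebra_carrier: "a \<in> carrier (subgroup_algebra G S) \<longleftrightarrow> finite {g. a g \<noteq> 0} \<and> (\<forall>g. a g \<noteq> 0 \<longrightarrow> g \<in> S)"
  by (simp add: group_algebra_simps)

lemma subgroup_algebra_mono: "S \<subseteq> S' ==> carrier (subgroup_algebra G S) \<subseteq> carrier (subgroup_algebra G S')"
  unfolding subset_iff subgroup_algebra_carrier by blast

lemma subgroup_algebra_subset: "S \<subseteq> carrier G ==> carrier (subgroup_algebra G S) \<subseteq> carrier (group_algebra G)"
  unfolding subset_iff subgroup_algebra_carrier group_algebra_simps(1)[of _ G] by auto

lemma left_module_restrict:
  fixes M :: "('g => 'k::field, 'b) module"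
  assumes "left_module (group_algebra G) M" "ring (subgroup_algebra G S :: ('g => 'k) ring)" "S \<subseteq> carrier G"
  shows "left_module (subgroup_algebra G S) M"
proof -
  interpret left_module "group_algebra G" M by fact
  note s = subsetD[OF subgroup_algebra_subset[OF assms(3)]]
  show ?thesis
    by (rule left_moduleI[OF assms(2) ab])
       (auto dest!: s simp: smult_closed smult_l_distr smult_r_distr smult_assoc1 smult_one)
qed

lemma lmod_hom_restrict:
  "f \<in> lmod_hom (group_algebra G) M N ==> S \<subseteq> carrier G ==> f \<in> lmod_hom (subgroup_algebra G S) M N"
  using subgroup_algebra_subset[of S G] by (fastforce simp: lmod_hom_def)

section \<open>Semidirect products\<close>

text \<open>The parameter \<open>K\<close> carries no data: it only ties the coefficient field
  \<open>'k\<close> to the locale.\<close>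

locale semidirect = group G for G (structure) +
  fixes T H and K :: "'k::field itself"
  assumes T: "T \<lhd> G" and T_comm: "comm_group (G\<lparr>carrier := T\<rparr>)" and H: "subgroup H G"
    and TH: "T \<inter> H = {\<one>}" and gen: "T <#> H = carrier G"
begin

sublocale T: normal T G by (rule T)
sublocale H: subgroup H G by (rule H)

lemma T_sub: "T \<subseteq> carrier G" by (rule T.subset)
lemma H_carrier: "h \<in> H ==> h \<in> carrier G" by (rule H.mem_carrier)
lemma T_carrier: "t \<in> T ==> t \<in> carrier G" by (rule T.mem_carrier)

lemma decompose: "g \<in> carrier G ==> \<exists>t\<in>T. \<exists>h\<in>H. g = t \<otimes> h"
  using gen unfolding set_mult_def by blast

text \<open>Two candidates for the component in H differ by an element of T \<inter> H.\<close>

lemma H_part_mult: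
  assumes "t \<in> T" "h \<in> H" shows "H_part G T H (t \<otimes> h) = h" "T_part G T H (t \<otimes> h) = t"
proof -
  note c = T_carrier H_carrier
  have "h' = h" if "h' \<in> H" "t \<otimes> h \<otimes> inv h' \<in> T" for h'
  proof -
    have "inv t \<otimes> (t \<otimes> h \<otimes> inv h') \<in> T" using that assms by auto
    also have "inv t \<otimes> (t \<otimes> h \<otimes> inv h') = h \<otimes> inv h'" using assms that c by (simp add: m_assoc inv_solve_left')
    finally have "h \<otimes> inv h' \<in> T \<inter> H" using assms that by auto
    hence "h \<otimes> inv h' = \<one>" using TH by auto
    thus ?thesis using assms that c by (metis H.m_inv_closed inv_equality inv_inv)
  qed
  moreover have "t \<otimes> h \<otimes> inv h \<in> T" using assms c by (simp add: m_assoc)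
  ultimately show 1: "H_part G T H (t \<otimes> h) = h" unfolding H_part_def using assms by (intro the_equality) auto
  show "T_part G T H (t \<otimes> h) = t" unfolding T_part_def 1 using assms c by (simp add: m_assoc)
qed

lemma parts:
  assumes "g \<in> carrier G"
  shows "H_part G T H g \<in> H" "T_part G T H g \<in> T" "g = T_part G T H g \<otimes> H_part G T H g"
  using decompose[OF assms] by (auto simp: H_part_mult)

lemma H_part_T: "t \<in> T ==> H_part G T H t = \<one>" "t \<in> T ==> T_part G T H t = t"
  using H_part_mult[of t \<one>] T_carrier by auto

lemma H_part_H: "h \<in> H ==> H_part G T H h = h" "h \<in> H ==> T_part G T H h = \<one>"
  using H_part_mult[of \<one> h] H_carrier by auto

lemma conj_closed: "g \<in> carrier G ==> t \<in> T ==> conj_act G g t \<in> T"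
  using T.inv_op_closed2 by (simp add: conj_act_def)

lemma inv_cancel: "x \<in> carrier G ==> y \<in> carrier G ==> inv x \<otimes> (x \<otimes> y) = y"
  "x \<in> carrier G ==> y \<in> carrier G ==> x \<otimes> (inv x \<otimes> y) = y"
  by (simp_all add: m_assoc[symmetric])

lemma conj_mult: "g \<in> carrier G ==> x \<in> carrier G ==> y \<in> carrier G ==>
   conj_act G g (x \<otimes> y) = conj_act G g x \<otimes> conj_act G g y"
  by (simp add: conj_act_def m_assoc inv_cancel)

lemma conj_conj: "g \<in> carrier G ==> h \<in> carrier G ==> x \<in> carrier G ==>
   conj_act G (g \<otimes> h) x = conj_act G g (conj_act G h x)"
  by (simp add: conj_act_def m_assoc inv_mult_group)

lemma conj_one: "x \<in> carrier G ==> conj_act G \<one> x = x"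
  by (simp add: conj_act_def)

lemma conj_closed_G: "g \<in> carrier G ==> x \<in> carrier G ==> conj_act G g x \<in> carrier G"
  by (simp add: conj_act_def)

abbreviation kG :: "('a => 'k) ring" where "kG \<equiv> group_algebra G"
abbreviation kT :: "('a => 'k) ring" where "kT \<equiv> subgroup_algebra G T"

lemma kG_ring: "ring kG" by (rule group_algebra_ring)
lemma kT_cring: "cring kT" by (rule comm_group.group_algebra_cring[OF T_comm])
lemma kT_ring: "ring kT" by (rule cring.axioms(1)[OF kT_cring])
lemma kT_kG: "a \<in> carrier kT ==> a \<in> carrier kG" using subgroup_algebra_subset[OF T_sub] by blast

lemma single_closed_T: "t \<in> T ==> single t c \<in> carrier kT"
  by (rule single_closed) simp

lemma kT_induct [consumes 1, case_names zero add single]: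
  assumes "a \<in> carrier kT" "P (\<lambda>_. 0)"
    "\<And>a b. a \<in> carrier kT ==> b \<in> carrier kT ==> P a ==> P b ==> P (a \<oplus>\<^bsub>kG\<^esub> b)"
    "\<And>g c. g \<in> T ==> P (single g c)"
  shows "P a"
  using assms(1) by (induction rule: group_algebra_induct) (use assms in auto)

lemma alg_conj_single: "g \<in> carrier G ==> x \<in> carrier G ==> alg_conj G g (single x c) = single (conj_act G g x) c"
proof (rule ext)
  fix y assume g: "g \<in> carrier G" "x \<in> carrier G"
  have "conj_act G (inv g) y = x \<longleftrightarrow> y = conj_act G g x" if "y \<in> carrier G"
    using g that by (metis conj_conj conj_one inv_closed l_inv r_inv)
  thus "alg_conj G g (single x c) y = single (conj_act G g x) c y"
    using g by (auto simp: alg_conj_def single_def conj_closed_G)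
qed

lemma alg_conj_add: "alg_conj G g (a \<oplus>\<^bsub>kG\<^esub> b) = alg_conj G g a \<oplus>\<^bsub>kG\<^esub> alg_conj G g b"
  by (auto simp: alg_conj_def group_algebra_simps)

lemma alg_conj_zero: "alg_conj G g (\<lambda>_. 0) = (\<lambda>_. 0)"
  by (auto simp: alg_conj_def)

lemma alg_conj_closed: "g \<in> carrier G ==> a \<in> carrier kT ==> alg_conj G g a \<in> carrier kT"
proof -
  interpret kT: cring kT by (rule kT_cring)
  assume g: "g \<in> carrier G" and a: "a \<in> carrier kT"
  from a show ?thesis
  proof (induction rule: kT_induct)
    case (add a b) thus ?case using kT.add.m_closed by (simp add: alg_conj_add)
  next
    case (single x c) thus ?case using g by (simp add: alg_conj_single T_carrier single_closed_T conj_closed)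
  qed (simp add: alg_conj_zero group_algebra_zero_closed)
qed

lemma alg_conj_ring_hom: "g \<in> carrier G ==> alg_conj G g \<in> ring_hom kT kT"
proof (rule ring_hom_memI, goal_cases)
  case (1 a) thus ?case by (rule alg_conj_closed)
next
  case (2 a b)
  note sc = subgroup_algebra_simps
  have g: "g \<in> carrier G" by (rule 2)
  have b: "b \<in> carrier kT" by (rule 2)
  from 2(2) show ?case unfolding sc
  proof (induction rule: kT_induct)
    case zero thus ?case by (simp add: conv_zero alg_conj_zero)
  next
    case (add a a')
    thus ?case using b g by (simp add: conv_add_left kT_kG alg_conj_add alg_conj_closed)
  next
    case (single x c)
    from b show ?case
    proof (induction rule: kT_induct)
      case (add a a')
      thus ?case using single g by (simp add: conv_add_right kT_kG alg_conj_add alg_conj_closed single_closed_T)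
    next
      case (single y d)
      thus ?case using \<open>x \<in> T\<close> g by (simp add: single_mult alg_conj_single T_carrier conj_mult)
    qed (simp add: conv_zero alg_conj_zero)
  qed
next
  case (3 a b) thus ?case by (simp add: alg_conj_add)
next
  case 4 thus ?case by (simp add: group_algebra_simps(5) alg_conj_single) (simp add: conj_act_def)
qed

lemma alg_conj_conj: "g \<in> carrier G ==> h \<in> carrier G ==> a \<in> carrier kT ==>
   alg_conj G (g \<otimes> h) a = alg_conj G g (alg_conj G h a)"
proof -
  assume g: "g \<in> carrier G" "h \<in> carrier G" and a: "a \<in> carrier kT"
  from a show ?thesis
    by (induction rule: kT_induct) (use g in \<open>auto simp: alg_conj_zero alg_conj_add alg_conj_single T_carrier conj_closed_G conj_conj\<close>)
qed

lemma alg_conj_one: "a \<in> carrier kT ==> alg_conj G \<one> a = a"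
  by (induction rule: kT_induct) (auto simp: alg_conj_zero alg_conj_add alg_conj_single T_carrier conj_one)

end

section \<open>Modules over the group algebra from semilinear actions\<close>

locale semidirect_action = semidirect G T H K for G (structure) and T H and K :: "'k::field itself" +
  fixes M :: "('a => 'k, 'c) module" and act :: "'a => 'c => 'c"
  assumes M: "left_module kT M"
    and act: "\<And>h. h \<in> H ==> act h \<in> slin (alg_conj G h) kT M M"
    and act_one: "\<And>x. x \<in> carrier M ==> act \<one> x = x"
    and act_mult: "\<And>h h' x. h \<in> H ==> h' \<in> H ==> x \<in> carrier M ==> act (h \<otimes> h') x = act h (act h' x)"
begin

sublocale M: left_module kT M by (rule M)

abbreviation "S \<equiv> semidirect_module G T H M act"

lemma act_closed: "h \<in> H ==> x \<in> carrier M ==> act h x \<in> carrier M"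
  using additive_map_closed[OF slin_additive[OF act]] .
lemma act_add: "h \<in> H ==> x \<in> carrier M ==> y \<in> carrier M ==> act h (x \<oplus>\<^bsub>M\<^esub> y) = act h x \<oplus>\<^bsub>M\<^esub> act h y"
  using additive_map_add[OF slin_additive[OF act]] .
lemma act_smult: "h \<in> H ==> a \<in> carrier kT ==> x \<in> carrier M ==> act h (a \<odot>\<^bsub>M\<^esub> x) = alg_conj G h a \<odot>\<^bsub>M\<^esub> act h x"
  using slin_smult[OF act] .

lemma S_simps [simp]: "carrier S = carrier M" "add S = add M" "ring.zero S = ring.zero M"
  by (simp_all add: semidirect_module_def)

text \<open>The action of the single term c g. The module axioms for \<open>S\<close> are reduced to
  terms of this kind by additivity.\<close>

definition A :: "'a => 'k => 'c => 'c"
  where "A g c x = single (T_part G T H g) c \<odot>\<^bsub>M\<^esub> act (H_part G T H g) x"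

lemma A_closed: "g \<in> carrier G ==> x \<in> carrier M ==> A g c x \<in> carrier M"
  unfolding A_def by (intro M.smult_closed single_closed_T act_closed parts)

lemma A_zero: "g \<in> carrier G ==> x \<in> carrier M ==> A g 0 x = \<zero>\<^bsub>M\<^esub>"
  unfolding A_def single_zero using M.smult_l_null act_closed[OF parts(1)] by (simp add: group_algebra_simps(4))

lemma smult_superset:
  assumes "finite W" "\<And>g. a g \<noteq> 0 ==> g \<in> W" "W \<subseteq> carrier G" "x \<in> carrier M"
  shows "a \<odot>\<^bsub>S\<^esub> x = (\<Oplus>\<^bsub>M\<^esub>g\<in>W. A g (a g) x)"
proof -
  have "a \<odot>\<^bsub>S\<^esub> x = (\<Oplus>\<^bsub>M\<^esub>g\<in>{g. a g \<noteq> 0}. A g (a g) x)"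
    by (simp add: semidirect_module_def A_def)
  also have "\<dots> = (\<Oplus>\<^bsub>M\<^esub>g\<in>W. A g (a g) x)"
    using assms by (intro M.M.add.finprod_mono_neutral_cong_left) (auto simp: A_zero intro!: A_closed)
  finally show ?thesis .
qed

lemma S_smult_single: "g \<in> carrier G ==> x \<in> carrier M ==> single g c \<odot>\<^bsub>S\<^esub> x = A g c x"
  by (subst smult_superset[of "{g}"]) (auto simp: single_def M.M.finsum_insert A_closed split: if_splits)

lemma S_smult_zero: "x \<in> carrier M ==> (\<lambda>_. 0) \<odot>\<^bsub>S\<^esub> x = \<zero>\<^bsub>M\<^esub>"
  by (subst smult_superset[of "{}"]) auto

lemma A_add_c: "g \<in> carrier G ==> x \<in> carrier M ==> A g (c + d) x = A g c x \<oplus>\<^bsub>M\<^esub> A g d x"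
  unfolding A_def using M.smult_l_distr[OF single_closed_T[OF parts(2)] single_closed_T[OF parts(2)] act_closed[OF parts(1)], of g g g x c d]
  by (simp add: single_add)

lemma A_add_x: "g \<in> carrier G ==> x \<in> carrier M ==> y \<in> carrier M ==> A g c (x \<oplus>\<^bsub>M\<^esub> y) = A g c x \<oplus>\<^bsub>M\<^esub> A g c y"
  unfolding A_def by (simp add: parts act_add M.smult_r_distr single_closed_T act_closed)

lemma S_smult_closed: "a \<in> carrier kG ==> x \<in> carrier M ==> a \<odot>\<^bsub>S\<^esub> x \<in> carrier M"
  by (subst smult_superset[of "{g. a g \<noteq> 0}"]) (auto simp: group_algebra_simps(1) intro!: M.M.finsum_closed A_closed)

lemma S_smult_add_l:
  assumes "a \<in> carrier kG" "b \<in> carrier kG" "x \<in> carrier M"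
  shows "(a \<oplus>\<^bsub>kG\<^esub> b) \<odot>\<^bsub>S\<^esub> x = a \<odot>\<^bsub>S\<^esub> x \<oplus>\<^bsub>M\<^esub> b \<odot>\<^bsub>S\<^esub> x"
proof -
  let ?W = "{g. a g \<noteq> 0} \<union> {g. b g \<noteq> 0}"
  have W: "finite ?W" "?W \<subseteq> carrier G" using assms by (auto simp: group_algebra_simps)
  have "(a \<oplus>\<^bsub>kG\<^esub> b) \<odot>\<^bsub>S\<^esub> x = (\<Oplus>\<^bsub>M\<^esub>g\<in>?W. A g ((a \<oplus>\<^bsub>kG\<^esub> b) g) x)"
    using W assms by (intro smult_superset) (auto simp: group_algebra_simps(3))
  also have "\<dots> = (\<Oplus>\<^bsub>M\<^esub>g\<in>?W. A g (a g) x \<oplus>\<^bsub>M\<^esub> A g (b g) x)"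
    using W assms by (intro M.M.finsum_cong') (auto simp: group_algebra_simps(3) A_add_c intro!: A_closed)
  also have "\<dots> = (\<Oplus>\<^bsub>M\<^esub>g\<in>?W. A g (a g) x) \<oplus>\<^bsub>M\<^esub> (\<Oplus>\<^bsub>M\<^esub>g\<in>?W. A g (b g) x)"
    using W assms by (intro M.M.finsum_addf) (auto intro!: A_closed)
  also have "\<dots> = a \<odot>\<^bsub>S\<^esub> x \<oplus>\<^bsub>M\<^esub> b \<odot>\<^bsub>S\<^esub> x"
    using smult_superset[OF W(1) _ W(2) assms(3), of a] smult_superset[OF W(1) _ W(2) assms(3), of b] by simp
  finally show ?thesis .
qed

lemma S_smult_add_r:
  assumes a: "a \<in> carrier kG" and xy: "x \<in> carrier M" "y \<in> carrier M"
  shows "a \<odot>\<^bsub>S\<^esub> (x \<oplus>\<^bsub>M\<^esub> y) = a \<odot>\<^bsub>S\<^esub> x \<oplus>\<^bsub>M\<^esub> a \<odot>\<^bsub>S\<^esub> y"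
  using a
proof (induction rule: group_algebra_induct)
  case (add a b)
  thus ?case using xy by (simp add: S_smult_add_l S_smult_closed M.M.a_ac)
qed (use xy in \<open>auto simp: S_smult_zero S_smult_single A_add_x\<close>)

text \<open>(t h)(t' h') = t (h t' h^-1) h h', and semilinearity of the action moves t' past h by
  exactly this conjugation.\<close>

lemma A_A:
  assumes "g \<in> carrier G" "g' \<in> carrier G" "x \<in> carrier M"
  shows "A g c (A g' c' x) = A (g \<otimes> g') (c * c') x"
proof -
  let ?t = "T_part G T H g" and ?h = "H_part G T H g" and ?t' = "T_part G T H g'" and ?h' = "H_part G T H g'"
  note p = parts[OF assms(1)] parts[OF assms(2)]
  note c = T_carrier[OF p(2)] T_carrier[OF p(5)] H_carrier[OF p(1)] H_carrier[OF p(4)]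
  let ?u = "?t \<otimes> conj_act G ?h ?t'"
  have u: "?u \<in> T" using p c by (simp add: conj_closed)
  have "g \<otimes> g' = (?t \<otimes> ?h) \<otimes> (?t' \<otimes> ?h')" using p(3,6) by simp
  also have "\<dots> = ?u \<otimes> (?h \<otimes> ?h')" using c by (simp add: conj_act_def m_assoc inv_cancel)
  finally have gg: "T_part G T H (g \<otimes> g') = ?u" "H_part G T H (g \<otimes> g') = ?h \<otimes> ?h'"
    using H_part_mult[OF u, of "?h \<otimes> ?h'"] p by auto
  have "A g c (A g' c' x) = single ?t c \<odot>\<^bsub>M\<^esub> (single (conj_act G ?h ?t') c' \<odot>\<^bsub>M\<^esub> act ?h (act ?h' x))"
    unfolding A_def using p c assms by (simp add: act_smult single_closed_T act_closed alg_conj_single)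
  also have "\<dots> = (single ?t c \<otimes>\<^bsub>kT\<^esub> single (conj_act G ?h ?t') c') \<odot>\<^bsub>M\<^esub> act ?h (act ?h' x)"
    using p c assms by (intro M.smult_assoc1[symmetric] single_closed_T act_closed conj_closed)
  also have "\<dots> = A (g \<otimes> g') (c * c') x"
    unfolding A_def gg using p assms by (simp add: single_mult act_mult)
  finally show ?thesis .
qed

lemma S_smult_assoc:
  assumes a: "a \<in> carrier kG" and b: "b \<in> carrier kG" and x: "x \<in> carrier M"
  shows "(a \<otimes>\<^bsub>kG\<^esub> b) \<odot>\<^bsub>S\<^esub> x = a \<odot>\<^bsub>S\<^esub> (b \<odot>\<^bsub>S\<^esub> x)"
proof -
  interpret k: ring kG by (rule kG_ring)
  from a show ?thesis
  proof (induction rule: group_algebra_induct)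
    case (single g c)
    note s = single single_closed[OF single]
    from b show ?case
    proof (induction rule: group_algebra_induct)
      case (add b b')
      thus ?case by (simp add: conv_add_right S_smult_add_l S_smult_add_r S_smult_closed s x k.m_closed)
    next
      case (single g' c')
      thus ?case using s x by (simp add: single_mult S_smult_single A_closed A_A)
    next
      case zero
      have "single g c \<odot>\<^bsub>S\<^esub> \<zero>\<^bsub>M\<^esub> = \<zero>\<^bsub>M\<^esub>"
        using S_smult_add_r[OF s(2), of "\<zero>\<^bsub>M\<^esub>" "\<zero>\<^bsub>M\<^esub>"] S_smult_closed[OF s(2), of "\<zero>\<^bsub>M\<^esub>"] by simp
      thus ?case using x by (simp add: conv_zero S_smult_zero)
    qed
  qed (use b x in \<open>auto simp: conv_zero S_smult_zero conv_add_left S_smult_add_l S_smult_closed\<close>)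
qed

lemma A_T: "t \<in> T ==> x \<in> carrier M ==> A t c x = single t c \<odot>\<^bsub>M\<^esub> x"
  by (simp add: A_def H_part_T act_one)

lemma A_H: "h \<in> H ==> x \<in> carrier M ==> A h 1 x = act h x"
  using M.smult_one[OF act_closed] by (simp add: A_def H_part_H group_algebra_simps(5))

lemma S_left_module: "left_module kG S"
proof (rule left_moduleI[OF kG_ring])
  show "abelian_group S"
    by (rule abelian_groupI') (auto simp: M.M.a_ac intro: bexI[of _ "\<ominus>\<^bsub>M\<^esub> _"] M.M.l_neg)
  show "\<one>\<^bsub>kG\<^esub> \<odot>\<^bsub>S\<^esub> x = x" if "x \<in> carrier S" for x
    using that A_T[of \<one> x 1] M.smult_one by (simp add: group_algebra_simps(5) S_smult_single)
qed (simp_all add: S_smult_closed S_smult_add_l S_smult_add_r S_smult_assoc)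

lemma S_smult_T: "a \<in> carrier kT ==> x \<in> carrier M ==> a \<odot>\<^bsub>S\<^esub> x = a \<odot>\<^bsub>M\<^esub> x"
proof (induction rule: kT_induct)
  case zero thus ?case using M.smult_l_null by (simp add: S_smult_zero group_algebra_simps(4))
next
  case (add a b) thus ?case using M.smult_l_distr[OF add(1,2)] by (simp add: S_smult_add_l kT_kG)
next
  case (single g c) thus ?case by (simp add: S_smult_single A_T T_carrier)
qed

lemma S_smult_H: "h \<in> H ==> x \<in> carrier M ==> single h 1 \<odot>\<^bsub>S\<^esub> x = act h x"
  by (simp add: S_smult_single H_carrier A_H)

end

text \<open>The differentials and telescope maps are built over kT; H-equivariance is what remains
  to be checked for linearity over the whole group algebra.\<close>

lemma semidirect_hom:
  fixes M :: "('g => 'k::field, 'b) module" and N :: "('g => 'k, 'c) module"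
  assumes "semidirect_action G T H M act" "semidirect_action G T H N act'"
    and f: "f \<in> lmod_hom (subgroup_algebra G T) M N"
    and act: "\<And>h x. h \<in> H ==> x \<in> carrier M ==> f (act h x) = act' h (f x)"
  shows "f \<in> lmod_hom (group_algebra G) (semidirect_module G T H M act) (semidirect_module G T H N act')"
proof -
  interpret M: semidirect_action G T H "TYPE('k)" M act by fact
  interpret N: semidirect_action G T H "TYPE('k)" N act' by fact
  have "f (a \<odot>\<^bsub>M.S\<^esub> x) = a \<odot>\<^bsub>N.S\<^esub> f x" if "a \<in> carrier M.kG" "x \<in> carrier M" for a x
    using that(1)
  proof (induction rule: group_algebra_induct)
    case zero
    show ?case using that hom_zero[OF M.M N.M f] hom_closed[OF f] by (simp add: M.S_smult_zero N.S_smult_zero)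
  next
    case (add a b)
    thus ?case using that hom_closed[OF f] by (simp add: M.S_smult_add_l N.S_smult_add_l hom_add[OF f] M.S_smult_closed)
  next
    case (single g c)
    thus ?case using that hom_closed[OF f]
      by (simp add: M.S_smult_single N.S_smult_single M.A_def N.A_def hom_smult[OF f] M.parts M.single_closed_T M.act_closed act)
  qed
  thus ?thesis using hom_add[OF f] hom_closed[OF f] by (intro lmod_homI) auto
qed

text \<open>The maps \<psi>_n are given as linear over the group algebra of \<Gamma>, whereas
  exterior powers over kT need their kT-linearity and their equivariance separately.\<close>

lemma semidirect_hom_restrict:
  fixes M :: "('g => 'k::field, 'b) module" and N :: "('g => 'k, 'c) module"
  assumes "semidirect_action G T H M act" "semidirect_action G T H N act'"
    and f: "f \<in> lmod_hom (group_algebra G) (semidirect_module G T H M act) (semidirect_module G T H N act')"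
  shows "f \<in> lmod_hom (subgroup_algebra G T) M N"
    and "\<And>h x. h \<in> H ==> x \<in> carrier M ==> f (act h x) = act' h (f x)"
proof -
  interpret M: semidirect_action G T H "TYPE('k)" M act by fact
  interpret N: semidirect_action G T H "TYPE('k)" N act' by fact
  have cl: "f x \<in> carrier N" if "x \<in> carrier M" for x using hom_closed[OF f] that by simp
  show "f \<in> lmod_hom (subgroup_algebra G T) M N"
  proof (rule lmod_homI)
    show "f (a \<odot>\<^bsub>M\<^esub> x) = a \<odot>\<^bsub>N\<^esub> f x" if "a \<in> carrier (subgroup_algebra G T)" "x \<in> carrier M" for a x
      using hom_smult[OF f M.kT_kG[OF that(1)], of x] that cl by (simp add: M.S_smult_T N.S_smult_T)
  qed (use cl hom_add[OF f] in auto)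
  show "f (act h x) = act' h (f x)" if "h \<in> H" "x \<in> carrier M" for h x
    using hom_smult[OF f single_closed[OF M.H_carrier[OF that(1)]], of x 1] that cl by (simp add: M.S_smult_H N.S_smult_H)
qed

section \<open>Averaging\<close>

context semidirect begin

lemma free_module_kT_kG: "u \<in> carrier (free_module kT S) ==> u \<in> carrier (free_module kG S)"
  unfolding free_module_simps by (auto intro: kT_kG)

text \<open>Maschke's argument relative to T: since H represents the cosets of T, a kT-linear
  splitting becomes linear over the whole algebra by averaging its conjugates under H, and the order
  of H is invertible in k.\<close>

theorem projective_kG:
  fixes P :: "('a => 'k, 'c) module"
  assumes P: "left_module kG P" and pr: "projective_module kT P"
    and fin: "finite H" and inv: "of_nat (card H) \<noteq> (0::'k)"
  shows "projective_module kG P"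
proof -
  interpret P: left_module kG P by fact
  obtain S :: "'c set" and i q where i: "i \<in> lmod_hom kT P (free_module kT S)"
    and q: "q \<in> lmod_hom kT (free_module kT S) P" and qi: "\<And>x. x \<in> carrier P ==> q (i x) = x"
    using pr unfolding projective_module_def by blast
  let ?N = "free_module kG S" and ?NT = "free_module kT S"
  interpret N: left_module kG ?N by (rule free_left_module[OF kG_ring])
  interpret NT: left_module kT ?NT by (rule free_left_module[OF kT_ring])
  have PT: "left_module kT P" by (rule left_module_restrict[OF P kT_ring T_sub])
  \<comment> \<open>The projection is extended from the free kT-module to the free module over the
    group algebra on the same set, by its values on the basis; on the smaller module both
    agree.\<close>
  let ?b = "\<lambda>s. q (free_basis kT s)"
  interpret Q: lincomb_setup kG kG P id S ?b
    using kG_ring P by (intro lincomb_setup.intro lincomb_setup_axioms.intro)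
       (auto simp: ring_hom_def intro!: hom_closed[OF q] free_basis_closed kT_ring)
  interpret QT: lincomb_setup kT kT P id S ?b
    using kT_ring PT by (intro lincomb_setup.intro lincomb_setup_axioms.intro)
       (auto simp: ring_hom_def intro!: hom_closed[OF q] free_basis_closed kT_ring)
  note Qh = Q.lin_slin[folded lmod_hom_slin] and QTh = QT.lin_slin[folded lmod_hom_slin]
  have "QT.lin u = q u" if "u \<in> carrier ?NT" for u
    using kT_ring that
  proof (induction rule: free_induct)
    case zero
    show ?case using hom_zero[OF NT.left_module PT q] hom_zero[OF NT.left_module PT QTh] by (simp only: free_module_simps(3))
  next
    case (add u v) thus ?case by (simp only: hom_add[OF q] hom_add[OF QTh])
  next
    case (basis a x) thus ?case by (simp only: hom_smult[OF q] hom_smult[OF QTh] free_basis_closed[OF kT_ring] QT.lin_basis)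
  qed
  hence Qq: "Q.lin u = q u" if "u \<in> carrier ?NT" for u using that by (simp add: lincomb_def)
  have icl: "i x \<in> carrier ?N" if "x \<in> carrier P" for x using hom_closed[OF i that] by (rule free_module_kT_kG)
  have ism: "i (a \<odot>\<^bsub>P\<^esub> x) = a \<odot>\<^bsub>?N\<^esub> i x" if "a \<in> carrier kT" "x \<in> carrier P" for a x
    using hom_smult[OF i that] by (simp add: free_module_simps)
  have iadd: "i (x \<oplus>\<^bsub>P\<^esub> y) = i x \<oplus>\<^bsub>?N\<^esub> i y" if "x \<in> carrier P" "y \<in> carrier P" for x y
    using hom_add[OF i that] by (simp add: free_module_simps)
  let ?s = "\<lambda>h. single h (1::'k)"
  have sc: "single g c \<in> carrier kG" if "g \<in> carrier G" for g and c :: 'k by (rule single_closed[OF that])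
  \<comment> \<open>The conjugate of the kT-linear section by h; \<open>I\<close> is the mean of
    these conjugates.\<close>
  define J where "J x h = ?s (inv h) \<odot>\<^bsub>?N\<^esub> i (?s h \<odot>\<^bsub>P\<^esub> x)" for x h
  have J: "J x h \<in> carrier ?N" if "x \<in> carrier P" "h \<in> H" for x h
    unfolding J_def using that by (intro N.smult_closed sc icl P.smult_closed) (auto intro: H_carrier)
  define I where "I x = single \<one> (1 / of_nat (card H)) \<odot>\<^bsub>?N\<^esub> (\<Oplus>\<^bsub>?N\<^esub>h\<in>H. J x h)" for x
  have Jsum: "(\<Oplus>\<^bsub>?N\<^esub>h\<in>H. J x h) \<in> carrier ?N" if "x \<in> carrier P" for x
    using J[OF that] by (intro N.M.finsum_closed) auto
  have Icl: "I x \<in> carrier ?N" if "x \<in> carrier P" for x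
    unfolding I_def using Jsum[OF that] by (intro N.smult_closed sc) auto
  have Iadd: "I (x \<oplus>\<^bsub>P\<^esub> y) = I x \<oplus>\<^bsub>?N\<^esub> I y" if xy: "x \<in> carrier P" "y \<in> carrier P" for x y
  proof -
    have "(\<Oplus>\<^bsub>?N\<^esub>h\<in>H. J (x \<oplus>\<^bsub>P\<^esub> y) h) = (\<Oplus>\<^bsub>?N\<^esub>h\<in>H. J x h \<oplus>\<^bsub>?N\<^esub> J y h)"
      using J[OF xy(1)] J[OF xy(2)] xy
      by (intro N.M.finsum_cong') (auto simp: J_def P.smult_r_distr iadd P.smult_closed sc H_carrier N.smult_r_distr icl)
    also have "\<dots> = (\<Oplus>\<^bsub>?N\<^esub>h\<in>H. J x h) \<oplus>\<^bsub>?N\<^esub> (\<Oplus>\<^bsub>?N\<^esub>h\<in>H. J y h)"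
      using J[OF xy(1)] J[OF xy(2)] by (intro N.M.finsum_addf) auto
    finally show ?thesis unfolding I_def using Jsum[OF xy(1)] Jsum[OF xy(2)] by (simp add: N.smult_r_distr sc)
  qed
  have Isingle: "I (single g c \<odot>\<^bsub>P\<^esub> x) = single g c \<odot>\<^bsub>?N\<^esub> I x" if g: "g \<in> carrier G" and x: "x \<in> carrier P" for g c x
  proof -
    let ?h = "\<lambda>h. H_part G T H (h \<otimes> g)" and ?t = "\<lambda>h. T_part G T H (h \<otimes> g)"
    have p: "?h h \<in> H" "?t h \<in> T" "h \<otimes> g = ?t h \<otimes> ?h h" if "h \<in> H" for h
      using parts[of "h \<otimes> g"] g that H_carrier by auto
    \<comment> \<open>Writing h g = t h', the assignment of h' to h permutes H: if two elements give
      the same h', their quotient lies in T \<inter> H.\<close>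
    have inj: "inj_on ?h H"
    proof (rule inj_onI)
      fix h h' assume h: "h \<in> H" "h' \<in> H" "?h h = ?h h'"
      note c = H_carrier[OF h(1)] H_carrier[OF h(2)] T_carrier[OF p(2)[OF h(1)]] T_carrier[OF p(2)[OF h(2)]] H_carrier[OF p(1)[OF h(1)]]
      have "inv (?t h) \<otimes> h \<otimes> g = ?h h" using p(3)[OF h(1)] c g by (simp add: m_assoc inv_solve_left')
      moreover have "inv (?t h') \<otimes> h' \<otimes> g = ?h h" using p(3)[OF h(2)] h(3) c g by (simp add: m_assoc inv_solve_left')
      ultimately have eq: "inv (?t h) \<otimes> h = inv (?t h') \<otimes> h'" using c g by (metis inv_closed m_closed right_cancel)
      have "?t h' \<otimes> (inv (?t h) \<otimes> h) = h'" unfolding eq using c by (simp only: inv_cancel(2))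
      hence "h' \<otimes> inv h = ?t h' \<otimes> inv (?t h)" using c by (metis inv_closed inv_solve_right m_assoc m_closed)
      hence "h' \<otimes> inv h \<in> T" using p(2)[OF h(1)] p(2)[OF h(2)] by (simp only: T.m_closed T.m_inv_closed)
      moreover have "h' \<otimes> inv h \<in> H" using h(1,2) by simp
      ultimately have "h' \<otimes> inv h \<in> T \<inter> H" by blast
      hence "h' \<otimes> inv h = \<one>" using TH by auto
      thus "h = h'" using c by (metis inv_closed inv_equality inv_inv)
    qed
    have surj: "?h ` H = H" using endo_inj_surj[OF fin _ inj] p(1) by auto
    have Jterm: "J (single g c \<odot>\<^bsub>P\<^esub> x) h = single g c \<odot>\<^bsub>?N\<^esub> J x (?h h)" if h: "h \<in> H" for h
    proof -
      note c = H_carrier[OF h] T_carrier[OF p(2)[OF h]] H_carrier[OF p(1)[OF h]] g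
      have "?s h \<odot>\<^bsub>P\<^esub> (single g c \<odot>\<^bsub>P\<^esub> x) = single (?t h \<otimes> ?h h) c \<odot>\<^bsub>P\<^esub> x"
        using c x p(3)[OF h] by (simp add: P.smult_assoc1[symmetric] sc single_mult)
      also have "\<dots> = single (?t h) c \<odot>\<^bsub>P\<^esub> (?s (?h h) \<odot>\<^bsub>P\<^esub> x)"
        using c x by (simp add: P.smult_assoc1[symmetric] sc single_mult)
      finally have "i (?s h \<odot>\<^bsub>P\<^esub> (single g c \<odot>\<^bsub>P\<^esub> x)) = single (?t h) c \<odot>\<^bsub>?N\<^esub> i (?s (?h h) \<odot>\<^bsub>P\<^esub> x)"
        using c x p[OF h] by (simp add: ism single_closed_T P.smult_closed sc)
      hence "J (single g c \<odot>\<^bsub>P\<^esub> x) h = single (inv h \<otimes> ?t h) c \<odot>\<^bsub>?N\<^esub> i (?s (?h h) \<odot>\<^bsub>P\<^esub> x)"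
        unfolding J_def using c x by (simp add: N.smult_assoc1[symmetric] sc single_mult icl P.smult_closed)
      \<comment> \<open>Rearranged from h g = t h'. It turns the term for h at g x into g applied to
        the term for h' at x.\<close>
      also have "inv h \<otimes> ?t h = g \<otimes> inv (?h h)"
        using p(3)[OF h] c by (metis inv_closed inv_solve_left inv_solve_right m_assoc m_closed)
      also have "single (g \<otimes> inv (?h h)) c \<odot>\<^bsub>?N\<^esub> i (?s (?h h) \<odot>\<^bsub>P\<^esub> x) = single g c \<odot>\<^bsub>?N\<^esub> J x (?h h)"
        unfolding J_def using c x by (simp add: N.smult_assoc1[symmetric] sc single_mult icl P.smult_closed)
      finally show ?thesis .
    qed
    have "(\<Oplus>\<^bsub>?N\<^esub>h\<in>H. J (single g c \<odot>\<^bsub>P\<^esub> x) h) = (\<Oplus>\<^bsub>?N\<^esub>h\<in>H. single g c \<odot>\<^bsub>?N\<^esub> J x (?h h))"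
      using J[OF x] p(1) g by (intro N.M.finsum_cong') (auto simp: Jterm intro!: N.smult_closed sc)
    also have "\<dots> = single g c \<odot>\<^bsub>?N\<^esub> (\<Oplus>\<^bsub>?N\<^esub>h\<in>H. J x (?h h))"
      using J[OF x] p(1) g by (intro N.smult_finsum[symmetric] sc fin) auto
    also have "(\<Oplus>\<^bsub>?N\<^esub>h\<in>H. J x (?h h)) = (\<Oplus>\<^bsub>?N\<^esub>h\<in>H. J x h)"
      using N.M.finsum_reindex[OF _ inj, of "J x"] J[OF x] unfolding surj by auto
    finally show ?thesis unfolding I_def using g Jsum[OF x]
      by (simp add: N.smult_assoc1[symmetric] sc single_mult mult.commute)
  qed
  have I: "I \<in> lmod_hom kG P ?N"
  proof (rule lmod_homI)
    fix a x assume a: "a \<in> carrier kG" and x: "x \<in> carrier P"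
    from a show "I (a \<odot>\<^bsub>P\<^esub> x) = a \<odot>\<^bsub>?N\<^esub> I x"
    proof (induction rule: group_algebra_induct)
      case zero
      have "I \<zero>\<^bsub>P\<^esub> = \<zero>\<^bsub>?N\<^esub>"
        using additive_map_zero[OF P.ab N.ab, of I] Icl Iadd by (auto simp: additive_map_def)
      thus ?case using P.smult_l_null[OF x] N.smult_l_null[OF Icl[OF x]] by (simp add: group_algebra_simps(4))
    next
      case (add a b) thus ?case using x by (simp add: P.smult_l_distr N.smult_l_distr Iadd P.smult_closed Icl)
    qed (use Isingle x in auto)
  qed (use Icl Iadd in auto)
  have "Q.lin (I x) = x" if x: "x \<in> carrier P" for x
  proof -
    have "Q.lin (\<Oplus>\<^bsub>?N\<^esub>h\<in>H. J x h) = (\<Oplus>\<^bsub>P\<^esub>h\<in>H. Q.lin (J x h))"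
      using J[OF x] by (intro hom_finsum[OF N.left_module P Qh fin]) auto
    also have "\<dots> = (\<Oplus>\<^bsub>P\<^esub>h\<in>H. x)"
    proof (intro P.M.finsum_cong')
      fix h assume h: "h \<in> H"
      have "Q.lin (J x h) = ?s (inv h) \<odot>\<^bsub>P\<^esub> q (i (?s h \<odot>\<^bsub>P\<^esub> x))"
        unfolding J_def using h x by (simp add: hom_smult[OF Qh] sc H_carrier icl P.smult_closed Qq hom_closed[OF i])
      also have "\<dots> = (?s (inv h) \<otimes>\<^bsub>kG\<^esub> ?s h) \<odot>\<^bsub>P\<^esub> x"
        using h x by (simp add: qi P.smult_closed sc H_carrier P.smult_assoc1)
      finally show "Q.lin (J x h) = x" using h x H_carrier[OF h] P.smult_one[OF x] by (simp add: single_mult group_algebra_simps(5))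
    qed (use x in auto)
    also have "\<dots> = single \<one> (of_nat (card H)) \<odot>\<^bsub>P\<^esub> x"
      using fin
    proof (induction H)
      case empty thus ?case using P.smult_l_null[OF x] by (simp add: single_zero group_algebra_simps(4))
    next
      case (insert h H)
      have "single \<one> (1 + of_nat (card H)) \<odot>\<^bsub>P\<^esub> x = single \<one> 1 \<odot>\<^bsub>P\<^esub> x \<oplus>\<^bsub>P\<^esub> single \<one> (of_nat (card H)) \<odot>\<^bsub>P\<^esub> x"
        using P.smult_l_distr[OF sc sc x, of \<one> \<one>] by (simp add: single_add)
      thus ?case using insert x P.smult_one[OF x] by (simp add: P.M.finsum_insert group_algebra_simps(5))
    qed
    finally have "Q.lin (I x) = (single \<one> (1 / of_nat (card H)) \<otimes>\<^bsub>kG\<^esub> single \<one> (of_nat (card H))) \<odot>\<^bsub>P\<^esub> x"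
      unfolding I_def using Jsum[OF x] x by (simp add: hom_smult[OF Qh] sc P.smult_assoc1)
    thus ?thesis using inv P.smult_one[OF x] by (simp add: single_mult group_algebra_simps(5))
  qed
  thus ?thesis unfolding projective_module_def using P I Qh by blast
qed

end

section \<open>Coordinates on a product of Pruefer groups\<close>

text \<open>A rational representative is picked in each coset of \<int>. Additivity therefore holds
  only modulo \<int>; the four clauses say that the representatives induce an isomorphism from T
  onto the r-th power of \<int>[1/p]/\<int>.\<close>

lemma prufer_coordinates:
  fixes G :: "('g, 'x) monoid_scheme"
  assumes T: "group (G\<lparr>carrier := T\<rparr>)" and iso: "G\<lparr>carrier := T\<rparr> \<cong> product_group {..<r} (\<lambda>_. prufer_group p)"
  shows "\<exists>q :: nat => 'g => rat.
    (\<forall>j<r. \<forall>t\<in>T. \<exists>n. q j t * of_nat p ^ n \<in> \<int>) \<and>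
    (\<forall>j<r. \<forall>s\<in>T. \<forall>t\<in>T. q j (s \<otimes>\<^bsub>G\<^esub> t) - q j s - q j t \<in> \<int>) \<and>
    (\<forall>t\<in>T. (\<forall>j<r. q j t \<in> \<int>) \<longrightarrow> t = \<one>\<^bsub>G\<^esub>) \<and>
    (\<forall>c. (\<forall>j<r. \<exists>n. c j * of_nat p ^ n \<in> \<int>) \<longrightarrow> (\<exists>t\<in>T. \<forall>j<r. q j t - c j \<in> \<int>))"
proof -
  interpret T: group "G\<lparr>carrier := T\<rparr>" by fact
  define A where "A = \<lparr>carrier = {x :: rat. \<exists>n. x * of_nat p ^ n \<in> \<int>}, monoid.mult = (+), one = (0 :: rat)\<rparr>"
  define cs where "cs x = {y :: rat. y - x \<in> \<int>}" for x
  have rc: "\<int> #>\<^bsub>A\<^esub> x = cs x" for x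
    by (auto simp: r_coset_def A_def cs_def intro: exI[of _ "_ - x"] dest: bspec[of _ _ "_ - x"])
  have car: "carrier (prufer_group p) = cs ` carrier A"
    unfolding prufer_group_def A_def[symmetric] carrier_FactGroup by (simp add: rc)
  have mul: "c \<otimes>\<^bsub>prufer_group p\<^esub> d = {x + y | x y. x \<in> c \<and> y \<in> d}" for c d
    unfolding prufer_group_def mult_FactGroup set_mult_def by auto
  have cs0: "{x + y | x y. x \<in> cs 0 \<and> y \<in> cs 0} = cs 0"
  proof -
    have "z \<in> {x + y | x y. x \<in> cs 0 \<and> y \<in> cs 0}" if "z \<in> cs 0" for z
      using that unfolding cs_def mem_Collect_eq by (intro exI[of _ z] exI[of _ 0]) auto
    thus ?thesis by (auto simp: cs_def)
  qed
  obtain \<phi> where "\<phi> \<in> iso (G\<lparr>carrier := T\<rparr>) (product_group {..<r} (\<lambda>_. prufer_group p))"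
    using iso by (auto simp: is_iso_def)
  hence hom: "\<And>s t. s \<in> T ==> t \<in> T ==> \<phi> (s \<otimes>\<^bsub>G\<^esub> t) = (\<lambda>j\<in>{..<r}. \<phi> s j \<otimes>\<^bsub>prufer_group p\<^esub> \<phi> t j)"
    and bij: "bij_betw \<phi> T (\<Pi>\<^sub>E j\<in>{..<r}. cs ` carrier A)"
    by (auto simp: iso_def hom_def car)
  define q where "q j t = (SOME x. x \<in> \<phi> t j)" for j t
  have \<phi>: "\<phi> t \<in> (\<Pi>\<^sub>E j\<in>{..<r}. cs ` carrier A)" if "t \<in> T" for t
    using bij_betwE[OF bij] that by (rule bspec)
  have cs_eq: "cs x = cs y" if "x - y \<in> \<int>" for x y
  proof -
    have "z - x \<in> \<int> \<longleftrightarrow> z - y \<in> \<int>" for z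
      using Ints_add[OF _ that, of "z - x"] Ints_diff[OF _ that, of "z - y"] by auto
    thus ?thesis by (simp add: cs_def)
  qed
  have q: "\<phi> t j = cs (q j t) \<and> q j t \<in> carrier A" if t: "t \<in> T" and j: "j < r" for t j
  proof -
    obtain a where a: "\<phi> t j = cs a" "a \<in> carrier A" using PiE_mem[OF \<phi>[OF t], of j] j by auto
    have "a \<in> \<phi> t j" using a by (simp add: cs_def)
    hence "q j t \<in> cs a" unfolding q_def using a(1) someI[of "\<lambda>x. x \<in> \<phi> t j" a] by simp
    hence d: "q j t - a \<in> \<int>" by (simp add: cs_def)
    obtain n where n: "a * of_nat p ^ n \<in> \<int>" using a by (auto simp: A_def)
    have "q j t * of_nat p ^ n = a * of_nat p ^ n + (q j t - a) * of_nat p ^ n" by (simp add: algebra_simps)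
    also have "\<dots> \<in> \<int>" by (rule Ints_add[OF n Ints_mult[OF d]]) (intro Ints_power Ints_of_nat)
    finally show ?thesis using cs_eq[OF d] a by (auto simp: A_def)
  qed
  have add: "q j (s \<otimes>\<^bsub>G\<^esub> t) - q j s - q j t \<in> \<int>" if "s \<in> T" "t \<in> T" "j < r" for s t j
  proof -
    have st: "s \<otimes>\<^bsub>G\<^esub> t \<in> T" using T.m_closed[of s t] that by simp
    have "q j (s \<otimes>\<^bsub>G\<^esub> t) \<in> cs (q j (s \<otimes>\<^bsub>G\<^esub> t))" by (simp add: cs_def)
    also have "\<dots> = {x + y | x y. x \<in> cs (q j s) \<and> y \<in> cs (q j t)}"
      using q[OF st that(3)] q[OF that(1,3)] q[OF that(2,3)] hom[OF that(1,2)] that(3) by (simp add: mul)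
    finally obtain x y where "q j (s \<otimes>\<^bsub>G\<^esub> t) = x + y" "x - q j s \<in> \<int>" "y - q j t \<in> \<int>" by (auto simp: cs_def)
    moreover have "x + y - q j s - q j t = (x - q j s) + (y - q j t)" by simp
    ultimately show ?thesis by (metis Ints_add)
  qed
  have triv: "t = \<one>\<^bsub>G\<^esub>" if t: "t \<in> T" and z: "\<forall>j<r. q j t \<in> \<int>" for t
  proof -
    have \<phi>t: "\<phi> t j = cs 0" if "j < r" for j using q[OF t that] cs_eq[of "q j t" 0] z that by auto
    have tt: "t \<otimes>\<^bsub>G\<^esub> t \<in> T" using T.m_closed[of t t] t by simp
    \<comment> \<open>A group element equal to its own square is trivial, so the unit is recognized
      without identifying its image in the product.\<close>
    have "\<phi> (t \<otimes>\<^bsub>G\<^esub> t) = \<phi> t"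
    proof (rule PiE_ext[OF \<phi>[OF tt] \<phi>[OF t]])
      fix j assume "j \<in> {..<r}"
      thus "\<phi> (t \<otimes>\<^bsub>G\<^esub> t) j = \<phi> t j" by (simp add: hom[OF t t] \<phi>t mul cs0)
    qed
    hence "t \<otimes>\<^bsub>G\<^esub> t = t" using bij t tt by (auto simp: bij_betw_def inj_on_def)
    thus ?thesis using T.r_cancel_one[of t t] t by simp
  qed
  have surj: "\<exists>t\<in>T. \<forall>j<r. q j t - c j \<in> \<int>" if c: "\<forall>j<r. \<exists>n. c j * of_nat p ^ n \<in> \<int>" for c
  proof -
    have "(\<lambda>j\<in>{..<r}. cs (c j)) \<in> (\<Pi>\<^sub>E j\<in>{..<r}. cs ` carrier A)" using c by (auto simp: A_def)
    hence "(\<lambda>j\<in>{..<r}. cs (c j)) \<in> \<phi> ` T" using bij_betw_imp_surj_on[OF bij] by (simp only:)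
    then obtain t where t: "t \<in> T" "\<phi> t = (\<lambda>j\<in>{..<r}. cs (c j))" by (metis imageE)
    have "q j t - c j \<in> \<int>" if "j < r" for j
    proof -
      have "cs (q j t) = cs (c j)" using q[OF t(1) that] t(2) that by simp
      moreover have "q j t \<in> cs (q j t)" by (simp add: cs_def)
      ultimately show ?thesis by (simp add: cs_def)
    qed
    thus ?thesis using t(1) by blast
  qed
  show ?thesis
    by (intro exI[of _ q] conjI allI ballI impI) (use q add triv surj in \<open>auto simp: A_def\<close>)
qed

section \<open>Torsion subgroups in coordinates\<close>

locale torsion_coordinates = group G for G (structure) +
  fixes T and p r :: nat and q :: "nat => 'a => rat"
  assumes T_subgroup: "subgroup T G" and T_comm': "comm_group (G\<lparr>carrier := T\<rparr>)"
    and p: "prime p"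
    and q_p: "\<And>j t. j < r ==> t \<in> T ==> \<exists>n. q j t * of_nat p ^ n \<in> \<int>"
    and q_add: "\<And>j s t. j < r ==> s \<in> T ==> t \<in> T ==> q j (s \<otimes> t) - q j s - q j t \<in> \<int>"
    and q_one: "\<And>t. t \<in> T ==> (\<And>j. j < r ==> q j t \<in> \<int>) ==> t = \<one>"
    and q_ex: "\<And>c. (\<And>j. j < r ==> \<exists>n. c j * of_nat p ^ n \<in> \<int>) ==> \<exists>t\<in>T. \<forall>j<r. q j t - c j \<in> \<int>"
begin

sublocale T: subgroup T G by (rule T_subgroup)

lemma T_commute: "s \<in> T ==> t \<in> T ==> s \<otimes> t = t \<otimes> s"
  using comm_monoid.m_comm[of "G\<lparr>carrier := T\<rparr>" s t] T_comm' by (simp add: comm_group_def)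

lemma p_pos: "p > 0" using p by (simp add: prime_gt_0_nat)
lemma p_gt_1: "p > 1" by (rule prime_gt_1_nat[OF p])

lemma T_pow: "t \<in> T ==> t [^] (n::nat) \<in> T"
  by (induction n) auto

lemma q_unit: "j < r ==> q j \<one> \<in> \<int>"
  using q_add[of j \<one> \<one>] by (simp add: Ints_minus minus_in_Ints_iff)

lemma q_pow: "j < r ==> t \<in> T ==> q j (t [^] (n::nat)) - of_nat n * q j t \<in> \<int>"
proof (induction n)
  case 0 thus ?case by (simp add: q_unit)
next
  case (Suc n)
  have "q j (t [^] Suc n) - of_nat (Suc n) * q j t =
    (q j (t [^] n \<otimes> t) - q j (t [^] n) - q j t) + (q j (t [^] n) - of_nat n * q j t)" by (simp add: algebra_simps)
  also have "\<dots> \<in> \<int>" using Suc q_add[OF Suc.prems(1) T_pow Suc.prems(2)] by (intro Ints_add) (auto simp: Suc.prems)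
  finally show ?case .
qed

lemma Ints_trans: "x - y \<in> \<int> ==> y \<in> \<int> ==> (x :: rat) \<in> \<int>"
  using Ints_add[of "x - y" y] by simp

lemma Ints_trans': "x - y \<in> \<int> ==> x \<in> \<int> ==> (y :: rat) \<in> \<int>"
  using Ints_diff[of x "x - y"] by simp

lemma torsion_iff: "t \<in> torsion G T p n \<longleftrightarrow> t \<in> T \<and> (\<forall>j<r. of_nat (p ^ n) * q j t \<in> \<int>)"
proof (intro iffI conjI allI impI)
  assume t: "t \<in> torsion G T p n"
  thus tT: "t \<in> T" by (simp add: torsion_def)
  fix j assume j: "j < r"
  have "q j (t [^] (p ^ n)) \<in> \<int>" using t q_unit[OF j] by (simp add: torsion_def)
  thus "of_nat (p ^ n) * q j t \<in> \<int>" using Ints_trans'[OF q_pow[OF j tT]] by blast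
next
  assume t: "t \<in> T \<and> (\<forall>j<r. of_nat (p ^ n) * q j t \<in> \<int>)"
  have "t [^] (p ^ n) = \<one>"
    by (rule q_one) (use t in \<open>auto simp: T_pow intro: Ints_trans[OF q_pow]\<close>)
  thus "t \<in> torsion G T p n" using t by (simp add: torsion_def)
qed

lemma torsion_T: "t \<in> torsion G T p n ==> t \<in> T" by (simp add: torsion_def)

lemma q_inj:
  assumes "s \<in> T" "t \<in> T" "\<And>j. j < r ==> q j s - q j t \<in> \<int>" shows "s = t"
proof -
  have st: "s \<otimes> inv t \<in> T" using assms by auto
  have eq: "s \<otimes> inv t \<otimes> t = s" using assms by (simp add: m_assoc)
  have "q j (s \<otimes> inv t) \<in> \<int>" if j: "j < r" for j
  proof -
    have "q j s - q j (s \<otimes> inv t) - q j t \<in> \<int>" using q_add[OF j st assms(2)] eq by simp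
    from Ints_diff[OF assms(3)[OF j] this] show ?thesis by simp
  qed
  hence "s \<otimes> inv t = \<one>" using st by (intro q_one)
  thus ?thesis using assms eq by simp
qed

lemma torsion_mult: "s \<in> torsion G T p n ==> t \<in> torsion G T p n ==> s \<otimes> t \<in> torsion G T p n"
proof -
  assume s: "s \<in> torsion G T p n" and t: "t \<in> torsion G T p n"
  have "of_nat (p ^ n) * q j (s \<otimes> t) \<in> \<int>" if j: "j < r" for j
  proof -
    have "of_nat (p ^ n) * q j (s \<otimes> t) =
       of_nat (p ^ n) * (q j (s \<otimes> t) - q j s - q j t) + of_nat (p ^ n) * q j s + of_nat (p ^ n) * q j t" by (simp add: algebra_simps)
    also have "\<dots> \<in> \<int>" using s t j Ints_mult[OF _ q_add[OF j torsion_T[OF s] torsion_T[OF t]]] unfolding torsion_iff by (intro Ints_add) auto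
    finally show ?thesis .
  qed
  thus ?thesis using s t unfolding torsion_iff by auto
qed

lemma torsion_one: "\<one> \<in> torsion G T p n"
  by (simp add: torsion_def)

lemma torsion_inv: "t \<in> torsion G T p n ==> inv t \<in> torsion G T p n"
  by (auto simp: torsion_def nat_pow_inv T.m_inv_closed)

lemma torsion_mono: "m \<le> n ==> torsion G T p m \<subseteq> torsion G T p n"
proof
  fix t assume mn: "m \<le> n" and t: "t \<in> torsion G T p m"
  hence "t [^] (p ^ m * p ^ (n - m)) = \<one>" by (subst nat_pow_pow[symmetric]) (auto simp: torsion_def)
  also have "p ^ m * p ^ (n - m) = p ^ n" using mn by (simp flip: power_add)
  finally show "t \<in> torsion G T p n" using t by (simp add: torsion_def)
qed

lemma torsion_exhaust: "t \<in> T ==> \<exists>n\<ge>1. t \<in> torsion G T p n"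
proof -
  assume t: "t \<in> T"
  have "\<forall>j. \<exists>n. j < r \<longrightarrow> q j t * of_nat p ^ n \<in> \<int>" using q_p t by blast
  then obtain n where n: "\<And>j. j < r ==> q j t * of_nat p ^ n j \<in> \<int>" by metis
  \<comment> \<open>Only a common bound for the exponents n j is needed, and their sum is one; the
    successor makes it positive.\<close>
  define N where "N = Suc (\<Sum>j<r. n j)"
  have "of_nat (p ^ N) * q j t \<in> \<int>" if j: "j < r" for j
  proof -
    have "n j \<le> (\<Sum>j<r. n j)" using j by (intro member_le_sum) auto
    hence "n j \<le> N" by (simp add: N_def)
    hence "(of_nat (p ^ N) :: rat) = of_nat p ^ n j * of_nat p ^ (N - n j)"
      by (metis le_add_diff_inverse of_nat_power power_add)
    hence "of_nat (p ^ N) * q j t = of_nat p ^ (N - n j) * (q j t * of_nat p ^ n j)" by simp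
    also have "\<dots> \<in> \<int>" by (rule Ints_mult[OF _ n[OF j]]) (intro Ints_power Ints_of_nat)
    finally show ?thesis .
  qed
  thus ?thesis using t unfolding torsion_iff by (intro exI[of _ N]) (auto simp: N_def)
qed

text \<open>
  The floor has an effect only off the torsion subgroup for \<open>n\<close>. There \<open>mu\<close> need not be
  additive, but it is when one of the two arguments lies in the torsion subgroup.
\<close>

definition mu :: "nat => nat => 'a => int" where "mu n j t = \<lfloor>of_nat (p ^ n) * q j t\<rfloor>"

lemma mu_torsion: "t \<in> torsion G T p n ==> j < r ==> of_int (mu n j t) = of_nat (p ^ n) * q j t"
  unfolding torsion_iff mu_def by (auto elim!: Ints_cases)

text \<open>The coordinates of the product differ from the sum of coordinates by an integer z, and
  p^n times the coordinate of s is an integer. Both can be taken out of the floor, the former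
  contributing the multiple p^n z.\<close>

lemma mu_add_exact:
  assumes "j < r" "t \<in> T" "s \<in> torsion G T p n"
  shows "[mu n j (t \<otimes> s) = mu n j t + mu n j s] (mod int (p ^ n))"
proof -
  note sT = torsion_T[OF assms(3)]
  obtain z where z: "q j (t \<otimes> s) - q j t - q j s = of_int z" using q_add[OF assms(1,2) sT] by (auto elim: Ints_cases)
  have "of_nat (p ^ n) * q j (t \<otimes> s) = of_nat (p ^ n) * q j t + (of_nat (p ^ n) * q j s + of_nat (p ^ n) * of_int z)"
    by (simp add: z[symmetric] algebra_simps)
  also have "\<dots> = of_nat (p ^ n) * q j t + of_int (mu n j s + int (p ^ n) * z)"
    using mu_torsion[OF assms(3,1)] by simp
  finally have "mu n j (t \<otimes> s) = mu n j t + mu n j s + int (p ^ n) * z" unfolding mu_def[of n j "t \<otimes> s"]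
    by (simp only: floor_add_int[symmetric]) (simp add: mu_def)
  thus ?thesis by (simp add: cong_def)
qed

lemma mu_add:
  assumes "j < r" "t \<in> T" "s \<in> torsion G T p n" "n \<ge> 1"
  shows "[mu n j (t \<otimes> s) = mu n j t + mu n j s] (mod int p)"
  using cong_dvd_modulus[OF mu_add_exact[OF assms(1-3)], of "int p"] assms(4) by (simp add: dvd_power)

lemma mu_one: "j < r ==> n \<ge> 1 ==> [mu n j \<one> = 0] (mod int p)"
  using mu_add[of j \<one> \<one> n] torsion_one by (simp add: cong_def mod_eq_dvd_iff mod_eq_0_iff_dvd)

text \<open>In units of p^-(n+1) the coordinates of an element killed by p^n are multiples of p.
  This is what lets a derivation separate level n + 1 from level n.\<close>

lemma mu_Suc: "j < r ==> t \<in> torsion G T p n ==> [mu (Suc n) j t = 0] (mod int p)"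
proof -
  assume j: "j < r" and t: "t \<in> torsion G T p n"
  have "of_nat (p ^ Suc n) * q j t = of_int (int p * mu n j t)" using mu_torsion[OF t j] by simp
  hence "mu (Suc n) j t = int p * mu n j t" unfolding mu_def[of "Suc n"] by (simp only: floor_of_int)
  thus ?thesis by (simp add: cong_def)
qed

text \<open>A generator of the j-th cyclic factor of order p^n of the torsion subgroup. For n = 1
  these form the basis of V.\<close>

definition sg :: "nat => nat => 'a"
  where "sg n j = (SOME t. t \<in> T \<and> (\<forall>i<r. q i t - (if i = j then 1 / of_nat (p ^ n) else 0) \<in> \<int>))"

lemma sg: "sg n j \<in> T" "i < r ==> q i (sg n j) - (if i = j then 1 / of_nat (p ^ n) else 0) \<in> \<int>"
proof -
  have "\<exists>t\<in>T. \<forall>i<r. q i t - (if i = j then 1 / of_nat (p ^ n) else 0) \<in> \<int>"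
    by (rule q_ex, rule exI[of _ n]) (use p_pos in auto)
  hence "sg n j \<in> T \<and> (\<forall>i<r. q i (sg n j) - (if i = j then 1 / of_nat (p ^ n) else 0) \<in> \<int>)"
    unfolding sg_def by (intro someI_ex[of "\<lambda>t. t \<in> T \<and> (\<forall>i<r. q i t - (if i = j then 1 / of_nat (p ^ n) else 0) \<in> \<int>)"]) blast
  thus "sg n j \<in> T" "i < r ==> q i (sg n j) - (if i = j then 1 / of_nat (p ^ n) else 0) \<in> \<int>" by auto
qed

lemma sg_q: "i < r ==> \<exists>z. of_nat (p ^ n) * q i (sg n j) = of_int ((if i = j then 1 else 0) + int (p ^ n) * z)"
proof -
  assume i: "i < r"
  obtain z where z: "q i (sg n j) - (if i = j then 1 / of_nat (p ^ n) else 0) = of_int z" using sg(2)[OF i, of n j] by (elim Ints_cases)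
  hence "of_nat (p ^ n) * q i (sg n j) = of_nat (p ^ n) * (of_int z + (if i = j then 1 / of_nat (p ^ n) else 0))"
    by (metis diff_add_cancel)
  thus ?thesis using p_pos by (intro exI[of _ z]) (simp add: algebra_simps)
qed

lemma sg_torsion: "sg n j \<in> torsion G T p n"
  unfolding torsion_iff using sg(1) sg_q by (metis Ints_of_int)

lemma mu_sg: "i < r ==> n \<ge> 1 ==> [mu n i (sg n j) = (if i = j then 1 else 0)] (mod int p)"
proof -
  assume i: "i < r" and n: "n \<ge> 1"
  obtain z where "of_nat (p ^ n) * q i (sg n j) = of_int ((if i = j then 1 else 0) + int (p ^ n) * z)" using sg_q[OF i] by blast
  hence "mu n i (sg n j) = (if i = j then 1 else 0) + int (p ^ n) * z" unfolding mu_def by (simp only: floor_of_int)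
  moreover have "int p dvd int (p ^ n) * z" using n by (simp add: dvd_power)
  ultimately show ?thesis unfolding cong_iff_dvd_diff by auto
qed

text \<open>The residues of the r coordinates modulo p^n determine the element. Finiteness makes the
  elimination in the lemma of Nakayama terminate.\<close>

lemma torsion_finite: "finite (torsion G T p n)"
proof (rule inj_on_finite)
  let ?f = "\<lambda>t. \<lambda>j\<in>{..<r}. mu n j t mod int (p ^ n)"
  show "finite ({..<r} \<rightarrow>\<^sub>E {0..<int (p ^ n)})" by (intro finite_PiE) auto
  show "?f ` torsion G T p n \<subseteq> {..<r} \<rightarrow>\<^sub>E {0..<int (p ^ n)}" using p_pos by (intro image_subsetI restrict_PiE_iff[THEN iffD2]) simp
  show "inj_on ?f (torsion G T p n)"
  proof (rule inj_onI)
    fix s t assume s: "s \<in> torsion G T p n" and t: "t \<in> torsion G T p n" and eq: "?f s = ?f t"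
    show "s = t"
    proof (rule q_inj)
      fix j assume j: "j < r"
      have "mu n j s mod int (p ^ n) = mu n j t mod int (p ^ n)" using fun_cong[OF eq, of j] j by simp
      then obtain z where z: "mu n j s - mu n j t = int (p ^ n) * z" by (auto simp: mod_eq_dvd_iff)
      have "of_nat (p ^ n) * (q j s - q j t) = of_int (mu n j s - mu n j t)"
        using mu_torsion[OF s j] mu_torsion[OF t j] by (simp add: algebra_simps)
      also have "\<dots> = of_nat (p ^ n) * of_int z" unfolding z by simp
      finally have "q j s - q j t = of_int z" using p_pos by simp
      thus "q j s - q j t \<in> \<int>" by simp
    qed (use s t torsion_T in auto)
  qed
qed

section \<open>The p-torsion V as a module over the prime field\<close>

abbreviation "V \<equiv> V_mod G T p"

lemma V_simps [simp]: "carrier V = torsion G T p 1" "add V = (\<otimes>)" "ring.zero V = \<one>" "c \<odot>\<^bsub>V\<^esub> v = v [^] c"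
  by (simp_all add: V_mod_def)

lemma F_simps: "carrier (prime_field p) = {0..<int p}" "x \<otimes>\<^bsub>prime_field p\<^esub> y = (x * y) mod int p"
  "x \<oplus>\<^bsub>prime_field p\<^esub> y = (x + y) mod int p" "\<one>\<^bsub>prime_field p\<^esub> = 1" "\<zero>\<^bsub>prime_field p\<^esub> = 0"
  by (auto simp: residue_ring_def)

lemma F_cring: "cring (prime_field p)"
proof -
  interpret residues "int p" "prime_field p" by unfold_locales (use p_gt_1 in auto)
  show ?thesis by (rule cring)
qed

lemma F_ring: "ring (prime_field p)" using F_cring by (simp add: cring_def)

lemma V_carrier: "v \<in> torsion G T p 1 ==> v \<in> carrier G" by (auto dest: torsion_T)

text \<open>Scalars are integer residues acting as exponents; the reduction after adding or
  multiplying them is harmless as V has exponent p.\<close>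

lemma V_pow_mod: "v \<in> torsion G T p 1 ==> v [^] (c mod int p) = v [^] (c :: int)"
proof -
  assume v: "v \<in> torsion G T p 1"
  have vp: "v [^] int p = \<one>" using v by (simp add: torsion_def int_pow_int)
  have "v [^] c = v [^] (int p * (c div int p) + c mod int p)" by simp
  also have "\<dots> = (v [^] int p) [^] (c div int p) \<otimes> v [^] (c mod int p)"
    using V_carrier[OF v] by (simp only: int_pow_mult int_pow_pow)
  finally show ?thesis using vp V_carrier[OF v] by simp
qed

lemma V_pow_closed: "v \<in> torsion G T p 1 ==> v [^] (c :: int) \<in> torsion G T p 1"
proof -
  assume v: "v \<in> torsion G T p 1"
  have 1: "v [^] (n :: nat) \<in> torsion G T p 1" for n
    by (induction n) (use v in \<open>auto intro: torsion_one torsion_mult\<close>)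
  show ?thesis
  proof (cases "0 \<le> c")
    case True thus ?thesis using 1[of "nat c"] by (metis int_nat_eq int_pow_int)
  next
    case False thus ?thesis using torsion_inv[OF 1[of "nat (- c)"]] V_carrier[OF v]
      by (metis int_nat_eq int_pow_neg_int minus_minus linorder_linear neg_le_0_iff_le)
  qed
qed

lemma V_left_module: "left_module (prime_field p) V"
proof (rule left_moduleI[OF F_ring])
  show "abelian_group V"
  proof (rule abelian_groupI', goal_cases)
    case (6 x) thus ?case using torsion_inv[of x 1] V_carrier[of x] by (intro bexI[of _ "inv x"]) auto
  next
    case (4 x y) thus ?case using torsion_T by (auto intro: T_commute)
  qed (use torsion_mult torsion_one V_carrier in \<open>auto simp: m_assoc\<close>)
  show "a \<odot>\<^bsub>V\<^esub> (x \<oplus>\<^bsub>V\<^esub> y) = a \<odot>\<^bsub>V\<^esub> x \<oplus>\<^bsub>V\<^esub> a \<odot>\<^bsub>V\<^esub> y" if "x \<in> carrier V" "y \<in> carrier V" for a x y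
    using that by (simp add: int_pow_mult_distrib V_carrier T_commute torsion_T)
  show "a \<odot>\<^bsub>V\<^esub> x \<in> carrier V" if "x \<in> carrier V" for a x using V_pow_closed that by simp
qed (auto simp: V_pow_mod F_simps int_pow_mult V_carrier int_pow_pow mult.commute)

lemma q_int_pow: "j < r ==> t \<in> T ==> 0 \<le> c ==> q j (t [^] (c :: int)) - of_int c * q j t \<in> \<int>"
  using q_pow[of j t "nat c"] by (metis int_nat_eq int_pow_int of_int_of_nat_eq)

text \<open>An element is determined by its coordinates modulo \<int>, and both sides have i-th
  coordinate \<open>mu 1 i v\<close> / p modulo \<int>.\<close>

lemma V_basis:
  assumes v: "v \<in> torsion G T p 1"
  shows "v = (\<Oplus>\<^bsub>V\<^esub>j\<in>{..<r}. (mu 1 j v mod int p) \<odot>\<^bsub>V\<^esub> sg 1 j)"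
proof -
  interpret V: left_module "prime_field p" V by (rule V_left_module)
  let ?x = "\<lambda>j. (mu 1 j v mod int p) \<odot>\<^bsub>V\<^esub> sg 1 j"
  have x: "?x j \<in> carrier V" for j using V_pow_closed[OF sg_torsion] by simp
  \<comment> \<open>Coordinates of a sum in V, which is a product in the group, are computed one
    factor at a time, with integral error.\<close>
  have sum: "(\<Oplus>\<^bsub>V\<^esub>j\<in>A. ?x j) \<in> carrier V \<and> q i (\<Oplus>\<^bsub>V\<^esub>j\<in>A. ?x j) - (\<Sum>j\<in>A. q i (?x j)) \<in> \<int>"
    if "finite A" "i < r" for A i
    using that(1)
  proof (induction A)
    case empty thus ?case using q_unit[OF that(2)] torsion_one by simp
  next
    case (insert j A)
    have eq: "(\<Oplus>\<^bsub>V\<^esub>j\<in>insert j A. ?x j) = ?x j \<otimes> (\<Oplus>\<^bsub>V\<^esub>j\<in>A. ?x j)"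
      using V.M.finsum_insert[OF insert.hyps, of ?x] x by simp
    have "q i (?x j \<otimes> (\<Oplus>\<^bsub>V\<^esub>j\<in>A. ?x j)) - q i (?x j) - q i (\<Oplus>\<^bsub>V\<^esub>j\<in>A. ?x j) \<in> \<int>"
      using x[of j] insert.IH by (intro q_add that(2)) (auto dest: torsion_T)
    from Ints_add[OF this insert.IH[THEN conjunct2]]
    have "q i (\<Oplus>\<^bsub>V\<^esub>j\<in>insert j A. ?x j) - (\<Sum>j\<in>insert j A. q i (?x j)) \<in> \<int>"
      unfolding eq using insert.hyps by (simp add: algebra_simps)
    moreover have "(\<Oplus>\<^bsub>V\<^esub>j\<in>insert j A. ?x j) \<in> carrier V"
      using x by (intro V.M.finsum_closed) auto
    ultimately show ?case by blast
  qed
  show ?thesis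
  proof (rule q_inj[OF torsion_T[OF v]])
    show "(\<Oplus>\<^bsub>V\<^esub>j\<in>{..<r}. ?x j) \<in> T" using V.M.finsum_closed[of ?x "{..<r}"] x by (auto dest: torsion_T)
    fix i assume i: "i < r"
    let ?d = "\<lambda>j. if i = j then 1 / of_nat p else (0 :: rat)" and ?m = "\<lambda>j. mu 1 j v mod int p"
    have 1: "q i (?x j) - of_int (?m j) * ?d j \<in> \<int>" for j
    proof -
      have "q i (?x j) - of_int (?m j) * ?d j = (q i (?x j) - of_int (?m j) * q i (sg 1 j)) + of_int (?m j) * (q i (sg 1 j) - ?d j)"
        by (simp add: algebra_simps)
      also have "\<dots> \<in> \<int>" using q_int_pow[OF i sg(1), of "?m j" 1 j] sg(2)[OF i, of 1 j] p_pos
        by (intro Ints_add Ints_mult) auto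
      finally show ?thesis .
    qed
    have "(\<Sum>j<r. of_int (?m j) * ?d j) = (\<Sum>j<r. if i = j then of_int (?m j) / of_nat p else 0)"
      by (intro sum.cong) auto
    also have "\<dots> = of_int (?m i) / of_nat p" using i by (simp add: sum.delta')
    finally have "(\<Sum>j<r. q i (?x j)) - of_int (?m i) / of_nat p = (\<Sum>j<r. q i (?x j) - of_int (?m j) * ?d j)"
      by (simp only: sum_subtractf)
    also have "\<dots> \<in> \<int>" using 1 by (intro Ints_sum)
    finally have 2: "(\<Sum>j<r. q i (?x j)) - of_int (?m i) / of_nat p \<in> \<int>" .
    have "of_nat p * q i v = of_int (mu 1 i v)" using mu_torsion[OF v i] by simp
    hence "q i v - of_int (?m i) / of_nat p = of_int (mu 1 i v - ?m i) / of_nat p" using p_pos by (simp add: field_simps)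
    also have "\<dots> = of_int (mu 1 i v div int p)" using p_pos by (simp add: minus_mod_eq_mult_div)
    finally have 3: "q i v - of_int (?m i) / of_nat p \<in> \<int>" by simp
    have "q i v - q i (\<Oplus>\<^bsub>V\<^esub>j\<in>{..<r}. ?x j) = (q i v - of_int (?m i) / of_nat p) -
      ((\<Sum>j<r. q i (?x j)) - of_int (?m i) / of_nat p) - (q i (\<Oplus>\<^bsub>V\<^esub>j\<in>{..<r}. ?x j) - (\<Sum>j<r. q i (?x j)))" by simp
    also have "\<dots> \<in> \<int>" by (rule Ints_diff[OF Ints_diff[OF 3 2] sum[OF finite_lessThan i, THEN conjunct2]])
    finally show "q i v - q i (\<Oplus>\<^bsub>V\<^esub>j\<in>{..<r}. ?x j) \<in> \<int>" .
  qed
qed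

end

lemma tensor_map_hom:
  assumes "tensor_product R M N" "tensor_product R M' N'"
    and f: "f \<in> lmod_hom R M M'" and g: "g \<in> lmod_hom R N N'"
  shows "tensor_map R M' N' f g \<in> lmod_hom R (tensor_module R M N) (tensor_module R M' N')"
    and "\<And>x y. x \<in> carrier M ==> y \<in> carrier N ==>
       tensor_map R M' N' f g (tensor R M N x y) = tensor R M' N' (f x) (g y)"
proof -
  interpret S: tensor_product R M N by fact
  interpret S': tensor_product R M' N' by fact
  have id: "id \<in> ring_hom R R" by (auto simp: ring_hom_def)
  note l = S.tensor_lift[OF S.M.ring_R S'.left_module_T id, of "\<lambda>(x, y). tensor R M' N' (f x) (g y)"]
  note c = hom_closed[OF f] hom_closed[OF g] hom_add[OF f] hom_add[OF g] hom_smult[OF f] hom_smult[OF g]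
  show "tensor_map R M' N' f g \<in> lmod_hom R (tensor_module R M N) (tensor_module R M' N')"
    unfolding tensor_map_def lmod_hom_slin
    by (rule l(1)) (simp_all add: c S'.tensor_closed S'.tensor_add_l S'.tensor_add_r S'.tensor_smult_l S'.tensor_smult_r)
  show "tensor_map R M' N' f g (tensor R M N x y) = tensor R M' N' (f x) (g y)" if "x \<in> carrier M" "y \<in> carrier N" for x y
    unfolding tensor_map_def
    by (subst l(2)[OF _ _ _ _ _ that]) (simp_all add: c S'.tensor_closed S'.tensor_add_l S'.tensor_add_r S'.tensor_smult_l S'.tensor_smult_r)
qed

text \<open>Turns pointwise scalar multiplication into a ring product, so that its compatibility
  with the multiplication of kT follows from ring laws.\<close>

lemma scalar_single:
  fixes b :: "'g => 'k::field"
  assumes "group G" "b \<in> carrier (group_algebra G)"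
  shows "(\<lambda>x. d * b x) = single \<one>\<^bsub>G\<^esub> d \<otimes>\<^bsub>group_algebra G\<^esub> b"
proof -
  interpret group G by fact
  from assms(2) show ?thesis
  proof (induction rule: group_algebra_induct)
    case zero thus ?case by (simp add: conv_zero)
  next
    case (add a b)
    have 1: "single \<one>\<^bsub>G\<^esub> d \<otimes>\<^bsub>group_algebra G\<^esub> (a \<oplus>\<^bsub>group_algebra G\<^esub> b) =
      (single \<one>\<^bsub>G\<^esub> d \<otimes>\<^bsub>group_algebra G\<^esub> a) \<oplus>\<^bsub>group_algebra G\<^esub> (single \<one>\<^bsub>G\<^esub> d \<otimes>\<^bsub>group_algebra G\<^esub> b)"
      using add by (intro conv_add_right single_closed) auto
    show ?case unfolding 1 add.IH[symmetric] by (simp add: group_algebra_simps(3) distrib_left)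
  next
    case (single g c) thus ?case by (auto simp: single_mult) (auto simp: single_def)
  qed
qed

text \<open>kT V is at once a module over the prime field and over kT, as two records with the same
  additive structure; sums must be moved between them.\<close>

lemma finsum_eq:
  assumes "abelian_group M" "abelian_group N" "carrier M = carrier N" "add M = add N" "ring.zero M = ring.zero N"
    and "finite A" "f \<in> A \<rightarrow> carrier N"
  shows "finsum M f A = finsum N f A"
proof -
  interpret M: abelian_group M by fact
  interpret N: abelian_group N by fact
  from assms(6,7) show ?thesis
    by (induction A) (use assms(3-5) in \<open>auto simp: M.finsum_insert N.finsum_insert\<close>)
qed

section \<open>The module kT V\<close>

text \<open>The characteristic condition makes kT a module over the prime field, whose scalars are
  integer representatives reduced modulo p after each operation.\<close>

locale kTV_setup = semidirect G T H K + torsion_coordinates G T p r q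
  for G (structure) and T H and K :: "'k::field itself" and p r q +
  assumes char: "CHAR('k) = p"
begin

abbreviation "F \<equiv> prime_field p"
abbreviation A :: "(int, 'a => 'k) module" where "A \<equiv> kT_Fp G T"
abbreviation Q :: "(int, ('a, 'k) kTV) module" where "Q \<equiv> tensor_module F A V"
abbreviation tn :: "('a => 'k) => 'a => ('a, 'k) kTV" where "tn \<equiv> tensor F A V"
abbreviation M :: "('a => 'k, ('a, 'k) kTV) module" where "M \<equiv> kTV_T G T p"
abbreviation act :: "'a => ('a, 'k) kTV => ('a, 'k) kTV" where "act \<equiv> kTV_act G T p"

sublocale kT: cring kT by (rule kT_cring)
sublocale kG: ring kG by (rule kG_ring)

lemma A_simps [simp]: "carrier A = carrier kT" "add A = add kG" "ring.zero A = ring.zero kG"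
  "c \<odot>\<^bsub>A\<^esub> a = (\<lambda>x. of_int c * a x)"
  by (simp_all add: kT_Fp_def Let_def)

lemma of_int_mod: "(of_int (c mod int p) :: 'k) = of_int c"
  using of_int_eq_iff_cong_CHAR[of "c mod int p" c, where ?'a = 'k] char by (simp add: cong_def)

lemma of_int_cong: "[c = d] (mod int p) ==> (of_int c :: 'k) = of_int d"
  using of_int_eq_iff_cong_CHAR[of c d, where ?'a = 'k] char by simp

lemma scalar_kT: "a \<in> carrier kT ==> (\<lambda>x. d * a x) = single \<one> d \<otimes>\<^bsub>kG\<^esub> a"
  by (rule scalar_single[OF is_group kT_kG])

lemma single_one_closed: "single \<one> d \<in> carrier kT" by (rule single_closed_T) simp

lemma scalar_closed: "a \<in> carrier kT ==> (\<lambda>x. d * a x) \<in> carrier kT"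
  unfolding scalar_kT using kT.m_closed[OF single_one_closed] by simp

lemma kT_mult_closed: "a \<in> carrier kT ==> b \<in> carrier kT ==> a \<otimes>\<^bsub>kG\<^esub> b \<in> carrier kT"
  using kT.m_closed by simp
lemma kT_add_closed: "a \<in> carrier kT ==> b \<in> carrier kT ==> a \<oplus>\<^bsub>kG\<^esub> b \<in> carrier kT"
  using kT.a_closed by simp

lemma scalar_mult: "a \<in> carrier kT ==> b \<in> carrier kT ==> a \<otimes>\<^bsub>kG\<^esub> (\<lambda>x. d * b x) = (\<lambda>x. d * (a \<otimes>\<^bsub>kG\<^esub> b) x)"
  using kT.m_lcomm[of a "single \<one> d" b] single_one_closed by (simp add: scalar_kT kT_mult_closed)

lemma A_left_module: "left_module F A"
proof (rule left_moduleI[OF F_ring])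
  show "abelian_group A"
  proof (rule abelian_groupI', goal_cases)
    case (6 x) thus ?case using kT.l_neg[of x] kT.a_inv_closed[of x] by auto
  qed (use kT.a_assoc kT.a_comm kT.a_closed kT.zero_closed kT.l_zero in auto)
  show "a \<odot>\<^bsub>A\<^esub> x \<in> carrier A" if "x \<in> carrier A" for a x using that scalar_closed by simp
qed (auto simp: F_simps of_int_mod group_algebra_simps(3) algebra_simps)

sublocale tp: tensor_product F A V
  by (intro tensor_product.intro A_left_module V_left_module)

lemma M_simps [simp]: "carrier M = carrier Q" "add M = add Q" "ring.zero M = ring.zero Q"
  by (simp_all add: kTV_T_def Let_def)

lemma mult_hom: "a \<in> carrier kT ==> (\<lambda>b. a \<otimes>\<^bsub>kG\<^esub> b) \<in> lmod_hom F A A"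
  by (intro lmod_homI) (auto simp: kT_mult_closed conv_add_right kT_kG scalar_mult)

lemma M_smult_hom: "a \<in> carrier kT ==> (\<lambda>x. a \<odot>\<^bsub>M\<^esub> x) \<in> lmod_hom F Q Q"
  using tensor_map_hom(1)[OF tp.tensor_product_axioms tp.tensor_product_axioms mult_hom lmod_hom_id, of a]
  by (simp add: kTV_T_def Let_def id_def)

lemma M_smult_tn: "a \<in> carrier kT ==> b \<in> carrier kT ==> v \<in> carrier V ==> a \<odot>\<^bsub>M\<^esub> tn b v = tn (a \<otimes>\<^bsub>kG\<^esub> b) v"
  using tensor_map_hom(2)[OF tp.tensor_product_axioms tp.tensor_product_axioms mult_hom lmod_hom_id, of a b v]
  by (simp add: kTV_T_def Let_def id_def)

lemma tn_closed: "b \<in> carrier kT ==> v \<in> carrier V ==> tn b v \<in> carrier Q"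
  using tp.tensor_closed by simp

lemma tn_add_l: "a \<in> carrier kT ==> b \<in> carrier kT ==> v \<in> carrier V ==> tn (a \<oplus>\<^bsub>kG\<^esub> b) v = tn a v \<oplus>\<^bsub>Q\<^esub> tn b v"
  using tp.tensor_add_l by simp

lemma M_smult_closed: "a \<in> carrier kT ==> x \<in> carrier Q ==> a \<odot>\<^bsub>M\<^esub> x \<in> carrier Q"
  using hom_closed[OF M_smult_hom] .
lemma M_smult_add: "a \<in> carrier kT ==> x \<in> carrier Q ==> y \<in> carrier Q ==>
   a \<odot>\<^bsub>M\<^esub> (x \<oplus>\<^bsub>Q\<^esub> y) = a \<odot>\<^bsub>M\<^esub> x \<oplus>\<^bsub>Q\<^esub> a \<odot>\<^bsub>M\<^esub> y"
  using hom_add[OF M_smult_hom] .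

sublocale Q: left_module F Q by (rule tp.left_module_T)

lemma Q_induct [consumes 1, case_names tensor add]:
  assumes "z \<in> carrier Q" "\<And>b v. b \<in> carrier kT ==> v \<in> carrier V ==> P (tn b v)"
    "\<And>x y. x \<in> carrier Q ==> y \<in> carrier Q ==> P x ==> P y ==> P (x \<oplus>\<^bsub>Q\<^esub> y)"
  shows "P z"
  using assms(1) by (rule tp.tensor_induct) (use assms(2,3) in auto)

lemma M_left_module: "left_module kT M"
proof (rule left_moduleI[OF kT_ring])
  show "abelian_group M"
    by (rule abelian_groupI') (auto simp: Q.M.a_ac intro: bexI[of _ "\<ominus>\<^bsub>Q\<^esub> _"] Q.M.l_neg)
  fix a b x y assume a: "a \<in> carrier kT"
  show "a \<odot>\<^bsub>M\<^esub> x \<in> carrier M" if "x \<in> carrier M" using M_smult_closed[OF a] that by simp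
  show "a \<odot>\<^bsub>M\<^esub> (x \<oplus>\<^bsub>M\<^esub> y) = a \<odot>\<^bsub>M\<^esub> x \<oplus>\<^bsub>M\<^esub> a \<odot>\<^bsub>M\<^esub> y" if "x \<in> carrier M" "y \<in> carrier M"
    using M_smult_add[OF a] that by simp
  assume b: "b \<in> carrier kT"
  show "(a \<oplus>\<^bsub>kT\<^esub> b) \<odot>\<^bsub>M\<^esub> x = a \<odot>\<^bsub>M\<^esub> x \<oplus>\<^bsub>M\<^esub> b \<odot>\<^bsub>M\<^esub> x" if x: "x \<in> carrier M"
    using x[unfolded M_simps]
  proof (induction rule: Q_induct)
    case (tensor c v)
    thus ?case using a b by (simp add: M_smult_tn kT_add_closed conv_add_left kT_kG tn_add_l kT_mult_closed)
  next
    case (add x y)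
    thus ?case using a b by (simp add: M_smult_add kT_add_closed M_smult_closed Q.M.a_ac)
  qed
  show "(a \<otimes>\<^bsub>kT\<^esub> b) \<odot>\<^bsub>M\<^esub> x = a \<odot>\<^bsub>M\<^esub> (b \<odot>\<^bsub>M\<^esub> x)" if x: "x \<in> carrier M"
    using x[unfolded M_simps]
  proof (induction rule: Q_induct)
    case (tensor c v)
    thus ?case using a b kT.m_assoc[OF a b] by (simp add: M_smult_tn kT_mult_closed)
  next
    case (add x y)
    thus ?case using a b by (simp add: M_smult_add kT_mult_closed M_smult_closed)
  qed
next
  show "\<one>\<^bsub>kT\<^esub> \<odot>\<^bsub>M\<^esub> x = x" if x: "x \<in> carrier M" for x
    using x[unfolded M_simps]
  proof (induction rule: Q_induct)
    case (tensor c v)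
    thus ?case using kT.one_closed kT.l_one by (simp add: M_smult_tn)
  next
    case (add x y)
    thus ?case using kT.one_closed by (simp add: M_smult_add)
  qed
qed

lemma conj_hom_group: "h \<in> carrier G ==> conj_act G h \<in> hom G G"
  by (auto simp: hom_def conj_closed_G conj_mult)

lemma conj_torsion: "h \<in> carrier G ==> t \<in> torsion G T p n ==> conj_act G h t \<in> torsion G T p n"
proof -
  assume h: "h \<in> carrier G" and t: "t \<in> torsion G T p n"
  note tT = torsion_T[OF t]
  have "conj_act G h t [^] (p ^ n) = conj_act G h (t [^] (p ^ n))"
    using hom_nat_pow[OF conj_hom_group[OF h] T_carrier[OF tT] is_group is_group] by simp
  also have "\<dots> = \<one>" using t h by (simp add: torsion_def conj_act_def)
  finally show ?thesis using conj_closed[OF h tT] by (simp add: torsion_def)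
qed

lemma conj_V: "h \<in> carrier G ==> conj_act G h \<in> lmod_hom F V V"
  using conj_torsion[of h _ 1] hom_int_pow[OF conj_hom_group _ is_group is_group, of h]
  by (intro lmod_homI) (auto simp: conj_mult V_carrier)

lemma alg_conj_A: "h \<in> carrier G ==> alg_conj G h \<in> lmod_hom F A A"
proof (rule lmod_homI)
  show "alg_conj G h (a \<odot>\<^bsub>A\<^esub> x) = a \<odot>\<^bsub>A\<^esub> alg_conj G h x" for a x by (auto simp: alg_conj_def)
qed (simp_all add: alg_conj_closed alg_conj_add)

lemma act_hom: "h \<in> H ==> act h \<in> lmod_hom F Q Q"
  unfolding kTV_act_def
  by (intro tensor_map_hom(1) tp.tensor_product_axioms alg_conj_A conj_V H_carrier)

lemma act_tn: "h \<in> H ==> b \<in> carrier kT ==> v \<in> carrier V ==> act h (tn b v) = tn (alg_conj G h b) (conj_act G h v)"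
  unfolding kTV_act_def
  using tensor_map_hom(2)[OF tp.tensor_product_axioms tp.tensor_product_axioms alg_conj_A conj_V, of h h b v] H_carrier by simp

lemma act_closed: "h \<in> H ==> x \<in> carrier Q ==> act h x \<in> carrier Q"
  using hom_closed[OF act_hom] .

lemma alg_conj_mult: "h \<in> H ==> a \<in> carrier kT ==> b \<in> carrier kT ==>
   alg_conj G h (a \<otimes>\<^bsub>kG\<^esub> b) = alg_conj G h a \<otimes>\<^bsub>kG\<^esub> alg_conj G h b"
  using ring_hom_mult[OF alg_conj_ring_hom[OF H_carrier]] by simp

lemma conj_V_closed: "h \<in> H ==> v \<in> carrier V ==> conj_act G h v \<in> carrier V"
  using hom_closed[OF conj_V[OF H_carrier]] .

sublocale MA: semidirect_action G T H K M act
proof (intro semidirect_action.intro semidirect_action_axioms.intro)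
  show "semidirect G T H" by (rule semidirect_axioms)
  show "left_module kT M" by (rule M_left_module)
  show "act h \<in> slin (alg_conj G h) kT M M" if h: "h \<in> H" for h
  proof -
    have "act h (a \<odot>\<^bsub>M\<^esub> x) = alg_conj G h a \<odot>\<^bsub>M\<^esub> act h x" if a: "a \<in> carrier kT" and x: "x \<in> carrier Q" for a x
      using x
    proof (induction rule: Q_induct)
      case (tensor c v)
      thus ?case using a h conj_V_closed[OF h]
        by (simp add: M_smult_tn act_tn kT_mult_closed alg_conj_mult alg_conj_closed H_carrier)
    next
      case (add x y)
      thus ?case using a h by (simp add: M_smult_add hom_add[OF act_hom] M_smult_closed act_closed alg_conj_closed H_carrier)
    qed
    thus ?thesis using hom_add[OF act_hom[OF h]] act_closed[OF h] by (auto simp: slin_def additive_map_def)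
  qed
  show "act \<one> x = x" if "x \<in> carrier M" for x
    using that[unfolded M_simps]
  proof (induction rule: Q_induct)
    case (tensor c v)
    thus ?case using act_tn[of \<one> c v] V_carrier by (simp add: alg_conj_one conj_one)
  next
    case (add x y) thus ?case by (simp add: hom_add[OF act_hom])
  qed
  show "act (h \<otimes> h') x = act h (act h' x)" if hh: "h \<in> H" "h' \<in> H" and x: "x \<in> carrier M" for h h' x
    using x[unfolded M_simps]
  proof (induction rule: Q_induct)
    case (tensor c v)
    thus ?case using hh conj_V_closed[OF hh(2)] V_carrier
      by (simp add: act_tn alg_conj_closed H_carrier alg_conj_conj conj_conj)
  next
    case (add x y) thus ?case using hh by (simp add: hom_add[OF act_hom] act_closed)
  qed
qed

section \<open>A basis of kT V and its coordinate forms\<close>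

definition e :: "nat => ('a, 'k) kTV" where "e j = tn \<one>\<^bsub>kG\<^esub> (sg 1 j)"

text \<open>The i-th coordinate form, sending a \<otimes> v to the i-th coordinate of v over the
  prime field times a.\<close>

definition e' :: "nat => ('a, 'k) kTV => 'a => 'k"
  where "e' i = induced_map F id A (\<lambda>(a, v) x. of_int (mu 1 i v) * a x)"

lemma mu_V_add: "i < r ==> v \<in> carrier V ==> v' \<in> carrier V ==> (of_int (mu 1 i (v \<otimes> v')) :: 'k) = of_int (mu 1 i v) + of_int (mu 1 i v')"
  using of_int_cong[OF mu_add[of i v v' 1]] torsion_T by simp

lemma mu_V_one: "i < r ==> (of_int (mu 1 i \<one>) :: 'k) = 0"
  using of_int_cong[OF mu_one[of i 1]] by simp

lemma mu_V_pow: "i < r ==> v \<in> carrier V ==> 0 \<le> c ==> (of_int (mu 1 i (v [^] c)) :: 'k) = of_int c * of_int (mu 1 i v)"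
proof -
  assume i: "i < r" and v: "v \<in> carrier V" and c: "0 \<le> c"
  have "v [^] n \<in> carrier V \<and> (of_int (mu 1 i (v [^] n)) :: 'k) = of_nat n * of_int (mu 1 i v)" for n :: nat
  proof (induction n)
    case 0 thus ?case using mu_V_one[OF i] torsion_one by simp
  next
    case (Suc n)
    hence vn: "v [^] n \<in> carrier V" by simp
    show ?case using mu_V_add[OF i vn v] Suc v torsion_mult[of "v [^] n" 1 v] by (simp add: algebra_simps)
  qed
  from this[of "nat c"] show ?thesis using c by (metis int_nat_eq int_pow_int of_int_of_nat_eq)
qed

context
  fixes i assumes i: "i < r"
begin

lemma e'_lift:
  "e' i \<in> lmod_hom F Q A" "\<And>b v. b \<in> carrier kT ==> v \<in> carrier V ==> e' i (tn b v) = (\<lambda>x. of_int (mu 1 i v) * b x)"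
proof -
  have id: "id \<in> ring_hom F F" by (auto simp: ring_hom_def)
  note l = tp.tensor_lift[OF F_ring A_left_module id, of "\<lambda>(a, v) x. of_int (mu 1 i v) * a x"]
  show "e' i \<in> lmod_hom F Q A" unfolding e'_def lmod_hom_slin
    by (rule l(1)) (use mu_V_add[OF i] mu_V_pow[OF i] in \<open>auto simp: scalar_closed group_algebra_simps(3) F_simps distrib_left distrib_right mult.assoc mult.left_commute\<close>)
  show "e' i (tn b v) = (\<lambda>x. of_int (mu 1 i v) * b x)" if "b \<in> carrier kT" "v \<in> carrier V" for b v
    unfolding e'_def
    by (subst l(2)) (use that mu_V_add[OF i] mu_V_pow[OF i] in \<open>auto simp: scalar_closed group_algebra_simps(3) F_simps distrib_left distrib_right mult.assoc mult.left_commute\<close>)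
qed

lemma e'_closed: "x \<in> carrier Q ==> e' i x \<in> carrier kT"
  using hom_closed[OF e'_lift(1)] by simp

lemma e'_add: "x \<in> carrier Q ==> y \<in> carrier Q ==> e' i (x \<oplus>\<^bsub>Q\<^esub> y) = e' i x \<oplus>\<^bsub>kG\<^esub> e' i y"
  using hom_add[OF e'_lift(1)] by simp

lemma e'_hom: "e' i \<in> lmod_hom kT M (regular kT)"
proof (rule lmod_homI)
  show "e' i (a \<odot>\<^bsub>M\<^esub> x) = a \<odot>\<^bsub>regular kT\<^esub> e' i x" if a: "a \<in> carrier kT" and x: "x \<in> carrier M" for a x
    using x[unfolded M_simps]
  proof (induction rule: Q_induct)
    case (tensor c v)
    thus ?case using a by (simp add: M_smult_tn e'_lift(2) kT_mult_closed scalar_mult)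
  next
    case (add x y)
    thus ?case using a by (simp add: M_smult_add e'_add M_smult_closed conv_add_right e'_closed kT_kG)
  qed
qed (auto simp: e'_closed e'_add)

end

lemma e_closed: "e j \<in> carrier M"
  using tn_closed[OF kT.one_closed, of "sg 1 j"] sg_torsion by (simp add: e_def)

text \<open>For a pure tensor the expansion of v in V is carried over, the residue coefficients
  moving through the tensor sign into kT.\<close>

lemma M_basis: "x \<in> carrier M ==> x = (\<Oplus>\<^bsub>M\<^esub>j\<in>{..<r}. e' j x \<odot>\<^bsub>M\<^esub> e j)"
proof -
  assume "x \<in> carrier M"
  hence "x \<in> carrier Q" by simp
  thus ?thesis
  proof (induction rule: Q_induct)
    case (tensor b v)
    let ?c = "\<lambda>j. mu 1 j v mod int p"
    have s: "sg 1 j \<in> carrier V" for j using sg_torsion by simp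
    have c: "?c j \<in> carrier F" for j using p_pos by (simp add: F_simps)
    have hom: "(\<lambda>v. tn b v) \<in> lmod_hom F V Q"
      using tensor tp.tensor_closed tp.tensor_add_r tp.tensor_smult_r by (intro lmod_homI) auto
    have cs: "(\<lambda>j. ?c j \<odot>\<^bsub>V\<^esub> sg 1 j) \<in> {..<r} \<rightarrow> carrier V"
      using V_pow_closed[OF sg_torsion] by simp
    have "tn b v = tn b (\<Oplus>\<^bsub>V\<^esub>j\<in>{..<r}. ?c j \<odot>\<^bsub>V\<^esub> sg 1 j)" using V_basis[of v] tensor by simp
    also have "\<dots> = (\<Oplus>\<^bsub>Q\<^esub>j\<in>{..<r}. tn b (?c j \<odot>\<^bsub>V\<^esub> sg 1 j))"
      by (rule hom_finsum[OF V_left_module Q.left_module hom _ cs]) simp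
    \<comment> \<open>So far the sum was formed over the prime field, since only there the map v
      \<mapsto> b \<otimes> v is linear.\<close>
    also have "\<dots> = (\<Oplus>\<^bsub>M\<^esub>j\<in>{..<r}. tn b (?c j \<odot>\<^bsub>V\<^esub> sg 1 j))"
      using tp.tensor_closed cs tensor by (intro finsum_eq[symmetric] MA.M.ab Q.ab) auto
    also have "\<dots> = (\<Oplus>\<^bsub>M\<^esub>j\<in>{..<r}. e' j (tn b v) \<odot>\<^bsub>M\<^esub> e j)"
    proof (intro MA.M.M.finsum_cong')
      fix j assume j: "j \<in> {..<r}"
      have "tn b (?c j \<odot>\<^bsub>V\<^esub> sg 1 j) = tn (?c j \<odot>\<^bsub>A\<^esub> b) (sg 1 j)"
        using tp.tensor_smult_l[OF c, of b "sg 1 j"] tp.tensor_smult_r[OF c, of b "sg 1 j"] tensor s by simp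
      also have "?c j \<odot>\<^bsub>A\<^esub> b = e' j (tn b v) \<otimes>\<^bsub>kG\<^esub> \<one>\<^bsub>kG\<^esub>"
        using j tensor kT.r_one[OF scalar_closed] by (simp add: e'_lift(2) of_int_mod)
      also have "tn \<dots> (sg 1 j) = e' j (tn b v) \<odot>\<^bsub>M\<^esub> e j"
        unfolding e_def using j tensor kT.one_closed s by (subst M_smult_tn) (auto intro!: e'_closed tn_closed)
      finally show "tn b (?c j \<odot>\<^bsub>V\<^esub> sg 1 j) = e' j (tn b v) \<odot>\<^bsub>M\<^esub> e j" .
    next
      have "e' j (tn b v) \<odot>\<^bsub>M\<^esub> e j \<in> carrier M" if "j < r" for j
        using that tensor e_closed by (intro MA.M.smult_closed e'_closed tn_closed) auto
      thus "(\<lambda>j. e' j (tn b v) \<odot>\<^bsub>M\<^esub> e j) \<in> {..<r} \<rightarrow> carrier M" by auto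
    qed simp
    finally show ?case .
  next
    case (add x y)
    have cl: "e' j z \<odot>\<^bsub>M\<^esub> e j \<in> carrier M" if "j < r" "z \<in> carrier Q" for j z
      using that e_closed by (intro MA.M.smult_closed e'_closed) auto
    have "x \<oplus>\<^bsub>Q\<^esub> y = x \<oplus>\<^bsub>M\<^esub> y" by simp
    also have "\<dots> = (\<Oplus>\<^bsub>M\<^esub>j\<in>{..<r}. e' j x \<odot>\<^bsub>M\<^esub> e j) \<oplus>\<^bsub>M\<^esub> (\<Oplus>\<^bsub>M\<^esub>j\<in>{..<r}. e' j y \<odot>\<^bsub>M\<^esub> e j)"
      using add.IH by simp
    also have "\<dots> = (\<Oplus>\<^bsub>M\<^esub>j\<in>{..<r}. e' j x \<odot>\<^bsub>M\<^esub> e j \<oplus>\<^bsub>M\<^esub> e' j y \<odot>\<^bsub>M\<^esub> e j)"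
      using cl add.hyps by (intro MA.M.M.finsum_addf[symmetric]) auto
    also have "\<dots> = (\<Oplus>\<^bsub>M\<^esub>j\<in>{..<r}. e' j (x \<oplus>\<^bsub>Q\<^esub> y) \<odot>\<^bsub>M\<^esub> e j)"
      using cl add.hyps MA.M.smult_l_distr[OF e'_closed e'_closed e_closed]
      by (intro MA.M.M.finsum_cong') (auto simp: e'_add)
    finally show ?case .
  qed
qed

lemma e'_e: "i < r ==> j < r ==> e' i (e j) = (if i = j then \<one>\<^bsub>kT\<^esub> else \<zero>\<^bsub>kT\<^esub>)"
  using of_int_cong[OF mu_sg[of i 1 j]] kT.one_closed sg_torsion[of 1 j]
  by (auto simp: e_def e'_lift(2) group_algebra_simps(4))

sublocale EX: exterior_basis kT M r e e'
  by (intro exterior_basis.intro exterior.intro exterior_basis_axioms.intro M_left_module kT_cring e_closed e'_hom e'_e M_basis)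

end

section \<open>Nakayama's lemma for nilpotent generators\<close>

context cring begin

lemma regular_module: "left_module R (regular R)"
  by (rule regular_left_module) (rule ring_axioms)

text \<open>The geometric series: v (1 - z) = 1 - z^n with v the sum of the powers below n.\<close>

lemma one_minus_nilpotent:
  assumes z: "z \<in> carrier R" "z [^] (q :: nat) = \<zero>" shows "\<one> \<ominus> z \<in> Units R"
proof -
  have "\<exists>v\<in>carrier R. v \<otimes> (\<one> \<ominus> z) = \<one> \<ominus> z [^] n" for n :: nat
  proof (induction n)
    case 0 show ?case using z by (intro bexI[of _ \<zero>]) (auto simp: a_minus_def r_neg)
  next
    case (Suc n)
    then obtain v where v: "v \<in> carrier R" "v \<otimes> (\<one> \<ominus> z) = \<one> \<ominus> z [^] n" by blast
    have "(v \<oplus> z [^] n) \<otimes> (\<one> \<ominus> z) = (\<one> \<ominus> z [^] n) \<oplus> z [^] n \<otimes> (\<one> \<ominus> z)"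
      using v z by (simp add: l_distr)
    also have "\<dots> = \<one> \<ominus> z [^] Suc n" using z by (simp add: a_minus_def r_distr r_minus a_assoc) (simp add: a_assoc[symmetric] l_neg)
    finally show ?case using v z by (intro bexI[of _ "v \<oplus> z [^] n"]) auto
  qed
  from this[of q] obtain v where v: "v \<in> carrier R" "v \<otimes> (\<one> \<ominus> z) = \<one>" using z by (auto simp: a_minus_def)
  moreover have "(\<one> \<ominus> z) \<otimes> v = \<one>" using v z by (simp add: m_comm)
  ultimately show ?thesis using z unfolding Units_def by auto
qed

text \<open>A statement about 1 - b alone would not pass to sums. The elements b for which w - s b
  is a unit, for all units w and all s, are closed under addition and scalars.\<close>

lemma unit_minus_span_nilpotent:
  assumes X: "X \<subseteq> carrier R" "\<And>x. x \<in> X ==> \<exists>q::nat. x [^] q = \<zero>"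
    and b: "b \<in> submodule_span R (regular R) X"
  shows "\<one> \<ominus> b \<in> Units R"
proof -
  interpret M: left_module R "regular R" by (rule regular_module)
  have Xr: "X \<subseteq> carrier (regular R)" using X by simp
  \<comment> \<open>For a sum x + y, the unit w - s x takes the role of w for y.\<close>
  from b Xr have "\<forall>s\<in>carrier R. \<forall>w\<in>Units R. w \<ominus> s \<otimes> b \<in> Units R"
  proof (induction rule: M.span_induct)
    case (base x)
    then obtain q :: nat where x: "x \<in> carrier R" "x [^] q = \<zero>" using X by blast
    show ?case
    proof (intro ballI)
      fix s w assume s: "s \<in> carrier R" and w: "w \<in> Units R"
      let ?z = "(inv w \<otimes> s) \<otimes> x"
      have wi: "w \<in> carrier R" "inv w \<in> carrier R" using w by auto
      have "?z [^] q = \<zero>" using s wi x by (simp add: nat_pow_distrib)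
      hence u: "\<one> \<ominus> ?z \<in> Units R" using s wi x by (intro one_minus_nilpotent) auto
      have "w \<otimes> (\<one> \<ominus> ?z) = w \<ominus> (w \<otimes> inv w) \<otimes> (s \<otimes> x)" using s wi x by (simp add: a_minus_def r_distr r_minus m_assoc)
      also have "\<dots> = w \<ominus> s \<otimes> x" using s w x by simp
      finally show "w \<ominus> s \<otimes> x \<in> Units R" using Units_m_closed[OF w u] by simp
    qed
  next
    case zero show ?case by (auto simp: a_minus_def Units_closed)
  next
    case (add x y)
    have eq: "w \<ominus> s \<otimes> (x \<oplus> y) = (w \<ominus> s \<otimes> x) \<ominus> s \<otimes> y" if "s \<in> carrier R" "w \<in> carrier R" for s w
      using that add by (simp add: a_minus_def r_distr minus_add a_assoc)
    show ?case
    proof (intro ballI)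
      fix s w assume s: "s \<in> carrier R" and w: "w \<in> Units R"
      have "w \<ominus> s \<otimes> x \<in> Units R" using add.IH(1) s w by blast
      hence "(w \<ominus> s \<otimes> x) \<ominus> s \<otimes> y \<in> Units R" using add.IH(2) s by blast
      moreover have "w \<ominus> s \<otimes> (x \<oplus> y) = (w \<ominus> s \<otimes> x) \<ominus> s \<otimes> y"
        using eq[OF s Units_closed[OF w]] .
      ultimately show "w \<ominus> s \<otimes> (x \<oplus>\<^bsub>regular R\<^esub> y) \<in> Units R" by simp
    qed
  next
    case (smult a x)
    thus ?case by (auto simp: m_assoc[symmetric])
  qed
  from this[rule_format, of \<one> \<one>] show ?thesis using M.submodule_props(1)[OF M.span_submodule[OF Xr]] b by auto
qed

text \<open>The generators in \<open>X\<close> are eliminated one at a time.\<close>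

lemma nakayama_finite:
  assumes J: "submodule J R (regular R)" and X: "finite X" "X \<subseteq> carrier R"
    and unit: "\<And>b. b \<in> submodule_span R (regular R) X ==> \<one> \<ominus> b \<in> Units R"
    and hyp: "\<And>x. x \<in> X ==> x \<in> submodule_span R (regular R)
       (J \<union> {a \<otimes> b | a b. a \<in> submodule_span R (regular R) X \<and> b \<in> X})"
  shows "X \<subseteq> J"
proof -
  interpret M: left_module R "regular R" by (rule regular_module)
  define A where "A = submodule_span R (regular R) X"
  define L where "L Y = submodule_span R (regular R) (J \<union> Y)" for Y
  have Jc: "J \<subseteq> carrier R" using M.submodule_props(1)[OF J] by simp
  have A: "submodule A R (regular R)" unfolding A_def by (rule M.span_submodule) (use X in simp)
  note Ap = M.submodule_props[OF A, simplified]
  have Ls: "submodule (L Y) R (regular R)" if "Y \<subseteq> X" for Y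
    unfolding L_def using Jc X that by (intro M.span_submodule) auto
  have Lincl: "J \<union> Y \<subseteq> L Y" for Y unfolding L_def by (rule M.span_incl)
  have Lleast: "L Y \<subseteq> N" if "submodule N R (regular R)" "J \<union> Y \<subseteq> N" for N Y
    using that unfolding L_def submodule_span_def by blast
  \<comment> \<open>With A the span of X, the hypothesis yields y = l + c y with l in
    \<open>L Y\<close> and c in A, so that y = (1 - c)^-1 l is redundant as a generator.\<close>
  have step: "X \<subseteq> L Y" if y: "y \<in> X" and Y: "Y \<subseteq> X" and XL: "X \<subseteq> L (insert y Y)" for y Y
  proof -
    note Lp = M.submodule_props[OF Ls[OF Y], simplified]
    have yc: "y \<in> carrier R" using X y by auto
    \<comment> \<open>\<open>L Y\<close> + A y, the submodule into which A carries everything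
      generated by J, Y and y.\<close>
    define B where "B = {l \<oplus> c \<otimes> y | l c. l \<in> L Y \<and> c \<in> A}"
    have LB: "L Y \<subseteq> B"
    proof
      fix l assume "l \<in> L Y"
      thus "l \<in> B" unfolding B_def using Lp(1) yc Ap(2) by (intro CollectI exI[of _ l] exI[of _ \<zero>]) auto
    qed
    have B: "submodule B R (regular R)"
    proof (rule M.submoduleI; simp)
      show "B \<subseteq> carrier R" using Lp(1) Ap(1) yc by (auto simp: B_def)
      show "\<zero> \<in> B" using LB Lp(2) by auto
      show "x \<oplus> x' \<in> B" if x: "x \<in> B" "x' \<in> B" for x x'
      proof -
        obtain l c l' c' where *: "x = l \<oplus> c \<otimes> y" "x' = l' \<oplus> c' \<otimes> y" "l \<in> L Y" "l' \<in> L Y" "c \<in> A" "c' \<in> A"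
          using x by (auto simp: B_def)
        hence "l \<in> carrier R" "l' \<in> carrier R" "c \<in> carrier R" "c' \<in> carrier R" using Lp(1) Ap(1) by auto
        hence "x \<oplus> x' = (l \<oplus> l') \<oplus> (c \<oplus> c') \<otimes> y" using yc unfolding * by (simp add: l_distr a_ac)
        thus ?thesis unfolding B_def using * Lp(3) Ap(3) by blast
      qed
      show "a \<otimes> x \<in> B" if a: "a \<in> carrier R" and x: "x \<in> B" for a x
      proof -
        obtain l c where *: "x = l \<oplus> c \<otimes> y" "l \<in> L Y" "c \<in> A" using x by (auto simp: B_def)
        hence "l \<in> carrier R" "c \<in> carrier R" using Lp(1) Ap(1) by auto
        hence "a \<otimes> x = a \<otimes> l \<oplus> (a \<otimes> c) \<otimes> y" using yc a unfolding * by (simp add: r_distr m_assoc)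
        thus ?thesis unfolding B_def using * a Lp(6) Ap(6) by blast
      qed
    qed
    note Bp = M.submodule_props[OF B, simplified]
    \<comment> \<open>An element of A either multiplies \<open>L Y\<close> into itself or puts y
      into A y; this is the reason for allowing only coefficients from A in front of y.\<close>
    have AB: "a \<otimes> x \<in> B" if a: "a \<in> A" and x: "x \<in> L (insert y Y)" for a x
    proof -
      have ac: "a \<in> carrier R" using a Ap(1) by auto
      have sub: "J \<union> insert y Y \<subseteq> carrier (regular R)" using Jc X Y yc by auto
      from x[unfolded L_def] sub show ?thesis
      proof (induction rule: M.span_induct)
        case (base x)
        show ?case
        proof (cases "x = y")
          case True
          show ?thesis unfolding B_def True using a ac yc Lp(2) by (intro CollectI exI[of _ \<zero>] exI[of _ a]) auto
        next
          case False
          hence "x \<in> L Y" using base Lincl[of Y] by auto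
          thus ?thesis using Lp(6) ac LB by auto
        qed
      next
        case zero thus ?case using ac Bp(2) by simp
      next
        case (add x z) thus ?case using ac Bp(3) by (simp add: r_distr)
      next
        case (smult c x)
        hence "c \<otimes> (a \<otimes> x) \<in> B" using Bp(6) by simp
        thus ?case using smult ac by (simp add: m_lcomm)
      qed
    qed
    have "submodule_span R (regular R) (J \<union> {a \<otimes> b | a b. a \<in> A \<and> b \<in> X}) \<subseteq> B"
    proof -
      have "J \<union> {a \<otimes> b | a b. a \<in> A \<and> b \<in> X} \<subseteq> B" using AB XL LB Lincl[of Y] by blast
      thus ?thesis using B unfolding submodule_span_def by blast
    qed
    hence "y \<in> B" using hyp[OF y] unfolding A_def by blast
    then obtain l c where lc: "y = l \<oplus> c \<otimes> y" "l \<in> L Y" "c \<in> A" by (auto simp: B_def)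
    have cl: "l \<in> carrier R" "c \<in> carrier R" using lc Lp(1) Ap(1) by auto
    have u: "\<one> \<ominus> c \<in> Units R" using unit lc(3) by (simp add: A_def)
    have "(\<one> \<ominus> c) \<otimes> y = y \<ominus> c \<otimes> y" using cl yc by (simp add: a_minus_def l_distr l_minus)
    also have "\<dots> = (l \<oplus> c \<otimes> y) \<ominus> c \<otimes> y" using lc(1) by simp
    also have "\<dots> = l" using cl yc by (simp add: a_minus_def a_assoc r_neg)
    finally have "inv (\<one> \<ominus> c) \<otimes> l = y" using u yc by (metis Units_closed Units_inv_closed Units_l_inv l_one m_assoc)
    hence "y \<in> L Y" using Lp(6)[OF Units_inv_closed[OF u] lc(2)] by simp
    hence "L (insert y Y) \<subseteq> L Y" using Lincl[of Y] by (intro Lleast[OF Ls[OF Y]]) auto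
    thus ?thesis using XL by blast
  qed
  \<comment> \<open>Remove the members of a finite D one by one; with D all of X only J
    remains.\<close>
  have "X \<subseteq> L (X - D)" if "finite D" "D \<subseteq> X" for D
    using that
  proof (induction D)
    case empty thus ?case using Lincl[of X] by auto
  next
    case (insert y D)
    have "X - D = insert y (X - insert y D)" using insert by auto
    thus ?case using step[of y "X - insert y D"] insert by auto
  qed
  from this[OF X(1) order_refl] have "X \<subseteq> L {}" by simp
  thus ?thesis using Lleast[OF J, of "{}"] by auto
qed

end

section \<open>The maps phi and psi\<close>

lemma (in abelian_group) minus_unique: "x \<in> carrier G ==> y \<in> carrier G ==> z \<in> carrier G ==> z \<oplus> y = x ==> x \<ominus> y = z"
  by (auto simp: a_minus_def a_assoc r_neg)

lemma group_algebra_minus: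
  assumes "a \<in> carrier (group_algebra G)" "b \<in> carrier (group_algebra G)"
  shows "a \<ominus>\<^bsub>group_algebra G\<^esub> b = (\<lambda>x. a x - b x)"
proof -
  interpret k: abelian_group "group_algebra G" by (rule group_algebra_abelian_group)
  have nb: "(\<lambda>x. - b x) \<in> carrier (group_algebra G)" using assms by (simp add: group_algebra_simps(1))
  have "a \<oplus>\<^bsub>group_algebra G\<^esub> (\<lambda>x. - b x) \<in> carrier (group_algebra G)" by (rule k.a_closed[OF assms(1) nb])
  thus ?thesis using assms by (intro k.minus_unique) (auto simp: group_algebra_simps(3))
qed

context kTV_setup begin

abbreviation "Tn n \<equiv> torsion G T p n"
abbreviation kTn :: "nat => ('a => 'k) ring" where "kTn n \<equiv> subgroup_algebra G (Tn n)"
abbreviation In :: "nat => ('a => 'k) set" where "In n \<equiv> augmentation_ideal (G\<lparr>carrier := Tn n\<rparr>)"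
abbreviation IT :: "('a => 'k) set" where "IT \<equiv> augmentation_ideal (G\<lparr>carrier := T\<rparr>)"
definition dl :: "'a => 'a => 'k" where "dl t = (\<lambda>x. single t 1 x - single \<one> 1 x)"

lemma Tn_sub: "Tn n \<subseteq> T" by (auto dest: torsion_T)

lemma kTn_kT: "a \<in> carrier (kTn n) ==> a \<in> carrier kT"
  using subgroup_algebra_mono[OF Tn_sub] by blast

lemma kTn_mono: "m \<le> n ==> a \<in> carrier (kTn m) ==> a \<in> carrier (kTn n)"
  using subgroup_algebra_mono[OF torsion_mono] by blast

lemma IT_iff: "a \<in> IT \<longleftrightarrow> a \<in> carrier kT \<and> augmentation a = 0" by (simp add: augmentation_ideal_def)
lemma In_iff: "a \<in> In n \<longleftrightarrow> a \<in> carrier (kTn n) \<and> augmentation a = 0" by (simp add: augmentation_ideal_def)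

lemma IT_sub: "IT \<subseteq> carrier kT" by (auto simp: IT_iff)

lemma kTn_induct [consumes 1, case_names zero add single]:
  assumes "a \<in> carrier (kTn n)" "P (\<lambda>_. 0)"
    "\<And>a b. a \<in> carrier (kTn n) ==> b \<in> carrier (kTn n) ==> P a ==> P b ==> P (a \<oplus>\<^bsub>kG\<^esub> b)"
    "\<And>g c. g \<in> Tn n ==> P (single g c)"
  shows "P a"
  using assms(1) by (induction rule: group_algebra_induct) (use assms in auto)

lemma aug_mult: "a \<in> carrier kT ==> b \<in> carrier kT ==> augmentation (a \<otimes>\<^bsub>kG\<^esub> b) = augmentation a * augmentation b"
  by (intro augmentation_mult kT_kG)

lemma aug_add: "a \<in> carrier kT ==> b \<in> carrier kT ==> augmentation (a \<oplus>\<^bsub>kG\<^esub> b) = augmentation a + augmentation b"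
  by (intro augmentation_add kT_kG)

lemma dl_minus: "t \<in> T ==> dl t = single t 1 \<ominus>\<^bsub>kT\<^esub> \<one>\<^bsub>kT\<^esub>"
  using group_algebra_minus[of "single t 1" "G\<lparr>carrier := T\<rparr>" "\<one>\<^bsub>kT\<^esub>"] kT.one_closed single_closed_T[of t 1]
  by (simp add: dl_def group_algebra_simps(5))

lemma dl_closed: "t \<in> T ==> dl t \<in> carrier kT"
  using kT.minus_closed[OF single_closed_T kT.one_closed] by (simp add: dl_minus)

lemma dl_add: "dl t \<oplus>\<^bsub>kG\<^esub> single \<one> 1 = single t 1"
  by (auto simp: dl_def group_algebra_simps(3))

subsection \<open>The derivations detecting the augmentation of coordinates\<close>

definition Theta :: "nat => nat => ('a => 'k) => 'k"
  where "Theta m i a = (\<Sum>t | a t \<noteq> 0. a t * of_int (mu m i t))"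

lemma Theta_superset: "finite W ==> (\<And>g. a g \<noteq> 0 ==> g \<in> W) ==> Theta m i a = (\<Sum>t\<in>W. a t * of_int (mu m i t))"
  unfolding Theta_def by (rule sum.mono_neutral_left) auto

lemma Theta_add:
  assumes "a \<in> carrier kT" "b \<in> carrier kT"
  shows "Theta m i (a \<oplus>\<^bsub>kG\<^esub> b) = Theta m i a + Theta m i b"
proof -
  let ?W = "{g. a g \<noteq> 0} \<union> {g. b g \<noteq> 0}"
  have f: "finite ?W" using assms by (simp add: group_algebra_simps)
  show ?thesis
    by (subst (1 2 3) Theta_superset[OF f]) (auto simp: group_algebra_simps(3) sum.distrib distrib_right)
qed

lemma Theta_single: "Theta m i (single t c) = c * of_int (mu m i t)"
  by (subst Theta_superset[of "{t}"]) (auto simp: single_def split: if_splits)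

lemma Theta_zero: "Theta m i (\<lambda>_. 0) = 0" by (simp add: Theta_def)

text \<open>A Leibniz rule over the augmentation. The second factor must lie in kT_m, because
  \<open>mu m i\<close> is additive only when one of the two group elements is torsion of that
  level.\<close>

lemma Theta_mult:
  assumes i: "i < r" and m: "m \<ge> 1" and a: "a \<in> carrier kT" and g: "g \<in> carrier (kTn m)"
  shows "Theta m i (a \<otimes>\<^bsub>kG\<^esub> g) = augmentation a * Theta m i g + Theta m i a * augmentation g"
  using a
proof (induction rule: kT_induct)
  case zero thus ?case by (simp add: conv_zero Theta_zero augmentation_zero)
next
  case (add a b)
  thus ?case using kTn_kT[OF g] by (simp add: conv_add_left kT_kG Theta_add kT_mult_closed aug_add algebra_simps)
next
  case (single t c)
  note t = single
  from g show ?case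
  proof (induction rule: kTn_induct)
    case zero thus ?case by (simp add: conv_zero Theta_zero augmentation_zero)
  next
    case (add a b)
    thus ?case using kTn_kT[OF add(1)] kTn_kT[OF add(2)] single_closed_T[OF t]
      by (simp add: conv_add_right kT_kG Theta_add kT_mult_closed aug_add algebra_simps)
  next
    case (single s d)
    thus ?case using of_int_cong[OF mu_add[OF i t single m]]
      by (simp add: single_mult Theta_single augmentation_single algebra_simps)
  qed
qed

text \<open>By \<open>mu_Suc\<close> the derivation of level m + 1 has values divisible by p on
  elements of T_m, hence zero in k.\<close>

lemma Theta_lower:
  assumes "i < r" "g \<in> carrier (kTn m)" shows "Theta (Suc m) i g = 0"
  using assms(2)
proof (induction rule: kTn_induct)
  case (add a b) thus ?case by (simp add: Theta_add kTn_kT)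
next
  case (single g c) thus ?case using of_int_cong[OF mu_Suc[OF assms(1) single]] by (simp add: Theta_single)
qed (rule Theta_zero)

text \<open>Both terms of the Leibniz rule contain a vanishing augmentation. Hence the derivation
  does not see the choice of a lift, which is determined modulo the square of the augmentation
  ideal.\<close>

lemma Theta_square:
  assumes "i < r" "m \<ge> 1" "a \<in> In m \<cdot>\<^bsub>kTn m\<^esub> In m"
  shows "a \<in> carrier kT \<and> Theta m i a = 0"
  using assms(3)
proof (induction rule: ideal_prod.induct)
  case (prod a b)
  thus ?case using assms(1,2) kTn_kT by (auto simp: In_iff Theta_mult kT_mult_closed)
next
  case (sum a b) thus ?case by (simp add: Theta_add kT_add_closed)
qed

text \<open>The condition on lifts speaks of all roots s of v; to extract information one root is
  needed, with its coordinates known.\<close>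

lemma root_exists:
  assumes v: "v \<in> Tn 1" and m: "m \<ge> 1"
  shows "\<exists>s\<in>Tn m. s [^] (p ^ (m - 1)) = v \<and> (\<forall>i<r. [mu m i s = mu 1 i v] (mod int p))"
proof -
  have vT: "v \<in> T" using v by (rule torsion_T)
  have pm: "p ^ m = p * p ^ (m - 1)" using m by (cases m) auto
  have pv: "of_nat p * q j v \<in> \<int>" if "j < r" for j using v that unfolding torsion_iff by auto
  \<comment> \<open>Divide the coordinates of v by p^(m-1); they remain in \<int>[1/p], so
    surjectivity of the coordinates supplies s.\<close>
  have "\<exists>t\<in>T. \<forall>j<r. q j t - q j v / of_nat (p ^ (m - 1)) \<in> \<int>"
  proof (rule q_ex)
    fix j assume "j < r"
    thus "\<exists>n. q j v / of_nat (p ^ (m - 1)) * of_nat p ^ n \<in> \<int>"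
      using pv[of j] p_pos by (intro exI[of _ m]) (simp add: pm mult.commute flip: of_nat_power)
  qed
  then obtain s where s: "s \<in> T" "\<And>j. j < r ==> q j s - q j v / of_nat (p ^ (m - 1)) \<in> \<int>" by blast
  have ex: "\<exists>z. of_nat (p ^ (m - 1)) * q j s = q j v + of_nat (p ^ (m - 1)) * of_int z" if j: "j < r" for j
  proof -
    obtain z where "q j s - q j v / of_nat (p ^ (m - 1)) = of_int z" using s(2)[OF j] by (rule Ints_cases)
    hence "q j s = q j v / of_nat (p ^ (m - 1)) + of_int z" by simp
    thus ?thesis using p_pos by (intro exI[of _ z]) (simp add: distrib_left)
  qed
  have "s [^] (p ^ (m - 1)) = v"
  proof (rule q_inj[OF T_pow[OF s(1)] vT])
    fix j assume j: "j < r"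
    obtain z where "of_nat (p ^ (m - 1)) * q j s = q j v + of_nat (p ^ (m - 1)) * of_int z" using ex[OF j] by blast
    hence "q j (s [^] (p ^ (m - 1))) - q j v = (q j (s [^] (p ^ (m - 1))) - of_nat (p ^ (m - 1)) * q j s) + of_int (int (p ^ (m - 1)) * z)"
      by simp
    also have "\<dots> \<in> \<int>" by (rule Ints_add[OF q_pow[OF j s(1)] Ints_of_int])
    finally show "q j (s [^] (p ^ (m - 1))) - q j v \<in> \<int>" .
  qed
  moreover have ms: "\<exists>z. of_nat (p ^ m) * q j s = of_int (mu 1 j v + int (p ^ m) * z)" if j: "j < r" for j
  proof -
    obtain z where "of_nat (p ^ (m - 1)) * q j s = q j v + of_nat (p ^ (m - 1)) * of_int z" using ex[OF j] by blast
    hence "of_nat p * (of_nat (p ^ (m - 1)) * q j s) = of_nat p * q j v + of_nat p * of_nat (p ^ (m - 1)) * of_int z"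
      by (simp add: distrib_left)
    thus ?thesis using mu_torsion[OF v j] by (intro exI[of _ z]) (simp add: pm)
  qed
  moreover have "s \<in> Tn m" using s(1) ms unfolding torsion_iff by (metis Ints_of_int)
  moreover have "[mu m j s = mu 1 j v] (mod int p)" if j: "j < r" for j
  proof -
    obtain z where "of_nat (p ^ m) * q j s = of_int (mu 1 j v + int (p ^ m) * z)" using ms[OF j] by blast
    hence "mu m j s = mu 1 j v + int (p ^ m) * z" unfolding mu_def[of m] by (simp only: floor_of_int)
    moreover have "int p dvd int (p ^ m) * z" using m by (simp add: dvd_power)
    ultimately show ?thesis unfolding cong_iff_dvd_diff by auto
  qed
  ultimately show ?thesis by blast
qed

section \<open>The map phi of a lift\<close>

context
  fixes n and f :: "'a => 'a => 'k" assumes n: "n \<ge> 1" and lift: "phi_lift G T H p n f"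
begin

lemma f_hom: "f \<in> lmod_hom F V A" and f_In: "v \<in> carrier V ==> f v \<in> In n"
  and f_equiv: "h \<in> H ==> v \<in> carrier V ==> f (conj_act G h v) = alg_conj G h (f v)"
  and f_coset: "v \<in> carrier V ==> s \<in> Tn n ==> s [^] (p ^ (n - 1)) = v ==>
    (In n \<cdot>\<^bsub>kTn n\<^esub> In n) +>\<^bsub>kTn n\<^esub> f v = (In n \<cdot>\<^bsub>kTn n\<^esub> In n) +>\<^bsub>kTn n\<^esub> (single s 1 \<ominus>\<^bsub>kTn n\<^esub> single \<one> 1)"
  using lift unfolding phi_lift_def Let_def by (blast+)

lemma f_kT: "v \<in> carrier V ==> f v \<in> carrier kT"
  using f_In by (auto simp: In_iff intro: kTn_kT)

text \<open>The equality of cosets in \<open>phi_lift\<close>, read off as f v = a + (s - 1) with a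
  in the square of the augmentation ideal.\<close>

lemma f_root:
  assumes "s \<in> Tn n" "s [^] (p ^ (n - 1)) = v" "v \<in> carrier V"
  shows "\<exists>a \<in> In n \<cdot>\<^bsub>kTn n\<^esub> In n. f v = a \<oplus>\<^bsub>kG\<^esub> dl s"
proof -
  have z: "(\<lambda>_. 0) \<in> In n" by (simp add: In_iff group_algebra_zero_closed augmentation_zero)
  have z2: "(\<lambda>_. 0) \<in> In n \<cdot>\<^bsub>kTn n\<^esub> In n" using ideal_prod.prod[OF z z, of "kTn n"] by (simp add: conv_zero)
  have m: "single s 1 \<ominus>\<^bsub>kTn n\<^esub> single \<one> (1::'k) = dl s"
    unfolding dl_def using assms(1) torsion_one by (intro group_algebra_minus single_closed) auto
  have "f v \<in> (In n \<cdot>\<^bsub>kTn n\<^esub> In n) +>\<^bsub>kTn n\<^esub> f v"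
    unfolding a_r_coset_def' using z2 by (intro UN_I[of "\<lambda>_. 0"]) (auto simp: group_algebra_simps(3))
  hence "f v \<in> (In n \<cdot>\<^bsub>kTn n\<^esub> In n) +>\<^bsub>kTn n\<^esub> dl s" by (simp only: f_coset[OF assms(3,1,2)] m)
  thus ?thesis unfolding a_r_coset_def' by (auto simp: group_algebra_simps(3))
qed

text \<open>The square contributes nothing, and s - 1 contributes the coordinate of s in units of
  p^-n, which is that of v in units of p^-1.\<close>

lemma Theta_f:
  assumes i: "i < r" and v: "v \<in> carrier V"
  shows "Theta n i (f v) = of_int (mu 1 i v)"
proof -
  obtain s where s: "s \<in> Tn n" "s [^] (p ^ (n - 1)) = v" "[mu n i s = mu 1 i v] (mod int p)"
    using root_exists[OF _ n, of v] v i by auto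
  obtain a where a: "a \<in> In n \<cdot>\<^bsub>kTn n\<^esub> In n" "f v = a \<oplus>\<^bsub>kG\<^esub> dl s" using f_root[OF s(1,2) v] by blast
  note sq = Theta_square[OF i n a(1)]
  note sT = torsion_T[OF s(1)]
  have "Theta n i (dl s) + Theta n i (single \<one> 1) = Theta n i (single s 1)"
    using Theta_add[OF dl_closed[OF sT] single_one_closed[of 1], of n i] by (simp add: dl_add)
  hence "Theta n i (dl s) = of_int (mu 1 i v)"
    using of_int_cong[OF s(3)] of_int_cong[OF mu_one[OF i n]] by (simp add: Theta_single)
  thus ?thesis using sq dl_closed[OF sT] unfolding a(2) by (simp add: Theta_add)
qed

abbreviation "phi \<equiv> phi_map G T p f"

lemma phi_F: "phi \<in> lmod_hom F Q A" "\<And>b v. b \<in> carrier kT ==> v \<in> carrier V ==> phi (tn b v) = b \<otimes>\<^bsub>kG\<^esub> f v"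
proof -
  have id: "id \<in> ring_hom F F" by (auto simp: ring_hom_def)
  note l = tp.tensor_lift[OF F_ring A_left_module id, of "\<lambda>(a, v). a \<otimes>\<^bsub>subgroup_algebra G T\<^esub> f v"]
  have sm: "(\<lambda>x. d * a x) \<otimes>\<^bsub>kG\<^esub> b = (\<lambda>x. d * (a \<otimes>\<^bsub>kG\<^esub> b) x)" if "a \<in> carrier kT" "b \<in> carrier kT" for a b d
    using kT.m_assoc[of "single \<one> d" a b] that single_one_closed by (simp add: scalar_kT kT_mult_closed)
  show "phi \<in> lmod_hom F Q A" unfolding phi_map_def lmod_hom_slin
    by (rule l(1)) (use hom_add[OF f_hom] hom_smult[OF f_hom] f_kT in
      \<open>auto simp: kT_mult_closed conv_add_left conv_add_right kT_kG scalar_mult sm\<close>)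
  show "phi (tn b v) = b \<otimes>\<^bsub>kG\<^esub> f v" if "b \<in> carrier kT" "v \<in> carrier V" for b v
    unfolding phi_map_def
    by (subst l(2)) (use that hom_add[OF f_hom] hom_smult[OF f_hom] f_kT in
      \<open>auto simp: kT_mult_closed conv_add_left conv_add_right kT_kG scalar_mult sm\<close>)
qed

lemma phi_closed: "x \<in> carrier Q ==> phi x \<in> carrier kT"
  using hom_closed[OF phi_F(1)] by simp

lemma phi_add: "x \<in> carrier Q ==> y \<in> carrier Q ==> phi (x \<oplus>\<^bsub>Q\<^esub> y) = phi x \<oplus>\<^bsub>kG\<^esub> phi y"
  using hom_add[OF phi_F(1)] by simp

lemma phi_hom: "phi \<in> lmod_hom kT M (regular kT)"
proof (rule lmod_homI)
  show "phi (a \<odot>\<^bsub>M\<^esub> x) = a \<odot>\<^bsub>regular kT\<^esub> phi x" if a: "a \<in> carrier kT" and x: "x \<in> carrier M" for a x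
    using x[unfolded M_simps]
  proof (induction rule: Q_induct)
    case (tensor c v)
    thus ?case using a kT.m_assoc[OF a _ f_kT, of c v] by (simp add: M_smult_tn phi_F(2) kT_mult_closed)
  next
    case (add x y)
    thus ?case using a by (simp add: M_smult_add phi_add M_smult_closed conv_add_right phi_closed kT_kG)
  qed
qed (auto simp: phi_closed phi_add)

lemma phi_act: "h \<in> H ==> x \<in> carrier M ==> phi (act h x) = alg_conj G h (phi x)"
proof -
  assume h: "h \<in> H" and x: "x \<in> carrier M"
  from x[unfolded M_simps] show ?thesis
  proof (induction rule: Q_induct)
    case (tensor c v)
    thus ?case using h f_kT conj_V_closed[OF h] f_equiv[OF h]
      by (simp add: act_tn phi_F(2) alg_conj_closed H_carrier alg_conj_mult)
  next
    case (add x y)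
    thus ?case using h by (simp add: hom_add[OF act_hom] phi_add act_closed alg_conj_add)
  qed
qed

lemma phi_IT: "x \<in> carrier M ==> phi x \<in> IT"
proof -
  assume x: "x \<in> carrier M"
  from x[unfolded M_simps] show ?thesis
  proof (induction rule: Q_induct)
    case (tensor c v)
    thus ?case using f_kT[of v] f_In[of v] by (simp add: phi_F(2) IT_iff In_iff kT_mult_closed aug_mult)
  next
    case (add x y) thus ?case by (simp add: phi_add IT_iff kT_add_closed aug_add)
  qed
qed

text \<open>On c \<otimes> v the Leibniz rule leaves only the augmentation of c times the coordinate
  of v, as f v has augmentation zero.\<close>

lemma Theta_phi: "i < r ==> x \<in> carrier M ==> Theta n i (phi x) = augmentation (e' i x)"
proof -
  assume i: "i < r" and x: "x \<in> carrier M"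
  from x[unfolded M_simps] show ?thesis
  proof (induction rule: Q_induct)
    case (tensor c v)
    have "augmentation (e' i (tn c v)) = of_int (mu 1 i v) * augmentation c"
      using tensor i aug_mult[OF single_one_closed, of c] by (simp add: e'_lift(2) scalar_kT augmentation_single)
    thus ?case using tensor i n f_In[of v] Theta_mult[OF i n, of c "f v"] Theta_f[OF i, of v]
      by (simp add: phi_F(2) In_iff mult.commute)
  next
    case (add x y) thus ?case using i by (simp add: phi_add Theta_add phi_closed e'_add aug_add e'_closed)
  qed
qed

text \<open>f v lies in kT_n, where the derivation of level n + 1 is zero, and has augmentation
  zero; so both terms of the Leibniz rule vanish.\<close>

lemma Theta_Suc_phi: "i < r ==> x \<in> carrier M ==> Theta (Suc n) i (phi x) = 0"
proof -
  assume i: "i < r" and x: "x \<in> carrier M"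
  from x[unfolded M_simps] show ?thesis
  proof (induction rule: Q_induct)
    case (tensor c v)
    thus ?case using i n f_In[of v] Theta_mult[OF i _, of "Suc n" c "f v"] Theta_lower[OF i, of "f v" n]
      kTn_mono[of n "Suc n" "f v"]
      by (simp add: phi_F(2) In_iff)
  next
    case (add x y) thus ?case using i by (simp add: phi_add Theta_add phi_closed)
  qed
qed

subsection \<open>The image of phi\<close>

text \<open>The evaluation homomorphism from k[x] to kT at t. The Frobenius identity for t - 1 is
  taken in \<open>'k poly\<close> and carried over by it.\<close>

definition ev :: "'a => 'k poly => 'a => 'k"
  where "ev t P = fold_coeffs (\<lambda>a b. single \<one> a \<oplus>\<^bsub>kG\<^esub> (single t 1 \<otimes>\<^bsub>kG\<^esub> b)) P (\<lambda>_. 0)"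

lemma ev_0: "ev t 0 = (\<lambda>_. 0)" by (simp add: ev_def)

lemma ev_pCons: "ev t (pCons a P) = single \<one> a \<oplus>\<^bsub>kG\<^esub> (single t 1 \<otimes>\<^bsub>kG\<^esub> ev t P)"
  by (cases "P = 0 \<and> a = 0") (auto simp: ev_def conv_zero single_zero group_algebra_simps(3))

context fixes t assumes t: "t \<in> T" begin

lemma ev_closed: "ev t P \<in> carrier kT"
  by (induction P) (auto simp: ev_0 ev_pCons group_algebra_zero_closed t intro!: kT_add_closed kT_mult_closed single_closed_T)

lemma ev_add: "ev t (P + P') = ev t P \<oplus>\<^bsub>kG\<^esub> ev t P'"
proof (induction P P' rule: poly_induct2)
  case 0 thus ?case by (simp add: ev_0 group_algebra_simps(3))
next
  case (pCons a P b Q)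
  note c = single_closed_T[OF t] ev_closed single_one_closed kT_mult_closed[OF single_closed_T[OF t] ev_closed]
  have "ev t (pCons a P + pCons b Q) = single \<one> (a + b) \<oplus>\<^bsub>kG\<^esub> (single t 1 \<otimes>\<^bsub>kG\<^esub> (ev t P \<oplus>\<^bsub>kG\<^esub> ev t Q))"
    by (simp add: ev_pCons pCons.IH)
  also have "single t 1 \<otimes>\<^bsub>kG\<^esub> (ev t P \<oplus>\<^bsub>kG\<^esub> ev t Q) = (single t 1 \<otimes>\<^bsub>kG\<^esub> ev t P) \<oplus>\<^bsub>kG\<^esub> (single t 1 \<otimes>\<^bsub>kG\<^esub> ev t Q)"
    by (intro conv_add_right kT_kG c)
  finally show ?case by (auto simp: ev_pCons group_algebra_simps(3) single_def)
qed

lemma ev_smult: "ev t (Polynomial.smult c P) = single \<one> c \<otimes>\<^bsub>kG\<^esub> ev t P"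
proof (induction P)
  case 0 thus ?case by (simp add: ev_0 conv_zero)
next
  case (pCons a P)
  note cl = single_closed_T[OF t, of 1] ev_closed[of P] single_one_closed[of c]
  have "single \<one> c \<otimes>\<^bsub>kG\<^esub> ev t (pCons a P) =
     (single \<one> c \<otimes>\<^bsub>kG\<^esub> single \<one> a) \<oplus>\<^bsub>kG\<^esub> (single \<one> c \<otimes>\<^bsub>kG\<^esub> (single t 1 \<otimes>\<^bsub>kG\<^esub> ev t P))"
    unfolding ev_pCons by (intro conv_add_right kT_kG cl kT_mult_closed single_one_closed)
  also have "single \<one> c \<otimes>\<^bsub>kG\<^esub> (single t 1 \<otimes>\<^bsub>kG\<^esub> ev t P) = single t 1 \<otimes>\<^bsub>kG\<^esub> (single \<one> c \<otimes>\<^bsub>kG\<^esub> ev t P)"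
    using kT.m_lcomm[OF cl(3,1,2)] by simp
  finally show ?case by (simp add: ev_pCons pCons.IH single_mult)
qed

lemma ev_mult: "ev t (P * P') = ev t P \<otimes>\<^bsub>kG\<^esub> ev t P'"
proof (induction P)
  case 0 thus ?case by (simp add: ev_0 conv_zero)
next
  case (pCons a P)
  note cl = single_closed_T[OF t, of 1] ev_closed[of P] ev_closed[of P'] single_one_closed[of a]
  have "ev t (pCons a P * P') = (single \<one> a \<otimes>\<^bsub>kG\<^esub> ev t P') \<oplus>\<^bsub>kG\<^esub> (single \<one> 0 \<oplus>\<^bsub>kG\<^esub> (single t 1 \<otimes>\<^bsub>kG\<^esub> (ev t P \<otimes>\<^bsub>kG\<^esub> ev t P')))"
    by (simp add: ev_add ev_smult ev_pCons pCons.IH)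
  also have "single t 1 \<otimes>\<^bsub>kG\<^esub> (ev t P \<otimes>\<^bsub>kG\<^esub> ev t P') = (single t 1 \<otimes>\<^bsub>kG\<^esub> ev t P) \<otimes>\<^bsub>kG\<^esub> ev t P'"
    using kT.m_assoc[OF cl(1-3)] by simp
  also have "single \<one> 0 \<oplus>\<^bsub>kG\<^esub> ((single t 1 \<otimes>\<^bsub>kG\<^esub> ev t P) \<otimes>\<^bsub>kG\<^esub> ev t P') = (single t 1 \<otimes>\<^bsub>kG\<^esub> ev t P) \<otimes>\<^bsub>kG\<^esub> ev t P'"
    by (simp add: single_zero group_algebra_simps(3))
  also have "(single \<one> a \<otimes>\<^bsub>kG\<^esub> ev t P') \<oplus>\<^bsub>kG\<^esub> \<dots> = ev t (pCons a P) \<otimes>\<^bsub>kG\<^esub> ev t P'"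
    unfolding ev_pCons by (intro conv_add_left[symmetric] kT_kG cl kT_mult_closed)
  finally show ?case .
qed

lemma ev_one: "ev t 1 = \<one>\<^bsub>kT\<^esub>"
  by (simp add: one_pCons ev_pCons ev_0 conv_zero group_algebra_simps(3)) (simp add: group_algebra_simps(5))

lemma ev_power: "ev t (P ^ m) = ev t P [^]\<^bsub>kT\<^esub> m"
proof (induction m)
  case 0 thus ?case by (simp add: ev_one)
next
  case (Suc m) thus ?case using ev_mult[of "P ^ m" P] by (simp add: mult.commute)
qed

text \<open>In characteristic p, (t - 1)^(p^n) is the sum of t^(p^n) = 1 and (-1)^(p^n).\<close>

lemma dl_nilpotent:
  assumes "t \<in> Tn n" shows "dl t [^]\<^bsub>kT\<^esub> (p ^ n) = \<zero>\<^bsub>kT\<^esub>"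
proof -
  have ch: "CHAR('k poly) = p" using char by simp
  have N: "p ^ n > 0" using p_pos by simp
  have "dl t = ev t ([:0, 1:] + [:-1:])"
  proof -
    have 1: "ev t [:c:] = single \<one> c" for c by (simp add: ev_pCons ev_0 conv_zero group_algebra_simps(3))
    have "ev t [:-1, 1:] = single \<one> (-1) \<oplus>\<^bsub>kG\<^esub> (single t 1 \<otimes>\<^bsub>kG\<^esub> single \<one> 1)"
      by (subst ev_pCons) (simp only: 1)
    also have "single t 1 \<otimes>\<^bsub>kG\<^esub> single \<one> 1 = single t (1 :: 'k)" using T_carrier[OF t] by (simp add: single_mult)
    finally show ?thesis by (auto simp: group_algebra_simps(3) single_def dl_def)
  qed
  hence "dl t [^]\<^bsub>kT\<^esub> (p ^ n) = ev t (([:0, 1:] + [:-1:]) ^ (p ^ n))" by (simp only: ev_power)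
  also have "([:0, 1:] + [:-1:] :: 'k poly) ^ (p ^ n) = [:0, 1:] ^ (p ^ n) + [:-1:] ^ (p ^ n)"
    by (rule freshmans_dream') (use ch p in auto)
  also have "ev t \<dots> = (ev t [:0, 1:] [^]\<^bsub>kT\<^esub> (p ^ n)) \<oplus>\<^bsub>kG\<^esub> ev t ([:-1:] ^ (p ^ n))" by (simp only: ev_add ev_power)
  also have "ev t [:0, 1:] = single t 1"
    by (simp add: ev_pCons ev_0 conv_zero single_zero group_algebra_simps(3) single_mult T_carrier[OF t])
  also have "single t 1 [^]\<^bsub>kT\<^esub> m = single (t [^] m) 1" for m :: nat
    by (induction m) (auto simp: group_algebra_simps(5) single_mult)
  also have "t [^] (p ^ n) = \<one>" using assms by (simp add: torsion_def)
  also have "[:-1:] ^ (p ^ n) = [:(-1 :: 'k) ^ (p ^ n):]" by (simp add: poly_const_pow)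
  also have "ev t [:(-1 :: 'k) ^ (p ^ n):] = single \<one> ((-1) ^ (p ^ n))"
    by (simp add: ev_pCons ev_0 conv_zero group_algebra_simps(3))
  also have "single \<one> 1 \<oplus>\<^bsub>kG\<^esub> single \<one> ((-1) ^ (p ^ n)) = single \<one> (1 + (-1) ^ (p ^ n))" by (rule single_add)
  \<comment> \<open>The Frobenius identity for 1 + (-1) = 0 gives this for all p at once, p = 2
    included.\<close>
  also have "1 + (-1 :: 'k) ^ (p ^ n) = 0"
  proof -
    have "(1 + -1 :: 'k) ^ (p ^ n) = 1 ^ (p ^ n) + (-1) ^ (p ^ n)" by (rule freshmans_dream') (use char p in auto)
    thus ?thesis using zero_power[OF N, where 'a = 'k] by (simp only: power_one add.right_inverse)
  qed
  finally show ?thesis by (simp add: single_zero group_algebra_simps(4))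
qed

end

text \<open>The lemma of Nakayama is applied over kT to the ideal A generated by X = {s - 1 | s in
  T_n}, finite with nilpotent members. What has to be shown is that X lies in the image of phi plus
  A X.\<close>

lemma dl_in_image:
  assumes t: "t \<in> Tn n" shows "\<exists>x\<in>carrier M. phi x = dl t"
proof -
  let ?R = "regular kT" and ?X = "dl ` Tn n" and ?J = "phi ` carrier M"
  interpret Rg: left_module kT ?R by (rule kT.regular_module)
  let ?A = "submodule_span kT ?R ?X"
  let ?AX = "{a \<otimes>\<^bsub>kT\<^esub> b | a b. a \<in> ?A \<and> b \<in> ?X}"
  have X: "finite ?X" "?X \<subseteq> carrier kT" using torsion_finite dl_closed torsion_T by auto
  hence Xr: "?X \<subseteq> carrier ?R" by simp
  have A: "submodule ?A kT ?R" by (rule Rg.span_submodule[OF Xr])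
  note Ap = Rg.submodule_props[OF A, simplified]
  have J: "submodule ?J kT ?R"
  proof (rule Rg.submoduleI)
    show "?J \<subseteq> carrier ?R" using phi_closed by auto
    show "\<zero>\<^bsub>?R\<^esub> \<in> ?J" using hom_zero[OF M_left_module kT.regular_module phi_hom]
      by (intro image_eqI[of _ _ "\<zero>\<^bsub>M\<^esub>"]) auto
    show "x \<oplus>\<^bsub>?R\<^esub> y \<in> ?J" if xy: "x \<in> ?J" "y \<in> ?J" for x y
    proof -
      obtain x' y' where *: "x = phi x'" "y = phi y'" "x' \<in> carrier M" "y' \<in> carrier M" using xy by auto
      thus ?thesis by (intro image_eqI[of _ _ "x' \<oplus>\<^bsub>M\<^esub> y'"]) (auto simp: phi_add)
    qed
    show "a \<odot>\<^bsub>?R\<^esub> x \<in> ?J" if ax: "a \<in> carrier kT" "x \<in> ?J" for a x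
    proof -
      obtain x' where *: "x = phi x'" "x' \<in> carrier M" using ax by auto
      thus ?thesis using hom_smult[OF phi_hom ax(1)] M_smult_closed[OF ax(1)] by (intro image_eqI[of _ _ "a \<odot>\<^bsub>M\<^esub> x'"]) auto
    qed
  qed
  have AXc: "?AX \<subseteq> carrier kT" using Ap(1) X(2) kT_mult_closed by auto
  \<comment> \<open>Every element of kT_n is its augmentation plus an element of A; in particular
    the augmentation ideal of kT_n lies in A.\<close>
  have "g \<in> carrier kT \<and> (\<exists>a\<in>?A. g = a \<oplus>\<^bsub>kG\<^esub> single \<one> (augmentation g))" if "g \<in> carrier (kTn n)" for g
    using that
  proof (induction rule: kTn_induct)
    case zero
    show ?case using Ap(2) by (intro conjI group_algebra_zero_closed bexI[of _ "\<zero>\<^bsub>kT\<^esub>"])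
      (auto simp: augmentation_zero single_zero group_algebra_simps(3,4))
  next
    case (add g g')
    then obtain a a' where a: "a \<in> ?A" "a' \<in> ?A" "g = a \<oplus>\<^bsub>kG\<^esub> single \<one> (augmentation g)" "g' = a' \<oplus>\<^bsub>kG\<^esub> single \<one> (augmentation g')" by blast
    have cl: "g \<in> carrier kT" "g' \<in> carrier kT" using add by auto
    have "g \<oplus>\<^bsub>kG\<^esub> g' = (a \<oplus>\<^bsub>kG\<^esub> single \<one> (augmentation g)) \<oplus>\<^bsub>kG\<^esub> (a' \<oplus>\<^bsub>kG\<^esub> single \<one> (augmentation g'))"
      using a(3,4) by simp
    also have "\<dots> = (a \<oplus>\<^bsub>kG\<^esub> a') \<oplus>\<^bsub>kG\<^esub> single \<one> (augmentation (g \<oplus>\<^bsub>kG\<^esub> g'))"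
      unfolding aug_add[OF cl] by (auto simp: group_algebra_simps(3) single_def)
    finally show ?case using a(1,2) Ap(3) cl by (intro conjI kT_add_closed bexI[of _ "a \<oplus>\<^bsub>kG\<^esub> a'"]) auto
  next
    case (single s c)
    have "dl s \<in> ?A" using Rg.span_incl[of ?X] single by auto
    hence "single \<one> c \<otimes>\<^bsub>kG\<^esub> dl s \<in> ?A" using Ap(6)[OF single_one_closed[of c]] by simp
    moreover have "single \<one> c \<otimes>\<^bsub>kG\<^esub> dl s = (\<lambda>x. c * dl s x)"
      using scalar_kT[OF dl_closed[OF torsion_T[OF single]]] by simp
    moreover have "single s c = (\<lambda>x. c * dl s x) \<oplus>\<^bsub>kG\<^esub> single \<one> c"
      by (auto simp: group_algebra_simps(3) dl_def single_def)
    ultimately have "\<exists>a\<in>?A. single s c = a \<oplus>\<^bsub>kG\<^esub> single \<one> c" by (intro bexI[of _ "\<lambda>x. c * dl s x"]) auto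
    thus ?case using single_closed_T[OF torsion_T[OF single], of c] by (simp only: augmentation_single)
  qed
  note dec = this
  have IA: "g \<in> ?A" if gI: "g \<in> In n" for g
  proof -
    obtain a where a: "a \<in> ?A" "g = a \<oplus>\<^bsub>kG\<^esub> single \<one> (augmentation g)" using dec[of g] gI unfolding In_iff by blast
    moreover have "augmentation g = 0" using gI by (simp add: In_iff)
    ultimately show ?thesis by (simp add: single_zero group_algebra_simps(3))
  qed
  let ?S = "submodule_span kT ?R (?J \<union> ?AX)"
  have JAX: "?J \<union> ?AX \<subseteq> carrier ?R" using AXc Rg.submodule_props(1)[OF J] by simp
  note Sp = Rg.submodule_props[OF Rg.span_submodule[OF JAX], simplified]
  \<comment> \<open>Products of two elements of A lie in A X up to the span, so the square of the
    augmentation ideal of kT_n is absorbed.\<close>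
  have AA: "g \<otimes>\<^bsub>kG\<^esub> h \<in> ?S" if g: "g \<in> ?A" and h: "h \<in> ?A" for g h
    using h Xr
  proof (induction rule: Rg.span_induct)
    case (base x)
    hence "g \<otimes>\<^bsub>kT\<^esub> x \<in> ?J \<union> ?AX" using g by blast
    hence "g \<otimes>\<^bsub>kT\<^esub> x \<in> ?S" by (rule subsetD[OF Rg.span_incl])
    thus ?case by simp
  next
    case zero thus ?case using Sp(2) by (simp add: conv_zero group_algebra_simps(4))
  next
    case (add x y)
    have "g \<in> carrier kT" using g Ap(1) by auto
    thus ?case using Sp(3) add by (simp add: conv_add_right kT_kG)
  next
    case (smult a x)
    have gc: "g \<in> carrier kT" using g Ap(1) by auto
    have "g \<otimes>\<^bsub>kG\<^esub> (a \<otimes>\<^bsub>kG\<^esub> x) = a \<otimes>\<^bsub>kG\<^esub> (g \<otimes>\<^bsub>kG\<^esub> x)"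
      using kT.m_lcomm[OF gc, of a x] smult by simp
    thus ?case using Sp(6)[of a "g \<otimes>\<^bsub>kG\<^esub> x"] smult by simp
  qed
  have I2: "a \<in> ?S" if "a \<in> In n \<cdot>\<^bsub>kTn n\<^esub> In n" for a
    using that by (induction rule: ideal_prod.induct) (use AA IA Sp(3) in auto)
  have "?X \<subseteq> ?J"
  proof (rule kT.nakayama_finite[OF J X])
    show "\<one>\<^bsub>kT\<^esub> \<ominus>\<^bsub>kT\<^esub> b \<in> Units kT" if "b \<in> ?A" for b
      using dl_nilpotent torsion_T by (intro kT.unit_minus_span_nilpotent[OF X(2) _ that]) auto
    fix x assume "x \<in> ?X"
    then obtain s where s: "s \<in> Tn n" "x = dl s" by auto
    \<comment> \<open>Chosen so that s is one of the roots of v to which the lift condition refers.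
      Then s - 1 differs from f v, a value of phi, by an element of the square.\<close>
    let ?v = "s [^] (p ^ (n - 1))"
    have "?v [^] p = s [^] (p ^ (n - 1) * p)" using T_carrier[OF torsion_T[OF s(1)]] by (simp add: nat_pow_pow)
    also have "p ^ (n - 1) * p = p ^ n" using n by (cases n) auto
    finally have v: "?v \<in> carrier V" using s(1) T_pow[of s] by (auto simp: torsion_def)
    obtain a where a: "a \<in> In n \<cdot>\<^bsub>kTn n\<^esub> In n" "f ?v = a \<oplus>\<^bsub>kG\<^esub> dl s" using f_root[OF s(1) refl v] by blast
    have aS: "a \<in> ?S" using I2[OF a(1)] .
    have "f ?v = phi (tn \<one>\<^bsub>kT\<^esub> ?v)" using phi_F(2)[OF kT.one_closed v] kT.l_one[OF f_kT[OF v]] by simp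
    hence "f ?v \<in> ?J \<union> ?AX" using tn_closed[OF kT.one_closed v] by auto
    hence fS: "f ?v \<in> ?S" by (rule subsetD[OF Rg.span_incl])
    have "f ?v \<ominus>\<^bsub>?R\<^esub> a \<in> ?S" using Rg.submodule_props(5)[OF Rg.span_submodule[OF JAX] fS aS] .
    moreover have "f ?v \<ominus>\<^bsub>?R\<^esub> a = dl s"
      using aS fS Sp(1) dl_closed[OF torsion_T[OF s(1)]] a(2) kT.a_comm[of a "dl s"] by (intro Rg.M.minus_unique) auto
    ultimately show "x \<in> ?S" using s by simp
  qed
  hence "dl t \<in> ?J" using t by blast
  thus ?thesis by (elim imageE) (auto intro!: bexI)
qed

end

section \<open>The maps psi modulo the augmentation ideal\<close>

lemma ideal_smult_coordinates:
  assumes "y \<in> carrier M" "\<And>j. j < r ==> e' j y \<in> IT" shows "y \<in> ideal_smult kT IT M"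
proof -
  note sub = MA.M.submodule_props[OF MA.M.ideal_smult_submodule[OF IT_sub]]
  have "(\<Oplus>\<^bsub>M\<^esub>j\<in>B. e' j y \<odot>\<^bsub>M\<^esub> e j) \<in> ideal_smult kT IT M" if "finite B" "B \<subseteq> {..<r}" for B
    using that
  proof (induction B)
    case empty thus ?case using sub(2) by simp
  next
    case (insert j B)
    have t: "e' j y \<odot>\<^bsub>M\<^esub> e j \<in> ideal_smult kT IT M" if "j < r" for j
      using assms(2)[OF that] e_closed by (intro MA.M.ideal_smultI)
    have "(\<lambda>j. e' j y \<odot>\<^bsub>M\<^esub> e j) \<in> B \<rightarrow> carrier M" "e' j y \<odot>\<^bsub>M\<^esub> e j \<in> carrier M"
      using t sub(1) insert.prems by auto
    thus ?case using insert t[of j] sub(3) by (subst MA.M.M.finsum_insert) auto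
  qed
  from this[of "{..<r}"] show ?thesis using M_basis[OF assms(1)] by simp
qed

text \<open>The inclusion follows for every choice of lifts and of \<open>\<psi>\<close>: the value
  of \<phi>_(n+1) at \<psi> x is also a value of \<phi>_n, so the derivation of level n + 1 gives
  zero for it, and this number is the augmentation of the j-th coordinate of \<psi> x.\<close>

lemma psi_ideal:
  assumes n: "n \<ge> 1" and f: "phi_lift G T H p n f" and f': "phi_lift G T H p (Suc n) f'"
    and \<psi>: "\<psi> \<in> lmod_hom kT M M"
    and eq: "\<And>x. x \<in> carrier M ==> phi_map G T p f' (\<psi> x) = phi_map G T p f x"
    and x: "x \<in> carrier M"
  shows "\<psi> x \<in> ideal_smult kT IT M"
proof (rule ideal_smult_coordinates)
  show y: "\<psi> x \<in> carrier M" by (rule hom_closed[OF \<psi> x])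
  fix j assume j: "j < r"
  have "augmentation (e' j (\<psi> x)) = Theta (Suc n) j (phi_map G T p f' (\<psi> x))"
    using Theta_phi[OF _ f' j y] by simp
  also have "\<dots> = 0" unfolding eq[OF x] by (rule Theta_Suc_phi[OF n f j x])
  finally show "e' j (\<psi> x) \<in> IT" using e'_closed[OF j] y by (simp add: IT_iff)
qed

end

section \<open>Homology of complexes of modules\<close>

lemma submodule_left_module:
  assumes M: "left_module R M" and H: "submodule H R M"
  shows "left_module R (M\<lparr>carrier := H\<rparr>)" and "(\<lambda>x. x) \<in> lmod_hom R (M\<lparr>carrier := H\<rparr>) M"
proof -
  interpret M: left_module R M by fact
  note Hp = M.submodule_props[OF H]
  show "left_module R (M\<lparr>carrier := H\<rparr>)"
  proof (rule left_moduleI[OF M.ring_R])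
    have "\<ominus>\<^bsub>M\<^esub> x \<in> H" if "x \<in> H" for x using Hp(6)[of "\<ominus>\<^bsub>R\<^esub> \<one>\<^bsub>R\<^esub>" x] that Hp(1) M.smult_l_minus[of "\<one>\<^bsub>R\<^esub>" x] M.smult_one[of x] by auto
    hence "\<exists>y\<in>H. y \<oplus>\<^bsub>M\<^esub> x = \<zero>\<^bsub>M\<^esub>" if "x \<in> H" for x using that Hp(1) M.M.l_neg by blast
    thus "abelian_group (M\<lparr>carrier := H\<rparr>)"
      using Hp(1-3) M.M.a_ac by (intro abelian_groupI') (auto simp: subset_iff)
  qed (use Hp M.smult_l_distr M.smult_r_distr M.smult_assoc1 M.smult_one in \<open>auto simp: subset_iff\<close>)
  show "(\<lambda>x. x) \<in> lmod_hom R (M\<lparr>carrier := H\<rparr>) M" using Hp(1) by (intro lmod_homI) auto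
qed

context
  fixes R :: "('a, 'r) ring_scheme" and C :: "int => ('a, 'b) module" and d
  assumes C: "chain_complex R C d"
begin

lemma complex_module: "left_module R (C n)"
  and complex_diff: "d n \<in> lmod_hom R (C n) (C (n - 1))"
  and complex_sq: "x \<in> carrier (C n) ==> d (n - 1) (d n x) = \<zero>\<^bsub>C (n - 2)\<^esub>"
  using C unfolding chain_complex_def by blast+

lemma complex_diff_Suc: "d (n + 1) \<in> lmod_hom R (C (n + 1)) (C n)"
  using complex_diff[of "n + 1"] by simp

lemma complex_sq_Suc: "x \<in> carrier (C (n + 1)) ==> d n (d (n + 1) x) = \<zero>\<^bsub>C (n - 1)\<^esub>"
  using complex_sq[of x "n + 1"] by simp

lemma cycles_module:
  "left_module R ((C n)\<lparr>carrier := cycles C d n\<rparr>)"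
  "(\<lambda>x. x) \<in> lmod_hom R ((C n)\<lparr>carrier := cycles C d n\<rparr>) (C n)"
  "submodule (boundaries C d n) R ((C n)\<lparr>carrier := cycles C d n\<rparr>)"
proof -
  interpret C: left_module R "C n" by (rule complex_module)
  interpret C': left_module R "C (n - 1)" by (rule complex_module)
  interpret C'': left_module R "C (n + 1)" by (rule complex_module)
  note d = complex_diff[of n] and d' = complex_diff_Suc[of n]
  have "submodule (cycles C d n) R (C n)"
    by (rule C.submoduleI)
       (auto simp: cycles_def hom_zero[OF C.left_module C'.left_module d] hom_add[OF d] hom_smult[OF d] C.smult_closed C'.smult_r_null)
  from submodule_left_module[OF C.left_module this]
  show m: "left_module R ((C n)\<lparr>carrier := cycles C d n\<rparr>)"
    and "(\<lambda>x. x) \<in> lmod_hom R ((C n)\<lparr>carrier := cycles C d n\<rparr>) (C n)" .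
  show "submodule (boundaries C d n) R ((C n)\<lparr>carrier := cycles C d n\<rparr>)"
  proof (rule left_module.submoduleI[OF m])
    show "boundaries C d n \<subseteq> carrier ((C n)\<lparr>carrier := cycles C d n\<rparr>)"
      using hom_closed[OF d'] complex_sq_Suc by (auto simp: boundaries_def cycles_def)
    show "\<zero>\<^bsub>(C n)\<lparr>carrier := cycles C d n\<rparr>\<^esub> \<in> boundaries C d n"
      using hom_zero[OF C''.left_module C.left_module d'] by (auto simp: boundaries_def intro!: image_eqI[of _ _ "\<zero>\<^bsub>C (n + 1)\<^esub>"])
    show "x \<oplus>\<^bsub>(C n)\<lparr>carrier := cycles C d n\<rparr>\<^esub> y \<in> boundaries C d n"
      if xy: "x \<in> boundaries C d n" "y \<in> boundaries C d n" for x y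
    proof -
      obtain x' y' where "x = d (n + 1) x'" "y = d (n + 1) y'" "x' \<in> carrier (C (n + 1))" "y' \<in> carrier (C (n + 1))"
        using xy by (auto simp: boundaries_def)
      thus ?thesis using hom_add[OF d'] by (auto simp: boundaries_def intro!: image_eqI[of _ _ "x' \<oplus>\<^bsub>C (n + 1)\<^esub> y'"])
    qed
    show "a \<odot>\<^bsub>(C n)\<lparr>carrier := cycles C d n\<rparr>\<^esub> x \<in> boundaries C d n"
      if ax: "a \<in> carrier R" "x \<in> boundaries C d n" for a x
    proof -
      obtain x' where "x = d (n + 1) x'" "x' \<in> carrier (C (n + 1))" using ax by (auto simp: boundaries_def)
      thus ?thesis using hom_smult[OF d' ax(1)] C''.smult_closed[OF ax(1)]
        by (auto simp: boundaries_def intro!: image_eqI[of _ _ "a \<odot>\<^bsub>C (n + 1)\<^esub> x'"])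
    qed
  qed
qed

lemma homology_class_eq:
  assumes "x \<in> cycles C d n" "y \<in> cycles C d n"
  shows "boundaries C d n +>\<^bsub>(C n)\<lparr>carrier := cycles C d n\<rparr>\<^esub> x = boundaries C d n +>\<^bsub>(C n)\<lparr>carrier := cycles C d n\<rparr>\<^esub> y
    \<longleftrightarrow> x \<ominus>\<^bsub>C n\<^esub> y \<in> boundaries C d n"
  using left_module.quotient_eq_iff[OF cycles_module(1,3), of x n y] assms
    hom_diff[OF cycles_module(1) complex_module cycles_module(2), of x n y] by simp

lemma homology_smult_eq:
  assumes a: "a \<in> carrier R" and x: "\<And>x. x \<in> cycles C d n ==> a \<odot>\<^bsub>C n\<^esub> x \<ominus>\<^bsub>C n\<^esub> x \<in> boundaries C d n"
    and z: "z \<in> carrier (homology C d n)"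
  shows "a \<odot>\<^bsub>homology C d n\<^esub> z = z"
proof -
  let ?Z = "(C n)\<lparr>carrier := cycles C d n\<rparr>"
  interpret Z: left_module R ?Z by (rule cycles_module)
  obtain x where x': "x \<in> cycles C d n" "z = boundaries C d n +>\<^bsub>?Z\<^esub> x"
    using z unfolding homology_def Z.quotient_carrier[OF cycles_module(3)] by auto
  have "a \<odot>\<^bsub>C n\<^esub> x \<in> cycles C d n" using Z.smult_closed[OF a, of x] x' by simp
  thus ?thesis using Z.quotient_smult[OF cycles_module(3) a, of x] x' x[OF x'(1)]
    by (simp add: homology_def homology_class_eq)
qed

text \<open>As degree -1 is zero, all of degree 0 consists of cycles, so that surjectivity and the
  kernel of the augmentation on chains decide the matter.\<close>

lemma homology_iso:
  assumes N: "left_module R N" and \<epsilon>: "\<epsilon> \<in> lmod_hom R (C 0) N"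
    and 0: "\<And>x. x \<in> carrier (C 1) ==> \<epsilon> (d 1 x) = \<zero>\<^bsub>N\<^esub>"
    and top: "carrier (C (-1)) = {\<zero>\<^bsub>C (-1)\<^esub>}"
    and surj: "\<And>y. y \<in> carrier N ==> \<exists>x\<in>carrier (C 0). \<epsilon> x = y"
    and inj: "\<And>x. x \<in> carrier (C 0) ==> \<epsilon> x = \<zero>\<^bsub>N\<^esub> ==> \<exists>y\<in>carrier (C 1). x = d 1 y"
  shows "(\<lambda>z. the_elem (\<epsilon> ` z)) \<in> lmod_iso R (homology C d 0) N"
proof -
  let ?Z = "(C 0)\<lparr>carrier := cycles C d 0\<rparr>" and ?B = "boundaries C d 0"
  let ?e = "\<lambda>z. the_elem (\<epsilon> ` z)"
  interpret Z: left_module R ?Z by (rule cycles_module)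
  interpret N: left_module R N by fact
  note B = cycles_module(3)[of 0]
  have cyc: "cycles C d 0 = carrier (C 0)" using hom_closed[OF complex_diff[of 0]] top by (auto simp: cycles_def)
  have \<epsilon>': "\<epsilon> \<in> lmod_hom R ?Z N" using lmod_hom_comp[OF cycles_module(2)[of 0] \<epsilon>] .
  have eB: "\<epsilon> x = \<zero>\<^bsub>N\<^esub>" if "x \<in> ?B" for x using that 0 by (auto simp: boundaries_def)
  have e: "?e (?B +>\<^bsub>?Z\<^esub> x) = \<epsilon> x" if "x \<in> carrier (C 0)" for x
    by (rule Z.the_elem_coset[OF B N.ab hom_additive[OF \<epsilon>'] eB]) (use that cyc in auto)
  have car: "carrier (homology C d 0) = (\<lambda>x. ?B +>\<^bsub>?Z\<^esub> x) ` carrier (C 0)"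
    unfolding homology_def Z.quotient_carrier[OF B] by (simp add: cyc)
  have "?e \<in> lmod_hom R (homology C d 0) N"
  proof (rule lmod_homI)
    show "?e z \<in> carrier N" if "z \<in> carrier (homology C d 0)" for z
      using that e hom_closed[OF \<epsilon>] unfolding car by auto
    show "?e (z \<oplus>\<^bsub>homology C d 0\<^esub> z') = ?e z \<oplus>\<^bsub>N\<^esub> ?e z'"
      if zz: "z \<in> carrier (homology C d 0)" "z' \<in> carrier (homology C d 0)" for z z'
    proof -
      obtain x x' where x: "z = ?B +>\<^bsub>?Z\<^esub> x" "z' = ?B +>\<^bsub>?Z\<^esub> x'" "x \<in> carrier (C 0)" "x' \<in> carrier (C 0)"
        using zz unfolding car by auto
      have "z \<oplus>\<^bsub>homology C d 0\<^esub> z' = ?B +>\<^bsub>?Z\<^esub> (x \<oplus>\<^bsub>C 0\<^esub> x')"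
        using Z.quotient_add[OF B, of x x'] x cyc by (simp add: homology_def)
      moreover have "x \<oplus>\<^bsub>C 0\<^esub> x' \<in> carrier (C 0)" using Z.M.a_closed[of x x'] x cyc by simp
      ultimately show ?thesis using x by (simp add: e hom_add[OF \<epsilon>])
    qed
    show "?e (a \<odot>\<^bsub>homology C d 0\<^esub> z) = a \<odot>\<^bsub>N\<^esub> ?e z"
      if az: "a \<in> carrier R" "z \<in> carrier (homology C d 0)" for a z
    proof -
      obtain x where x: "z = ?B +>\<^bsub>?Z\<^esub> x" "x \<in> carrier (C 0)" using az unfolding car by auto
      have "a \<odot>\<^bsub>homology C d 0\<^esub> z = ?B +>\<^bsub>?Z\<^esub> (a \<odot>\<^bsub>C 0\<^esub> x)"
        using Z.quotient_smult[OF B az(1), of x] x cyc by (simp add: homology_def)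
      moreover have "a \<odot>\<^bsub>C 0\<^esub> x \<in> carrier (C 0)" using Z.smult_closed[OF az(1), of x] x cyc by simp
      ultimately show ?thesis using x az by (simp add: e hom_smult[OF \<epsilon>])
    qed
  qed
  moreover have "inj_on ?e (carrier (homology C d 0))"
  proof (rule inj_onI)
    fix z z' assume zz: "z \<in> carrier (homology C d 0)" "z' \<in> carrier (homology C d 0)" "?e z = ?e z'"
    then obtain x x' where x: "z = ?B +>\<^bsub>?Z\<^esub> x" "z' = ?B +>\<^bsub>?Z\<^esub> x'" "x \<in> carrier (C 0)" "x' \<in> carrier (C 0)"
      unfolding car by blast
    interpret C0: left_module R "C 0" by (rule complex_module)
    have "\<epsilon> (x \<ominus>\<^bsub>C 0\<^esub> x') = \<zero>\<^bsub>N\<^esub>"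
      using zz(3) x hom_diff[OF C0.left_module N \<epsilon> x(3,4)] hom_closed[OF \<epsilon>] N.M.minus_eq_zero_iff by (simp add: e)
    hence "x \<ominus>\<^bsub>C 0\<^esub> x' \<in> ?B" using inj[of "x \<ominus>\<^bsub>C 0\<^esub> x'"] x by (auto simp: boundaries_def)
    thus "z = z'" unfolding x(1,2) by (intro iffD2[OF homology_class_eq]) (use x cyc in auto)
  qed
  moreover have "?e ` carrier (homology C d 0) = carrier N"
  proof
    show "?e ` carrier (homology C d 0) \<subseteq> carrier N" using e hom_closed[OF \<epsilon>] unfolding car by auto
    show "carrier N \<subseteq> ?e ` carrier (homology C d 0)"
    proof
      fix y assume "y \<in> carrier N"
      then obtain x where x: "x \<in> carrier (C 0)" "\<epsilon> x = y" using surj by blast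
      thus "y \<in> ?e ` carrier (homology C d 0)" using e[OF x(1)] unfolding car by (intro image_eqI[of _ _ "?B +>\<^bsub>?Z\<^esub> x"]) auto
    qed
  qed
  ultimately show ?thesis by (simp add: lmod_iso_def bij_betw_def)
qed

end

section \<open>Tensoring with a cyclic module\<close>

context
  fixes R :: "('a, 'r) ring_scheme" and N :: "('a, 'c) module" and g
  assumes R: "cring R" and N: "left_module R N" and g: "g \<in> carrier N"
    and gen: "\<And>c. c \<in> carrier N ==> \<exists>a\<in>carrier R. c = a \<odot>\<^bsub>N\<^esub> g"
begin

interpretation R: cring R by (rule R)
interpretation N: left_module R N by (rule N)

abbreviation "ann \<equiv> {a \<in> carrier R. a \<odot>\<^bsub>N\<^esub> g = \<zero>\<^bsub>N\<^esub>}"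

text \<open>The scalar in c = a g passes through the tensor sign, and sums of tensors with left
  factor g combine into one.\<close>

lemma tensor_cyclic_ex:
  assumes P: "left_module R P" and z: "z \<in> carrier (tensor_module R N P)"
  shows "\<exists>x\<in>carrier P. z = tensor R N P g x"
proof -
  interpret P: left_module R P by fact
  interpret t: tensor_product R N P ..
  from z show ?thesis
  proof (induction rule: t.tensor_induct)
    case (tensor c x)
    then obtain a where a: "a \<in> carrier R" "c = a \<odot>\<^bsub>N\<^esub> g" using gen by blast
    hence "tensor R N P c x = tensor R N P g (a \<odot>\<^bsub>P\<^esub> x)" using tensor g by (simp add: t.tensor_smult_l t.tensor_smult_r)
    thus ?case using P.smult_closed[OF a(1) tensor(2)] by blast
  next
    case (add z z')
    then obtain x x' where x: "x \<in> carrier P" "x' \<in> carrier P" "z = tensor R N P g x" "z' = tensor R N P g x'" by blast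
    thus ?case using g by (intro bexI[of _ "x \<oplus>\<^bsub>P\<^esub> x'"]) (auto simp: t.tensor_add_r)
  qed
qed

text \<open>For cyclic N = R g the tensor product is P modulo ann(g) P. Elements of ann(g) P clearly
  give zero; conversely, a bilinear map from N and P to this quotient detects every other
  element.\<close>

lemma tensor_cyclic_zero:
  assumes P: "left_module R P" and x: "x \<in> carrier P"
  shows "tensor R N P g x = \<zero>\<^bsub>tensor_module R N P\<^esub> \<longleftrightarrow> x \<in> ideal_smult R ann P"
proof
  interpret P: left_module R P by fact
  interpret t: tensor_product R N P ..
  interpret T: left_module R "tensor_module R N P" by (rule t.left_module_T)
  have annR: "ann \<subseteq> carrier R" by auto
  let ?K = "ideal_smult R ann P"
  have K: "submodule ?K R P" by (rule P.ideal_smult_submodule[OF annR])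
  {
    assume "x \<in> ?K"
    moreover have "{a \<odot>\<^bsub>P\<^esub> x | a x. a \<in> ann \<and> x \<in> carrier P} \<subseteq> carrier P" by (rule P.ideal_gens_subset[OF annR])
    ultimately have "x \<in> carrier P \<and> tensor R N P g x = \<zero>\<^bsub>tensor_module R N P\<^esub>" unfolding ideal_smult_def
    proof (induction rule: P.span_induct)
      case (base x)
      then obtain a y where a: "x = a \<odot>\<^bsub>P\<^esub> y" "a \<in> ann" "y \<in> carrier P" by blast
      have "tensor R N P g x = tensor R N P (a \<odot>\<^bsub>N\<^esub> g) y" using a g t.tensor_smult_l[of a g y] t.tensor_smult_r[of a g y] by auto
      also have "a \<odot>\<^bsub>N\<^esub> g = \<zero>\<^bsub>N\<^esub>" using a(2) by simp
      finally show ?case using a P.smult_closed by (simp add: t.tensor_zero_l)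
    next
      case zero show ?case using g by (simp add: t.tensor_zero_r)
    next
      case (add x y) thus ?case using g by (simp add: t.tensor_add_r)
    next
      case (smult a x) thus ?case using g by (simp add: t.tensor_smult_r P.smult_closed T.smult_r_null)
    qed
    thus "tensor R N P g x = \<zero>\<^bsub>tensor_module R N P\<^esub>" by blast
  }
  \<comment> \<open>The bilinear map needs a ring element for each c in N; it is chosen arbitrarily
    among those with c = a g.\<close>
  define \<gamma> where "\<gamma> c = (SOME a. a \<in> carrier R \<and> c = a \<odot>\<^bsub>N\<^esub> g)" for c
  have \<gamma>: "\<gamma> c \<in> carrier R" "c = \<gamma> c \<odot>\<^bsub>N\<^esub> g" if "c \<in> carrier N" for c
    using someI_ex[of "\<lambda>a. a \<in> carrier R \<and> c = a \<odot>\<^bsub>N\<^esub> g"] gen[OF that] unfolding \<gamma>_def by blast+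
  let ?L = "quotient_module P ?K"
  define \<beta> where "\<beta> = (\<lambda>(c, x). ?K +>\<^bsub>P\<^esub> (\<gamma> c \<odot>\<^bsub>P\<^esub> x))"
  have \<beta>: "\<beta> (c, y) = ?K +>\<^bsub>P\<^esub> (\<gamma> c \<odot>\<^bsub>P\<^esub> y)" for c y by (simp add: \<beta>_def)
  \<comment> \<open>Two choices differ by an annihilator of g, hence their products with y agree in
    the quotient. All bilinearity conditions on the choice come from this.\<close>
  have eq: "?K +>\<^bsub>P\<^esub> (a \<odot>\<^bsub>P\<^esub> y) = ?K +>\<^bsub>P\<^esub> (b \<odot>\<^bsub>P\<^esub> y)"
    if "a \<in> carrier R" "b \<in> carrier R" "y \<in> carrier P" "a \<odot>\<^bsub>N\<^esub> g = b \<odot>\<^bsub>N\<^esub> g" for a b y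
  proof -
    have "a \<ominus>\<^bsub>R\<^esub> b \<in> ann" using that g by (simp add: N.smult_l_diff N.M.minus_eq_zero_iff N.smult_closed)
    from P.ideal_smultI[OF this that(3)] show ?thesis
      using that by (simp add: P.quotient_eq_iff[OF K] P.smult_closed P.smult_l_diff)
  qed
  have id: "id \<in> ring_hom R R" by (auto simp: ring_hom_def)
  note lift = t.tensor_lift[OF P.ring_R P.quotient_left_module[OF K] id, of \<beta>]
  have L1: "\<beta> (c, y) \<in> carrier ?L" if "c \<in> carrier N" "y \<in> carrier P" for c y
    using that \<gamma> P.smult_closed by (auto simp: \<beta> P.quotient_carrier[OF K])
  have L2: "\<beta> (c \<oplus>\<^bsub>N\<^esub> c', y) = \<beta> (c, y) \<oplus>\<^bsub>?L\<^esub> \<beta> (c', y)" if "c \<in> carrier N" "c' \<in> carrier N" "y \<in> carrier P" for c c' y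
  proof -
    have "\<beta> (c \<oplus>\<^bsub>N\<^esub> c', y) = ?K +>\<^bsub>P\<^esub> ((\<gamma> c \<oplus>\<^bsub>R\<^esub> \<gamma> c') \<odot>\<^bsub>P\<^esub> y)"
      unfolding \<beta>
      by (rule eq) (use that \<gamma>(1) \<gamma>(2)[symmetric] g in \<open>simp_all add: N.smult_l_distr\<close>)
    thus ?thesis using that \<gamma>(1) by (simp add: \<beta> P.smult_l_distr P.quotient_add[OF K] P.smult_closed)
  qed
  have L3: "\<beta> (c, y \<oplus>\<^bsub>P\<^esub> y') = \<beta> (c, y) \<oplus>\<^bsub>?L\<^esub> \<beta> (c, y')" if "c \<in> carrier N" "y \<in> carrier P" "y' \<in> carrier P" for c y y'
    using that \<gamma>(1) by (simp add: \<beta> P.smult_r_distr P.quotient_add[OF K] P.smult_closed)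
  have L4: "\<beta> (a \<odot>\<^bsub>N\<^esub> c, y) = id a \<odot>\<^bsub>?L\<^esub> \<beta> (c, y)" if "a \<in> carrier R" "c \<in> carrier N" "y \<in> carrier P" for a c y
  proof -
    have "\<beta> (a \<odot>\<^bsub>N\<^esub> c, y) = ?K +>\<^bsub>P\<^esub> ((a \<otimes>\<^bsub>R\<^esub> \<gamma> c) \<odot>\<^bsub>P\<^esub> y)"
      unfolding \<beta>
      by (rule eq) (use that \<gamma>(1) \<gamma>(2)[symmetric] g N.smult_closed in \<open>simp_all add: N.smult_assoc1\<close>)
    thus ?thesis using that \<gamma>(1) by (simp add: \<beta> P.smult_assoc1 P.quotient_smult[OF K] P.smult_closed)
  qed
  have L5: "\<beta> (c, a \<odot>\<^bsub>P\<^esub> y) = id a \<odot>\<^bsub>?L\<^esub> \<beta> (c, y)" if "a \<in> carrier R" "c \<in> carrier N" "y \<in> carrier P" for a c y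
  proof -
    have "\<gamma> c \<odot>\<^bsub>P\<^esub> (a \<odot>\<^bsub>P\<^esub> y) = a \<odot>\<^bsub>P\<^esub> (\<gamma> c \<odot>\<^bsub>P\<^esub> y)"
      using that \<gamma>(1)[of c] by (simp add: P.smult_assoc1[symmetric] R.m_comm)
    thus ?thesis using that \<gamma>(1) by (simp add: \<beta> P.quotient_smult[OF K] P.smult_closed)
  qed
  have l1: "induced_map R id ?L \<beta> \<in> slin id R (tensor_module R N P) ?L"
    by (rule lift(1)) (fact L1 L2 L3 L4 L5)+
  have l2: "induced_map R id ?L \<beta> (tensor R N P g x) = \<beta> (g, x)"
    by (rule lift(2)[OF _ _ _ _ _ g x]) (fact L1 L2 L3 L4 L5)+
  assume "tensor R N P g x = \<zero>\<^bsub>tensor_module R N P\<^esub>"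
  moreover have "induced_map R id ?L \<beta> \<zero>\<^bsub>tensor_module R N P\<^esub> = \<zero>\<^bsub>?L\<^esub>"
    by (rule hom_zero[OF T.left_module P.quotient_left_module[OF K]]) (use l1 in \<open>simp only: lmod_hom_slin\<close>)
  ultimately have "?K +>\<^bsub>P\<^esub> (\<gamma> g \<odot>\<^bsub>P\<^esub> x) = \<zero>\<^bsub>?L\<^esub>" using l2 by (simp add: \<beta>)
  moreover have "?K +>\<^bsub>P\<^esub> (\<gamma> g \<odot>\<^bsub>P\<^esub> x) = ?K +>\<^bsub>P\<^esub> (\<one>\<^bsub>R\<^esub> \<odot>\<^bsub>P\<^esub> x)"
    by (rule eq) (use g x \<gamma>(1) \<gamma>(2)[symmetric] in \<open>simp_all add: N.smult_one\<close>)
  ultimately have "x \<ominus>\<^bsub>P\<^esub> \<zero>\<^bsub>P\<^esub> \<in> ?K"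
    using x P.quotient_eq_iff[OF K, of x "\<zero>\<^bsub>P\<^esub>"] by (simp add: P.smult_one P.quotient_zero'[OF K])
  thus "x \<in> ?K" using x by (simp add: P.M.minus_zero)
qed

text \<open>Every element is g \<otimes> x, so exactness asks that an x whose image is zero modulo
  ann(g) be itself a boundary modulo ann(g).\<close>

lemma tensor_cyclic_exact:
  assumes P: "left_module R P" "left_module R P'" "left_module R P''"
    and f: "f \<in> lmod_hom R P' P" and h: "h \<in> lmod_hom R P P''"
    and hf: "\<And>x. x \<in> carrier P' ==> h (f x) = \<zero>\<^bsub>P''\<^esub>"
    and ex: "\<And>x. x \<in> carrier P ==> h x \<in> ideal_smult R ann P'' ==> \<exists>y\<in>carrier P'. x \<ominus>\<^bsub>P\<^esub> f y \<in> ideal_smult R ann P"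
  shows "exact_at (tensor_module R N P') (tensor_map R N P id f) (tensor_module R N P)
    (tensor_map R N P'' id h) (tensor_module R N P'')"
proof -
  interpret P: left_module R P by fact
  interpret t: tensor_product R N P ..
  interpret t': tensor_product R N P' by (intro tensor_product.intro N P)
  interpret t'': tensor_product R N P'' by (intro tensor_product.intro N P)
  have id: "id \<in> lmod_hom R N N" using lmod_hom_id[of R N] by (simp add: id_def)
  note tf = tensor_map_hom[OF t'.tensor_product_axioms t.tensor_product_axioms id f]
  note th = tensor_map_hom[OF t.tensor_product_axioms t''.tensor_product_axioms id h]
  show ?thesis unfolding exact_at_def
  proof (intro equalityI subsetI)
    fix z assume "z \<in> tensor_map R N P id f ` carrier (tensor_module R N P')"
    then obtain y where y: "y \<in> carrier P'" "z = tensor R N P g (f y)"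
      using tensor_cyclic_ex[OF P(2)] tf(2)[OF g] by force
    thus "z \<in> {y \<in> carrier (tensor_module R N P). tensor_map R N P'' id h y = \<zero>\<^bsub>tensor_module R N P''\<^esub>}"
      using hom_closed[OF f] g th(2)[OF g] hf t''.tensor_zero_r[OF g] by (simp add: t.tensor_closed)
  next
    fix z assume z: "z \<in> {y \<in> carrier (tensor_module R N P). tensor_map R N P'' id h y = \<zero>\<^bsub>tensor_module R N P''\<^esub>}"
    then obtain x where x: "x \<in> carrier P" "z = tensor R N P g x" using tensor_cyclic_ex[OF P(1)] by blast
    hence "tensor R N P'' g (h x) = \<zero>\<^bsub>tensor_module R N P''\<^esub>" using z th(2)[OF g x(1)] by simp
    hence "h x \<in> ideal_smult R ann P''" using tensor_cyclic_zero[OF P(3)] hom_closed[OF h x(1)] by blast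
    then obtain y where y: "y \<in> carrier P'" "x \<ominus>\<^bsub>P\<^esub> f y \<in> ideal_smult R ann P" using ex x(1) by blast
    have fy: "f y \<in> carrier P" by (rule hom_closed[OF f y(1)])
    have "tensor R N P g (x \<ominus>\<^bsub>P\<^esub> f y) = \<zero>\<^bsub>tensor_module R N P\<^esub>" using tensor_cyclic_zero[OF P(1)] x(1) fy y(2) by blast
    moreover have "x = (x \<ominus>\<^bsub>P\<^esub> f y) \<oplus>\<^bsub>P\<^esub> f y" using x(1) fy by (simp add: a_minus_def P.M.a_assoc P.M.l_neg)
    ultimately have "z = tensor R N P g (f y)"
      using t.tensor_add_r[OF g, of "x \<ominus>\<^bsub>P\<^esub> f y" "f y"] x fy left_module_ab[OF t.left_module_T] t.tensor_closed[OF g fy]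
      by (simp add: abelian_group_def abelian_monoid.l_zero)
    thus "z \<in> tensor_map R N P id f ` carrier (tensor_module R N P')"
      using tf(2)[OF g y(1)] t'.tensor_closed[OF g y(1)] by (intro image_eqI[of _ _ "tensor R N P' g y"]) auto
  qed
qed


end

section \<open>The mapping telescope\<close>

lemma direct_sum_hom:
  assumes M: "\<And>i. i \<in> I ==> left_module R (M i)" and g: "\<And>i. i \<in> I ==> g i \<in> lmod_hom R N (M i)"
    and fin: "\<And>x. x \<in> carrier N ==> \<exists>B. finite B \<and> (\<forall>i\<in>I - B. g i x = \<zero>\<^bsub>M i\<^esub>)"
  shows "(\<lambda>x. \<lambda>i\<in>I. g i x) \<in> lmod_hom R N (direct_sum I M)"
proof (rule lmod_homI)
  show "(\<lambda>i\<in>I. g i x) \<in> carrier (direct_sum I M)" if x: "x \<in> carrier N" for x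
  proof -
    obtain B where "finite B" "\<forall>i\<in>I - B. g i x = \<zero>\<^bsub>M i\<^esub>" using fin[OF x] by blast
    thus ?thesis using hom_closed[OF g x] by (intro direct_sum_memI) auto
  qed
qed (auto simp: direct_sum_simps(2,4) hom_add[OF g] hom_smult[OF g] intro!: restrict_ext)

lemma pair_hom: "f \<in> lmod_hom R N M ==> g \<in> lmod_hom R N M' ==> (\<lambda>x. (f x, g x)) \<in> lmod_hom R N (module_pair M M')"
  by (rule lmod_homI) (auto simp: hom_closed hom_add hom_smult)

lemma fst_hom: "fst \<in> lmod_hom R (module_pair M M') M" and snd_hom: "snd \<in> lmod_hom R (module_pair M M') M'"
  by (rule lmod_homI; auto)+

lemma alt_sign_hom: "left_module R N ==> f \<in> lmod_hom R M N ==> (\<lambda>x. alt_sign N e (f x)) \<in> lmod_hom R M N"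
  using lmod_hom_neg[of R N f M] by (cases "even e") (simp_all add: alt_sign_def)

text \<open>The complexes D^(n) share their modules and differ only in the differentials; hence one
  family \<open>D\<close> and n-indexed maps \<open>d\<close> and \<open>u\<close>. Nothing is
  assumed about the ring besides being one, so that the locale can be used over kT and over the
  group algebra of \<Gamma>.\<close>

locale telescope =
  fixes R :: "('a, 'r) ring_scheme" and D :: "int => ('a, 'b) module"
    and d :: "nat => int => 'b => 'b" and u :: "nat => int => 'b => 'b"
  assumes R: "ring R" and D: "\<And>m. left_module R (D m)"
    and d: "\<And>n m. n \<ge> 1 ==> d n m \<in> lmod_hom R (D m) (D (m - 1))"
    and dd: "\<And>n m x. n \<ge> 1 ==> x \<in> carrier (D m) ==> d n (m - 1) (d n m x) = \<zero>\<^bsub>D (m - 2)\<^esub>"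
    and u: "\<And>n m. n \<ge> 1 ==> u n m \<in> lmod_hom R (D m) (D m)"
    and du: "\<And>n m x. n \<ge> 1 ==> x \<in> carrier (D m) ==> d (Suc n) m (u n m x) = u n (m - 1) (d n m x)"
begin

definition "S m = direct_sum {1::nat..} (\<lambda>n. D m)"
definition "sd m x = (\<lambda>n\<in>{1::nat..}. d n m (x n))"
definition "P m x = (\<lambda>n\<in>{1::nat..}. if n = 1 then x 1 else x n \<ominus>\<^bsub>D m\<^esub> u (n - 1) m (x (n - 1)))"
definition "inc m N = summand_incl {1::nat..} (\<lambda>n. D m) N"
abbreviation "B \<equiv> cone_module S S"
abbreviation "bd \<equiv> cone_diff S sd sd P"

sublocale D: left_module R "D m" for m by (rule D)

lemma u_zero: "n \<ge> 1 ==> u n m \<zero>\<^bsub>D m\<^esub> = \<zero>\<^bsub>D m\<^esub>" by (rule hom_zero[OF D D u])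
lemma d_zero: "n \<ge> 1 ==> d n m \<zero>\<^bsub>D m\<^esub> = \<zero>\<^bsub>D (m - 1)\<^esub>" by (rule hom_zero[OF D D d])
lemma u_closed: "n \<ge> 1 ==> x \<in> carrier (D m) ==> u n m x \<in> carrier (D m)" by (rule hom_closed[OF u])
lemma d_closed: "n \<ge> 1 ==> x \<in> carrier (D m) ==> d n m x \<in> carrier (D (m - 1))" by (rule hom_closed[OF d])

lemma S: "left_module R (S m)" unfolding S_def by (rule direct_sum_left_module[OF R D])

sublocale S: left_module R "S m" for m by (rule S)

lemma S_simps: "n \<ge> 1 ==> (x \<oplus>\<^bsub>S m\<^esub> y) n = x n \<oplus>\<^bsub>D m\<^esub> y n" "n \<ge> 1 ==> \<zero>\<^bsub>S m\<^esub> n = \<zero>\<^bsub>D m\<^esub>"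
  "n \<ge> 1 ==> (a \<odot>\<^bsub>S m\<^esub> x) n = a \<odot>\<^bsub>D m\<^esub> x n"
  by (simp_all add: S_def direct_sum_simps(2-4))

lemma S_comp: "x \<in> carrier (S m) ==> n \<ge> 1 ==> x n \<in> carrier (D m)"
  unfolding S_def by (drule direct_sum_comp[of _ _ _ n]) auto

lemma proj: "n \<ge> 1 ==> (\<lambda>x. x n) \<in> lmod_hom R (S m) (D m)"
  unfolding S_def by (rule proj_hom[OF R D]) simp

lemma S_minus: "n \<ge> 1 ==> x \<in> carrier (S m) ==> (\<ominus>\<^bsub>S m\<^esub> x) n = \<ominus>\<^bsub>D m\<^esub> x n"
  by (rule hom_minus[OF S D proj])

lemma S_ext: "x \<in> carrier (S m) ==> y \<in> carrier (S m) ==> (\<And>n. n \<ge> 1 ==> x n = y n) ==> x = y"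
  unfolding S_def by (rule direct_sum_ext) auto

lemma S_bound:
  assumes "x \<in> carrier (S m)" shows "\<exists>N\<ge>1. \<forall>n\<ge>N. x n = \<zero>\<^bsub>D m\<^esub>"
proof -
  have "finite {n \<in> {1..}. x n \<noteq> \<zero>\<^bsub>D m\<^esub>}" using assms by (simp add: S_def direct_sum_simps(1))
  then obtain N where N: "\<forall>n\<in>{n \<in> {1..}. x n \<noteq> \<zero>\<^bsub>D m\<^esub>}. n < N" using finite_nat_set_iff_bounded by auto
  show ?thesis by (rule exI[of _ "max 1 N"]) (use N in force)
qed

lemma inc_hom: "N \<ge> 1 ==> inc m N \<in> lmod_hom R (D m) (S m)"
  unfolding S_def inc_def by (rule summand_incl_hom[OF R D]) simp

lemma inc_apply: "n \<ge> 1 ==> inc m N x n = (if n = N then x else \<zero>\<^bsub>D m\<^esub>)"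
  by (simp add: inc_def summand_incl_apply)

lemma inc_closed: "N \<ge> 1 ==> x \<in> carrier (D m) ==> inc m N x \<in> carrier (S m)"
  by (rule hom_closed[OF inc_hom])

lemma S_induct [consumes 1, case_names zero add inc]:
  assumes "x \<in> carrier (S m)" "Q \<zero>\<^bsub>S m\<^esub>"
    "\<And>x y. x \<in> carrier (S m) ==> y \<in> carrier (S m) ==> Q x ==> Q y ==> Q (x \<oplus>\<^bsub>S m\<^esub> y)"
    "\<And>N w. N \<ge> 1 ==> w \<in> carrier (D m) ==> Q (inc m N w)"
  shows "Q x"
proof (rule direct_sum_induct[where R = R and I = "{1..}" and M = "\<lambda>n. D m" and x = x and P = Q])
  show "Q (summand_incl {1..} (\<lambda>n. D m) j (x j))" if "j \<in> {1..}" for j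
    using that assms(4)[of j "x j"] S_comp[OF assms(1), of j] by (simp add: inc_def)
qed (use R D assms(1-3) in \<open>auto simp: S_def\<close>)

lemma sd_hom: "sd m \<in> lmod_hom R (S m) (S (m - 1))"
proof -
  have "(\<lambda>x. \<lambda>n\<in>{1::nat..}. d n m (x n)) \<in> lmod_hom R (S m) (direct_sum {1..} (\<lambda>n. D (m - 1)))"
  proof (rule direct_sum_hom[OF D])
    fix x assume "x \<in> carrier (S m)"
    from S_bound[OF this] obtain N where "\<forall>n\<ge>N. x n = \<zero>\<^bsub>D m\<^esub>" by blast
    thus "\<exists>B. finite B \<and> (\<forall>n\<in>{1..} - B. d n m (x n) = \<zero>\<^bsub>D (m - 1)\<^esub>)"
      by (intro exI[of _ "{..<N}"]) (auto simp: d_zero)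
  qed (auto intro!: lmod_hom_comp[OF proj d])
  thus ?thesis by (simp add: S_def sd_def[abs_def])
qed

lemma P_hom: "P m \<in> lmod_hom R (S m) (S m)"
proof -
  have "(\<lambda>x. \<lambda>n\<in>{1::nat..}. if n = 1 then x 1 else x n \<ominus>\<^bsub>D m\<^esub> u (n - 1) m (x (n - 1))) \<in>
    lmod_hom R (S m) (direct_sum {1..} (\<lambda>n. D m))"
  proof (rule direct_sum_hom[OF D])
    fix x assume "x \<in> carrier (S m)"
    from S_bound[OF this] obtain N where N: "N \<ge> 1" "\<forall>n\<ge>N. x n = \<zero>\<^bsub>D m\<^esub>" by blast
    have "(if n = 1 then x 1 else x n \<ominus>\<^bsub>D m\<^esub> u (n - 1) m (x (n - 1))) = \<zero>\<^bsub>D m\<^esub>" if "n \<in> {1..} - {..N}" for n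
    proof -
      have "n \<noteq> 1" "n - 1 \<ge> 1" "x n = \<zero>\<^bsub>D m\<^esub>" "x (n - 1) = \<zero>\<^bsub>D m\<^esub>" using that N by auto
      thus ?thesis using u_zero[of "n - 1" m] by (simp add: D.M.minus_zero)
    qed
    thus "\<exists>B. finite B \<and> (\<forall>n\<in>{1..} - B. (if n = 1 then x 1 else x n \<ominus>\<^bsub>D m\<^esub> u (n - 1) m (x (n - 1))) = \<zero>\<^bsub>D m\<^esub>)"
      by (intro exI[of _ "{..N}"]) blast
  next
    fix n :: nat assume n: "n \<in> {1..}"
    show "(\<lambda>x. if n = 1 then x 1 else x n \<ominus>\<^bsub>D m\<^esub> u (n - 1) m (x (n - 1))) \<in> lmod_hom R (S m) (D m)"
    proof (cases "n = 1")
      case True thus ?thesis using proj[of 1 m] by simp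
    next
      case False
      hence "n - 1 \<ge> 1" "n \<ge> 1" using n by auto
      from lmod_hom_diff[OF D proj[OF this(2)] lmod_hom_comp[OF proj[OF this(1)] u[OF this(1)]], of m]
      show ?thesis using False by simp
    qed
  qed
  thus ?thesis by (simp add: S_def P_def[abs_def])
qed

lemma sd_apply: "n \<ge> 1 ==> sd m x n = d n m (x n)" by (simp add: sd_def)
lemma P_1: "P m x 1 = x 1" and P_Suc: "n \<ge> 1 ==> P m x (Suc n) = x (Suc n) \<ominus>\<^bsub>D m\<^esub> u n m (x n)"
  by (simp_all add: P_def)

lemma sd_closed: "x \<in> carrier (S m) ==> sd m x \<in> carrier (S (m - 1))" by (rule hom_closed[OF sd_hom])
lemma P_closed: "x \<in> carrier (S m) ==> P m x \<in> carrier (S m)" by (rule hom_closed[OF P_hom])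

lemma sd_sd: "x \<in> carrier (S m) ==> sd (m - 1) (sd m x) = \<zero>\<^bsub>S (m - 2)\<^esub>"
  using sd_closed[OF sd_closed, of x m] by (intro S_ext[of _ "m - 2"]) (auto simp: sd_apply S_simps dd S_comp)

lemma sd_P: "x \<in> carrier (S m) ==> sd m (P m x) = P (m - 1) (sd m x)"
proof (rule S_ext[OF sd_closed[OF P_closed] P_closed[OF sd_closed]])
  fix n :: nat assume x: "x \<in> carrier (S m)" and n: "n \<ge> 1"
  show "sd m (P m x) n = P (m - 1) (sd m x) n"
  proof (cases "n = 1")
    case True thus ?thesis using P_1 by (simp add: sd_apply)
  next
    case False
    then obtain k where k: "n = Suc k" "k \<ge> 1" using n by (cases n) auto
    thus ?thesis using x by (simp add: sd_apply P_Suc hom_diff[OF D D d] S_comp u_closed du)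
  qed
qed

text \<open>The telescope map is unitriangular with respect to the index n: a component of z is
  determined by the corresponding component of the image and the preceding component of z. The
  version up to N is the one that \<open>cycle_reduce\<close> uses.\<close>

lemma inj_P:
  assumes z: "z \<in> carrier (S m)" and "\<And>n. 1 \<le> n ==> n < N ==> P m z n = \<zero>\<^bsub>D m\<^esub>"
  shows "1 \<le> n ==> n < N ==> z n = \<zero>\<^bsub>D m\<^esub>"
proof (induction n)
  case (Suc k)
  show ?case
  proof (cases "k = 0")
    case True thus ?thesis using assms(2)[of 1] Suc P_1[of m z] by simp
  next
    case False
    hence "z k = \<zero>\<^bsub>D m\<^esub>" "k \<ge> 1" using Suc by auto
    thus ?thesis using assms(2)[of "Suc k"] Suc S_comp[OF z, of "Suc k"] by (simp add: P_Suc u_zero D.M.minus_zero)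
  qed
qed simp

text \<open>The sign in the cone differential, as an endomorphism of each degree. It changes when
  the differential is passed, and this is what makes the square of the cone differential
  vanish.\<close>

definition "sg m x = alt_sign (S m) m x"

lemma sg_hom: "f \<in> lmod_hom R M (S m) ==> (\<lambda>x. sg m (f x)) \<in> lmod_hom R M (S m)"
  unfolding sg_def by (rule alt_sign_hom[OF S])

lemma sg_hom': "sg m \<in> lmod_hom R (S m) (S m)" using sg_hom[OF lmod_hom_id] .

lemma sg_closed: "x \<in> carrier (S m) ==> sg m x \<in> carrier (S m)" by (rule hom_closed[OF sg_hom'])

lemma sg_sg: "x \<in> carrier (S m) ==> sg m (sg m x) = x"
  by (simp add: sg_def alt_sign_def)

lemma sg_commute: "f \<in> lmod_hom R (S m) (S m) ==> x \<in> carrier (S m) ==> f (sg m x) = sg m (f x)"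
  by (simp add: sg_def alt_sign_def hom_minus[OF S S])

lemma sg_sd: "x \<in> carrier (S m) ==> sd m (sg m x) = \<ominus>\<^bsub>S (m - 1)\<^esub> sg (m - 1) (sd m x)"
  by (simp add: sg_def alt_sign_def hom_minus[OF S S sd_hom] sd_closed)

lemma B_simps: "B m = module_pair (S m) (S (m - 1))"
  "bd m x = (sd m (fst x) \<oplus>\<^bsub>S (m - 1)\<^esub> sg (m - 1) (P (m - 1) (snd x)), sd (m - 1) (snd x))"
  by (auto simp: cone_module_def cone_diff_def sg_def split: prod.splits)

lemma B: "left_module R (B m)" unfolding B_simps by (rule module_pair_left_module[OF S S])

lemma bd_hom: "bd m \<in> lmod_hom R (B m) (B (m - 1))"
  unfolding B_simps
  by (intro pair_hom lmod_hom_add[OF S] lmod_hom_comp[OF fst_hom sd_hom] lmod_hom_comp[OF snd_hom sd_hom]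
      sg_hom lmod_hom_comp[OF snd_hom P_hom])

lemma bd_bd: "x \<in> carrier (B m) ==> bd (m - 1) (bd m x) = \<zero>\<^bsub>B (m - 2)\<^esub>"
proof -
  assume "x \<in> carrier (B m)"
  hence x: "fst x \<in> carrier (S m)" "snd x \<in> carrier (S (m - 1))" by (auto simp: B_simps)
  have m2: "m - 1 - 1 = m - 2" by simp
  let ?y = "sg (m - 2) (P (m - 2) (sd (m - 1) (snd x)))"
  have sdc: "sd (m - 1) (snd x) \<in> carrier (S (m - 2))" using sd_closed[OF x(2)] by simp
  hence y: "?y \<in> carrier (S (m - 2))" by (intro sg_closed P_closed)
  have "sd (m - 1) (sd m (fst x) \<oplus>\<^bsub>S (m - 1)\<^esub> sg (m - 1) (P (m - 1) (snd x))) =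
    sd (m - 1) (sd m (fst x)) \<oplus>\<^bsub>S (m - 2)\<^esub> sd (m - 1) (sg (m - 1) (P (m - 1) (snd x)))"
    using hom_add[OF sd_hom[of "m - 1"] sd_closed[OF x(1)] sg_closed[OF P_closed[OF x(2)]]] by (simp only: m2)
  also have "\<dots> = \<zero>\<^bsub>S (m - 2)\<^esub> \<oplus>\<^bsub>S (m - 2)\<^esub> \<ominus>\<^bsub>S (m - 2)\<^esub> ?y"
    using sg_sd[OF P_closed[OF x(2)]] sd_P[OF x(2)] sd_sd[OF x(1)] by (simp only: m2)
  finally have "sd (m - 1) (sd m (fst x) \<oplus>\<^bsub>S (m - 1)\<^esub> sg (m - 1) (P (m - 1) (snd x))) = \<ominus>\<^bsub>S (m - 2)\<^esub> ?y" using y by simp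
  moreover have "sd (m - 2) (sd (m - 1) (snd x)) = \<zero>\<^bsub>S (m - 2 - 1)\<^esub>" using sd_sd[OF x(2)] by simp
  ultimately show ?thesis unfolding B_simps fst_conv snd_conv m2 module_pair_simps using y S.M.l_neg by simp
qed

lemma complex_B: "chain_complex R B bd"
  unfolding chain_complex_def using B bd_hom bd_bd by blast

subsection \<open>Every cycle is homologous to a cycle of a single summand\<close>

text \<open>In the cokernel of the telescope map, w in summand N is identified with its image in
  summand N + 1, as in the colimit of the D^(n).\<close>

lemma slide_step:
  assumes N: "N \<ge> 1" and w: "w \<in> carrier (D m)"
  shows "inc m N w = inc m (Suc N) (u N m w) \<oplus>\<^bsub>S m\<^esub> P m (inc m N w)"
proof (rule S_ext)
  show "inc m N w \<in> carrier (S m)" by (rule inc_closed[OF assms])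
  thus "inc m (Suc N) (u N m w) \<oplus>\<^bsub>S m\<^esub> P m (inc m N w) \<in> carrier (S m)"
    using inc_closed[OF _ u_closed[OF assms], of "Suc N"] by (intro S.M.a_closed P_closed) auto
  fix n :: nat assume n: "n \<ge> 1"
  note uw = u_closed[OF assms]
  show "inc m N w n = (inc m (Suc N) (u N m w) \<oplus>\<^bsub>S m\<^esub> P m (inc m N w)) n"
  proof (cases "n = 1")
    case True
    have "inc m N w 1 = \<zero>\<^bsub>D m\<^esub> \<oplus>\<^bsub>D m\<^esub> inc m N w 1" using w by (simp add: inc_apply)
    thus ?thesis using N w P_1[of m "inc m N w"] True by (simp add: S_simps inc_apply)
  next
    case False
    then obtain k where k: "n = Suc k" "k \<ge> 1" using n by (cases n) auto
    consider "k = N" | "N = Suc k" | "k \<noteq> N" "Suc k \<noteq> N" by blast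
    thus ?thesis
      by cases (use k w uw N in \<open>simp_all add: S_simps inc_apply P_Suc u_zero D.M.minus_zero a_minus_def D.M.r_neg\<close>)
  qed
qed

lemma inc_slide:
  assumes w: "w \<in> carrier (D m)" and x: "x = inc m N w \<oplus>\<^bsub>S m\<^esub> P m y" and N: "N \<ge> 1"
    and y: "y \<in> carrier (S m)" "\<And>n. n \<ge> N ==> y n = \<zero>\<^bsub>D m\<^esub>"
  shows "\<exists>y'\<in>carrier (S m). x = inc m (Suc N) (u N m w) \<oplus>\<^bsub>S m\<^esub> P m y' \<and> (\<forall>n\<ge>Suc N. y' n = \<zero>\<^bsub>D m\<^esub>)"
proof (intro bexI[of _ "inc m N w \<oplus>\<^bsub>S m\<^esub> y"] conjI allI impI)
  have iN: "inc m N w \<in> carrier (S m)" "inc m (Suc N) (u N m w) \<in> carrier (S m)"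
    using inc_closed u_closed N w by auto
  show "x = inc m (Suc N) (u N m w) \<oplus>\<^bsub>S m\<^esub> P m (inc m N w \<oplus>\<^bsub>S m\<^esub> y)"
    unfolding x hom_add[OF P_hom iN(1) y(1)] using iN y P_closed
    by (subst slide_step[OF N w]) (simp add: S.M.a_assoc)
  show "inc m N w \<oplus>\<^bsub>S m\<^esub> y \<in> carrier (S m)" using iN y by simp
  fix n assume "n \<ge> Suc N"
  thus "(inc m N w \<oplus>\<^bsub>S m\<^esub> y) n = \<zero>\<^bsub>D m\<^esub>" using N y(2) by (simp add: S_simps inc_apply)
qed

text \<open>A finitely supported element is pushed into any sufficiently late summand. The bound on
  the support of y is kept because the reduction of cycles must know that the correction vanishes
  from N on.\<close>

lemma slide:
  assumes "x \<in> carrier (S m)"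
  shows "\<exists>N0\<ge>1. \<forall>N\<ge>N0. \<exists>w\<in>carrier (D m). \<exists>y\<in>carrier (S m).
    x = inc m N w \<oplus>\<^bsub>S m\<^esub> P m y \<and> (\<forall>n\<ge>N. y n = \<zero>\<^bsub>D m\<^esub>)"
  using assms
proof (induction rule: S_induct)
  case zero
  have "inc m N \<zero>\<^bsub>D m\<^esub> = \<zero>\<^bsub>S m\<^esub>" if "N \<ge> 1" for N by (rule hom_zero[OF D S inc_hom[OF that]])
  moreover have "P m \<zero>\<^bsub>S m\<^esub> = \<zero>\<^bsub>S m\<^esub>" by (rule hom_zero[OF S S P_hom])
  ultimately show ?case
    by (intro exI[of _ 1] conjI allI impI bexI[of _ "\<zero>\<^bsub>D m\<^esub>"] bexI[of _ "\<zero>\<^bsub>S m\<^esub>"]) (auto simp: S_simps)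
next
  case (add x x')
  obtain N0 where N0: "N0 \<ge> 1" "\<And>N. N \<ge> N0 ==> \<exists>w\<in>carrier (D m). \<exists>y\<in>carrier (S m).
    x = inc m N w \<oplus>\<^bsub>S m\<^esub> P m y \<and> (\<forall>n\<ge>N. y n = \<zero>\<^bsub>D m\<^esub>)" using add.IH(1) by blast
  obtain N1 where N1: "N1 \<ge> 1" "\<And>N. N \<ge> N1 ==> \<exists>w\<in>carrier (D m). \<exists>y\<in>carrier (S m).
    x' = inc m N w \<oplus>\<^bsub>S m\<^esub> P m y \<and> (\<forall>n\<ge>N. y n = \<zero>\<^bsub>D m\<^esub>)" using add.IH(2) by blast
  show ?case
  proof (intro exI[of _ "max N0 N1"] conjI allI impI)
    show "max N0 N1 \<ge> 1" using N0 by simp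
    fix N assume N: "N \<ge> max N0 N1"
    hence N': "N \<ge> 1" "N \<ge> N0" "N \<ge> N1" using N0(1) by auto
    obtain w y where wy: "w \<in> carrier (D m)" "y \<in> carrier (S m)" "x = inc m N w \<oplus>\<^bsub>S m\<^esub> P m y" "\<forall>n\<ge>N. y n = \<zero>\<^bsub>D m\<^esub>"
      using N0(2)[OF N'(2)] by blast
    obtain w' y' where wy': "w' \<in> carrier (D m)" "y' \<in> carrier (S m)" "x' = inc m N w' \<oplus>\<^bsub>S m\<^esub> P m y'" "\<forall>n\<ge>N. y' n = \<zero>\<^bsub>D m\<^esub>"
      using N1(2)[OF N'(3)] by blast
    have "x \<oplus>\<^bsub>S m\<^esub> x' = inc m N (w \<oplus>\<^bsub>D m\<^esub> w') \<oplus>\<^bsub>S m\<^esub> P m (y \<oplus>\<^bsub>S m\<^esub> y')"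
      unfolding hom_add[OF inc_hom[OF N'(1)] wy(1) wy'(1)] hom_add[OF P_hom wy(2) wy'(2)] wy(3) wy'(3)
      using inc_closed[OF N'(1)] P_closed wy wy' by (simp add: S.M.a_ac)
    thus "\<exists>w\<in>carrier (D m). \<exists>y\<in>carrier (S m). x \<oplus>\<^bsub>S m\<^esub> x' = inc m N w \<oplus>\<^bsub>S m\<^esub> P m y \<and> (\<forall>n\<ge>N. y n = \<zero>\<^bsub>D m\<^esub>)"
      using wy wy' N'(1) by (intro bexI[of _ "w \<oplus>\<^bsub>D m\<^esub> w'"] bexI[of _ "y \<oplus>\<^bsub>S m\<^esub> y'"]) (auto simp: S_simps)
  qed
next
  case (inc K v)
  show ?case
  proof (intro exI[of _ K] conjI allI impI)
    show "K \<ge> 1" by fact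
    fix N assume "N \<ge> K"
    thus "\<exists>w\<in>carrier (D m). \<exists>y\<in>carrier (S m). inc m K v = inc m N w \<oplus>\<^bsub>S m\<^esub> P m y \<and> (\<forall>n\<ge>N. y n = \<zero>\<^bsub>D m\<^esub>)"
    proof (induction N rule: dec_induct)
      case base
      have "inc m K v = inc m K v \<oplus>\<^bsub>S m\<^esub> P m \<zero>\<^bsub>S m\<^esub>" using hom_zero[OF S S P_hom] inc_closed[OF inc] by simp
      thus ?case using inc by (intro bexI[of _ v] bexI[of _ "\<zero>\<^bsub>S m\<^esub>"]) (auto simp: S_simps)
    next
      case (step N)
      then obtain w y where wy: "w \<in> carrier (D m)" "y \<in> carrier (S m)" "inc m K v = inc m N w \<oplus>\<^bsub>S m\<^esub> P m y" "\<forall>n\<ge>N. y n = \<zero>\<^bsub>D m\<^esub>"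
        by blast
      have N1: "N \<ge> 1" using step.hyps inc(1) by simp
      from inc_slide[OF wy(1,3) N1 wy(2)] wy(4) u_closed[OF N1 wy(1)] show ?case by blast
    qed
  qed
qed

text \<open>Where the transition maps are identities, w does not change while sliding, so one w
  serves for all late summands.\<close>

lemma slide_0:
  assumes x: "x \<in> carrier (S m)" and u1: "\<And>n w. n \<ge> 1 ==> w \<in> carrier (D m) ==> u n m w = w"
  shows "\<exists>w\<in>carrier (D m). \<exists>N0\<ge>1. \<forall>N\<ge>N0. \<exists>y\<in>carrier (S m). x = inc m N w \<oplus>\<^bsub>S m\<^esub> P m y"
proof -
  obtain N0 where N0: "N0 \<ge> 1" "\<And>N. N \<ge> N0 ==> \<exists>w\<in>carrier (D m). \<exists>y\<in>carrier (S m).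
    x = inc m N w \<oplus>\<^bsub>S m\<^esub> P m y \<and> (\<forall>n\<ge>N. y n = \<zero>\<^bsub>D m\<^esub>)" using slide[OF x] by blast
  from N0(2)[OF order_refl] obtain w y where wy: "w \<in> carrier (D m)" "y \<in> carrier (S m)"
    "x = inc m N0 w \<oplus>\<^bsub>S m\<^esub> P m y" "\<forall>n\<ge>N0. y n = \<zero>\<^bsub>D m\<^esub>" by blast
  have "\<exists>y\<in>carrier (S m). x = inc m N w \<oplus>\<^bsub>S m\<^esub> P m y \<and> (\<forall>n\<ge>N. y n = \<zero>\<^bsub>D m\<^esub>)" if "N \<ge> N0" for N
    using that
  proof (induction N rule: dec_induct)
    case base show ?case using wy by blast
  next
    case (step N)
    have N: "N \<ge> 1" using step.hyps N0(1) by simp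
    from step.IH obtain y where y: "y \<in> carrier (S m)" "x = inc m N w \<oplus>\<^bsub>S m\<^esub> P m y" "\<forall>n\<ge>N. y n = \<zero>\<^bsub>D m\<^esub>" by blast
    from inc_slide[OF wy(1) y(2) N y(1)] y(3) u1[OF N wy(1)] show ?case by auto
  qed
  thus ?thesis using wy(1) N0(1) by blast
qed

text \<open>Sliding the first component of the cycle changes it by the boundary of an element with
  first component zero. The second component that remains is zero: below N by triangularity, from N
  on by its support.\<close>

lemma cycle_reduce:
  assumes x: "x \<in> carrier (B m)" and cyc: "bd m x = \<zero>\<^bsub>B (m - 1)\<^esub>"
  shows "\<exists>N0\<ge>1. \<forall>N\<ge>N0. \<exists>w\<in>carrier (D m). \<exists>y\<in>carrier (B (m + 1)). d N m w = \<zero>\<^bsub>D (m - 1)\<^esub> \<and>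
    x = (inc m N w, \<zero>\<^bsub>S (m - 1)\<^esub>) \<oplus>\<^bsub>B m\<^esub> bd (m + 1) y"
proof -
  have xc: "fst x \<in> carrier (S m)" "snd x \<in> carrier (S (m - 1))" using x by (auto simp: B_simps)
  obtain N1 where N1: "N1 \<ge> 1" "\<And>N. N \<ge> N1 ==> \<exists>w\<in>carrier (D m). \<exists>y\<in>carrier (S m).
    fst x = inc m N w \<oplus>\<^bsub>S m\<^esub> P m y \<and> (\<forall>n\<ge>N. y n = \<zero>\<^bsub>D m\<^esub>)" using slide[OF xc(1)] by blast
  obtain N2 where N2: "N2 \<ge> 1" "\<forall>n\<ge>N2. snd x n = \<zero>\<^bsub>D (m - 1)\<^esub>" using S_bound[OF xc(2)] by blast
  show ?thesis
  proof (intro exI[of _ "max N1 N2"] conjI allI impI)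
    show "max N1 N2 \<ge> 1" using N1(1) by simp
    fix N assume "N \<ge> max N1 N2"
    hence N: "N \<ge> 1" "N \<ge> N1" "N \<ge> N2" using N1(1) by auto
    obtain w y where wy: "w \<in> carrier (D m)" "y \<in> carrier (S m)" "fst x = inc m N w \<oplus>\<^bsub>S m\<^esub> P m y" "\<forall>n\<ge>N. y n = \<zero>\<^bsub>D m\<^esub>"
      using N1(2)[OF N(2)] by blast
    \<comment> \<open>The sign compensates the one in the cone differential, so that the boundary of
      (0, y') has first component P y.\<close>
    define y' where "y' = sg m y"
    have y': "y' \<in> carrier (S m)" unfolding y'_def by (rule sg_closed[OF wy(2)])
    define z where "z = snd x \<ominus>\<^bsub>S (m - 1)\<^esub> sd m y'"
    have z: "z \<in> carrier (S (m - 1))" unfolding z_def using xc(2) sd_closed[OF y'] by simp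
    have iw: "inc m N w \<in> carrier (S m)" by (rule inc_closed[OF N(1) wy(1)])
    let ?Y = "(\<zero>\<^bsub>S (m + 1)\<^esub>, y')"
    have Y: "?Y \<in> carrier (B (m + 1))" using y' by (simp add: B_simps)
    have s0: "sd (m + 1) \<zero>\<^bsub>S (m + 1)\<^esub> = \<zero>\<^bsub>S m\<^esub>" using hom_zero[OF S S sd_hom, of "m + 1"] by simp
    have sP: "sg m (P m y') = P m y"
      unfolding y'_def using sg_commute[OF P_hom wy(2)] sg_sg[OF P_closed[OF wy(2)]] by simp
    have bdY: "bd (m + 1) ?Y = (P m y, sd m y')"
      unfolding B_simps using s0 sP P_closed[OF wy(2)] by simp
    have zx: "snd x = z \<oplus>\<^bsub>S (m - 1)\<^esub> sd m y'"
      unfolding z_def using xc(2) sd_closed[OF y'] by (simp add: a_minus_def S.M.a_assoc S.M.l_neg)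
    have x_eq: "x = (inc m N w, z) \<oplus>\<^bsub>B m\<^esub> bd (m + 1) ?Y"
      unfolding bdY unfolding B_simps using wy(3) zx by (simp add: prod_eq_iff)
    have iz: "(inc m N w, z) \<in> carrier (B m)" using iw z by (simp add: B_simps)
    interpret Bm: left_module R "B (m - 1)" by (rule B)
    have bdYc: "bd (m + 1) ?Y \<in> carrier (B m)" using hom_closed[OF bd_hom Y] by simp
    have "bd m (bd (m + 1) ?Y) = \<zero>\<^bsub>B (m - 1)\<^esub>" using bd_bd[OF Y] by simp
    hence "bd m (inc m N w, z) = \<zero>\<^bsub>B (m - 1)\<^esub>"
      using cyc hom_add[OF bd_hom iz bdYc] hom_closed[OF bd_hom iz] unfolding x_eq[symmetric] by simp
    hence e: "sd m (inc m N w) \<oplus>\<^bsub>S (m - 1)\<^esub> sg (m - 1) (P (m - 1) z) = \<zero>\<^bsub>S (m - 1)\<^esub>"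
      unfolding B_simps by simp
    have sPz: "sg (m - 1) (P (m - 1) z) \<in> carrier (S (m - 1))" by (intro sg_closed P_closed z)
    have en: "d n m (inc m N w n) \<oplus>\<^bsub>D (m - 1)\<^esub> sg (m - 1) (P (m - 1) z) n = \<zero>\<^bsub>D (m - 1)\<^esub>" if "n \<ge> 1" for n
      using arg_cong[OF e, of "\<lambda>v. v n"] that by (simp add: S_simps sd_apply)
    \<comment> \<open>The differential of w is concentrated in summand N, so the cycle condition
      forces the image of z to vanish in all earlier components.\<close>
    have Pz: "P (m - 1) z n = \<zero>\<^bsub>D (m - 1)\<^esub>" if n: "n \<ge> 1" "n < N" for n
    proof -
      have "sg (m - 1) (P (m - 1) z) n = \<zero>\<^bsub>D (m - 1)\<^esub>"
        using en[OF n(1)] n S_comp[OF sPz n(1)] by (simp add: inc_apply d_zero)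
      thus ?thesis using S_comp[OF P_closed[OF z] n(1)] D.M.minus_equality
        by (auto simp: sg_def alt_sign_def S_minus[OF n(1) P_closed[OF z]] split: if_splits)
    qed
    \<comment> \<open>From N on, the second component of x and the correction y are both zero by the
      choice of N.\<close>
    have "z n = \<zero>\<^bsub>D (m - 1)\<^esub>" if n: "n \<ge> 1" for n
    proof (cases "n < N")
      case True show ?thesis by (rule inj_P[OF z Pz n True])
    next
      case False
      hence "y' n = \<zero>\<^bsub>D m\<^esub>" unfolding y'_def using wy(2,4) n by (simp add: sg_def alt_sign_def S_minus)
      thus ?thesis unfolding z_def a_minus_def using False N N2(2) n sd_closed[OF y']
        by (simp add: S_simps S_minus sd_apply d_zero)
    qed
    hence z0: "z = \<zero>\<^bsub>S (m - 1)\<^esub>" by (intro S_ext[OF z]) (auto simp: S_simps)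
    have "P (m - 1) \<zero>\<^bsub>S (m - 1)\<^esub> = \<zero>\<^bsub>S (m - 1)\<^esub>" "sg (m - 1) \<zero>\<^bsub>S (m - 1)\<^esub> = \<zero>\<^bsub>S (m - 1)\<^esub>"
      using hom_zero[OF S S P_hom] hom_zero[OF S S sg_hom'] by blast+
    hence "d N m w = \<zero>\<^bsub>D (m - 1)\<^esub>"
      using en[OF N(1)] N(1) d_closed[OF N(1) wy(1)] unfolding z0 by (simp add: inc_apply S_simps)
    thus "\<exists>w\<in>carrier (D m). \<exists>y\<in>carrier (B (m + 1)). d N m w = \<zero>\<^bsub>D (m - 1)\<^esub> \<and>
      x = (inc m N w, \<zero>\<^bsub>S (m - 1)\<^esub>) \<oplus>\<^bsub>B m\<^esub> bd (m + 1) y"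
      using wy(1) Y x_eq unfolding z0 by blast
  qed
qed

end

section \<open>The telescope as a resolution\<close>

text \<open>For the application N is k with generator g = 1, so that \<open>I\<close> becomes the
  augmentation ideal, and \<open>X\<close> is the image of T. The threshold in
  \<open>homotopy\<close> may depend on t but must serve all degrees m; in \<open>aug_ker\<close> it
  may depend on w.\<close>

locale telescope_resolution = telescope R D d u + R: cring R
  for R :: "('a, 'r) ring_scheme" and D :: "int => ('a, 'b) module" and d u +
  fixes N :: "('a, 'c) module" and g and eps :: "(nat => 'b) => 'c" and aug :: "'b => 'c" and X :: "'a set" and I :: "'a set"
  defines "I \<equiv> {a \<in> carrier R. a \<odot>\<^bsub>N\<^esub> g = \<zero>\<^bsub>N\<^esub>}"
  assumes N: "left_module R N" and g: "g \<in> carrier N"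
    and gen: "\<And>c. c \<in> carrier N ==> \<exists>a\<in>carrier R. c = a \<odot>\<^bsub>N\<^esub> g"
    and D_neg: "\<And>m. m < 0 ==> carrier (D m) = {\<zero>\<^bsub>D m\<^esub>}"
    and u_0: "\<And>n w. n \<ge> 1 ==> w \<in> carrier (D 0) ==> u n 0 w = w"
    and d_ideal: "\<And>n m x. n \<ge> 1 ==> x \<in> carrier (D m) ==> d n m x \<in> ideal_smult R I (D (m - 1))"
    and u_ideal: "\<And>n m x. n \<ge> 1 ==> m \<ge> 1 ==> x \<in> carrier (D m) ==> u n m x \<in> ideal_smult R I (D m)"
    and eps: "eps \<in> lmod_hom R (S 0) N"
    and eps_inc: "\<And>n w. n \<ge> 1 ==> w \<in> carrier (D 0) ==> eps (inc 0 n w) = aug w"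
    and aug_d: "\<And>n x. n \<ge> 1 ==> x \<in> carrier (D 1) ==> aug (d n 1 x) = \<zero>\<^bsub>N\<^esub>"
    and aug_surj: "\<And>c. c \<in> carrier N ==> \<exists>w\<in>carrier (D 0). aug w = c"
    and aug_ker: "\<And>w. w \<in> carrier (D 0) ==> aug w = \<zero>\<^bsub>N\<^esub> ==> \<exists>n0. \<forall>n\<ge>n0. \<exists>a\<in>carrier (D 1). w = d n 1 a"
    and X: "X \<subseteq> carrier R"
    and homotopy: "\<And>t. t \<in> X ==> \<exists>n0. \<forall>n\<ge>n0. \<forall>m\<ge>0. \<forall>w\<in>carrier (D m). d n m w = \<zero>\<^bsub>D (m - 1)\<^esub> \<longrightarrow>
      (\<exists>a\<in>carrier (D (m + 1)). t \<odot>\<^bsub>D m\<^esub> w \<ominus>\<^bsub>D m\<^esub> w = d n (m + 1) a)"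
    and db: "\<And>m. \<exists>(l :: nat) c v. dual_basis R (D m) {..<l} c v"
begin

sublocale N: left_module R N by (rule N)
sublocale B: left_module R "B m" for m by (rule B)

lemma S_trivial: "carrier (D m) = {\<zero>\<^bsub>D m\<^esub>} ==> carrier (S m) = {\<zero>\<^bsub>S m\<^esub>}"
proof -
  assume D0: "carrier (D m) = {\<zero>\<^bsub>D m\<^esub>}"
  have "x = \<zero>\<^bsub>S m\<^esub>" if x: "x \<in> carrier (S m)" for x
  proof (rule S_ext[OF x])
    fix n :: nat assume n: "n \<ge> 1"
    show "x n = \<zero>\<^bsub>S m\<^esub> n" using S_comp[OF x n] unfolding D0 S_simps(2)[OF n] by blast
  qed simp
  thus ?thesis using S.M.zero_closed by blast
qed

lemma S_neg: "m < 0 ==> x \<in> carrier (S m) ==> x = \<zero>\<^bsub>S m\<^esub>"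
  using S_trivial[OF D_neg] by blast

lemma B_trivial: "carrier (D m) = {\<zero>\<^bsub>D m\<^esub>} ==> carrier (D (m - 1)) = {\<zero>\<^bsub>D (m - 1)\<^esub>} ==> carrier (B m) = {\<zero>\<^bsub>B m\<^esub>}"
  by (simp add: B_simps S_trivial)

lemma B_neg: "m < 0 ==> carrier (B m) = {\<zero>\<^bsub>B m\<^esub>}"
  by (intro B_trivial D_neg) auto

lemma B_0: "x \<in> carrier (B 0) ==> snd x = \<zero>\<^bsub>S (-1)\<^esub>"
proof -
  assume "x \<in> carrier (B 0)"
  hence "snd x \<in> carrier (S (-1))" unfolding B_simps(1) by (simp add: mem_Times_iff)
  thus ?thesis using S_neg[of "-1"] by simp
qed

section \<open>The augmentation of the telescope\<close>

definition "\<epsilon> x = eps (fst x)"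

lemma eps_hom: "\<epsilon> \<in> lmod_hom R (B 0) N"
  unfolding \<epsilon>_def[abs_def] B_simps by (rule lmod_hom_comp[OF fst_hom eps])

lemma sd_inc: "n \<ge> 1 ==> w \<in> carrier (D m) ==> sd m (inc m n w) = inc (m - 1) n (d n m w)"
  by (rule S_ext[OF sd_closed[OF inc_closed] inc_closed[OF _ d_closed]]) (auto simp: sd_apply inc_apply d_zero)

text \<open>In degree 0 the transition maps are identities, so by \<open>slide_step\<close> the
  image of w in summand n is a difference of two copies of w, with equal augmentation.\<close>

lemma eps_P: "y \<in> carrier (S 0) ==> eps (P 0 y) = \<zero>\<^bsub>N\<^esub>"
proof (induction rule: S_induct)
  case zero show ?case using hom_zero[OF S S P_hom] hom_zero[OF S N eps] by simp
next
  case (add x y) thus ?case by (simp add: hom_add[OF P_hom] hom_add[OF eps] P_closed)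
next
  case (inc n w)
  have "eps (inc 0 n w) = eps (inc 0 (Suc n) w) \<oplus>\<^bsub>N\<^esub> eps (P 0 (inc 0 n w))"
    using slide_step[OF inc] u_0[OF inc] inc_closed[of "Suc n" w 0] P_closed[OF inc_closed[OF inc]] inc
    by (metis hom_add[OF eps] le_SucI)
  hence "aug w = aug w \<oplus>\<^bsub>N\<^esub> eps (P 0 (inc 0 n w))" using inc by (simp add: eps_inc)
  moreover have "aug w \<in> carrier N" using hom_closed[OF eps inc_closed[OF inc]] inc by (simp add: eps_inc)
  ultimately show ?case using hom_closed[OF eps P_closed[OF inc_closed[OF inc]]]
    by (metis N.M.add.l_cancel_one')
qed

lemma eps_sd: "y \<in> carrier (S 1) ==> eps (sd 1 y) = \<zero>\<^bsub>N\<^esub>"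
proof (induction rule: S_induct)
  case zero show ?case using hom_zero[OF S S sd_hom[of 1]] hom_zero[OF S N eps] by simp
next
  case (add x y) thus ?case using sd_closed[of x 1] sd_closed[of y 1] hom_add[OF sd_hom[of 1]] by (simp add: hom_add[OF eps])
next
  case (inc n w)
  thus ?case using sd_inc[OF inc] d_closed[OF inc] by (simp add: eps_inc aug_d)
qed

lemma sg_0: "sg 0 x = x" by (simp add: sg_def alt_sign_def)

lemma eps_bd: "x \<in> carrier (B 1) ==> \<epsilon> (bd 1 x) = \<zero>\<^bsub>N\<^esub>"
  using sd_closed[of "fst x" 1] P_closed[of "snd x" 0]
  by (auto simp: B_simps \<epsilon>_def sg_0 hom_add[OF eps] eps_sd eps_P)

lemma eps_surj: "c \<in> carrier N ==> \<exists>x\<in>carrier (B 0). \<epsilon> x = c"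
proof -
  assume "c \<in> carrier N"
  then obtain w where w: "w \<in> carrier (D 0)" "aug w = c" using aug_surj by blast
  thus ?thesis using inc_closed[of 1 w 0] by (intro bexI[of _ "(inc 0 1 w, \<zero>\<^bsub>S (-1)\<^esub>)"]) (auto simp: B_simps \<epsilon>_def eps_inc)
qed

text \<open>After sliding, one w of augmentation zero represents x in every late summand, and in a
  late enough one it is the boundary of a chain.\<close>

lemma eps_ker:
  assumes x: "x \<in> carrier (B 0)" and 0: "\<epsilon> x = \<zero>\<^bsub>N\<^esub>" shows "\<exists>y\<in>carrier (B 1). x = bd 1 y"
proof -
  have x1: "fst x \<in> carrier (S 0)" using x by (auto simp: B_simps)
  obtain w N0 where w: "w \<in> carrier (D 0)" "N0 \<ge> 1" "\<And>n. n \<ge> N0 ==> \<exists>y\<in>carrier (S 0). fst x = inc 0 n w \<oplus>\<^bsub>S 0\<^esub> P 0 y"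
    using slide_0[OF x1 u_0] by blast
  have "aug w = \<zero>\<^bsub>N\<^esub>"
  proof -
    obtain y where y: "y \<in> carrier (S 0)" "fst x = inc 0 N0 w \<oplus>\<^bsub>S 0\<^esub> P 0 y" using w(3)[OF order_refl] by blast
    have "aug w \<in> carrier N" using hom_closed[OF eps inc_closed[OF w(2,1)]] w by (simp add: eps_inc)
    thus ?thesis using 0 y w by (simp add: \<epsilon>_def hom_add[OF eps] inc_closed P_closed eps_P eps_inc)
  qed
  then obtain n0 where n0: "\<And>n. n \<ge> n0 ==> \<exists>a\<in>carrier (D 1). w = d n 1 a" using aug_ker w(1) by blast
  \<comment> \<open>The threshold n0 is known only once w is; this is why w must not depend on the
    summand.\<close>
  let ?n = "max n0 N0"
  have n: "?n \<ge> 1" using w(2) by simp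
  obtain a where a: "a \<in> carrier (D 1)" "w = d ?n 1 a" using n0[of ?n] by auto
  obtain y where y: "y \<in> carrier (S 0)" "fst x = inc 0 ?n w \<oplus>\<^bsub>S 0\<^esub> P 0 y" using w(3)[of ?n] by auto
  have "fst x = fst (bd 1 (inc 1 ?n a, y))" using y sd_inc[OF n a(1)] a(2) by (simp add: B_simps sg_0)
  moreover have "snd (bd 1 (inc 1 ?n a, y)) = \<zero>\<^bsub>S (-1)\<^esub>"
    using S_neg[OF _ sd_closed[OF y(1)]] by (simp add: B_simps(2))
  ultimately show ?thesis using B_0[OF x] inc_closed[OF n a(1)] y(1)
    by (intro bexI[of _ "(inc 1 ?n a, y)"]) (auto simp: B_simps(1) prod_eq_iff)
qed

text \<open>Reduce the cycle to one summand so late that the homotopy for t exists there; t - 1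
  commutes with all linear maps and takes the boundary term to a boundary.\<close>

lemma homology_trivial:
  assumes m: "m \<ge> 0" and t: "t \<in> X" and x: "x \<in> carrier (B m)" "bd m x = \<zero>\<^bsub>B (m - 1)\<^esub>"
  shows "\<exists>y\<in>carrier (B (m + 1)). t \<odot>\<^bsub>B m\<^esub> x \<ominus>\<^bsub>B m\<^esub> x = bd (m + 1) y"
proof -
  have tR: "t \<in> carrier R" using t X by blast
  obtain N0 where N0: "N0 \<ge> 1" "\<And>n. n \<ge> N0 ==> \<exists>w\<in>carrier (D m). \<exists>y\<in>carrier (B (m + 1)). d n m w = \<zero>\<^bsub>D (m - 1)\<^esub> \<and>
    x = (inc m n w, \<zero>\<^bsub>S (m - 1)\<^esub>) \<oplus>\<^bsub>B m\<^esub> bd (m + 1) y" using cycle_reduce[OF x] by blast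
  obtain n0 where n0: "\<And>n w. n \<ge> n0 ==> w \<in> carrier (D m) ==> d n m w = \<zero>\<^bsub>D (m - 1)\<^esub> ==>
      \<exists>a\<in>carrier (D (m + 1)). t \<odot>\<^bsub>D m\<^esub> w \<ominus>\<^bsub>D m\<^esub> w = d n (m + 1) a" using homotopy[OF t] m by blast
  let ?n = "max n0 N0"
  have n: "?n \<ge> 1" using N0(1) by simp
  obtain w y where wy: "w \<in> carrier (D m)" "y \<in> carrier (B (m + 1))" "d ?n m w = \<zero>\<^bsub>D (m - 1)\<^esub>"
    "x = (inc m ?n w, \<zero>\<^bsub>S (m - 1)\<^esub>) \<oplus>\<^bsub>B m\<^esub> bd (m + 1) y" using N0(2)[of ?n] by auto
  obtain a where a: "a \<in> carrier (D (m + 1))" "t \<odot>\<^bsub>D m\<^esub> w \<ominus>\<^bsub>D m\<^esub> w = d ?n (m + 1) a" using n0[of ?n] wy by auto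
  let ?j = "\<lambda>w. (inc m ?n w, \<zero>\<^bsub>S (m - 1)\<^esub>)"
  have j: "?j \<in> lmod_hom R (D m) (B m)"
    unfolding B_simps by (rule pair_hom[OF inc_hom[OF n] lmod_hom_zero[OF S]])
  \<comment> \<open>Multiplication by t - 1 is itself linear, as the ring is commutative.\<close>
  have F: "(\<lambda>x. t \<odot>\<^bsub>M\<^esub> x \<ominus>\<^bsub>M\<^esub> x) \<in> lmod_hom R M M" if "left_module R M" for M :: "('a, 'q) module"
    by (rule lmod_hom_diff[OF that lmod_hom_smult[OF R.is_cring that lmod_hom_id tR] lmod_hom_id])
  have hF: "h (t \<odot>\<^bsub>M\<^esub> z \<ominus>\<^bsub>M\<^esub> z) = t \<odot>\<^bsub>M'\<^esub> h z \<ominus>\<^bsub>M'\<^esub> h z"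
    if "left_module R M" "left_module R M'" "h \<in> lmod_hom R M M'" "z \<in> carrier M"
    for M :: "('a, 'q) module" and M' :: "('a, 'q') module" and h z
    using hom_diff[OF that(1-3) left_module.smult_closed[OF that(1) tR that(4)] that(4)] hom_smult[OF that(3) tR that(4)] by simp
  have b: "bd (m + 1) \<in> lmod_hom R (B (m + 1)) (B m)" using bd_hom[of "m + 1"] by simp
  let ?y = "t \<odot>\<^bsub>B (m + 1)\<^esub> y \<ominus>\<^bsub>B (m + 1)\<^esub> y"
  have yc: "?y \<in> carrier (B (m + 1))" by (rule hom_closed[OF F[OF B] wy(2)])
  have ac: "(inc (m + 1) ?n a, \<zero>\<^bsub>S m\<^esub>) \<in> carrier (B (m + 1))" using inc_closed[OF n a(1)] by (simp add: B_simps)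
  have P0: "sg m (P m \<zero>\<^bsub>S m\<^esub>) = \<zero>\<^bsub>S m\<^esub>" using hom_zero[OF S S P_hom] hom_zero[OF S S sg_hom'] by simp
  have s0: "sd m \<zero>\<^bsub>S m\<^esub> = \<zero>\<^bsub>S (m - 1)\<^esub>" by (rule hom_zero[OF S S sd_hom])
  have "t \<odot>\<^bsub>B m\<^esub> x \<ominus>\<^bsub>B m\<^esub> x = (t \<odot>\<^bsub>B m\<^esub> ?j w \<ominus>\<^bsub>B m\<^esub> ?j w) \<oplus>\<^bsub>B m\<^esub> (t \<odot>\<^bsub>B m\<^esub> bd (m + 1) y \<ominus>\<^bsub>B m\<^esub> bd (m + 1) y)"
    unfolding wy(4) by (rule hom_add[OF F[OF B] hom_closed[OF j wy(1)] hom_closed[OF b wy(2)]])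
  also have "t \<odot>\<^bsub>B m\<^esub> ?j w \<ominus>\<^bsub>B m\<^esub> ?j w = ?j (d ?n (m + 1) a)" unfolding hF[OF D B j wy(1), symmetric] a(2) ..
  also have "?j (d ?n (m + 1) a) = bd (m + 1) (inc (m + 1) ?n a, \<zero>\<^bsub>S m\<^esub>)"
    unfolding B_simps using sd_inc[OF n a(1)] P0 s0 inc_closed[OF n d_closed[OF n a(1)]] by simp
  also have "t \<odot>\<^bsub>B m\<^esub> bd (m + 1) y \<ominus>\<^bsub>B m\<^esub> bd (m + 1) y = bd (m + 1) ?y" by (rule hF[OF B B b wy(2), symmetric])
  also have "bd (m + 1) (inc (m + 1) ?n a, \<zero>\<^bsub>S m\<^esub>) \<oplus>\<^bsub>B m\<^esub> bd (m + 1) ?y =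
    bd (m + 1) ((inc (m + 1) ?n a, \<zero>\<^bsub>S m\<^esub>) \<oplus>\<^bsub>B (m + 1)\<^esub> ?y)" by (rule hom_add[OF b ac yc, symmetric])
  finally show ?thesis using ac yc by blast
qed

section \<open>Exactness modulo the ideal\<close>

lemma I_R: "I \<subseteq> carrier R" by (auto simp: I_def)

text \<open>The finite support allows the element to be reassembled from its components, each
  included from I times a summand.\<close>

lemma IS_iff: "x \<in> ideal_smult R I (S m) \<longleftrightarrow> x \<in> carrier (S m) \<and> (\<forall>n\<ge>1. x n \<in> ideal_smult R I (D m))"
proof
  assume x: "x \<in> ideal_smult R I (S m)"
  thus "x \<in> carrier (S m) \<and> (\<forall>n\<ge>1. x n \<in> ideal_smult R I (D m))"
    using S.submodule_props(1)[OF S.ideal_smult_submodule[OF I_R]] S.ideal_smult_hom[OF I_R D proj x] by blast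
next
  assume x: "x \<in> carrier (S m) \<and> (\<forall>n\<ge>1. x n \<in> ideal_smult R I (D m))"
  note sub = S.submodule_props[OF S.ideal_smult_submodule[OF I_R]]
  show "x \<in> ideal_smult R I (S m)"
  proof (rule direct_sum_induct[where R = R and I = "{1..}" and M = "\<lambda>n. D m" and x = x])
    show "x \<in> carrier (direct_sum {1..} (\<lambda>n. D m))" using x by (simp add: S_def)
    show "summand_incl {1..} (\<lambda>n. D m) j (x j) \<in> ideal_smult R I (S m)" if "j \<in> {1..}" for j
      using D.ideal_smult_hom[OF I_R S inc_hom[of j m], of "x j"] x that by (simp add: inc_def)
  qed (use R D sub(2,3) in \<open>auto simp: S_def\<close>)
qed

lemma IB_pair: "x \<in> ideal_smult R I (S m) ==> y \<in> ideal_smult R I (S (m - 1)) ==> (x, y) \<in> ideal_smult R I (B m)"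
proof -
  assume x: "x \<in> ideal_smult R I (S m)" and y: "y \<in> ideal_smult R I (S (m - 1))"
  have "(\<lambda>x. (x, \<zero>\<^bsub>S (m - 1)\<^esub>)) \<in> lmod_hom R (S m) (B m)" unfolding B_simps by (rule pair_hom[OF lmod_hom_id lmod_hom_zero[OF S]])
  from S.ideal_smult_hom[OF I_R B this x] have 1: "(x, \<zero>\<^bsub>S (m - 1)\<^esub>) \<in> ideal_smult R I (B m)" .
  have "(\<lambda>y. (\<zero>\<^bsub>S m\<^esub>, y)) \<in> lmod_hom R (S (m - 1)) (B m)" unfolding B_simps by (rule pair_hom[OF lmod_hom_zero[OF S] lmod_hom_id])
  from S.ideal_smult_hom[OF I_R B this y] have 2: "(\<zero>\<^bsub>S m\<^esub>, y) \<in> ideal_smult R I (B m)" .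
  have "x \<in> carrier (S m)" "y \<in> carrier (S (m - 1))" using x y by (auto simp: IS_iff)
  hence "(x, \<zero>\<^bsub>S (m - 1)\<^esub>) \<oplus>\<^bsub>B m\<^esub> (\<zero>\<^bsub>S m\<^esub>, y) = (x, y)" by (simp add: B_simps(1))
  thus ?thesis using B.submodule_props(3)[OF B.ideal_smult_submodule[OF I_R] 1 2] by simp
qed

text \<open>Write x = (a, z). Differentials vanish modulo I, so the hypothesis says that the
  telescope map kills z modulo I, and triangularity puts z into I times the module. Modulo I the
  telescope map is the identity in degree m \<ge> 1, so a is its own image, hence a boundary. For z,
  which may have degree 0, only injectivity is used.\<close>

lemma IB_ex:
  assumes m: "m \<ge> 1" and x: "x \<in> carrier (B m)" and bx: "bd m x \<in> ideal_smult R I (B (m - 1))"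
  shows "\<exists>y\<in>carrier (B (m + 1)). x \<ominus>\<^bsub>B m\<^esub> bd (m + 1) y \<in> ideal_smult R I (B m)"
proof -
  have xc: "fst x \<in> carrier (S m)" "snd x \<in> carrier (S (m - 1))" using x by (auto simp: B_simps)
  note IS = S.submodule_props[OF S.ideal_smult_submodule[OF I_R]]
  note ID = D.submodule_props[OF D.ideal_smult_submodule[OF I_R]]
  have sdI: "sd k y \<in> ideal_smult R I (S (k - 1))" if "y \<in> carrier (S k)" for k y
    using that sd_closed[OF that] d_ideal S_comp[OF that] by (simp add: IS_iff sd_apply)
  let ?z = "sg (m - 1) (P (m - 1) (snd x))"
  have zc: "?z \<in> carrier (S (m - 1))" by (intro sg_closed P_closed xc)
  have "sd m (fst x) \<oplus>\<^bsub>S (m - 1)\<^esub> ?z \<in> ideal_smult R I (S (m - 1))"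
  proof -
    have "fst \<in> lmod_hom R (B (m - 1)) (S (m - 1))" unfolding B_simps(1) by (rule fst_hom)
    from B.ideal_smult_hom[OF I_R S this bx] show ?thesis by (simp only: B_simps(2) fst_conv)
  qed
  from IS(5)[OF this sdI[OF xc(1)]] have "?z \<in> ideal_smult R I (S (m - 1))"
    using zc sd_closed[OF xc(1)] by (simp add: a_minus_def S.M.a_ac S.M.r_neg S.M.r_neg2)
  from S.ideal_smult_hom[OF I_R S sg_hom' this] have Pz: "P (m - 1) (snd x) \<in> ideal_smult R I (S (m - 1))"
    by (simp add: sg_sg[OF P_closed[OF xc(2)]])
  \<comment> \<open>The triangular system is solved from the first component upwards; the maps
    \<open>u\<close> preserve multiples of I.\<close>
  have "snd x n \<in> ideal_smult R I (D (m - 1))" if "n \<ge> 1" for n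
    using that
  proof (induction n rule: dec_induct)
    case base show ?case using Pz P_1[of "m - 1" "snd x"] by (metis IS_iff order_refl)
  next
    case (step n)
    have 1: "P (m - 1) (snd x) (Suc n) \<in> ideal_smult R I (D (m - 1))" using Pz by (simp add: IS_iff)
    have 2: "u n (m - 1) (snd x n) \<in> ideal_smult R I (D (m - 1))" by (rule D.ideal_smult_hom[OF I_R D u[OF step.hyps(1)] step.IH])
    have c: "snd x (Suc n) \<in> carrier (D (m - 1))" "u n (m - 1) (snd x n) \<in> carrier (D (m - 1))"
      using S_comp[OF xc(2), of "Suc n"] u_closed[OF step.hyps(1) S_comp[OF xc(2) step.hyps(1)]] by auto
    have "snd x (Suc n) = P (m - 1) (snd x) (Suc n) \<oplus>\<^bsub>D (m - 1)\<^esub> u n (m - 1) (snd x n)"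
      using c step.hyps(1) by (simp add: P_Suc a_minus_def D.M.a_assoc D.M.l_neg)
    thus ?case using ID(3)[OF 1 2] by simp
  qed
  hence zI: "snd x \<in> ideal_smult R I (S (m - 1))" using xc(2) by (simp add: IS_iff)
  \<comment> \<open>The sign again cancels the one in the cone differential: the boundary of (0, y)
    has first component P a.\<close>
  let ?y = "sg m (fst x)"
  let ?Y = "(\<zero>\<^bsub>S (m + 1)\<^esub>, ?y)"
  have y: "?y \<in> carrier (S m)" by (rule sg_closed[OF xc(1)])
  have Y: "?Y \<in> carrier (B (m + 1))" using y by (simp add: B_simps)
  have bY: "bd (m + 1) ?Y = (P m (fst x), sd m ?y)"
    using hom_zero[OF S S sd_hom, of "m + 1"] sg_commute[OF P_hom xc(1)] sg_sg[OF P_closed[OF xc(1)]] P_closed[OF xc(1)]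
    by (simp add: B_simps)
  have bYc: "bd (m + 1) ?Y \<in> carrier (B m)" using hom_closed[OF bd_hom Y] by simp
  \<comment> \<open>The components of a - P a are zero and the values of \<open>u\<close> at the
    preceding components of a; the latter lie in I times the module because m \<ge> 1.\<close>
  have uI: "fst x \<ominus>\<^bsub>S m\<^esub> P m (fst x) \<in> ideal_smult R I (S m)"
  proof (subst IS_iff, intro conjI allI impI)
    show "fst x \<ominus>\<^bsub>S m\<^esub> P m (fst x) \<in> carrier (S m)" using xc P_closed by simp
    fix n :: nat assume n: "n \<ge> 1"
    have e: "(fst x \<ominus>\<^bsub>S m\<^esub> P m (fst x)) n = fst x n \<ominus>\<^bsub>D m\<^esub> P m (fst x) n"
      by (rule hom_diff[OF S D proj[OF n] xc(1) P_closed[OF xc(1)]])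
    show "(fst x \<ominus>\<^bsub>S m\<^esub> P m (fst x)) n \<in> ideal_smult R I (D m)"
    proof (cases "n = 1")
      case True
      thus ?thesis using e P_1[of m "fst x"] S_comp[OF xc(1) n] ID(2) by (simp add: a_minus_def D.M.r_neg)
    next
      case False
      then obtain k where k: "n = Suc k" "k \<ge> 1" using n by (cases n) auto
      have c: "fst x (Suc k) \<in> carrier (D m)" "u k m (fst x k) \<in> carrier (D m)"
        using S_comp[OF xc(1), of "Suc k"] u_closed[OF k(2) S_comp[OF xc(1) k(2)]] by auto
      have "fst x (Suc k) \<ominus>\<^bsub>D m\<^esub> (fst x (Suc k) \<ominus>\<^bsub>D m\<^esub> u k m (fst x k)) = u k m (fst x k)"
        using c by (simp add: a_minus_def D.M.minus_add D.M.a_assoc[symmetric] D.M.r_neg)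
      thus ?thesis using e k u_ideal[OF k(2) m S_comp[OF xc(1) k(2)]] by (simp add: P_Suc)
    qed
  qed
  have "x \<ominus>\<^bsub>B m\<^esub> bd (m + 1) ?Y = (fst x \<ominus>\<^bsub>S m\<^esub> P m (fst x), snd x \<ominus>\<^bsub>S (m - 1)\<^esub> sd m ?y)"
  proof -
    have h: "fst \<in> lmod_hom R (B m) (S m)" "snd \<in> lmod_hom R (B m) (S (m - 1))"
      unfolding B_simps(1) by (rule fst_hom snd_hom)+
    show ?thesis using hom_diff[OF B S h(1) x bYc] hom_diff[OF B S h(2) x bYc]
      unfolding bY by (simp only: prod_eq_iff fst_conv snd_conv)
  qed
  also have "\<dots> \<in> ideal_smult R I (B m)" by (rule IB_pair[OF uI IS(5)[OF zI sdI[OF y]]])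
  finally show ?thesis using Y by blast
qed

lemma tensor_exact:
  assumes "m \<ge> 1"
  shows "exact_at (tensor_module R N (B (m + 1))) (tensor_map R N (B m) id (bd (m + 1))) (tensor_module R N (B m))
    (tensor_map R N (B (m - 1)) id (bd m)) (tensor_module R N (B (m - 1)))"
proof (rule tensor_cyclic_exact[OF R.is_cring N g gen B B B])
  show "bd (m + 1) \<in> lmod_hom R (B (m + 1)) (B m)" using bd_hom[of "m + 1"] by simp
  show "bd m (bd (m + 1) x) = \<zero>\<^bsub>B (m - 1)\<^esub>" if "x \<in> carrier (B (m + 1))" for x using bd_bd[OF that] by simp
qed (use IB_ex[OF assms] bd_hom in \<open>auto simp: I_def\<close>)

text \<open>An annihilator of the generator g annihilates all of N, by commutativity.\<close>

lemma IN: "x \<in> ideal_smult R I N ==> x = \<zero>\<^bsub>N\<^esub>"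
  unfolding ideal_smult_def
proof (induction rule: N.span_induct[OF _ N.ideal_gens_subset[OF I_R], consumes 1])
  case (1 x)
  then obtain a c where a: "x = a \<odot>\<^bsub>N\<^esub> c" "a \<in> I" "c \<in> carrier N" by blast
  then obtain b where b: "b \<in> carrier R" "c = b \<odot>\<^bsub>N\<^esub> g" using gen by blast
  have aR: "a \<in> carrier R" "a \<odot>\<^bsub>N\<^esub> g = \<zero>\<^bsub>N\<^esub>" using a(2) by (auto simp: I_def)
  have "x = (b \<otimes>\<^bsub>R\<^esub> a) \<odot>\<^bsub>N\<^esub> g" using a b aR g by (simp add: N.smult_assoc1[symmetric] R.m_comm)
  thus ?case using aR b g by (simp add: N.smult_assoc1 N.smult_r_null)
qed (auto simp: N.smult_r_null)

text \<open>Since I N = 0, nothing is lost modulo I on the side of N, and exactness here is that of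
  the complex before tensoring.\<close>

lemma tensor_exact_0:
  "exact_at (tensor_module R N (B 1)) (tensor_map R N (B 0) id (bd 1)) (tensor_module R N (B 0))
    (tensor_map R N N id \<epsilon>) (tensor_module R N N)"
proof (rule tensor_cyclic_exact[OF R.is_cring N g gen B B N _ eps_hom eps_bd])
  show "bd 1 \<in> lmod_hom R (B 1) (B 0)" using bd_hom[of 1] by simp
  fix x assume x: "x \<in> carrier (B 0)" "\<epsilon> x \<in> ideal_smult R {a \<in> carrier R. a \<odot>\<^bsub>N\<^esub> g = \<zero>\<^bsub>N\<^esub>} N"
  have "\<epsilon> x = \<zero>\<^bsub>N\<^esub>" by (rule IN) (use x(2) in \<open>simp only: I_def\<close>)
  then obtain y where y: "y \<in> carrier (B 1)" "x = bd 1 y" using eps_ker[OF x(1)] by blast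
  moreover have "x \<ominus>\<^bsub>B 0\<^esub> x \<in> ideal_smult R I (B 0)"
    using B.submodule_props(2)[OF B.ideal_smult_submodule[OF I_R]] x(1) by (simp add: a_minus_def B.M.r_neg)
  ultimately show "\<exists>y\<in>carrier (B 1). x \<ominus>\<^bsub>B 0\<^esub> bd 1 y \<in> ideal_smult R {a \<in> carrier R. a \<odot>\<^bsub>N\<^esub> g = \<zero>\<^bsub>N\<^esub>} (B 0)"
    unfolding I_def by (intro bexI[of _ y]) simp_all
qed auto

lemma tensor_surj: "tensor_map R N N id \<epsilon> ` carrier (tensor_module R N (B 0)) = carrier (tensor_module R N N)"
proof -
  interpret t: tensor_product R N "B 0" by (intro tensor_product.intro N B)
  interpret t': tensor_product R N N by (intro tensor_product.intro N)
  have id: "id \<in> lmod_hom R N N" using lmod_hom_id[of R N] by (simp add: id_def)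
  note h = tensor_map_hom[OF t.tensor_product_axioms t'.tensor_product_axioms id eps_hom]
  show ?thesis
  proof (intro equalityI subsetI)
    fix z assume "z \<in> carrier (tensor_module R N N)"
    then obtain c where c: "c \<in> carrier N" "z = tensor R N N g c" using tensor_cyclic_ex[OF R.is_cring N g gen N] by blast
    obtain x where x: "x \<in> carrier (B 0)" "\<epsilon> x = c" using eps_surj[OF c(1)] by blast
    thus "z \<in> tensor_map R N N id \<epsilon> ` carrier (tensor_module R N (B 0))"
      using c h(2)[OF g x(1)] t.tensor_closed[OF g x(1)] by (intro image_eqI[of _ _ "tensor R N (B 0) g x"]) auto
  qed (use hom_closed[OF h(1)] in auto)
qed

lemma B_projective: "projective_module R (B m)"
proof -
  have "\<exists>(l :: nat => nat) c v. dual_basis R (S m) (Sigma {1..} (\<lambda>n. {..<l n})) c v" for m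
  proof -
    obtain l :: nat and c v where "dual_basis R (D m) {..<l} c v" using db by blast
    from dual_basis_sum[where I = "{1::nat..}" and M = "\<lambda>n. D m" and S = "\<lambda>n. {..<l}", OF R D this] show ?thesis
      unfolding S_def by (intro exI[of _ "\<lambda>_. l"] exI)
  qed
  note sum = this
  obtain l c v where 1: "dual_basis R (S m) (Sigma {1::nat..} (\<lambda>n. {..<l n :: nat})) c v"
    using sum[of m] by (elim exE)
  obtain l' c' v' where 2: "dual_basis R (S (m - 1)) (Sigma {1::nat..} (\<lambda>n. {..<l' n :: nat})) c' v'"
    using sum[of "m - 1"] by (elim exE)
  from dual_basis_pair[OF S S 1 2] show ?thesis unfolding B_simps(1)
    by (rule dual_basis_projective[OF module_pair_left_module[OF S S]])
qed

lemma homology_smult: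
  assumes "m \<ge> 0" "t \<in> X" "z \<in> carrier (homology B bd m)"
  shows "t \<odot>\<^bsub>homology B bd m\<^esub> z = z"
proof (rule homology_smult_eq[OF complex_B _ _ assms(3)])
  show "t \<in> carrier R" using assms(2) X by blast
  fix x assume "x \<in> cycles B bd m"
  hence "x \<in> carrier (B m)" "bd m x = \<zero>\<^bsub>B (m - 1)\<^esub>" by (simp_all add: cycles_def)
  from homology_trivial[OF assms(1,2) this] show "t \<odot>\<^bsub>B m\<^esub> x \<ominus>\<^bsub>B m\<^esub> x \<in> boundaries B bd m"
    unfolding boundaries_def by blast
qed

lemma homology_0: "(\<lambda>z. the_elem (\<epsilon> ` z)) \<in> lmod_iso R (homology B bd 0) N"
  by (rule homology_iso[OF complex_B N eps_hom eps_bd B_neg eps_surj eps_ker]) auto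

end

section \<open>The complex D\<close>

lemma zero_module_left_module: "ring R ==> left_module R zero_module"
  by (rule left_moduleI) (auto simp: zero_module_def intro!: abelian_groupI')

lemma zero_module_carrier: "carrier zero_module = {\<zero>\<^bsub>zero_module\<^esub>}"
  by (simp add: zero_module_def)

locale D_setup = kTV_setup G T H K p r q
  for G (structure) and T H and K :: "'k::field itself" and p r q +
  fixes f :: "nat => 'a => 'a => 'k" and \<psi> :: "nat => ('a, 'k) kTV => ('a, 'k) kTV"
  assumes r_pos: "r \<ge> 1"
    and lift: "\<And>n. n \<ge> 1 ==> phi_lift G T H p n (f n)"
    and psi: "\<And>n. n \<ge> 1 ==> \<psi> n \<in> lmod_hom kG (kTV G T H p) (kTV G T H p)"
    and psi_phi: "\<And>n x. n \<ge> 1 ==> x \<in> carrier M ==> phi_map G T p (f (n + 1)) (\<psi> n x) = phi_map G T p (f n) x"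
    and finite_H: "finite H" and card_H: "of_nat (card H) \<noteq> (0 :: 'k)"
begin

abbreviation "E \<equiv> exterior_power kT M"
abbreviation X :: "int => ('a => 'k, ('a, 'k) D) module" where "X \<equiv> D_mod G T H p r"
abbreviation "ph n \<equiv> phi_map G T p (f n)"
abbreviation "dX n m \<equiv> D_diff G T H p r (ph n) m"
abbreviation "uX n m \<equiv> D_map G T H p r (\<psi> n) m"
abbreviation "ea h m \<equiv> EX.ext_map (alg_conj G h) (act h) m"
abbreviation triv :: "('a => 'k, 'k) module" where "triv \<equiv> trivial_module"

lemma psi_M: "n \<ge> 1 ==> \<psi> n \<in> lmod_hom kT M M"
  and psi_act: "n \<ge> 1 ==> h \<in> H ==> x \<in> carrier M ==> \<psi> n (act h x) = act h (\<psi> n x)"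
  using semidirect_hom_restrict[OF MA.semidirect_action_axioms MA.semidirect_action_axioms psi[unfolded kTV_def]] by blast+

lemma id_ring_hom: "id \<in> ring_hom kT kT" by (auto simp: ring_hom_def)

text \<open>Functoriality of exterior powers for semilinear maps. For the product law one of the
  four maps in \<open>ext_map_comp\<close> is the identity.\<close>

lemma ME: "semidirect_action G T H (E m) (\<lambda>h. ea h m)"
proof (intro semidirect_action.intro semidirect_action_axioms.intro)
  note rh = alg_conj_ring_hom[OF H_carrier]
  show "semidirect G T H" by (rule semidirect_axioms)
  show "left_module kT (E m)" by (rule EX.left_module_E)
  show "ea h m \<in> slin (alg_conj G h) kT (E m) (E m)" if "h \<in> H" for h
    by (rule EX.ext_map_slin[OF rh[OF that] MA.act[OF that]])
  show "ea \<one> m x = x" if "x \<in> carrier (E m)" for x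
    by (rule EX.ext_map_id[OF rh[OF H.one_closed] MA.act[OF H.one_closed] alg_conj_one MA.act_one that])
  show "ea (h \<otimes> h') m x = ea h m (ea h' m x)" if hh: "h \<in> H" "h' \<in> H" and x: "x \<in> carrier (E m)" for h h' x
  proof -
    have i: "(\<lambda>x. x) \<in> slin id kT M M" using lmod_hom_id[of kT M] by (simp add: lmod_hom_slin)
    have "ea (h \<otimes> h') m x = ea (h \<otimes> h') m (EX.ext_map id (\<lambda>x. x) m x)"
      using EX.ext_map_id[OF id_ring_hom i _ _ x] by simp
    also have "\<dots> = ea h m (ea h' m x)"
      by (rule EX.ext_map_comp[OF rh[OF H.m_closed[OF hh]] id_ring_hom rh[OF hh(1)] rh[OF hh(2)] MA.act[OF H.m_closed[OF hh]] i
          MA.act[OF hh(1)] MA.act[OF hh(2)] _ _ x])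
        (use hh in \<open>auto simp: alg_conj_conj H_carrier MA.act_mult\<close>)
    finally show ?thesis .
  qed
qed

lemma X_eq: "m \<le> r ==> X (int m) = semidirect_module G T H (E m) (\<lambda>h. ea h m)"
  by (simp add: D_mod_def Let_def EX.ext_map_def)

lemma X_out: "\<not> (0 \<le> m \<and> m \<le> int r) ==> X m = zero_module"
  by (auto simp: D_mod_def)

text \<open>Outside degrees 0 to r the modules are set to zero, so each statement about them splits
  into exterior powers and a trivial case.\<close>

lemma X_cases:
  obtains k where "k \<le> r" "m = int k" | "\<not> (0 \<le> m \<and> m \<le> int r)"
  by (metis nat_le_iff nat_0_le)

lemma X_simps: "m \<le> r ==> carrier (X (int m)) = carrier (E m)" "m \<le> r ==> add (X (int m)) = add (E m)"
  "m \<le> r ==> \<zero>\<^bsub>X (int m)\<^esub> = \<zero>\<^bsub>E m\<^esub>"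
  by (simp_all add: X_eq semidirect_module_def)

lemma X_trivial: "\<not> (0 \<le> m \<and> m \<le> int r) ==> carrier (X m) = {\<zero>\<^bsub>X m\<^esub>}"
  by (simp add: X_out zero_module_carrier)

lemma X_G: "left_module kG (X m)"
proof (cases rule: X_cases[of m])
  case (1 k) thus ?thesis using semidirect_action.S_left_module[OF ME] by (simp add: X_eq)
next
  case 2 thus ?thesis using zero_module_left_module[OF kG_ring] by (simp add: X_out)
qed

lemma X_T: "left_module kT (X m)" by (rule left_module_restrict[OF X_G kT_ring T_sub])

lemma X_smult: "m \<le> r ==> a \<in> carrier kT ==> x \<in> carrier (E m) ==> a \<odot>\<^bsub>X (int m)\<^esub> x = a \<odot>\<^bsub>E m\<^esub> x"
  using semidirect_action.S_smult_T[OF ME] by (simp add: X_eq)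

text \<open>The exterior power over kT and the module over the group algebra have the same elements,
  and their scalars agree on kT; results move between them along the identity map.\<close>

lemma E_X: "m \<le> r ==> (\<lambda>x. x) \<in> lmod_hom kT (E m) (X (int m))"
  and X_E: "m \<le> r ==> (\<lambda>x. x) \<in> lmod_hom kT (X (int m)) (E m)"
  by (rule lmod_homI; simp add: X_simps X_smult)+

lemma ideal_X: "m \<le> r ==> z \<in> ideal_smult kT IT (E m) ==> z \<in> ideal_smult kT IT (X (int m))"
  using left_module.ideal_smult_hom[OF EX.left_module_E IT_sub X_T E_X] by simp

lemma zero_ideal_X: "\<zero>\<^bsub>X m\<^esub> \<in> ideal_smult kT IT (X m)"
  by (rule left_module.submodule_props(2)[OF X_T left_module.ideal_smult_submodule[OF X_T IT_sub]])

lemma phm: "n \<ge> 1 ==> ph n \<in> lmod_hom kT M (regular kT)" using phi_hom[OF _ lift] .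

text \<open>\<open>contr\<close> is indexed by the degree of its target, the differential by that of
  its source.\<close>

lemma dX_eq: "m < r ==> dX n (int (Suc m)) = EX.contr (ph n) m"
  by (simp add: D_diff_def Let_def EX.contr_def EX.koszul_def[abs_def] EX.koszul_term_def[abs_def])

lemma dX_out: "\<not> (1 \<le> m \<and> m \<le> int r) ==> dX n m = (\<lambda>_. \<zero>\<^bsub>X (m - 1)\<^esub>)"
  by (auto simp: D_diff_def)

lemma dX_cases:
  obtains k where "k < r" "m = int (Suc k)" | "\<not> (1 \<le> m \<and> m \<le> int r)"
proof (cases "1 \<le> m \<and> m \<le> int r")
  case True
  hence "nat (m - 1) < r" "m = int (Suc (nat (m - 1)))" by auto
  thus ?thesis by (rule that(1))
qed (rule that(2))

lemma uX_eq: "m \<le> r ==> uX n (int m) = EX.ext_map id (\<psi> n) m"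
  by (simp add: D_map_def Let_def EX.ext_map_def)

lemma uX_out: "\<not> (0 \<le> m \<and> m \<le> int r) ==> uX n m = (\<lambda>_. \<zero>\<^bsub>X m\<^esub>)"
  by (auto simp: D_map_def)

lemma psi_slin: "n \<ge> 1 ==> \<psi> n \<in> slin id kT M M" using psi_M by (simp add: lmod_hom_slin)

lemma dX_hom: "n \<ge> 1 ==> dX n m \<in> lmod_hom kG (X m) (X (m - 1))"
proof (cases rule: dX_cases[of m])
  case (1 k)
  assume n: "n \<ge> 1"
  have "EX.contr (ph n) k \<in> lmod_hom kG (semidirect_module G T H (E (Suc k)) (\<lambda>h. ea h (Suc k))) (semidirect_module G T H (E k) (\<lambda>h. ea h k))"
  proof (rule semidirect_hom[OF ME ME EX.contr_hom[OF phm[OF n]]])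
    fix h x assume h: "h \<in> H" and x: "x \<in> carrier (E (Suc k))"
    show "EX.contr (ph n) k (ea h (Suc k) x) = ea h k (EX.contr (ph n) k x)"
      by (rule EX.contr_ext_map[OF alg_conj_ring_hom[OF H_carrier[OF h]] MA.act[OF h] phm[OF n] phm[OF n] phi_act[OF n lift[OF n] h] x])
  qed
  moreover have "m - 1 = int k" using 1 by simp
  ultimately show ?thesis using 1 X_eq[of "Suc k"] X_eq[of k] dX_eq[of k] by simp
next
  case 2 thus ?thesis using lmod_hom_zero[OF X_G] by (simp add: dX_out)
qed

lemma uX_hom: "n \<ge> 1 ==> uX n m \<in> lmod_hom kG (X m) (X m)"
proof (cases rule: X_cases[of m])
  case (1 k)
  assume n: "n \<ge> 1"
  have "EX.ext_map id (\<psi> n) k \<in> lmod_hom kG (semidirect_module G T H (E k) (\<lambda>h. ea h k)) (semidirect_module G T H (E k) (\<lambda>h. ea h k))"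
  proof (rule semidirect_hom[OF ME ME])
    show "EX.ext_map id (\<psi> n) k \<in> lmod_hom kT (E k) (E k)"
      unfolding lmod_hom_slin by (rule EX.ext_map_slin[OF id_ring_hom psi_slin[OF n]])
    fix h x assume h: "h \<in> H" and x: "x \<in> carrier (E k)"
    note rh = alg_conj_ring_hom[OF H_carrier[OF h]]
    show "EX.ext_map id (\<psi> n) k (ea h k x) = ea h k (EX.ext_map id (\<psi> n) k x)"
      by (rule EX.ext_map_comp[OF id_ring_hom rh rh id_ring_hom psi_slin[OF n] MA.act[OF h] MA.act[OF h] psi_slin[OF n] _ _ x])
         (use psi_act[OF n h] in auto)
  qed
  thus ?thesis using 1 by (simp add: X_eq uX_eq)
next
  case 2 thus ?thesis using lmod_hom_zero[OF X_G] by (simp add: uX_out)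
qed

lemma dX_T: "n \<ge> 1 ==> dX n m \<in> lmod_hom kT (X m) (X (m - 1))"
  and uX_T: "n \<ge> 1 ==> uX n m \<in> lmod_hom kT (X m) (X m)"
  using lmod_hom_restrict[OF dX_hom T_sub] lmod_hom_restrict[OF uX_hom T_sub] by blast+

lemma dX_dX: "n \<ge> 1 ==> x \<in> carrier (X m) ==> dX n (m - 1) (dX n m x) = \<zero>\<^bsub>X (m - 2)\<^esub>"
proof (cases rule: dX_cases[of m])
  case (1 k)
  assume n: "n \<ge> 1" and x: "x \<in> carrier (X m)"
  show ?thesis
  proof (cases k)
    case 0
    \<comment> \<open>The second differential starts in degree 0, where it is zero by
      definition.\<close>
    thus ?thesis using 1 by (simp add: dX_out)
  next
    case (Suc j)
    have m: "m - 1 = int (Suc j)" "m - 2 = int j" "m = int (Suc (Suc j))" using 1 Suc by auto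
    have "x \<in> carrier (E (Suc (Suc j)))" using x X_simps(1)[of "Suc (Suc j)"] 1 Suc m by simp
    from EX.contr_contr[OF phm[OF n] this] show ?thesis
      using 1 Suc dX_eq[of j n] dX_eq[of "Suc j" n] X_simps(3)[of j] unfolding m by simp
  qed
next
  case 2
  assume n: "n \<ge> 1"
  have m: "m - 1 - 1 = m - 2" by simp
  show ?thesis unfolding dX_out[OF 2] using hom_zero[OF X_T X_T dX_T[OF n], of "m - 1"] by (simp only: m)
qed

lemma dX_uX: "n \<ge> 1 ==> x \<in> carrier (X m) ==> dX (Suc n) m (uX n m x) = uX n (m - 1) (dX n m x)"
proof (cases rule: dX_cases[of m])
  case (1 k)
  assume n: "n \<ge> 1" and x: "x \<in> carrier (X m)"
  have k: "m - 1 = int k" using 1 by simp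
  have x: "x \<in> carrier (E (Suc k))" using x 1 X_simps(1)[of "Suc k"] by simp
  have "EX.contr (ph (Suc n)) k (EX.ext_map id (\<psi> n) (Suc k) x) = EX.ext_map id (\<psi> n) k (EX.contr (ph n) k x)"
    by (rule EX.contr_ext_map[OF id_ring_hom psi_slin[OF n] phm[OF n] phm _ x]) (use n psi_phi[OF n] in auto)
  thus ?thesis unfolding k using 1 dX_eq[of k] uX_eq[of "Suc k"] uX_eq[of k] by simp
next
  case 2
  assume n: "n \<ge> 1"
  show ?thesis unfolding dX_out[OF 2] using hom_zero[OF X_T X_T uX_T[OF n]] by simp
qed

lemma dX_ideal: "n \<ge> 1 ==> x \<in> carrier (X m) ==> dX n m x \<in> ideal_smult kT IT (X (m - 1))"
proof (cases rule: dX_cases[of m])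
  case (1 k)
  assume n: "n \<ge> 1" and x: "x \<in> carrier (X m)"
  have k: "m - 1 = int k" using 1 by simp
  have x: "x \<in> carrier (E (Suc k))" using x 1 X_simps(1)[of "Suc k"] by simp
  have "EX.contr (ph n) k x \<in> ideal_smult kT IT (E k)"
    by (rule EX.contr_ideal[OF phm[OF n] IT_sub phi_IT[OF n lift[OF n]] x])
  thus ?thesis unfolding k using 1 ideal_X[of k] dX_eq[of k] by simp
next
  case 2 thus ?thesis using zero_ideal_X by (simp add: dX_out)
qed

lemma uX_ideal: "n \<ge> 1 ==> m \<ge> 1 ==> x \<in> carrier (X m) ==> uX n m x \<in> ideal_smult kT IT (X m)"
proof (cases rule: dX_cases[of m])
  case (1 k)
  assume n: "n \<ge> 1" and x: "x \<in> carrier (X m)"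
  have x: "x \<in> carrier (E (Suc k))" using x 1 X_simps(1)[of "Suc k"] by simp
  have "EX.ext_map id (\<psi> n) (Suc k) x \<in> ideal_smult kT IT (E (Suc k))"
  proof (rule EX.ext_map_ideal[OF IT_sub psi_M[OF n] _ x])
    fix a assume a: "a \<in> carrier M"
    show "\<psi> n a \<in> ideal_smult kT IT M"
      by (rule psi_ideal[OF n lift[OF n] lift psi_M[OF n] _ a]) (use psi_phi[OF n] in auto)
  qed
  thus ?thesis using 1 ideal_X[of "Suc k"] uX_eq[of "Suc k"] by simp
next
  case 2
  assume "m \<ge> 1"
  thus ?thesis using 2 zero_ideal_X by (simp add: uX_out)
qed

lemma uX_0: "n \<ge> 1 ==> w \<in> carrier (X 0) ==> uX n 0 w = w"
  using uX_eq[of 0 n] X_simps(1)[of 0] EX.ext_map_id[OF id_ring_hom psi_slin[of n], of 0 w] by simp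

subsection \<open>The augmentation\<close>

lemma triv_simps: "carrier triv = UNIV" "add triv = (+)" "\<zero>\<^bsub>triv\<^esub> = 0" "a \<odot>\<^bsub>triv\<^esub> c = augmentation a * c"
  by (simp_all add: trivial_module_def)

lemma triv_module: "left_module kT triv"
proof (rule left_moduleI[OF kT_ring])
  show "abelian_group triv"
  proof (rule abelian_groupI')
    show "\<exists>y\<in>carrier triv. y \<oplus>\<^bsub>triv\<^esub> x = \<zero>\<^bsub>triv\<^esub>" for x by (rule bexI[of _ "- x"]) (simp_all add: triv_simps)
  qed (simp_all add: triv_simps)
  show "\<one>\<^bsub>kT\<^esub> \<odot>\<^bsub>triv\<^esub> x = x" for x by (simp add: triv_simps group_algebra_simps(5) augmentation_single)
qed (simp_all add: triv_simps aug_add aug_mult algebra_simps)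

lemma w_closed: "EX.w [] \<in> carrier (E 0)" using EX.wedge_closed[of "[]" 0] by (simp add: tuples_def)

lemma D0_aug_E: "a \<in> carrier kT ==> D0_aug (a \<odot>\<^bsub>E 0\<^esub> EX.w []) = augmentation a"
  by (simp add: D0_aug_def EX.E_0_coeff)

lemma D0_aug_E_hom: "D0_aug \<in> lmod_hom kT (E 0) triv"
proof (rule lmod_homI)
  interpret E0: left_module kT "E 0" by (rule EX.left_module_E)
  show "D0_aug (x \<oplus>\<^bsub>E 0\<^esub> y) = D0_aug x \<oplus>\<^bsub>triv\<^esub> D0_aug y" if xy: "x \<in> carrier (E 0)" "y \<in> carrier (E 0)" for x y
  proof -
    obtain a b where ab: "a \<in> carrier kT" "x = a \<odot>\<^bsub>E 0\<^esub> EX.w []" "b \<in> carrier kT" "y = b \<odot>\<^bsub>E 0\<^esub> EX.w []"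
      using EX.E_0[OF xy(1)] EX.E_0[OF xy(2)] by blast
    hence "x \<oplus>\<^bsub>E 0\<^esub> y = (a \<oplus>\<^bsub>kT\<^esub> b) \<odot>\<^bsub>E 0\<^esub> EX.w []" using E0.smult_l_distr[OF ab(1,3) w_closed] by simp
    thus ?thesis using ab D0_aug_E[OF kT.add.m_closed[OF ab(1,3)]] by (simp add: D0_aug_E triv_simps aug_add)
  qed
  show "D0_aug (a \<odot>\<^bsub>E 0\<^esub> x) = a \<odot>\<^bsub>triv\<^esub> D0_aug x" if ax: "a \<in> carrier kT" "x \<in> carrier (E 0)" for a x
  proof -
    obtain b where b: "b \<in> carrier kT" "x = b \<odot>\<^bsub>E 0\<^esub> EX.w []" using EX.E_0[OF ax(2)] by blast
    hence "a \<odot>\<^bsub>E 0\<^esub> x = (a \<otimes>\<^bsub>kT\<^esub> b) \<odot>\<^bsub>E 0\<^esub> EX.w []" using E0.smult_assoc1[OF ax(1) b(1) w_closed] by simp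
    thus ?thesis using ax b D0_aug_E[OF kT.m_closed[OF ax(1) b(1)]] by (simp add: D0_aug_E triv_simps aug_mult)
  qed
qed (simp add: triv_simps)

lemma D0_aug_hom: "D0_aug \<in> lmod_hom kT (X 0) triv"
  using lmod_hom_comp[OF X_E[of 0] D0_aug_E_hom] by simp

lemma D0_aug_dX: "n \<ge> 1 ==> x \<in> carrier (X 1) ==> D0_aug (dX n 1 x) = 0"
proof -
  assume n: "n \<ge> 1" and x: "x \<in> carrier (X 1)"
  interpret X0: left_module kT "X 0" by (rule X_T)
  have "dX n 1 x \<in> ideal_smult kT IT (X 0)" using dX_ideal[OF n x] by simp
  thus ?thesis unfolding ideal_smult_def
  proof (induction rule: X0.span_induct[OF _ X0.ideal_gens_subset[OF IT_sub], consumes 1])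
    case (1 z)
    then obtain a y where "z = a \<odot>\<^bsub>X 0\<^esub> y" "a \<in> IT" "y \<in> carrier (X 0)" by blast
    thus ?case using hom_smult[OF D0_aug_hom, of a y] by (simp add: IT_iff triv_simps)
  next
    case 2 show ?case using hom_zero[OF X_T triv_module D0_aug_hom] by (simp add: triv_simps)
  next
    case (3 x y) thus ?case using hom_add[OF D0_aug_hom, of x y] by (simp add: triv_simps)
  next
    case (4 a x) thus ?case using hom_smult[OF D0_aug_hom, of a x] by (simp add: triv_simps)
  qed
qed

text \<open>Every element of kT has its support in some T_n, and there each t - 1 is a value of phi
  by \<open>dl_in_image\<close>. As the torsion subgroups increase, this remains so for all larger
  n.\<close>

lemma kT_phi:
  assumes "a \<in> carrier kT"
  shows "\<exists>n0\<ge>1. \<forall>n\<ge>n0. \<exists>x\<in>carrier M. a = ph n x \<oplus>\<^bsub>kG\<^esub> single \<one> (augmentation a)"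
  using assms
proof (induction rule: kT_induct)
  case zero
  have "ph n \<zero>\<^bsub>M\<^esub> = (\<lambda>_. 0)" if "n \<ge> 1" for n
    using hom_zero[OF M_left_module kT.regular_module phm[OF that]] by (simp add: group_algebra_simps(4))
  thus ?case using MA.M.M.zero_closed
    by (intro exI[of _ 1] conjI allI impI bexI[of _ "\<zero>\<^bsub>M\<^esub>"]) (auto simp: augmentation_zero single_zero group_algebra_simps(3))
next
  case (add a b)
  obtain n0 where n0: "n0 \<ge> 1" "\<And>n. n \<ge> n0 ==> \<exists>x\<in>carrier M. a = ph n x \<oplus>\<^bsub>kG\<^esub> single \<one> (augmentation a)" using add.IH(1) by blast
  obtain n1 where n1: "n1 \<ge> 1" "\<And>n. n \<ge> n1 ==> \<exists>x\<in>carrier M. b = ph n x \<oplus>\<^bsub>kG\<^esub> single \<one> (augmentation b)" using add.IH(2) by blast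
  show ?case
  proof (intro exI[of _ "max n0 n1"] conjI allI impI)
    show "max n0 n1 \<ge> 1" using n0(1) by simp
    fix n assume n: "n \<ge> max n0 n1"
    have n': "n \<ge> 1" using n n0(1) by simp
    obtain x where x: "x \<in> carrier M" "a = ph n x \<oplus>\<^bsub>kG\<^esub> single \<one> (augmentation a)" using n0(2)[of n] n by auto
    obtain y where y: "y \<in> carrier M" "b = ph n y \<oplus>\<^bsub>kG\<^esub> single \<one> (augmentation b)" using n1(2)[of n] n by auto
    have "ph n (x \<oplus>\<^bsub>M\<^esub> y) = ph n x \<oplus>\<^bsub>kG\<^esub> ph n y" using hom_add[OF phm[OF n'] x(1) y(1)] by simp
    moreover have "a \<oplus>\<^bsub>kG\<^esub> b = (ph n x \<oplus>\<^bsub>kG\<^esub> single \<one> (augmentation a)) \<oplus>\<^bsub>kG\<^esub> (ph n y \<oplus>\<^bsub>kG\<^esub> single \<one> (augmentation b))"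
      using x(2) y(2) by simp
    ultimately have "a \<oplus>\<^bsub>kG\<^esub> b = ph n (x \<oplus>\<^bsub>M\<^esub> y) \<oplus>\<^bsub>kG\<^esub> single \<one> (augmentation (a \<oplus>\<^bsub>kG\<^esub> b))"
      unfolding aug_add[OF add.hyps] by (simp add: group_algebra_simps(3) single_def fun_eq_iff)
    thus "\<exists>x\<in>carrier M. a \<oplus>\<^bsub>kG\<^esub> b = ph n x \<oplus>\<^bsub>kG\<^esub> single \<one> (augmentation (a \<oplus>\<^bsub>kG\<^esub> b))"
      using MA.M.M.a_closed[OF x(1) y(1)] by blast
  qed
next
  case (single t c)
  obtain n0 where n0: "n0 \<ge> 1" "t \<in> Tn n0" using torsion_exhaust[OF single] by blast
  show ?case
  proof (intro exI[of _ n0] conjI allI impI n0(1))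
    fix n assume n: "n \<ge> n0"
    hence n': "n \<ge> 1" "t \<in> Tn n" using n0 torsion_mono[OF n] by auto
    obtain x where x: "x \<in> carrier M" "ph n x = dl t" using dl_in_image[OF n'(1) lift[OF n'(1)] n'(2)] by blast
    have "ph n (single \<one> c \<odot>\<^bsub>M\<^esub> x) = single \<one> c \<otimes>\<^bsub>kG\<^esub> dl t"
      using hom_smult[OF phm[OF n'(1)] single_one_closed x(1), of c] x(2) by simp
    also have "\<dots> = (\<lambda>x. c * dl t x)" using scalar_kT[OF dl_closed[OF single], of c] by simp
    finally have "ph n (single \<one> c \<odot>\<^bsub>M\<^esub> x) \<oplus>\<^bsub>kG\<^esub> single \<one> (augmentation (single t c)) = single t c"
      unfolding augmentation_single by (auto simp: group_algebra_simps(3) dl_def single_def)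
    thus "\<exists>x\<in>carrier M. single t c = ph n x \<oplus>\<^bsub>kG\<^esub> single \<one> (augmentation (single t c))"
      using MA.M.smult_closed[OF single_one_closed x(1), of c] by (intro bexI[of _ "single \<one> c \<odot>\<^bsub>M\<^esub> x"]) auto
  qed
qed

lemma D0_aug_ker:
  assumes w: "w \<in> carrier (X 0)" and 0: "D0_aug w = 0"
  shows "\<exists>n0. \<forall>n\<ge>n0. \<exists>a\<in>carrier (X 1). w = dX n 1 a"
proof -
  have "w \<in> carrier (E 0)" using w X_simps(1)[of 0] by simp
  then obtain a where a: "a \<in> carrier kT" "w = a \<odot>\<^bsub>E 0\<^esub> EX.w []" using EX.E_0 by blast
  have aug: "augmentation a = 0" using 0 a by (simp add: D0_aug_E)
  obtain n0 where n0: "n0 \<ge> 1" "\<And>n. n \<ge> n0 ==> \<exists>x\<in>carrier M. a = ph n x \<oplus>\<^bsub>kG\<^esub> single \<one> (augmentation a)"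
    using kT_phi[OF a(1)] by blast
  have "\<exists>a\<in>carrier (X 1). w = dX n 1 a" if n: "n \<ge> n0" for n
  proof -
    have n': "n \<ge> 1" using n n0(1) by simp
    obtain x where x: "x \<in> carrier M" "a = ph n x" using n0(2)[OF n] aug by (auto simp: single_zero group_algebra_simps(3))
    have l: "EX.lw 0 x (EX.w []) \<in> carrier (E (Suc 0))" by (rule EX.lw_closed[OF x(1) w_closed])
    have "EX.contr (ph n) 0 (EX.lw 0 x (EX.w [])) = w" using EX.contr_lw_0[OF phm[OF n'] x(1) w_closed] a(2) x(2) by simp
    \<comment> \<open>Here r \<ge> 1 ensures that degree 1 is the exterior power and not the zero
      module.\<close>
    thus ?thesis using l dX_eq[of 0 n] X_simps(1)[of 1] r_pos by (intro bexI[of _ "EX.lw 0 x (EX.w [])"]) auto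
  qed
  thus ?thesis by blast
qed

text \<open>The threshold is the level at which t becomes torsion. It depends on t alone, since the
  same vector x with value t - 1 contracts all degrees.\<close>

lemma T_homotopy:
  assumes t: "t \<in> T"
  shows "\<exists>n0. \<forall>n\<ge>n0. \<forall>m\<ge>0. \<forall>w\<in>carrier (X m). dX n m w = \<zero>\<^bsub>X (m - 1)\<^esub> \<longrightarrow>
      (\<exists>a\<in>carrier (X (m + 1)). single t 1 \<odot>\<^bsub>X m\<^esub> w \<ominus>\<^bsub>X m\<^esub> w = dX n (m + 1) a)"
proof -
  obtain n0 where n0: "n0 \<ge> 1" "t \<in> Tn n0" using torsion_exhaust[OF t] by blast
  have "\<exists>a\<in>carrier (X (m + 1)). single t 1 \<odot>\<^bsub>X m\<^esub> w \<ominus>\<^bsub>X m\<^esub> w = dX n (m + 1) a"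
    if n: "n \<ge> n0" and m: "m \<ge> 0" and w: "w \<in> carrier (X m)" "dX n m w = \<zero>\<^bsub>X (m - 1)\<^esub>" for n m w
  proof -
    have n': "n \<ge> 1" "t \<in> Tn n" using n n0 torsion_mono[OF n] by auto
    obtain x where x: "x \<in> carrier M" "ph n x = dl t" using dl_in_image[OF n'(1) lift[OF n'(1)] n'(2)] by blast
    interpret Xm: left_module kT "X m" by (rule X_T)
    interpret X': left_module kT "X (m + 1)" by (rule X_T)
    have z: "dX n (m + 1) \<zero>\<^bsub>X (m + 1)\<^esub> = \<zero>\<^bsub>X m\<^esub>" using hom_zero[OF X_T X_T dX_T[OF n'(1)], of "m + 1"] by simp
    have "single t 1 \<odot>\<^bsub>X m\<^esub> w \<ominus>\<^bsub>X m\<^esub> w = dl t \<odot>\<^bsub>X m\<^esub> w"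
      using Xm.smult_l_diff[OF single_closed_T[OF t] kT.one_closed w(1), of 1] Xm.smult_one[OF w(1)] dl_minus[OF t] by simp
    note tw = this
    show ?thesis
    proof (cases rule: X_cases[of m])
      case (1 k)
      have wE: "w \<in> carrier (E k)" using w(1) 1 by (simp add: X_simps)
      have lw: "EX.lw k x w \<in> carrier (E (Suc k))" by (rule EX.lw_closed[OF x(1) wE])
      interpret Ek: left_module kT "E k" by (rule EX.left_module_E)
      have tE: "dl t \<odot>\<^bsub>X m\<^esub> w = ph n x \<odot>\<^bsub>E k\<^esub> w" using 1 X_smult[OF 1(1) dl_closed[OF t] wE] x(2) by simp
      have px: "ph n x \<in> carrier kT" using x(2) dl_closed[OF t] by simp
      \<comment> \<open>The antiderivation rule; its second term disappears because w is a
        cycle.\<close>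
      have c: "EX.contr (ph n) k (EX.lw k x w) = ph n x \<odot>\<^bsub>E k\<^esub> w"
      proof (cases k)
        case 0
        thus ?thesis using EX.contr_lw_0[OF phm[OF n'(1)] x(1), of w] wE by simp
      next
        case (Suc j)
        have "m - 1 = int j" using 1 Suc by simp
        hence "EX.contr (ph n) j w = \<zero>\<^bsub>E j\<^esub>" using w(2) 1 Suc dX_eq[of j n] X_simps(3)[of j] by simp
        moreover have "EX.lw j x \<zero>\<^bsub>E j\<^esub> = \<zero>\<^bsub>E (Suc j)\<^esub>" by (rule hom_zero[OF EX.left_module_E EX.left_module_E EX.lw_hom[OF x(1)]])
        ultimately show ?thesis using EX.contr_lw[OF phm[OF n'(1)] x(1), of w j] wE Suc px
          Ek.M.minus_zero[OF Ek.smult_closed[OF px wE]] by simp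
      qed
      show ?thesis
      proof (cases "k < r")
        case True
        have m1: "m + 1 = int (Suc k)" using 1 by simp
        show ?thesis unfolding tw tE c[symmetric] m1
          using True dX_eq[OF True, of n] X_simps(1)[of "Suc k"] lw by (intro bexI[of _ "EX.lw k x w"]) auto
      next
        case False
        \<comment> \<open>In the top degree the multiple x \<and> w is zero, so t - 1 annihilates
          the cycles there and the zero chain will do.\<close>
        have "EX.lw k x w = \<zero>\<^bsub>E (Suc k)\<^esub>" by (rule EX.E_top_zero[OF _ lw]) (use False in simp)
        hence "ph n x \<odot>\<^bsub>E k\<^esub> w = \<zero>\<^bsub>E k\<^esub>"
          using c hom_zero[OF EX.left_module_E EX.left_module_E EX.contr_hom[OF phm[OF n'(1)]], of k] by simp
        thus ?thesis unfolding tw tE using z X_simps(3)[OF 1(1)] 1(2) X'.M.zero_closed by (intro bexI[of _ "\<zero>\<^bsub>X (m + 1)\<^esub>"]) auto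
      qed
    next
      case 2
      have "dl t \<odot>\<^bsub>X m\<^esub> w = \<zero>\<^bsub>X m\<^esub>" using Xm.smult_closed[OF dl_closed[OF t] w(1)] X_trivial[OF 2] by blast
      thus ?thesis unfolding tw using z X'.M.zero_closed by (intro bexI[of _ "\<zero>\<^bsub>X (m + 1)\<^esub>"]) auto
    qed
  qed
  thus ?thesis by blast
qed

text \<open>The dual basis of the exterior power is reused; only the sums have to be rewritten from
  one module record to the other.\<close>

lemma X_dual_basis: "\<exists>(l :: nat) c v. dual_basis kT (X m) {..<l} c v"
proof (cases rule: X_cases[of m])
  case (1 k)
  obtain l :: nat and c v where "(\<forall>i<l. c i \<in> lmod_hom kT (E k) (regular kT) \<and> v i \<in> carrier (E k)) \<and>
    (\<forall>x\<in>carrier (E k). x = (\<Oplus>\<^bsub>E k\<^esub>i\<in>{..<l}. c i x \<odot>\<^bsub>E k\<^esub> v i))"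
    using finite_factor_sum[OF EX.left_module_E EX.finite_factor_E[of k]] by (elim exE)
  hence cv: "i < l ==> c i \<in> lmod_hom kT (E k) (regular kT) \<and> v i \<in> carrier (E k)"
    and cv_sum: "x \<in> carrier (E k) ==> x = (\<Oplus>\<^bsub>E k\<^esub>i\<in>{..<l}. c i x \<odot>\<^bsub>E k\<^esub> v i)" for i x
    by blast+
  interpret Ek: left_module kT "E k" by (rule EX.left_module_E)
  have "dual_basis kT (X (int k)) {..<l} c v"
  proof (rule finite_dual_basis[OF X_T])
    show "c i \<in> lmod_hom kT (X (int k)) (regular kT) \<and> v i \<in> carrier (X (int k))" if "i < l" for i
      using cv[OF that] lmod_hom_comp[OF X_E[OF 1(1)]] X_simps(1)[OF 1(1)] by blast
    fix x assume "x \<in> carrier (X (int k))"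
    hence x: "x \<in> carrier (E k)" using X_simps(1)[OF 1(1)] by simp
    have ci: "c i x \<in> carrier kT" if "i < l" for i using hom_closed[OF cv[OF that, THEN conjunct1] x] by simp
    have "x = (\<Oplus>\<^bsub>E k\<^esub>i\<in>{..<l}. c i x \<odot>\<^bsub>E k\<^esub> v i)" by (rule cv_sum[OF x])
    also have "\<dots> = (\<Oplus>\<^bsub>X (int k)\<^esub>i\<in>{..<l}. c i x \<odot>\<^bsub>E k\<^esub> v i)"
      by (rule hom_finsum[OF EX.left_module_E X_T E_X[OF 1(1)]]) (use ci cv Ek.smult_closed in auto)
    also have "\<dots> = (\<Oplus>\<^bsub>X (int k)\<^esub>i\<in>{..<l}. c i x \<odot>\<^bsub>X (int k)\<^esub> v i)"
      using ci cv Ek.smult_closed X_smult[OF 1(1)] X_simps(1)[OF 1(1)]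
      by (intro abelian_monoid.finsum_cong' abelian_group.axioms(1) left_module_ab[OF X_T]) auto
    finally show "x = (\<Oplus>\<^bsub>X (int k)\<^esub>i\<in>{..<l}. c i x \<odot>\<^bsub>X (int k)\<^esub> v i)" .
  qed
  thus ?thesis using 1(2) by blast
next
  case 2
  interpret Xm: left_module kT "X m" by (rule X_T)
  have "dual_basis kT (X m) {..<0::nat} (\<lambda>_ _. \<zero>\<^bsub>kT\<^esub>) (\<lambda>_. \<zero>\<^bsub>X m\<^esub>)"
  proof (rule finite_dual_basis[OF X_T])
    fix x assume "x \<in> carrier (X m)"
    hence "x = \<zero>\<^bsub>X m\<^esub>" unfolding X_trivial[OF 2] by (rule singletonD)
    thus "x = (\<Oplus>\<^bsub>X m\<^esub>l\<in>{..<0 :: nat}. \<zero>\<^bsub>kT\<^esub> \<odot>\<^bsub>X m\<^esub> \<zero>\<^bsub>X m\<^esub>)" by simp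
  qed simp
  thus ?thesis by blast
qed

subsection \<open>The telescope of the complexes\<close>

text \<open>The chain modules and maps of a telescope are defined without reference to the ring.
  Hence this and \<open>telescope_kT\<close> describe the same complex, and facts proved over either
  ring can be combined.\<close>

lemma telescope_kG: "telescope kG X (\<lambda>n m. dX n m) (\<lambda>n m. uX n m)"
  by (intro telescope.intro kG_ring X_G dX_hom uX_hom dX_dX dX_uX)

lemma telescope_kT: "telescope kT X (\<lambda>n m. dX n m) (\<lambda>n m. uX n m)"
  by (intro telescope.intro kT_ring X_T dX_T uX_T dX_dX dX_uX)

interpretation KG: telescope kG X "\<lambda>n m. dX n m" "\<lambda>n m. uX n m" by (rule telescope_kG)
interpretation KT: telescope kT X "\<lambda>n m. dX n m" "\<lambda>n m. uX n m" by (rule telescope_kT)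

definition "eps x = (\<Sum>n | n \<ge> 1 \<and> x n \<noteq> \<zero>\<^bsub>X 0\<^esub>. D0_aug (x n))"

lemma D0_aug_zero: "D0_aug \<zero>\<^bsub>X 0\<^esub> = 0"
  using hom_zero[OF X_T triv_module D0_aug_hom] by (simp add: triv_simps)

lemma eps_superset:
  assumes "finite W" "W \<subseteq> {1..}" "\<And>n. n \<ge> 1 ==> n \<notin> W ==> x n = \<zero>\<^bsub>X 0\<^esub>"
  shows "eps x = (\<Sum>n\<in>W. D0_aug (x n))"
  unfolding eps_def using assms by (intro sum.mono_neutral_left) (auto simp: D0_aug_zero)

lemma eps_hom: "eps \<in> lmod_hom kT (KT.S 0) triv"
proof (rule lmod_homI)
  show "eps (x \<oplus>\<^bsub>KT.S 0\<^esub> y) = eps x \<oplus>\<^bsub>triv\<^esub> eps y" if xy: "x \<in> carrier (KT.S 0)" "y \<in> carrier (KT.S 0)" for x y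
  proof -
    obtain N where N: "\<And>n. n \<ge> N ==> x n = \<zero>\<^bsub>X 0\<^esub>" using KT.S_bound[OF xy(1)] by blast
    obtain N' where N': "\<And>n. n \<ge> N' ==> y n = \<zero>\<^bsub>X 0\<^esub>" using KT.S_bound[OF xy(2)] by blast
    let ?W = "{1..<max N N'}"
    have z: "x n = \<zero>\<^bsub>X 0\<^esub>" "y n = \<zero>\<^bsub>X 0\<^esub>" "(x \<oplus>\<^bsub>KT.S 0\<^esub> y) n = \<zero>\<^bsub>X 0\<^esub>" if "n \<ge> 1" "n \<notin> ?W" for n
      using that N[of n] N'[of n] left_module_ab[OF X_T[of 0]] by (simp_all add: KT.S_simps abelian_group_def abelian_monoid.l_zero abelian_monoid.zero_closed)
    have W: "finite ?W" "?W \<subseteq> {1..}" by auto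
    have "eps (x \<oplus>\<^bsub>KT.S 0\<^esub> y) = (\<Sum>n\<in>?W. D0_aug ((x \<oplus>\<^bsub>KT.S 0\<^esub> y) n))" by (rule eps_superset[OF W z(3)])
    also have "\<dots> = (\<Sum>n\<in>?W. D0_aug (x n) + D0_aug (y n))"
      using hom_add[OF D0_aug_hom KT.S_comp[OF xy(1)] KT.S_comp[OF xy(2)]]
      by (intro sum.cong) (auto simp: KT.S_simps triv_simps)
    also have "\<dots> = eps x + eps y"
    proof -
      have "eps x = (\<Sum>n\<in>?W. D0_aug (x n))" by (rule eps_superset[OF W z(1)])
      moreover have "eps y = (\<Sum>n\<in>?W. D0_aug (y n))" by (rule eps_superset[OF W z(2)])
      ultimately show ?thesis by (simp only: sum.distrib)
    qed
    finally show ?thesis by (simp add: triv_simps)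
  qed
  show "eps (a \<odot>\<^bsub>KT.S 0\<^esub> x) = a \<odot>\<^bsub>triv\<^esub> eps x" if ax: "a \<in> carrier kT" "x \<in> carrier (KT.S 0)" for a x
  proof -
    obtain N where N: "\<And>n. n \<ge> N ==> x n = \<zero>\<^bsub>X 0\<^esub>" using KT.S_bound[OF ax(2)] by blast
    let ?W = "{1..<N}"
    have z: "x n = \<zero>\<^bsub>X 0\<^esub>" "(a \<odot>\<^bsub>KT.S 0\<^esub> x) n = \<zero>\<^bsub>X 0\<^esub>" if "n \<ge> 1" "n \<notin> ?W" for n
      using that N[of n] left_module.smult_r_null[OF X_T ax(1)] by (simp_all add: KT.S_simps)
    have W: "finite ?W" "?W \<subseteq> {1..}" by auto
    have "eps (a \<odot>\<^bsub>KT.S 0\<^esub> x) = (\<Sum>n\<in>?W. D0_aug ((a \<odot>\<^bsub>KT.S 0\<^esub> x) n))" by (rule eps_superset[OF W z(2)])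
    also have "\<dots> = (\<Sum>n\<in>?W. augmentation a * D0_aug (x n))"
      using hom_smult[OF D0_aug_hom ax(1) KT.S_comp[OF ax(2)]]
      by (intro sum.cong) (auto simp: KT.S_simps triv_simps)
    also have "\<dots> = augmentation a * eps x"
    proof -
      have "eps x = (\<Sum>n\<in>?W. D0_aug (x n))" by (rule eps_superset[OF W z(1)])
      thus ?thesis by (simp only: sum_distrib_left)
    qed
    finally show ?thesis by (simp add: triv_simps)
  qed
qed (simp add: triv_simps)

lemma eps_inc: "n \<ge> 1 ==> w \<in> carrier (X 0) ==> eps (KT.inc 0 n w) = D0_aug w"
  by (subst eps_superset[of "{n}"]) (auto simp: KT.inc_apply)

lemma ann_triv: "{a \<in> carrier kT. a \<odot>\<^bsub>triv\<^esub> 1 = \<zero>\<^bsub>triv\<^esub>} = IT"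
  by (auto simp: triv_simps IT_iff)

lemma resolution:
  "telescope_resolution kT X (\<lambda>n m. dX n m) (\<lambda>n m. uX n m) triv 1 eps D0_aug ((\<lambda>t. single t 1) ` T)"
\<comment> \<open>The annihilator of 1 in k is the augmentation ideal of kT, the form in which the
  ideal facts were proved.\<close>
proof (intro telescope_resolution.intro telescope_kT kT_cring telescope_resolution_axioms.intro; (unfold ann_triv)?)
  show "left_module kT triv" by (rule triv_module)
  show "(1 :: 'k) \<in> carrier triv" by (simp add: triv_simps)
  show "\<exists>a\<in>carrier kT. c = a \<odot>\<^bsub>triv\<^esub> 1" for c
    by (rule bexI[of _ "single \<one> c", OF _ single_one_closed]) (simp add: triv_simps augmentation_single)
  show "carrier (X m) = {\<zero>\<^bsub>X m\<^esub>}" if "m < 0" for m by (rule X_trivial) (use that in simp)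
  show "\<exists>w\<in>carrier (X 0). D0_aug w = c" for c
  proof -
    have "single \<one> c \<odot>\<^bsub>E 0\<^esub> EX.w [] \<in> carrier (E 0)"
      by (rule left_module.smult_closed[OF EX.left_module_E single_one_closed w_closed])
    thus ?thesis using D0_aug_E[OF single_one_closed, of c] X_simps(1)[of 0]
      by (intro bexI[of _ "single \<one> c \<odot>\<^bsub>E 0\<^esub> EX.w []"]) (auto simp: augmentation_single)
  qed
  show "(\<lambda>t. single t 1) ` T \<subseteq> carrier kT" using single_closed_T by blast
  show "\<exists>n0. \<forall>n\<ge>n0. \<forall>m\<ge>0. \<forall>w\<in>carrier (X m). dX n m w = \<zero>\<^bsub>X (m - 1)\<^esub> \<longrightarrow>
      (\<exists>a\<in>carrier (X (m + 1)). t \<odot>\<^bsub>X m\<^esub> w \<ominus>\<^bsub>X m\<^esub> w = dX n (m + 1) a)" if "t \<in> (\<lambda>t. single t 1) ` T" for t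
    using that T_homotopy by blast
  show "\<exists>n0. \<forall>n\<ge>n0. \<exists>a\<in>carrier (X 1). w = dX n 1 a" if "w \<in> carrier (X 0)" "D0_aug w = \<zero>\<^bsub>triv\<^esub>" for w
    using D0_aug_ker that by (simp add: triv_simps)
  show "D0_aug (dX n 1 x) = \<zero>\<^bsub>triv\<^esub>" if "n \<ge> 1" "x \<in> carrier (X 1)" for n x
    using D0_aug_dX that by (simp add: triv_simps)
qed (fact uX_0 dX_ideal uX_ideal eps_hom eps_inc X_dual_basis)+

lemma bD_eq:
  "bD_mod G T H p r = cone_module KT.S KT.S"
  "bD_diff G T H p r f \<psi> = cone_diff KT.S KT.sd KT.sd KT.P"
  "bD_aug G T H p r = (\<lambda>x. eps (fst x))"
proof -
  have 1: "sum_mod G T H p r = KT.S" by (simp add: fun_eq_iff sum_mod_def KT.S_def)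
  have 2: "sum_diff G T H p r f = KT.sd" by (simp add: fun_eq_iff sum_diff_def KT.sd_def)
  have 3: "sum_Psi G T H p r \<psi> = KT.P" by (simp add: fun_eq_iff sum_Psi_def KT.P_def)
  show "bD_mod G T H p r = cone_module KT.S KT.S" by (simp add: bD_mod_def 1)
  show "bD_diff G T H p r f \<psi> = cone_diff KT.S KT.sd KT.sd KT.P" by (simp add: bD_diff_def 1 2 3)
  show "bD_aug G T H p r = (\<lambda>x. eps (fst x))" by (auto simp: bD_aug_def eps_def)
qed

theorem bD_resolution:
  "chain_complex kG (bD_mod G T H p r) (bD_diff G T H p r f \<psi>)
    \<and> has_length (bD_mod G T H p r :: int => ('a => 'k, ('a, 'k) bD) module) (r + 1)
    \<and> (\<forall>n. projective_module kG (bD_mod G T H p r n :: ('a => 'k, ('a, 'k) bD) module))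
    \<and> omega_resolution (G\<lparr>carrier := T\<rparr>) (bD_mod G T H p r) (bD_diff G T H p r f \<psi>) (bD_aug G T H p r)"
proof (intro conjI allI)
  interpret TR: telescope_resolution kT X "\<lambda>n m. dX n m" "\<lambda>n m. uX n m" triv 1 eps D0_aug "(\<lambda>t. single t 1) ` T"
    "{a \<in> carrier kT. a \<odot>\<^bsub>triv\<^esub> 1 = \<zero>\<^bsub>triv\<^esub>}"
    by (rule resolution) simp
  have aug: "bD_aug G T H p r = TR.\<epsilon>" unfolding bD_eq by (simp add: fun_eq_iff TR.\<epsilon>_def)
  show cG: "chain_complex kG (bD_mod G T H p r) (bD_diff G T H p r f \<psi>)" unfolding bD_eq by (rule KG.complex_B)
  show "has_length (bD_mod G T H p r :: int => ('a => 'k, ('a, 'k) bD) module) (r + 1)"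
    unfolding has_length_def bD_eq by (intro allI impI TR.B_trivial X_trivial) auto
  \<comment> \<open>The dual bases give projectivity over kT; averaging over H passes to the group
    algebra of \<Gamma>.\<close>
  show "projective_module kG (bD_mod G T H p r n :: ('a => 'k, ('a, 'k) bD) module)" for n
    unfolding bD_eq by (rule projective_kG[OF KG.B TR.B_projective finite_H card_H])
  show "omega_resolution (G\<lparr>carrier := T\<rparr>) (bD_mod G T H p r) (bD_diff G T H p r f \<psi>) (bD_aug G T H p r)"
    unfolding omega_resolution_def Let_def aug unfolding bD_eq
    using KT.complex_B TR.B_neg TR.eps_hom TR.eps_bd TR.B_projective TR.tensor_exact TR.tensor_exact_0 TR.tensor_surj
      TR.homology_smult TR.homology_0
    by (auto simp: triv_simps)
qed

end

section \<open>From the hypotheses on the groups to the setting of the proof\<close>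

lemma (in semidirect) H_bij: "bij_betw (\<lambda>h. T #> h) H (carrier (G Mod T))"
  unfolding bij_betw_def
proof
  show "inj_on (\<lambda>h. T #> h) H"
  proof (rule inj_onI)
    fix h h' assume h: "h \<in> H" "h' \<in> H" "T #> h = T #> h'"
    have "h \<in> T #> h" by (rule rcos_self[OF H_carrier[OF h(1)] T.subgroup_axioms])
    hence "h \<in> T #> h'" by (simp only: h(3))
    hence "h \<in> (\<Union>t\<in>T. {t \<otimes> h'})" by (simp only: r_coset_def)
    then obtain t where t: "t \<in> T" "h = t \<otimes> h'" by (elim UN_E) (simp only: singleton_iff)
    have "H_part G T H h = h" using H_part_H[OF h(1)] by simp
    thus "h = h'" using H_part_mult(1)[OF t(1) h(2)] t(2) by simp
  qed
  show "(\<lambda>h. T #> h) ` H = carrier (G Mod T)"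
  proof (intro equalityI subsetI)
    fix c assume "c \<in> carrier (G Mod T)"
    then obtain g where g: "g \<in> carrier G" "c = T #> g" unfolding carrier_FactGroup by blast
    obtain t h where th: "t \<in> T" "h \<in> H" "g = t \<otimes> h" using decompose[OF g(1)] by blast
    have "c = (T #> t) #> h" using coset_mult_assoc[OF T_sub T_carrier[OF th(1)] H_carrier[OF th(2)]] g(2) th(3) by simp
    also have "T #> t = T" by (rule coset_join2[OF T_carrier[OF th(1)] T.subgroup_axioms th(1)])
    finally show "c \<in> (\<lambda>h. T #> h) ` H" using th(2) by blast
  qed (auto simp: carrier_FactGroup H_carrier)
qed

theorem proposition5p10:
  fixes G :: "('g, 'x) monoid_scheme" and T H :: "'g set" and p r :: nat
    and f :: "nat \<Rightarrow> 'g \<Rightarrow> 'g \<Rightarrow> 'k::field"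
    and \<psi> :: "nat \<Rightarrow> ('g, 'k) kTV \<Rightarrow> ('g, 'k) kTV"
  assumes "prime p" and "CHAR('k) = p"
    and "group G" and "T \<lhd> G"
    and "r \<ge> 1" and "G\<lparr>carrier := T\<rparr> \<cong> product_group {..<r} (\<lambda>_. prufer_group p)"
    and "finite (carrier (G Mod T))" and "coprime (order (G Mod T)) p"
    and "subgroup H G" and "T \<inter> H = {\<one>\<^bsub>G\<^esub>}" and "T <#>\<^bsub>G\<^esub> H = carrier G"
    and "\<And>n. n \<ge> 1 \<Longrightarrow> phi_lift G T H p n (f n)"
    and "\<And>n. n \<ge> 1 \<Longrightarrow> \<psi> n \<in> lmod_hom (group_algebra G) (kTV G T H p) (kTV G T H p)"
    and "\<And>n x. n \<ge> 1 \<Longrightarrow> x \<in> carrier (kTV G T H p :: ('g \<Rightarrow> 'k, ('g, 'k) kTV) module) \<Longrightarrow>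
           phi_map G T p (f (n + 1)) (\<psi> n x) = phi_map G T p (f n) x"
  shows "chain_complex (group_algebra G) (bD_mod G T H p r) (bD_diff G T H p r f \<psi>)
    \<and> has_length (bD_mod G T H p r :: int \<Rightarrow> ('g \<Rightarrow> 'k, ('g, 'k) bD) module) (r + 1)
    \<and> (\<forall>n. projective_module (group_algebra G)
            (bD_mod G T H p r n :: ('g \<Rightarrow> 'k, ('g, 'k) bD) module))
    \<and> omega_resolution (G\<lparr>carrier := T\<rparr>) (bD_mod G T H p r) (bD_diff G T H p r f \<psi>)
        (bD_aug G T H p r)"
proof -
  interpret G: group G by fact
  interpret T: normal T G by fact
  have T_group: "group (G\<lparr>carrier := T\<rparr>)" by (rule G.subgroup_imp_group[OF T.subgroup_axioms])
  obtain q :: "nat => 'g => rat" where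
    "(\<forall>j<r. \<forall>t\<in>T. \<exists>n. q j t * of_nat p ^ n \<in> \<int>) \<and>
    (\<forall>j<r. \<forall>s\<in>T. \<forall>t\<in>T. q j (s \<otimes>\<^bsub>G\<^esub> t) - q j s - q j t \<in> \<int>) \<and>
    (\<forall>t\<in>T. (\<forall>j<r. q j t \<in> \<int>) \<longrightarrow> t = \<one>\<^bsub>G\<^esub>) \<and>
    (\<forall>c. (\<forall>j<r. \<exists>n. c j * of_nat p ^ n \<in> \<int>) \<longrightarrow> (\<exists>t\<in>T. \<forall>j<r. q j t - c j \<in> \<int>))"
    using prufer_coordinates[OF T_group assms(6)] by (elim exE)
  hence q: "\<And>j t. j < r ==> t \<in> T ==> \<exists>n. q j t * of_nat p ^ n \<in> \<int>"
    "\<And>j s t. j < r ==> s \<in> T ==> t \<in> T ==> q j (s \<otimes>\<^bsub>G\<^esub> t) - q j s - q j t \<in> \<int>"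
    "\<And>t. t \<in> T ==> (\<And>j. j < r ==> q j t \<in> \<int>) ==> t = \<one>\<^bsub>G\<^esub>"
    "\<And>c. (\<And>j. j < r ==> \<exists>n. c j * of_nat p ^ n \<in> \<int>) ==> \<exists>t\<in>T. \<forall>j<r. q j t - c j \<in> \<int>"
    by blast+
  \<comment> \<open>Read off from the coordinates: those of s t and of t s agree modulo \<int>, so
    the quotient of the two products has integral coordinates and is trivial.\<close>
  have comm: "s \<otimes>\<^bsub>G\<^esub> t = t \<otimes>\<^bsub>G\<^esub> s" if st: "s \<in> T" "t \<in> T" for s t
  proof -
    let ?c = "(s \<otimes>\<^bsub>G\<^esub> t) \<otimes>\<^bsub>G\<^esub> inv\<^bsub>G\<^esub> (t \<otimes>\<^bsub>G\<^esub> s)"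
    have cl: "s \<otimes>\<^bsub>G\<^esub> t \<in> T" "t \<otimes>\<^bsub>G\<^esub> s \<in> T" "?c \<in> T" using st by simp_all
    have e: "?c \<otimes>\<^bsub>G\<^esub> (t \<otimes>\<^bsub>G\<^esub> s) = s \<otimes>\<^bsub>G\<^esub> t" using st by (simp add: G.m_assoc)
    have "?c = \<one>\<^bsub>G\<^esub>"
    proof (rule q(3)[OF cl(3)])
      fix j assume j: "j < r"
      have "q j ?c = (q j (s \<otimes>\<^bsub>G\<^esub> t) - q j s - q j t) - (q j (t \<otimes>\<^bsub>G\<^esub> s) - q j t - q j s) -
        (q j (?c \<otimes>\<^bsub>G\<^esub> (t \<otimes>\<^bsub>G\<^esub> s)) - q j ?c - q j (t \<otimes>\<^bsub>G\<^esub> s))" unfolding e by simp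
      also have "\<dots> \<in> \<int>" using q(2)[OF j st] q(2)[OF j st(2,1)] q(2)[OF j cl(3,2)] by (rule Ints_diff[OF Ints_diff])
      finally show "q j ?c \<in> \<int>" .
    qed
    thus ?thesis using e cl(2) by (metis G.l_one T.mem_carrier)
  qed
  have T_comm: "comm_group (G\<lparr>carrier := T\<rparr>)"
    by (rule group.group_comm_groupI[OF T_group]) (use comm in simp)
  have S: "semidirect G T H" using assms T_comm by (intro semidirect.intro semidirect_axioms.intro)
  have "torsion_coordinates G T p r q"
    by (intro torsion_coordinates.intro torsion_coordinates_axioms.intro assms(1,3) T_comm T.subgroup_axioms) (fact q)+
  interpret S: kTV_setup G T H "TYPE('k)" p r q
    by (intro kTV_setup.intro kTV_setup_axioms.intro S assms(2)) fact
  have fin: "finite H" using assms(7) bij_betw_finite[OF S.H_bij] by simp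
  \<comment> \<open>As H represents the cosets of T, its order is prime to p and thus nonzero in k,
    which averaging over H requires.\<close>
  have "card H = order (G Mod T)" using bij_betw_same_card[OF S.H_bij] by (simp add: order_def)
  hence card: "of_nat (card H) \<noteq> (0 :: 'k)"
    using assms(1,2,8) by (auto simp: of_nat_eq_0_iff_char_dvd coprime_absorb_right)
  have car: "carrier (kTV G T H p :: ('g => 'k, ('g, 'k) kTV) module) = carrier S.M" by (simp add: kTV_def)
  interpret D: D_setup G T H "TYPE('k)" p r q f \<psi>
    by (intro D_setup.intro D_setup_axioms.intro S.kTV_setup_axioms assms fin card) (simp_all only: car)
  show ?thesis by (rule D.bD_resolution)
qed

end
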